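(* Let $n\ge3$, and let $x\subset\mathbb{C}^{2n-1}$ be a deformation of the quadric $x_0\subset\mathbb{C}^{n+1}$ (that is, $|dx|^2=|dx_0|^2$) with $(u^1,\dots,u^n)$ common conjugate system and non-degenerate joined second fundamental forms, and let $N_0^Td^2x_0=:\sum_{j=1}^nh_j^0(du^j)^2$ be the second fundamental form of $x_0$. Then $\Gamma_{jk}^l=0$ for $j,k,l$ distinct, and such deformations are in bijective correspondence with solutions $\{\mathbf{a}_j\}_{j=1,\dots,n}\subset\mathbb{C}^*$ of the differential system $$\partial_{u^k}\log\mathbf{a}_j=\Gamma_{jk}^j,\quad j\ne k,\qquad \sum_{j=1}^n\frac{(h_j^0)^2}{\mathbf{a}_j^2}+1=0.$$ In particular this implies that for $(u^1,\dots,u^n)$ being the conjugate system given by the spherical coordinates on $\mathbb{S}^n\subset\mathbb{C}^{n+1}$, the explicit $(n-1)$-dimensional family of deformations $\mathcal{X}_{\mathbf{z}}$, $\mathbf{z}\in\mathbb{C}^{n-1}$, of the quadric $\sum_{j=0}^n\frac{(x_j)^2}{a_j}=1$ ($a_j\in\mathbb{C}^*$ distinct), written out in the context, is maximal.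
   Context: On $\mathbb{C}^m$ use the complex bilinear form $\langle x,y\rangle=x^Ty$ and $|x|^2=x^Tx$ (no complex conjugation). A quadric means a non-degenerate one (projectively equivalent to the complex unit sphere). Sub-manifolds are parametrized by $(u^1,\dots,u^n)$ with $du^1\wedge\dots\wedge du^n\ne0$, and their tangent spaces are assumed non-isotropic (the induced scalar product is non-degenerate), so that orthonormal normal frames exist. $N_0$ is the unit normal field of $x_0$. With linear element $|dx|^2=|dx_0|^2=g_{jk}du^j\odot du^k$, the Christoffel symbols are $\Gamma_{jk}^l=\frac{g^{lm}}{2}[\partial_{u^k}g_{jm}+\partial_{u^j}g_{km}-\partial_{u^m}g_{jk}]$. All computations are local and assumed valid on their open domain of validity; functions have the needed differentiability and are assumed invertible, non-zero, etc. when required (for practical purposes, analytic). Common conjugate system: coordinates $(u^1,\dots,u^n)$ for which the second fundamental forms of both $x_0$ and $x$ have no mixed terms $du^j\odot du^k$, $j\ne k$; for an orthonormal normal frame $N_{n+1},\dots,N_{2n-1}$ of $x$ write $N_\alpha^Td^2x=\sum_jh_j^\alpha(du^j)^2$. Non-degenerate joined second fundamental forms: the vectors $h_j:=[ih_j^0\ \ h_j^{n+1}\ \cdots\ h_j^{2n-1}]^T\in\mathbb{C}^n$, $j=1,\dots,n$, are linearly independent. The explicit family: the quadric is parametrized by $$\mathcal{X}=\sqrt{a_0}\,\mathbf{C}_0e_0+\sum_{k=1}^n\sqrt{a_k}\,\mathbf{C}_k\sin(u^k)e_k,\qquad \mathbf{C}_k:=\prod_{j=k+1}^n\cos(u^j),$$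 and for $\mathbf{z}=(z_1,\dots,z_{n-1})\in\mathbb{C}^{n-1}$, $z_0:=1$, with $e_0,\dots,e_{2n-2}$ the standard basis of $\mathbb{C}^{2n-1}$, $$\mathcal{X}_{\mathbf{z}}=\sum_{k=1}^{n-1}\mathbf{C}_kf_k\big(\cos(g_k)e_{2k-2}+\sin(g_k)e_{2k-1}\big)+h\,e_{2n-2},$$ $$f_k:=\sqrt{(z_{k-1}-z_k)a_0+(a_k-z_{k-1}a_0)\sin^2(u^k)},\qquad k=1,\dots,n-1,$$ $$g_k:=\int_0^{u^k}\frac{\sqrt{(z_{k-1}-z_k)a_0a_k+(a_k-z_{k-1}a_0)z_ka_0\sin^2(t)}}{(z_{k-1}-z_k)a_0+(a_k-z_{k-1}a_0)\sin^2(t)}\,dt,\qquad k=1,\dots,n-1,$$ $$h:=\int_0^{u^n}\sqrt{a_n-(a_n-z_{n-1}a_0)\sin^2(t)}\,dt.$$ *)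

theory Defs
  imports "HOL-Analysis.Analysis"
begin

unbundle no fps_syntax

text \<open>
  The index type \<open>'n\<close> labels the coordinates \<open>u\<^sup>1,\<dots>,u\<^sup>n\<close>; \<open>complex ^ ('n option)\<close> is the space
  \<open>\<complex>\<^sup>n\<^sup>+\<^sup>1\<close> (with \<open>None\<close> in the role of the index \<open>0\<close>); for \<open>'a\<close> with \<open>n - 1\<close> elements,
  \<open>complex ^ ('n + 'a)\<close> is \<open>\<complex>\<^sup>2\<^sup>n\<^sup>-\<^sup>1\<close>.  All inner products are complex bilinear.
\<close>

section \<open>Holomorphic maps and partial derivatives\<close>

definition holo_fun :: "(complex^'n) set \<Rightarrow> (complex^'n \<Rightarrow> complex) \<Rightarrow> bool" where
  "holo_fun U f \<longleftrightarrow>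
     (\<forall>u\<in>U. \<exists>D. (f has_derivative D) (at u) \<and> (\<forall>c v. D (c *s v) = c * D v))"

definition holo_map :: "(complex^'n) set \<Rightarrow> (complex^'n \<Rightarrow> complex^'m) \<Rightarrow> bool" where
  "holo_map U x \<longleftrightarrow> (\<forall>i. holo_fun U (\<lambda>u. x u $ i))"

definition pd :: "'n \<Rightarrow> (complex^'n \<Rightarrow> complex) \<Rightarrow> complex^'n \<Rightarrow> complex" where
  "pd k f u = deriv (\<lambda>t. f (u + t *s axis k 1)) 0"

definition vpd :: "'n \<Rightarrow> (complex^'n \<Rightarrow> complex^'m) \<Rightarrow> complex^'n \<Rightarrow> complex^'m" where
  "vpd k x u = (\<chi> i. pd k (\<lambda>v. x v $ i) u)"

section \<open>Metric, Christoffel symbols and second fundamental forms\<close>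

definition bil :: "complex^'m \<Rightarrow> complex^'m \<Rightarrow> complex" where
  "bil x y = (\<Sum>i\<in>UNIV. x $ i * y $ i)"

definition induced_metric :: "(complex^'n \<Rightarrow> complex^'m) \<Rightarrow> complex^'n \<Rightarrow> complex^'n^'n" where
  "induced_metric x u = (\<chi> j k. bil (vpd j x u) (vpd k x u))"

text \<open>\<open>christoffel g l j k\<close> is \<open>\<Gamma>\<close> with upper index \<open>l\<close> and lower indices \<open>j\<close>, \<open>k\<close>.\<close>

definition christoffel ::
    "(complex^'n \<Rightarrow> complex^'n^'n) \<Rightarrow> 'n \<Rightarrow> 'n \<Rightarrow> 'n \<Rightarrow> complex^'n \<Rightarrow> complex" where
  "christoffel g l j k u =
     (\<Sum>m\<in>UNIV. matrix_inv (g u) $ l $ m / 2 *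
        (pd k (\<lambda>v. g v $ j $ m) u + pd j (\<lambda>v. g v $ k $ m) u - pd m (\<lambda>v. g v $ j $ k) u))"

definition sff :: "(complex^'n \<Rightarrow> complex^'m) \<Rightarrow> (complex^'n \<Rightarrow> complex^'m) \<Rightarrow>
    'n \<Rightarrow> 'n \<Rightarrow> complex^'n \<Rightarrow> complex" where
  "sff N x j k u = bil (N u) (vpd j (vpd k x) u)"

definition conjugate_system ::
    "(complex^'n) set \<Rightarrow> (complex^'n \<Rightarrow> complex^'m) \<Rightarrow> (complex^'n \<Rightarrow> complex^'m) \<Rightarrow> bool" where
  "conjugate_system U N x \<longleftrightarrow> (\<forall>u\<in>U. \<forall>j k. j \<noteq> k \<longrightarrow> sff N x j k u = 0)"

definition unit_normal ::
    "(complex^'n) set \<Rightarrow> (complex^'n \<Rightarrow> complex^('n option)) \<Rightarrow> (complex^'n \<Rightarrow> complex^('n option)) \<Rightarrow> bool" where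
  "unit_normal U x0 N0 \<longleftrightarrow> holo_map U N0 \<and>
     (\<forall>u\<in>U. bil (N0 u) (N0 u) = 1 \<and> (\<forall>j. bil (N0 u) (vpd j x0 u) = 0))"

text \<open>
  Only the values of the frame enter the coefficients of the second fundamental forms, never its
  derivatives, so the frame may be chosen independently at each point.
\<close>

definition normal_frame ::
    "(complex^'n) set \<Rightarrow> (complex^'n \<Rightarrow> complex^('n::finite + 'a::finite)) \<Rightarrow>
     ('a \<Rightarrow> complex^'n \<Rightarrow> complex^('n::finite + 'a::finite)) \<Rightarrow> bool" where
  "normal_frame U x N \<longleftrightarrow>
     (\<forall>u\<in>U. (\<forall>\<alpha> \<beta>. bil (N \<alpha> u) (N \<beta> u) = (if \<alpha> = \<beta> then 1 else 0)) \<and>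
            (\<forall>\<alpha> j. bil (N \<alpha> u) (vpd j x u) = 0))"

section \<open>Quadrics\<close>

definition hom_coords :: "complex^'k \<Rightarrow> complex^('k::finite option)" where
  "hom_coords X = (\<chi> i. case i of None \<Rightarrow> 1 | Some j \<Rightarrow> X $ j)"

text \<open>The unit sphere is the zero set of \<open>sphere_form \<circ> hom_coords\<close>.\<close>

definition sphere_form :: "complex^('k::finite option) \<Rightarrow> complex" where
  "sphere_form Y = (\<Sum>j\<in>UNIV. (Y $ Some j)\<^sup>2) - (Y $ None)\<^sup>2"

definition quadric :: "(complex^'k) set \<Rightarrow> bool" where
  "quadric Q \<longleftrightarrow> (\<exists>M :: complex^('k::finite option)^('k option).
     invertible M \<and> Q = {X. sphere_form (M *v hom_coords X) = 0})"

text \<open>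
  A parametrized piece of a quadric with non-isotropic tangent spaces whose parameters form a
  conjugate system.  The determinant condition also makes the partial derivatives of \<open>x0\<close>
  linearly independent.
\<close>

definition quadric_piece ::
    "(complex^'n) set \<Rightarrow> (complex^'n \<Rightarrow> complex^('n option)) \<Rightarrow> (complex^'n \<Rightarrow> complex^('n option)) \<Rightarrow> bool" where
  "quadric_piece U x0 N0 \<longleftrightarrow>
     open U \<and> U \<noteq> {} \<and> holo_map U x0 \<and> (\<exists>Q. quadric Q \<and> x0 ` U \<subseteq> Q) \<and>
     (\<forall>u\<in>U. det (induced_metric x0 u) \<noteq> 0) \<and> unit_normal U x0 N0 \<and> conjugate_system U N0 x0"

section \<open>Deformations\<close>

definition deformation ::
    "(complex^'n) set \<Rightarrow> (complex^'n \<Rightarrow> complex^'k) \<Rightarrow> (complex^'n \<Rightarrow> complex^'m) \<Rightarrow> bool" where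
  "deformation U x0 x \<longleftrightarrow> holo_map U x \<and> (\<forall>u\<in>U. induced_metric x u = induced_metric x0 u)"

definition joined_vec ::
    "(complex^'n \<Rightarrow> complex^('n option)) \<Rightarrow> (complex^'n \<Rightarrow> complex^('n option)) \<Rightarrow>
     ('a \<Rightarrow> complex^'n \<Rightarrow> complex^('n::finite + 'a::finite)) \<Rightarrow> (complex^'n \<Rightarrow> complex^('n::finite + 'a::finite)) \<Rightarrow>
     'n \<Rightarrow> complex^'n \<Rightarrow> complex^('a::finite option)" where
  "joined_vec N0 x0 N x j u =
     (\<chi> i. case i of None \<Rightarrow> \<i> * sff N0 x0 j j u | Some \<alpha> \<Rightarrow> sff (N \<alpha>) x j j u)"

definition nondegenerate_joined ::
    "(complex^'n) set \<Rightarrow> (complex^'n \<Rightarrow> complex^('n option)) \<Rightarrow> (complex^'n \<Rightarrow> complex^('n option)) \<Rightarrow>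
     ('a \<Rightarrow> complex^'n \<Rightarrow> complex^('n::finite + 'a::finite)) \<Rightarrow> (complex^'n \<Rightarrow> complex^('n::finite + 'a::finite)) \<Rightarrow> bool" where
  "nondegenerate_joined U N0 x0 N x \<longleftrightarrow>
     (\<forall>u\<in>U. \<forall>c. (\<Sum>j\<in>UNIV. c j *s joined_vec N0 x0 N x j u) = 0 \<longrightarrow> (\<forall>j. c j = 0))"

text \<open>
  The deformations of \<open>x0\<close> sharing its conjugate system, with non-degenerate joined second
  fundamental forms.  Neither condition depends on the orthonormal normal frame.
\<close>

definition conjugate_deformations ::
    "(complex^'n) set \<Rightarrow> (complex^'n \<Rightarrow> complex^('n option)) \<Rightarrow> (complex^'n \<Rightarrow> complex^('n option)) \<Rightarrow>
     (complex^'n \<Rightarrow> complex^('n::finite + 'a::finite)) set" where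
  "conjugate_deformations U x0 N0 =
     {x. deformation U x0 x \<and>
         (\<exists>N. normal_frame U x N \<and> (\<forall>\<alpha>. conjugate_system U (N \<alpha>) x) \<and>
              nondegenerate_joined U N0 x0 N x)}"

text \<open>Congruence is taken with respect to the full complex orthogonal group.\<close>

definition congruent_on ::
    "(complex^'n) set \<Rightarrow> (complex^'n \<Rightarrow> complex^'m) \<Rightarrow> (complex^'n \<Rightarrow> complex^'m) \<Rightarrow> bool" where
  "congruent_on U x y \<longleftrightarrow>
     (\<exists>A c. orthogonal_matrix A \<and> (\<forall>u\<in>U. y u = A *v x u + c))"

definition congruence_rel ::
    "(complex^'n) set \<Rightarrow> (complex^'n \<Rightarrow> complex^'m) set \<Rightarrow>
     ((complex^'n \<Rightarrow> complex^'m) \<times> (complex^'n \<Rightarrow> complex^'m)) set" where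
  "congruence_rel U D = {(x, y). x \<in> D \<and> y \<in> D \<and> congruent_on U x y}"

section \<open>The differential system\<close>

text \<open>The derivative of \<open>log (a j)\<close> is the logarithmic derivative, independent of a branch.\<close>

definition solutions ::
    "(complex^'n) set \<Rightarrow> (complex^'n \<Rightarrow> complex^('n option)) \<Rightarrow> (complex^'n \<Rightarrow> complex^('n option)) \<Rightarrow>
     ('n \<Rightarrow> complex^'n \<Rightarrow> complex) set" where
  "solutions U x0 N0 =
     {a. (\<forall>j. holo_fun U (a j)) \<and> (\<forall>u\<in>U. \<forall>j. a j u \<noteq> 0) \<and>
         (\<forall>u\<in>U. \<forall>j k. j \<noteq> k \<longrightarrow> pd k (a j) u / a j u = christoffel (induced_metric x0) j j k u) \<and>
         (\<forall>u\<in>U. (\<Sum>j\<in>UNIV. (sff N0 x0 j j u)\<^sup>2 / (a j u)\<^sup>2) + 1 = 0)}"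

text \<open>
  A deformation determines \<open>a j\<close>, the length of the \<open>j\<close>-th joined vector, only up to sign; the
  system is invariant under these sign changes.
\<close>

definition sign_rel ::
    "(complex^'n) set \<Rightarrow> ('n \<Rightarrow> complex^'n \<Rightarrow> complex) set \<Rightarrow>
     (('n \<Rightarrow> complex^'n \<Rightarrow> complex) \<times> ('n \<Rightarrow> complex^'n \<Rightarrow> complex)) set" where
  "sign_rel U S = {(a, b). a \<in> S \<and> b \<in> S \<and>
     (\<forall>j. \<exists>\<epsilon>\<in>{1, -1}. \<forall>u\<in>U. b j u = \<epsilon> * a j u)}"

definition corresponds ::
    "(complex^'n) set \<Rightarrow> (complex^'n \<Rightarrow> complex^('n option)) \<Rightarrow> (complex^'n \<Rightarrow> complex^('n option)) \<Rightarrow>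
     (complex^'n \<Rightarrow> complex^('n::finite + 'a::finite)) \<Rightarrow> ('n \<Rightarrow> complex^'n \<Rightarrow> complex) \<Rightarrow> bool" where
  "corresponds U x0 N0 x a \<longleftrightarrow>
     (\<exists>N. normal_frame U x N \<and>
        (\<forall>u\<in>U. \<forall>j. (a j u)\<^sup>2 = bil (joined_vec N0 x0 N x j u) (joined_vec N0 x0 N x j u)))"

definition correspondence ::
    "(complex^'n) set \<Rightarrow> (complex^'n \<Rightarrow> complex^('n option)) \<Rightarrow> (complex^'n \<Rightarrow> complex^('n option)) \<Rightarrow>
     (complex^'n \<Rightarrow> complex^('n::finite + 'a::finite)) set \<Rightarrow> ('n \<Rightarrow> complex^'n \<Rightarrow> complex) set" where
  "correspondence U x0 N0 X = {a \<in> solutions U x0 N0. \<exists>x\<in>X. corresponds U x0 N0 x a}"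

section \<open>Spherical coordinates and the explicit family\<close>

text \<open>
  In this section \<open>\<iota>\<close> enumerates the coordinates by \<open>{1..n}\<close> and \<open>e\<close> enumerates the standard basis
  of \<open>\<complex>\<^sup>2\<^sup>n\<^sup>-\<^sup>1\<close> by \<open>{0..2 * n - 2}\<close>, where \<open>n = CARD('n)\<close>.
\<close>

definition cosprod :: "(nat \<Rightarrow> 'n) \<Rightarrow> complex^'n \<Rightarrow> nat \<Rightarrow> complex" where
  "cosprod \<iota> u k = (\<Prod>j\<in>{k+1..CARD('n)}. cos (u $ \<iota> j))"

definition central_quadric :: "(nat \<Rightarrow> complex) \<Rightarrow> (nat \<Rightarrow> 'n) \<Rightarrow> (complex^('n::finite option)) set" where
  "central_quadric a \<iota> =
     {X. (X $ None)\<^sup>2 / a 0 + (\<Sum>k\<in>{1..CARD('n)}. (X $ Some (\<iota> k))\<^sup>2 / a k) = 1}"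

definition spherical :: "(nat \<Rightarrow> complex) \<Rightarrow> (nat \<Rightarrow> 'n) \<Rightarrow> complex^'n \<Rightarrow> complex^('n option)" where
  "spherical a \<iota> u =
     (csqrt (a 0) * cosprod \<iota> u 0) *s axis None 1 +
     (\<Sum>k\<in>{1..CARD('n)}. (csqrt (a k) * cosprod \<iota> u k * sin (u $ \<iota> k)) *s axis (Some (\<iota> k)) 1)"

text \<open>
  The radicands in \<open>f\<^sub>k\<close>, in the numerator of the integrand of \<open>g\<^sub>k\<close>, and in the integrand of \<open>h\<close>.
\<close>

definition radf :: "(nat \<Rightarrow> complex) \<Rightarrow> (nat \<Rightarrow> complex) \<Rightarrow> nat \<Rightarrow> complex \<Rightarrow> complex" where
  "radf a z k t = (z (k-1) - z k) * a 0 + (a k - z (k-1) * a 0) * (sin t)\<^sup>2"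

definition radg :: "(nat \<Rightarrow> complex) \<Rightarrow> (nat \<Rightarrow> complex) \<Rightarrow> nat \<Rightarrow> complex \<Rightarrow> complex" where
  "radg a z k t = (z (k-1) - z k) * a 0 * a k + (a k - z (k-1) * a 0) * z k * a 0 * (sin t)\<^sup>2"

definition radh :: "nat \<Rightarrow> (nat \<Rightarrow> complex) \<Rightarrow> (nat \<Rightarrow> complex) \<Rightarrow> complex \<Rightarrow> complex" where
  "radh n a z t = a n - (a n - z (n-1) * a 0) * (sin t)\<^sup>2"

text \<open>
  \<open>Y\<close> is the map of the family with parameter \<open>z\<close> on \<open>V\<close>, for some choice of holomorphic branches
  \<open>f\<close>, \<open>r\<close>, \<open>s\<close> of the square roots.  The integrals \<open>g\<close>, \<open>h\<close> are primitives on the projections of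
  \<open>V\<close>, vanishing at \<open>0\<close> whenever \<open>0\<close> is in the projection; otherwise the path from \<open>0\<close> is left
  open and they are defined up to a constant.  Changing the branches or these constants changes
  \<open>Y\<close> by a congruence.
\<close>

definition peterson_map ::
    "(nat \<Rightarrow> complex) \<Rightarrow> (nat \<Rightarrow> 'n) \<Rightarrow> (nat \<Rightarrow> 'm) \<Rightarrow> (complex^'n) set \<Rightarrow> (nat \<Rightarrow> complex) \<Rightarrow>
     (complex^'n \<Rightarrow> complex^'m) \<Rightarrow> bool" where
  "peterson_map a \<iota> e V z Y \<longleftrightarrow> z 0 = 1 \<and>
     (let n = CARD('n); P = (\<lambda>k. (\<lambda>u. u $ \<iota> k) ` V) in
      \<exists>f r g s h.
        (\<forall>k\<in>{1..n-1}.
           f k holomorphic_on P k \<and> r k holomorphic_on P k \<and>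
           (\<forall>t\<in>P k. (f k t)\<^sup>2 = radf a z k t \<and> radf a z k t \<noteq> 0 \<and> (r k t)\<^sup>2 = radg a z k t \<and>
                    (g k has_field_derivative r k t / radf a z k t) (at t)) \<and>
           (0 \<in> P k \<longrightarrow> g k 0 = 0)) \<and>
        s holomorphic_on P n \<and>
        (\<forall>t\<in>P n. (s t)\<^sup>2 = radh n a z t \<and> (h has_field_derivative s t) (at t)) \<and>
        (0 \<in> P n \<longrightarrow> h 0 = 0) \<and>
        (\<forall>u\<in>V. Y u =
           (\<Sum>k\<in>{1..n-1}. (cosprod \<iota> u k * f k (u $ \<iota> k)) *s
              (cos (g k (u $ \<iota> k)) *s axis (e (2*k-2)) 1 + sin (g k (u $ \<iota> k)) *s axis (e (2*k-1)) 1))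
           + h (u $ \<iota> n) *s axis (e (2*n-2)) 1))"

text \<open>
  Parameters for which the family has non-degenerate joined second fundamental forms on \<open>V\<close>: if
  some \<open>z k\<close> vanishes these forms are degenerate (for \<open>z 1 = \<dots> = z (n-1) = 0\<close> one gets the
  quadric itself).
\<close>

definition peterson_regular ::
    "(nat \<Rightarrow> complex) \<Rightarrow> (nat \<Rightarrow> 'n) \<Rightarrow> (complex^'n) set \<Rightarrow> (nat \<Rightarrow> complex) \<Rightarrow> bool" where
  "peterson_regular a \<iota> V z \<longleftrightarrow>
     (\<forall>k\<in>{1..CARD('n)-1}. z k \<noteq> 0 \<and> (\<forall>u\<in>V. radg a z k (u $ \<iota> k) \<noteq> 0)) \<and>
     (\<forall>u\<in>V. radh CARD('n) a z (u $ \<iota> CARD('n)) \<noteq> 0)"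

definition subdomain :: "(complex^'n) set \<Rightarrow> (complex^'n) set \<Rightarrow> bool" where
  "subdomain V U \<longleftrightarrow> open V \<and> convex V \<and> V \<noteq> {} \<and> V \<subseteq> U"

text \<open>
  For the spherical coordinates the general solution of the differential system depends on
  constants \<open>w 1, \<dots>, w (n-1)\<close>, arising by separation of variables, with \<open>w 0 = 1 / a 0\<close> and
  \<open>w n = 0\<close>.  The map with parameter \<open>z\<close> has \<open>w k = 1 / (a 0 * z k)\<close>.
\<close>

definition separation_constants ::
    "(complex^'n) set \<Rightarrow> (nat \<Rightarrow> complex) \<Rightarrow> (nat \<Rightarrow> 'n) \<Rightarrow> ('n \<Rightarrow> complex^'n \<Rightarrow> complex) \<Rightarrow>
     (nat \<Rightarrow> complex) \<Rightarrow> bool" where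
  "separation_constants U a \<iota> b w \<longleftrightarrow> w 0 = 1 / a 0 \<and> w CARD('n) = 0 \<and>
     (\<forall>u\<in>U. \<forall>k\<in>{1..CARD('n)}.
        (b (\<iota> k) u)\<^sup>2 * (w k - w (k-1) * (cos (u $ \<iota> k))\<^sup>2 - (sin (u $ \<iota> k))\<^sup>2 / a k)
          = (cosprod \<iota> u k)\<^sup>2)"

text \<open>
  A family of pairwise non-congruent deformations, depending continuously on \<open>d = CARD('d)\<close>
  complex parameters.
\<close>

definition effective_family ::
    "(complex^'n) set \<Rightarrow> (complex^'n \<Rightarrow> complex^('n option)) \<Rightarrow> (complex^'n \<Rightarrow> complex^('n option)) \<Rightarrow>
     (complex^'d) set \<Rightarrow> (complex^'d \<Rightarrow> complex^'n \<Rightarrow> complex^('n::finite + 'a::finite)) \<Rightarrow> bool" where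
  "effective_family U x0 N0 T y \<longleftrightarrow> open T \<and> T \<noteq> {} \<and>
     continuous_on (T \<times> U) (\<lambda>(t, u). y t u) \<and>
     (\<forall>t\<in>T. y t \<in> conjugate_deformations U x0 N0) \<and>
     (\<forall>t\<in>T. \<forall>t'\<in>T. congruent_on U (y t) (y t') \<longrightarrow> t = t')"

end

theory Submission
  imports Defs "HOL-Complex_Analysis.Complex_Analysis"
begin

text \<open>
  By the Gauss equations the joined second fundamental vectors of a deformation in a common
  conjugate system are mutually orthogonal.  Commuting third derivatives gives
  \<open>\<Gamma>\<^sup>l\<^sub>j\<^sub>k h\<^sub>l = \<Gamma>\<^sup>j\<^sub>l\<^sub>k h\<^sub>j\<close>, so the symbols with distinct indices
  vanish, and it gives the differential equations for the lengths \<open>a\<^sub>j\<close> of these vectors; the algebraic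
  equation says that the coordinate axis \<open>0\<close> is a unit vector in their orthogonal basis.

  Conversely, a solution \<open>a\<close> makes a linear system for a matrix \<open>P\<close> with \<open>\<partial>\<^sub>j x = P \<partial>\<^sub>j x\<^sub>0\<close> and vectors
  \<open>W\<^sub>l\<close>, the normalized components of \<open>\<partial>\<^sub>l \<partial>\<^sub>l x\<close> transversal to the tangent space, completely integrable.
  This uses the quadric through the multiple \<open>q = \<sigma> N\<^sub>0\<close> of the normal that is an affine image of the
  quadric itself.  The coefficients are antisymmetric, so an orthogonal initial frame of
  \<open>\<complex>\<^sup>2\<^sup>n\<^sup>+\<^sup>1\<close> stays orthogonal, and \<open>P N\<^sub>0\<close> and \<open>\<Sum>\<^sub>l (h\<^sub>l / a\<^sub>l) W\<^sub>l\<close> are constant; projecting along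
  these two directions gives \<open>x\<close>.  Two deformations with equal \<open>a\<^sub>j\<^sup>2\<close> solve the same system
  with equal Gram matrices, hence are congruent.

  In spherical coordinates \<open>\<partial>\<^sub>l \<partial>\<^sub>m X = - tan u\<^sub>l \<partial>\<^sub>m X\<close> for \<open>m < l\<close>, so the ratio of
  \<open>cosprod \<iota> u k\<close> to the \<open>k\<close>-th unknown depends on \<open>u\<^sub>k\<close> alone and the algebraic equation telescopes into
  a recursion with constants \<open>w\<^sub>k\<close>.  The explicit family realizes \<open>w\<^sub>k = 1 / (a\<^sub>0 z\<^sub>k)\<close>.  As
  \<open>(w\<^sub>1, \<dots>, w\<^sub>n\<^sub>-\<^sub>1)\<close> is a complete congruence invariant depending continuously on the deformation,
  invariance of dimension bounds the number of parameters of any effective family.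
\<close>

text \<open>The obstacle in the converse is that a solution prescribes \<open>pd k (a j)\<close>
  only for \<open>k\<close> different from \<open>j\<close>, so integrability cannot be checked by
  expanding every derivative. Two relations supply what is missing. The algebraic equation says that
  the squares of \<open>B j = h j / a j\<close> sum to \<open>- 1\<close>, and its derivative gives
  \<open>pd k (B k)\<close>. On a quadric, computing the derivative of the product of
  \<open>vpd i q\<close> with \<open>vpd i x0\<close> in two ways ties the derivatives of
  \<open>\<sigma>\<close> to the Christoffel symbols; rewritten in terms of \<open>B\<close> and
  differentiated once more, this yields the equations of the rotation coefficients
  \<open>\<beta>\<close>. The derivatives of \<open>\<beta> k l\<close> and
  \<open>\<beta> l k\<close> that remain unknown enter only through a sum, which is found by
  commuting derivatives of \<open>B k\<close>. Keeping the two constant directions inside the frame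
  makes the coefficients antisymmetric and avoids choosing a normal frame of the unknown map in
  advance.\<close>

unbundle no Formal_Power_Series.fps_syntax

section \<open>Several complex variables\<close>

lemma norm_cscale: "norm (t *s v) = norm t * norm (v :: complex^'n)"
  by (simp add: norm_vec_def norm_mult L2_set_right_distrib)

lemma norm_cscale_axis [simp]: "norm (t *s axis k (1::complex)) = norm t"
proof -
  have "t *s axis k (1::complex) = axis k t"
    by (simp add: vec_eq_iff axis_def)
  then show ?thesis
    by (simp add: norm_vec_def axis_def L2_set_def if_distrib [of norm] if_distrib [of "\<lambda>x. x\<^sup>2"] cong: if_cong)
qed

lemma bounded_linear_cscale: "bounded_linear (\<lambda>t::complex. t *s (v :: complex^'n))"
  by (rule bounded_linear_intro [where K = "norm v"])
    (auto simp: norm_cscale vec_eq_iff algebra_simps)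

lemma continuous_on_cscale [continuous_intros]:
  "continuous_on S f \<Longrightarrow> continuous_on S (\<lambda>x. f x *s (v :: complex^'n))"
  using bounded_linear.continuous_on [OF bounded_linear_cscale] by blast

section \<open>Restriction of holomorphic functions to complex lines\<close>

lemma has_derivative_along_line:
  fixes f :: "complex^'n \<Rightarrow> complex"
  assumes "(f has_derivative D) (at (u + t *s v))" and "\<And>c w. D (c *s w) = c * D w"
  shows "((\<lambda>s. f (u + s *s v)) has_field_derivative D v) (at t)"
proof -
  have "((\<lambda>s. u + s *s v) has_derivative (\<lambda>s. s *s v)) (at t)"
    by (auto intro!: derivative_eq_intros bounded_linear.has_derivative [OF bounded_linear_cscale])
  from diff_chain_at [OF this assms(1)] show ?thesis
    by (simp add: o_def assms(2) has_field_derivative_def mult_commute_abs)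
qed

lemma derivative_eq_sum_pd:
  fixes f :: "complex^'n \<Rightarrow> complex"
  assumes D: "(f has_derivative D) (at u)" and lin: "\<And>c w. D (c *s w) = c * D w"
  shows "D v = (\<Sum>k\<in>UNIV. v $ k * pd k f u)"
proof -
  have pd: "pd k f u = D (axis k 1)" for k
    unfolding pd_def using has_derivative_along_line [of f D u 0 "axis k 1"] D lin
    by (simp add: DERIV_imp_deriv)
  have "v = (\<Sum>k\<in>UNIV. v $ k *s axis k 1)"
    by (simp add: vec_eq_iff axis_def if_distrib [of "(*) _"] cong: if_cong)
  then have "D v = D (\<Sum>k\<in>UNIV. v $ k *s axis k 1)" by simp
  also have "\<dots> = (\<Sum>k\<in>UNIV. v $ k * pd k f u)"
    using D by (simp add: linear_sum has_derivative_linear lin pd)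
  finally show ?thesis .
qed

lemma holo_fun_along_line:
  assumes "holo_fun U f" and "u + t *s v \<in> U"
  shows "((\<lambda>s. f (u + s *s v)) has_field_derivative (\<Sum>k\<in>UNIV. v $ k * pd k f (u + t *s v))) (at t)"
proof -
  obtain D where D: "(f has_derivative D) (at (u + t *s v))" "\<And>c w. D (c *s w) = c * D w"
    using assms unfolding holo_fun_def by blast
  show ?thesis
    using has_derivative_along_line [of f D u t v] derivative_eq_sum_pd [of f D "u + t *s v" v] D by simp
qed

lemma sum_axis_mult: "(\<Sum>j\<in>UNIV. axis k 1 $ j * x j) = (x k :: complex)"
  by (simp add: axis_def if_distrib [of "\<lambda>c. c * _"] cong: if_cong)

lemma holo_fun_slice:
  assumes "holo_fun U f" and "u + t *s axis k 1 \<in> U"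
  shows "((\<lambda>s. f (u + s *s axis k 1)) has_field_derivative pd k f (u + t *s axis k 1)) (at t)"
  using holo_fun_along_line [OF assms] by (simp add: sum_axis_mult)

lemma holo_fun_slice0:
  assumes "holo_fun U f" and "u \<in> U"
  shows "((\<lambda>s. f (u + s *s axis k 1)) has_field_derivative pd k f u) (at 0)"
  using holo_fun_slice [of U f u 0 k] assms by simp

lemma holo_fun_continuous_on: "holo_fun U f \<Longrightarrow> continuous_on U f"
  unfolding holo_fun_def
  by (meson has_derivative_continuous continuous_at_imp_continuous_on)

text \<open>Separate holomorphy is what one-variable arguments on slices deliver; together with
  continuity it is upgraded to \<open>holo_fun\<close> by \<open>osgood\<close>.\<close>

definition sepholo :: "(complex^'n) set \<Rightarrow> (complex^'n \<Rightarrow> complex) \<Rightarrow> bool" where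
  "sepholo U f \<longleftrightarrow> (\<forall>u\<in>U. \<forall>k. (\<lambda>t. f (u + t *s axis k 1)) field_differentiable (at 0))"

lemma holo_fun_sepholo: "holo_fun U f \<Longrightarrow> sepholo U f"
  unfolding sepholo_def field_differentiable_def using holo_fun_slice0 by blast

lemma sepholo_slice:
  assumes "sepholo U f" and "u + t *s axis k 1 \<in> U"
  shows "((\<lambda>s. f (u + s *s axis k 1)) has_field_derivative pd k f (u + t *s axis k 1)) (at t)"
proof -
  have "((\<lambda>s. f (u + t *s axis k 1 + s *s axis k 1)) has_field_derivative pd k f (u + t *s axis k 1)) (at 0)"
    using assms unfolding sepholo_def pd_def
    by (simp add: field_differentiable_derivI)
  then have "((\<lambda>s. f (u + t *s axis k 1 + (s - t) *s axis k 1)) has_field_derivative pd k f (u + t *s axis k 1)) (at (0 + t))"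
    using DERIV_shift [of "\<lambda>s. f (u + t *s axis k 1 + (s - t) *s axis k 1)" _ 0 t] by simp
  moreover have "u + t *s axis k 1 + (s - t) *s axis k 1 = u + s *s axis k (1::complex)" for s
    by (simp add: vec_eq_iff algebra_simps)
  ultimately show ?thesis by simp
qed

lemma sepholo_slice_holomorphic:
  assumes "sepholo U f" and "\<And>t. t \<in> S \<Longrightarrow> u + t *s axis k 1 \<in> U"
  shows "(\<lambda>s. f (u + s *s axis k 1)) holomorphic_on S"
  using sepholo_slice [OF assms(1)] assms(2)
  by (meson field_differentiable_at_within field_differentiable_def holomorphic_on_def)

text \<open>Cauchy's inequality on a slice disc of fixed radius bounds the difference of two partial
  derivatives by the maximal difference of the slices, and compactness of the disc makes the slices
  uniformly close. The parameter serves families of deformations; with a trivial parameter this is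
  the input of \<open>osgood\<close>.\<close>

lemma continuous_on_pd_param:
  fixes F :: "'p::topological_space \<Rightarrow> complex^'n \<Rightarrow> complex"
  assumes "open U" and cont: "continuous_on (T \<times> U) (\<lambda>(t, u). F t u)"
    and sep: "\<And>t. t \<in> T \<Longrightarrow> sepholo U (F t)"
  shows "continuous_on (T \<times> U) (\<lambda>(t, u). pd k (F t) u)"
  unfolding continuous_on_def tendsto_iff
proof (intro ballI allI impI)
  fix x0 and e :: real assume x0: "x0 \<in> T \<times> U" and e: "0 < e"
  obtain t0 u0 where x0_eq: "x0 = (t0, u0)" and t0: "t0 \<in> T" and u0: "u0 \<in> U" using x0 by auto
  obtain r0 where r0: "r0 > 0" "cball u0 r0 \<subseteq> U"
    using \<open>open U\<close> u0 open_contains_cball by blast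
  define r where "r = r0 / 2"
  have r: "r > 0" using r0 r_def by simp
  have inU: "u + z *s axis k 1 \<in> U" if "u \<in> ball u0 r" "z \<in> cball 0 r" for u z
  proof -
    have "dist u0 (u + z *s axis k 1) \<le> dist u0 u + norm (z *s axis k (1::complex))"
      by (metis dist_norm dist_triangle add_diff_cancel_left' norm_minus_commute)
    then have "u + z *s axis k 1 \<in> cball u0 r0" using that by (simp add: r_def)
    then show ?thesis using r0 by blast
  qed
  define G where "G = (\<lambda>((t, u), z). F t (u + z *s axis k 1))"
  have contG: "continuous_on ((T \<times> ball u0 r) \<times> cball 0 r) G"
  proof -
    have "continuous_on ((T \<times> ball u0 r) \<times> cball 0 r) (\<lambda>x. (\<lambda>(t, u). F t u) (fst (fst x), snd (fst x) + snd x *s axis k 1))"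
      by (rule continuous_on_compose2 [OF cont]) (use inU in \<open>auto intro!: continuous_intros\<close>)
    then show ?thesis unfolding G_def by (simp add: case_prod_unfold)
  qed
  \<comment> \<open>The tolerance \<open>e * r / 2\<close> becomes \<open>e / 2\<close> after the
    division by \<open>r\<close> in Cauchy's inequality.\<close>
  obtain X0 where X0: "x0 \<in> X0" "open X0"
    "\<forall>x\<in>X0 \<inter> (T \<times> ball u0 r). \<forall>z\<in>cball 0 r. dist (G (x, z)) (G (x0, z)) \<le> e * r / 2"
    by (rule continuous_on_prod_compactE [OF contG compact_cball, of x0 "e * r / 2"])
      (use t0 r e x0_eq in auto)
  have close: "dist (pd k (F t) u) (pd k (F t0) u0) < e" if tu: "(t, u) \<in> X0" "t \<in> T" "u \<in> ball u0 r" for t u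
  proof -
    let ?g = "\<lambda>z. F t (u + z *s axis k 1)" and ?h = "\<lambda>z. F t0 (u0 + z *s axis k 1)"
    have hol: "?g holomorphic_on cball 0 r"
      by (rule sepholo_slice_holomorphic [OF sep [OF tu(2)]]) (use tu inU in auto)
    have hol0: "?h holomorphic_on cball 0 r"
      by (rule sepholo_slice_holomorphic [OF sep [OF t0]]) (use r inU in auto)
    have "u \<in> U" using inU [of u 0] tu r by simp
    then have d: "(?g has_field_derivative pd k (F t) u) (at 0)" "(?h has_field_derivative pd k (F t0) u0) (at 0)"
      using sepholo_slice [OF sep [OF tu(2)], of u 0 k] sepholo_slice [OF sep [OF t0], of u0 0 k] u0 by auto
    have "deriv (\<lambda>z. ?g z - ?h z) 0 = pd k (F t) u - pd k (F t0) u0"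
      by (intro DERIV_imp_deriv DERIV_diff d)
    moreover have "norm ((deriv ^^ 1) (\<lambda>z. ?g z - ?h z) 0) \<le> fact 1 * (e * r / 2) / r ^ 1"
    proof (rule Cauchy_inequality)
      show "(\<lambda>z. ?g z - ?h z) holomorphic_on ball 0 r"
        by (intro holomorphic_on_diff holomorphic_on_subset [OF hol] holomorphic_on_subset [OF hol0] ball_subset_cball)
      show "continuous_on (cball 0 r) (\<lambda>z. ?g z - ?h z)"
        using hol hol0 by (intro continuous_on_diff holomorphic_on_imp_continuous_on)
      show "norm (?g x - ?h x) \<le> e * r / 2" if "norm (0 - x) = r" for x
        using bspec [OF bspec [OF X0(3), of "(t, u)"], of x] tu that
        by (simp add: G_def x0_eq dist_norm)
    qed (use r in auto)
    ultimately show ?thesis using r e by (simp add: dist_norm)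
  qed
  have "open (X0 \<inter> (UNIV \<times> ball u0 r))" using X0 by (intro open_Int open_Times) auto
  then show "\<forall>\<^sub>F x in at x0 within T \<times> U. dist ((\<lambda>(t, u). pd k (F t) u) x) ((\<lambda>(t, u). pd k (F t) u) x0) < e"
    unfolding eventually_at_topological
    using X0 r x0_eq close by (intro exI [of _ "X0 \<inter> (UNIV \<times> ball u0 r)"]) auto
qed

lemma continuous_on_pd:
  assumes "open U" "continuous_on U f" "sepholo U f"
  shows "continuous_on U (pd k f)"
proof -
  \<comment> \<open>A one-point parameter set reduces the plain statement to the parametrized
    one.\<close>
  have "continuous_on ({0::real} \<times> U) (\<lambda>(t, u). pd k f u)"
    by (rule continuous_on_pd_param [where F = "\<lambda>_. f"])
      (use assms in \<open>auto simp: case_prod_unfold intro!: continuous_on_compose2 [of U f] continuous_intros\<close>)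
  then have "continuous_on U (\<lambda>u. (\<lambda>(t, u). pd k f u) (0::real, u))"
    by (rule continuous_on_compose2) (auto intro!: continuous_intros)
  then show ?thesis by simp
qed

lemma norm_zero_coordinate_le: "norm ((\<chi> i. if i = k then 0 else v $ i) :: complex^'n) \<le> norm (v :: complex^'n)"
  unfolding norm_vec_def by (rule L2_set_mono) auto

text \<open>The partial derivatives are continuous by Cauchy's inequality, so the classical argument
  applies: the increment is split into moves along one coordinate at a time, and each move is
  estimated by the mean value inequality for a slice minus its linear part.\<close>

theorem osgood:
  fixes U :: "(complex^'n) set"
  assumes U: "open U" and cont: "continuous_on U f" and sep: "sepholo U f"
  shows "holo_fun U f"
  unfolding holo_fun_def
proof (intro ballI exI conjI allI)
  fix u assume u: "u \<in> U"
  have contpd: "continuous_on U (pd k f)" for k using continuous_on_pd assms by blast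
  \<comment> \<open>Induction over the set \<open>K\<close> of coordinates in which the increment
    may be nonzero.\<close>
  have approx: "\<forall>e>0. \<exists>d>0. \<forall>v. (\<forall>k. k \<notin> K \<longrightarrow> v $ k = 0) \<and> norm v < d \<longrightarrow>
      norm (f (u + v) - f u - (\<Sum>k\<in>K. v $ k * pd k f u)) \<le> e * norm v" if "finite K" for K
    using that
  proof (induction K rule: finite_induct)
    case empty
    have "norm (f (u + v) - f u) \<le> e * norm v" if "\<forall>k. v $ k = 0" for v :: "complex^'n" and e :: real
    proof -
      have "v = 0" using that by (simp add: vec_eq_iff)
      then show ?thesis by simp
    qed
    then show ?case by (auto intro!: exI [of _ 1])
  next
    case (insert k K)
    show ?case
    proof (intro allI impI)
      fix e :: real assume e: "0 < e"
      obtain d1 where d1: "d1 > 0" "\<And>v. (\<forall>k. k \<notin> K \<longrightarrow> v $ k = 0) \<Longrightarrow> norm v < d1 \<Longrightarrow>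
          norm (f (u + v) - f u - (\<Sum>k\<in>K. v $ k * pd k f u)) \<le> e / 2 * norm v"
        using insert.IH e by (meson half_gt_zero)
      obtain d2 where d2: "d2 > 0" "ball u d2 \<subseteq> U" using U u open_contains_ball by blast
      have "isCont (pd k f) u" using contpd U u by (simp add: continuous_on_eq_continuous_at)
      then obtain d3 where d3: "d3 > 0" "\<And>w. dist w u < d3 \<Longrightarrow> dist (pd k f w) (pd k f u) < e / 2"
        using e unfolding continuous_at_eps_delta by (metis half_gt_zero)
      \<comment> \<open>Intermediate points differ from \<open>u\<close> by at most
        \<open>norm w + norm v\<close>, hence by less than \<open>2 * d\<close>.\<close>
      define d where "d = min d1 (min d2 d3) / 2"
      have d: "d > 0" "d < d1" "2 * d \<le> d2" "2 * d \<le> d3" using d1 d2 d3 by (auto simp: d_def)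
      have "norm (f (u + v) - f u - (\<Sum>k\<in>insert k K. v $ k * pd k f u)) \<le> e * norm v"
        if v: "\<forall>i. i \<notin> insert k K \<longrightarrow> v $ i = 0" "norm v < d" for v
      proof -
        define w where "w = (\<chi> i. if i = k then 0 else v $ i)"
        have w: "norm w \<le> norm v" unfolding w_def by (rule norm_zero_coordinate_le)
        have vw: "v = w + v $ k *s axis k 1" by (auto simp: w_def vec_eq_iff axis_def)
        have "norm (f (u + w) - f u - (\<Sum>i\<in>K. w $ i * pd i f u)) \<le> e / 2 * norm w"
          using v w d by (intro d1) (auto simp: w_def)
        moreover have "(\<Sum>i\<in>K. w $ i * pd i f u) = (\<Sum>i\<in>K. v $ i * pd i f u)"
          using insert.hyps by (intro sum.cong) (auto simp: w_def)
        ultimately have 1: "norm (f (u + w) - f u - (\<Sum>i\<in>K. v $ i * pd i f u)) \<le> e / 2 * norm v"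
          using w e by (smt (verit) mult_left_mono half_gt_zero)
        have near: "dist (u + w + s *s axis k 1) u < 2 * d" if "norm s \<le> norm (v $ k)" for s :: complex
        proof -
          have "norm (w + s *s axis k 1) \<le> norm w + norm (s *s axis k (1::complex))" by (rule norm_triangle_ineq)
          also have "\<dots> \<le> norm v + norm v" using w that Finite_Cartesian_Product.norm_nth_le [of v k] by simp
          finally show ?thesis using v by (simp add: dist_norm add.assoc)
        qed
        let ?g = "\<lambda>s. f (u + w + s *s axis k 1) - s * pd k f u"
        have "norm (?g (v $ k) - ?g 0) \<le> e / 2 * norm (v $ k - 0)"
        proof (rule field_differentiable_bound [where S = "cball 0 (norm (v $ k))"])
          fix s :: complex assume s: "s \<in> cball 0 (norm (v $ k))"
          have sd: "dist (u + w + s *s axis k 1) u < 2 * d" using near s by simp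
          then have "u + w + s *s axis k 1 \<in> ball u d2"
            unfolding mem_ball dist_commute [of u] using d(3) by linarith
          then have "u + w + s *s axis k 1 \<in> U" using d2 by blast
          from sepholo_slice [OF sep this]
          show "(?g has_field_derivative pd k f (u + w + s *s axis k 1) - pd k f u) (at s within cball 0 (norm (v $ k)))"
            by (auto intro!: derivative_eq_intros intro: DERIV_subset)
          show "norm (pd k f (u + w + s *s axis k 1) - pd k f u) \<le> e / 2"
            using d3(2) [of "u + w + s *s axis k 1"] sd d by (simp add: dist_norm)
        qed auto
        also have "\<dots> \<le> e / 2 * norm v" using e Finite_Cartesian_Product.norm_nth_le [of v k] by simp
        finally have 2: "norm (f (u + v) - f (u + w) - v $ k * pd k f u) \<le> e / 2 * norm v"
          by (subst vw) (simp add: add.assoc algebra_simps)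
        have "f (u + v) - f u - (\<Sum>i\<in>insert k K. v $ i * pd i f u) =
          (f (u + w) - f u - (\<Sum>i\<in>K. v $ i * pd i f u)) + (f (u + v) - f (u + w) - v $ k * pd k f u)"
          using insert.hyps by simp
        then show ?thesis using norm_triangle_ineq 1 2
          by (smt (verit) field_sum_of_halves distrib_right)
      qed
      then show "\<exists>d>0. \<forall>v. (\<forall>i. i \<notin> insert k K \<longrightarrow> v $ i = 0) \<and> norm v < d \<longrightarrow>
          norm (f (u + v) - f u - (\<Sum>k\<in>insert k K. v $ k * pd k f u)) \<le> e * norm v"
        using d by blast
    qed
  qed
  let ?D = "\<lambda>v. \<Sum>k\<in>UNIV. v $ k * pd k f u"
  show "(f has_derivative ?D) (at u)"
    unfolding has_derivative_at_alt
  proof (intro conjI allI impI)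
    show "bounded_linear ?D"
      by (intro bounded_linear_sum bounded_linear_mult_const bounded_linear_vec_nth)
    fix e :: real assume "0 < e"
    then obtain d where "d > 0" and d: "\<And>v. norm v < d \<Longrightarrow> norm (f (u + v) - f u - ?D v) \<le> e * norm v"
      using approx [of UNIV] by auto
    then show "\<exists>d>0. \<forall>y. norm (y - u) < d \<longrightarrow> norm (f y - f u - ?D (y - u)) \<le> e * norm (y - u)"
      using d [of "_ - u"] by (intro exI [of _ d]) auto
  qed
  show "?D (c *s v) = c * ?D v" for c v by (simp add: sum_distrib_left mult.assoc)
qed

text \<open>The difference quotients of \<open>f\<close> in direction \<open>k\<close>, as functions
  of the slice variable in direction \<open>l\<close>, converge uniformly to \<open>pd k f\<close>.
  By Weierstrass their \<open>l\<close>-derivatives converge too; these are difference quotients of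
  \<open>pd l f\<close>, so one number \<open>d\<close> is both mixed derivatives.\<close>

lemma pd_pd_slice:
  fixes f :: "complex^'n \<Rightarrow> complex"
  assumes U: "open U" and f: "holo_fun U f" and w: "w \<in> U"
  shows "\<exists>d. ((\<lambda>t. pd k f (w + t *s axis l 1)) has_field_derivative d) (at 0) \<and>
             ((\<lambda>t. pd l f (w + t *s axis k 1)) has_field_derivative d) (at 0)"
proof -
  have contpd: "continuous_on U (pd k f)" for k
    using continuous_on_pd U f holo_fun_continuous_on holo_fun_sepholo by blast
  obtain r0 where r0: "r0 > 0" "cball w r0 \<subseteq> U" using U w open_contains_cball by blast
  define r where "r = r0 / 2"
  have r: "r > 0" using r0 r_def by simp
  have inC: "w + t *s axis l 1 + s *s axis k 1 \<in> cball w r0" if "norm t \<le> r" "norm s \<le> r" for s t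
  proof -
    have "norm (t *s axis l 1 + s *s axis k (1::complex)) \<le> norm t + norm s"
      using norm_triangle_ineq [of "t *s axis l 1" "s *s axis k 1"] by simp
    then have "norm (- (t *s axis l 1 + s *s axis k (1::complex))) \<le> norm t + norm s"
      by (simp only: norm_minus_cancel)
    then show ?thesis using that by (simp add: dist_norm r_def)
  qed
  have inU: "w + t *s axis l 1 + s *s axis k 1 \<in> U" if "norm t \<le> r" "norm s \<le> r" for s t
    using inC [OF that] r0 by blast
  let ?q = "\<lambda>s t. (f (w + t *s axis l 1 + s *s axis k 1) - f (w + t *s axis l 1)) / s"
  let ?q' = "\<lambda>s t. (pd l f (w + t *s axis l 1 + s *s axis k 1) - pd l f (w + t *s axis l 1)) / s"
  have nearz: "\<forall>\<^sub>F s in at (0::complex). norm s < r \<and> s \<noteq> 0"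
    using r unfolding eventually_at by (auto intro!: exI [of _ r])
  have deriv_q: "(?q s has_field_derivative ?q' s t) (at t)" if s: "norm s < r" "s \<noteq> 0" and t: "norm t \<le> r" for s t
  proof -
    have comm: "w + s *s axis k 1 + t *s axis l 1 = w + t *s axis l 1 + s *s axis k 1" for s t :: complex
      by (simp add: algebra_simps)
    have "((\<lambda>t. f (w + s *s axis k 1 + t *s axis l 1)) has_field_derivative
        pd l f (w + s *s axis k 1 + t *s axis l 1)) (at t)"
    proof (rule holo_fun_slice [OF f])
      show "w + s *s axis k 1 + t *s axis l 1 \<in> U"
        unfolding comm by (rule inU) (use s t in auto)
    qed
    moreover have "((\<lambda>t. f (w + t *s axis l 1)) has_field_derivative pd l f (w + t *s axis l 1)) (at t)"
      by (rule holo_fun_slice [OF f]) (use inU [of t 0] t r in simp)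
    ultimately show ?thesis using s
      by (auto intro!: derivative_eq_intros simp: comm)
  qed
  \<comment> \<open>Uniform continuity of \<open>pd k f\<close> on a compact ball makes the mean
    value estimate independent of \<open>t\<close>.\<close>
  have unif: "uniform_limit (cball 0 r) ?q (\<lambda>t. pd k f (w + t *s axis l 1)) (at 0)"
    unfolding uniform_limit_iff
  proof (intro allI impI)
    fix e :: real assume e: "e > 0"
    have "uniformly_continuous_on (cball w r0) (pd k f)"
      using contpd r0 by (intro compact_uniformly_continuous) (auto intro: continuous_on_subset)
    then obtain d where d: "d > 0" "\<And>x y. x \<in> cball w r0 \<Longrightarrow> y \<in> cball w r0 \<Longrightarrow> dist y x < d \<Longrightarrow> dist (pd k f y) (pd k f x) < e / 2"
      unfolding uniformly_continuous_on_def using e by (metis half_gt_zero)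
    have "dist (?q s t) (pd k f (w + t *s axis l 1)) < e" if s: "norm s < min r d" "s \<noteq> 0" and t: "t \<in> cball 0 r" for s t
    proof -
      let ?g = "\<lambda>z. f (w + t *s axis l 1 + z *s axis k 1) - z * pd k f (w + t *s axis l 1)"
      have "norm (?g s - ?g 0) \<le> e / 2 * norm (s - 0)"
      proof (rule field_differentiable_bound [where S = "cball 0 (norm s)"])
        fix z :: complex assume z: "z \<in> cball 0 (norm s)"
        have "((\<lambda>z. f (w + t *s axis l 1 + z *s axis k 1)) has_field_derivative pd k f (w + t *s axis l 1 + z *s axis k 1)) (at z)"
          by (rule holo_fun_slice [OF f]) (use inU [of t z] t z s in auto)
        then show "(?g has_field_derivative pd k f (w + t *s axis l 1 + z *s axis k 1) - pd k f (w + t *s axis l 1)) (at z within cball 0 (norm s))"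
          by (auto intro!: derivative_eq_intros intro: DERIV_subset)
        have "dist (pd k f (w + t *s axis l 1 + z *s axis k 1)) (pd k f (w + t *s axis l 1)) < e / 2"
          by (rule d(2)) (use inC [of t z] inC [of t 0] t z s r in \<open>auto simp: dist_norm\<close>)
        then show "norm (pd k f (w + t *s axis l 1 + z *s axis k 1) - pd k f (w + t *s axis l 1)) \<le> e / 2"
          by (simp add: dist_norm)
      qed auto
      then have "norm ((f (w + t *s axis l 1 + s *s axis k 1) - f (w + t *s axis l 1)) - s * pd k f (w + t *s axis l 1)) \<le> e / 2 * norm s"
        by (simp add: algebra_simps)
      moreover have "(f (w + t *s axis l 1 + s *s axis k 1) - f (w + t *s axis l 1)) - s * pd k f (w + t *s axis l 1)
          = s * (?q s t - pd k f (w + t *s axis l 1))"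
        using s by (simp add: field_simps)
      ultimately have "norm (?q s t - pd k f (w + t *s axis l 1)) \<le> e / 2"
        using s by (simp add: norm_mult mult.commute)
      then show ?thesis using e by (simp add: dist_norm)
    qed
    then show "\<forall>\<^sub>F s in at 0. \<forall>t\<in>cball 0 r. dist (?q s t) (pd k f (w + t *s axis l 1)) < e"
      unfolding eventually_at using r d by (intro exI [of _ "min r d"]) auto
  qed
  have ev: "\<forall>\<^sub>F s in at 0. continuous_on (cball 0 r) (?q s) \<and> (\<forall>t\<in>ball 0 r. (?q s has_field_derivative ?q' s t) (at t))"
    using nearz
  proof eventually_elim
    case (elim s)
    then show ?case using deriv_q [of s]
      by (auto intro!: continuous_at_imp_continuous_on DERIV_isCont)
  qed
  from has_complex_derivative_uniform_limit [OF ev unif _ r]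
  obtain g' where g': "\<And>t. t \<in> ball 0 r \<Longrightarrow> ((\<lambda>t. pd k f (w + t *s axis l 1)) has_field_derivative g' t) (at t) \<and>
      ((\<lambda>s. ?q' s t) \<longlongrightarrow> g' t) (at 0)" by auto
  have "((\<lambda>s. (pd l f (w + s *s axis k 1) - pd l f w) / s) \<longlongrightarrow> g' 0) (at 0)"
    using g' [of 0] r by simp
  then have "((\<lambda>s. pd l f (w + s *s axis k 1)) has_field_derivative g' 0) (at 0)"
    by (simp add: has_field_derivative_iff)
  moreover have "((\<lambda>t. pd k f (w + t *s axis l 1)) has_field_derivative g' 0) (at 0)"
    using g' [of 0] r by simp
  ultimately show ?thesis by blast
qed

lemma holo_fun_pd:
  assumes "open U" "holo_fun U f"
  shows "holo_fun U (pd k f)"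
proof (rule osgood [OF assms(1)])
  show "continuous_on U (pd k f)"
    using continuous_on_pd [OF assms(1)] assms holo_fun_continuous_on holo_fun_sepholo by blast
  show "sepholo U (pd k f)"
    unfolding sepholo_def field_differentiable_def using pd_pd_slice [OF assms] by blast
qed

lemma pd_commute:
  assumes "open U" "holo_fun U f" "u \<in> U"
  shows "pd l (pd k f) u = pd k (pd l f) u"
proof -
  obtain d where "((\<lambda>t. pd k f (u + t *s axis l 1)) has_field_derivative d) (at 0)"
    "((\<lambda>t. pd l f (u + t *s axis k 1)) has_field_derivative d) (at 0)"
    using pd_pd_slice [OF assms] by blast
  then show ?thesis
    unfolding pd_def [of l "pd k f"] pd_def [of k "pd l f"] by (simp add: DERIV_imp_deriv)
qed

subsection \<open>Calculus of partial derivatives\<close>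

named_theorems holo_intros

lemma holo_fun_subset: "holo_fun U f \<Longrightarrow> V \<subseteq> U \<Longrightarrow> holo_fun V f"
  unfolding holo_fun_def by blast

lemma has_derivative_vec_nth_cart: "((\<lambda>v :: complex^'n. v $ i) has_derivative (\<lambda>v. v $ i)) (at u)"
  by (rule bounded_linear.has_derivative [OF bounded_linear_vec_nth has_derivative_ident])

lemma holo_fun_const [holo_intros]: "holo_fun U (\<lambda>_. c)"
  unfolding holo_fun_def by (intro ballI exI [of _ "\<lambda>_. 0"]) auto

lemma holo_fun_coord [holo_intros]: "holo_fun U (\<lambda>u. u $ i)"
  unfolding holo_fun_def
  by (intro ballI exI [of _ "\<lambda>v. v $ i"] conjI has_derivative_vec_nth_cart) auto

lemma holo_fun_add [holo_intros]:
  assumes "holo_fun U f" "holo_fun U g" shows "holo_fun U (\<lambda>u. f u + g u)"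
  unfolding holo_fun_def
proof
  fix u assume "u \<in> U"
  then obtain D E where D: "(f has_derivative D) (at u)" "\<forall>c v. D (c *s v) = c * D v"
    and E: "(g has_derivative E) (at u)" "\<forall>c v. E (c *s v) = c * E v"
    using assms unfolding holo_fun_def by blast
  show "\<exists>D. ((\<lambda>u. f u + g u) has_derivative D) (at u) \<and> (\<forall>c v. D (c *s v) = c * D v)"
    by (rule exI [of _ "\<lambda>v. D v + E v"]) (use has_derivative_add [OF D(1) E(1)] D(2) E(2) in \<open>auto simp: algebra_simps\<close>)
qed

lemma holo_fun_mult [holo_intros]:
  assumes "holo_fun U f" "holo_fun U g" shows "holo_fun U (\<lambda>u. f u * g u)"
  unfolding holo_fun_def
proof
  fix u assume "u \<in> U"
  then obtain D E where D: "(f has_derivative D) (at u)" "\<forall>c v. D (c *s v) = c * D v"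
    and E: "(g has_derivative E) (at u)" "\<forall>c v. E (c *s v) = c * E v"
    using assms unfolding holo_fun_def by blast
  show "\<exists>D. ((\<lambda>u. f u * g u) has_derivative D) (at u) \<and> (\<forall>c v. D (c *s v) = c * D v)"
    by (rule exI [of _ "\<lambda>v. f u * E v + D v * g u"])
      (use has_derivative_mult [OF D(1) E(1)] D(2) E(2) in \<open>auto simp: algebra_simps\<close>)
qed

lemma holo_fun_compose:
  assumes "holo_fun U f" "\<And>u. u \<in> U \<Longrightarrow> g field_differentiable (at (f u))"
  shows "holo_fun U (\<lambda>u. g (f u))"
  unfolding holo_fun_def
proof
  fix u assume u: "u \<in> U"
  then obtain D where D: "(f has_derivative D) (at u)" "\<forall>c v. D (c *s v) = c * D v"
    using assms(1) unfolding holo_fun_def by blast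
  obtain g' where "(g has_field_derivative g') (at (f u))"
    using assms(2) [OF u] unfolding field_differentiable_def by blast
  then have "(g has_derivative (*) g') (at (f u))" by (simp add: has_field_derivative_def)
  from diff_chain_at [OF D(1) this]
  have "((\<lambda>u. g (f u)) has_derivative (\<lambda>v. g' * D v)) (at u)" by (simp add: o_def)
  then show "\<exists>D. ((\<lambda>u. g (f u)) has_derivative D) (at u) \<and> (\<forall>c v. D (c *s v) = c * D v)"
    using D(2) by (intro exI [of _ "\<lambda>v. g' * D v"]) auto
qed

lemma holo_fun_minus [holo_intros]: "holo_fun U f \<Longrightarrow> holo_fun U (\<lambda>u. - f u)"
  using holo_fun_mult [OF holo_fun_const [of U "-1"], of f] by simp

lemma holo_fun_diff [holo_intros]: "holo_fun U f \<Longrightarrow> holo_fun U g \<Longrightarrow> holo_fun U (\<lambda>u. f u - g u)"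
  using holo_fun_add [OF _ holo_fun_minus, of U f g] by simp

lemma holo_fun_sum [holo_intros]: "(\<And>i. i \<in> I \<Longrightarrow> holo_fun U (f i)) \<Longrightarrow> holo_fun U (\<lambda>u. \<Sum>i\<in>I. f i u)"
  by (induction I rule: infinite_finite_induct) (auto intro: holo_intros)

lemma holo_fun_prod [holo_intros]: "(\<And>i. i \<in> I \<Longrightarrow> holo_fun U (f i)) \<Longrightarrow> holo_fun U (\<lambda>u. \<Prod>i\<in>I. f i u)"
  by (induction I rule: infinite_finite_induct) (auto intro: holo_intros)

lemma holo_fun_power [holo_intros]: "holo_fun U f \<Longrightarrow> holo_fun U (\<lambda>u. f u ^ m)"
  by (induction m) (auto intro: holo_intros)

lemma holo_fun_inverse:
  "holo_fun U f \<Longrightarrow> (\<And>u. u \<in> U \<Longrightarrow> f u \<noteq> 0) \<Longrightarrow> holo_fun U (\<lambda>u. inverse (f u))"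
  by (rule holo_fun_compose) (auto intro: field_differentiable_inverse field_differentiable_ident)

lemma holo_fun_divide [holo_intros]:
  "holo_fun U f \<Longrightarrow> holo_fun U g \<Longrightarrow> (\<And>u. u \<in> U \<Longrightarrow> g u \<noteq> 0) \<Longrightarrow> holo_fun U (\<lambda>u. f u / g u)"
  using holo_fun_mult [OF _ holo_fun_inverse, of U f g] by (simp add: divide_inverse)

lemma holo_fun_transfer:
  assumes "holo_fun U f" "open U" "\<And>u. u \<in> U \<Longrightarrow> f u = g u"
  shows "holo_fun U g"
  unfolding holo_fun_def
proof
  fix u assume u: "u \<in> U"
  then obtain D where D: "(f has_derivative D) (at u)" "\<forall>c v. D (c *s v) = c * D v"
    using assms(1) unfolding holo_fun_def by blast
  have "(g has_derivative D) (at u)"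
    by (rule has_derivative_transform_within_open [OF D(1) assms(2) u assms(3)])
  then show "\<exists>D. (g has_derivative D) (at u) \<and> (\<forall>c v. D (c *s v) = c * D v)" using D(2) by blast
qed

lemma pd_eqI:
  assumes "((\<lambda>t. f (u + t *s axis k 1)) has_field_derivative d) (at 0)"
  shows "pd k f u = d"
  unfolding pd_def using assms by (rule DERIV_imp_deriv)

lemma pd_cong:
  assumes "open U" "u \<in> U" "\<And>v. v \<in> U \<Longrightarrow> f v = g v"
  shows "pd k f u = pd k g u"
  unfolding pd_def
proof (rule deriv_cong_ev)
  have "continuous_on UNIV (\<lambda>t. u + t *s axis k (1::complex))" by (intro continuous_intros)
  then have "open ((\<lambda>t. u + t *s axis k (1::complex)) -` U)"
    using assms(1) by (simp add: continuous_on_open_vimage)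
  then have "\<forall>\<^sub>F t in nhds 0. t \<in> (\<lambda>t. u + t *s axis k (1::complex)) -` U"
    by (rule eventually_nhds_in_open) (use assms(2) in simp)
  then show "\<forall>\<^sub>F t in nhds 0. f (u + t *s axis k 1) = g (u + t *s axis k 1)"
    by eventually_elim (use assms(3) in auto)
qed simp

lemma pd_coord [simp]: "pd k (\<lambda>v. v $ i) u = (if i = k then 1 else 0)"
  by (rule pd_eqI) (auto intro!: derivative_eq_intros simp: axis_def)

lemma pd_const [simp]: "pd k (\<lambda>_. c) u = 0"
  unfolding pd_def by simp

lemma pd_compose:
  assumes "holo_fun U f" "u \<in> U" "(g has_field_derivative g') (at (f u))"
  shows "pd k (\<lambda>v. g (f v)) u = g' * pd k f u"
proof (rule pd_eqI)
  have "((\<lambda>t. f (u + t *s axis k 1)) has_field_derivative pd k f u) (at 0)"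
    by (rule holo_fun_slice0 [OF assms(1,2)])
  then show "((\<lambda>t. g (f (u + t *s axis k 1))) has_field_derivative g' * pd k f u) (at 0)"
    using DERIV_chain' [of "\<lambda>t. f (u + t *s axis k 1)" "pd k f u" 0 UNIV g g'] assms(3) by simp
qed

lemma pd_coord_compose:
  assumes "(g has_field_derivative g') (at (u $ i))"
  shows "pd k (\<lambda>v. g (v $ i)) u = (if i = k then g' else 0)"
  using pd_compose [OF holo_fun_coord [of UNIV i] UNIV_I assms, of k] by simp

locale holo_domain =
  fixes U :: "(complex^'n) set"
  assumes open_U: "open U"
begin

lemma
  assumes "holo_fun U f" "holo_fun U g" "u \<in> U"
  shows pd_add: "pd k (\<lambda>v. f v + g v) u = pd k f u + pd k g u"
    and pd_diff: "pd k (\<lambda>v. f v - g v) u = pd k f u - pd k g u"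
    and pd_mult: "pd k (\<lambda>v. f v * g v) u = pd k f u * g u + f u * pd k g u"
proof -
  have f: "((\<lambda>t. f (u + t *s axis k 1)) has_field_derivative pd k f u) (at 0)"
    and g: "((\<lambda>t. g (u + t *s axis k 1)) has_field_derivative pd k g u) (at 0)"
    using holo_fun_slice0 assms by blast+
  show "pd k (\<lambda>v. f v + g v) u = pd k f u + pd k g u"
    by (rule pd_eqI [OF DERIV_add [OF f g]])
  show "pd k (\<lambda>v. f v - g v) u = pd k f u - pd k g u"
    by (rule pd_eqI [OF DERIV_diff [OF f g]])
  show "pd k (\<lambda>v. f v * g v) u = pd k f u * g u + f u * pd k g u"
    by (rule pd_eqI) (use DERIV_mult [OF f g] in \<open>simp add: algebra_simps\<close>)
qed

lemma pd_minus:
  assumes "holo_fun U f" "u \<in> U"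
  shows "pd k (\<lambda>v. - f v) u = - pd k f u"
  by (rule pd_eqI [OF DERIV_minus [OF holo_fun_slice0 [OF assms]]])

lemma pd_cmult:
  assumes "holo_fun U f" "u \<in> U"
  shows "pd k (\<lambda>v. c * f v) u = c * pd k f u"
  using pd_mult [OF holo_fun_const [of U c] assms] by simp

lemma pd_power2:
  assumes "holo_fun U f" "u \<in> U"
  shows "pd k (\<lambda>v. (f v)\<^sup>2) u = 2 * f u * pd k f u"
  using pd_mult [OF assms(1) assms(1,2)] by (simp add: power2_eq_square)

lemma pd_divide:
  assumes "holo_fun U f" "holo_fun U g" "u \<in> U" "g u \<noteq> 0"
  shows "pd k (\<lambda>v. f v / g v) u = (pd k f u * g u - f u * pd k g u) / (g u * g u)"
proof (rule pd_eqI)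
  have f: "((\<lambda>t. f (u + t *s axis k 1)) has_field_derivative pd k f u) (at 0)"
    and g: "((\<lambda>t. g (u + t *s axis k 1)) has_field_derivative pd k g u) (at 0)"
    using holo_fun_slice0 assms by blast+
  from DERIV_divide [OF f g] assms(4)
  show "((\<lambda>t. f (u + t *s axis k 1) / g (u + t *s axis k 1)) has_field_derivative
      (pd k f u * g u - f u * pd k g u) / (g u * g u)) (at 0)" by simp
qed

lemma pd_sum:
  assumes "\<And>i. i \<in> I \<Longrightarrow> holo_fun U (f i)" "u \<in> U"
  shows "pd k (\<lambda>v. \<Sum>i\<in>I. f i v) u = (\<Sum>i\<in>I. pd k (f i) u)"
proof (rule pd_eqI)
  show "((\<lambda>t. \<Sum>i\<in>I. f i (u + t *s axis k 1)) has_field_derivative (\<Sum>i\<in>I. pd k (f i) u)) (at 0)"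
    by (rule DERIV_sum) (use holo_fun_slice0 assms in blast)
qed

lemma holo_pd [holo_intros]: "holo_fun U f \<Longrightarrow> holo_fun U (pd k f)"
  using holo_fun_pd [OF open_U] .

lemmas pd_rules = pd_add pd_diff pd_mult pd_minus pd_sum pd_divide pd_power2

end

subsection \<open>Completely integrable linear systems\<close>

lemma open_line_set: "open U \<Longrightarrow> open {s. u + s *s v \<in> U}" for v :: "complex^'n"
proof -
  assume "open U"
  have "continuous_on UNIV (\<lambda>s. u + s *s v)" by (intro continuous_intros)
  then have "open ((\<lambda>s. u + s *s v) -` U)"
    using \<open>open U\<close> by (simp add: continuous_on_open_vimage)
  then show ?thesis by (simp add: vimage_def)
qed

lemma convex_line_set: "convex U \<Longrightarrow> convex {s. u + s *s v \<in> U}" for v :: "complex^'n"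
proof -
  assume U: "convex U"
  show ?thesis
  proof (rule convexI)
    fix x y :: complex and a b :: real
    assume "x \<in> {s. u + s *s v \<in> U}" "y \<in> {s. u + s *s v \<in> U}" and ab: "0 \<le> a" "0 \<le> b" "a + b = 1"
    then have "a *\<^sub>R (u + x *s v) + b *\<^sub>R (u + y *s v) \<in> U"
      using U by (auto intro: convexD)
    moreover have "a *\<^sub>R (u + x *s v) + b *\<^sub>R (u + y *s v) = (a + b) *\<^sub>R u + (a *\<^sub>R x + b *\<^sub>R y) *s v"
      by (simp add: vec_eq_iff algebra_simps)
    ultimately show "a *\<^sub>R x + b *\<^sub>R y \<in> {s. u + s *s v \<in> U}" using ab by simp
  qed
qed

text \<open>By the equation every higher derivative of \<open>G\<close> is a holomorphic combination
  of the \<open>G B\<close>, so all derivatives vanish at \<open>z\<close> and the identity theorem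
  applies.\<close>

lemma linear_ode_zero:
  fixes G :: "'r::finite \<Rightarrow> complex \<Rightarrow> complex"
  assumes S: "open S" "connected S" "z \<in> S"
    and M: "\<And>A B. M A B holomorphic_on S"
    and G: "\<And>A t. t \<in> S \<Longrightarrow> (G A has_field_derivative (\<Sum>B\<in>UNIV. M A B t * G B t)) (at t)"
    and z: "\<And>A. G A z = 0" and t: "t \<in> S"
  shows "G A t = 0"
proof -
  have holG: "G A holomorphic_on S" for A
    using G S(1) by (auto simp: holomorphic_on_open)
  have coeffs: "\<exists>c. (\<forall>A B. c A B holomorphic_on S) \<and>
      (\<forall>t\<in>S. \<forall>A. (deriv ^^ m) (G A) t = (\<Sum>B\<in>UNIV. c A B t * G B t))" for m
  proof (induction m)
    case 0
    have "(\<Sum>B\<in>UNIV. (if A = B then 1 else 0) * G B t) = G A t" for A t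
      by (simp add: if_distrib [of "\<lambda>x. x * _"] cong: if_cong)
    then show ?case by (intro exI [of _ "\<lambda>A B t. if A = B then 1 else 0"]) auto
  next
    case (Suc m)
    then obtain c where c: "\<And>A B. c A B holomorphic_on S"
      and eq: "\<And>A t. t \<in> S \<Longrightarrow> (deriv ^^ m) (G A) t = (\<Sum>B\<in>UNIV. c A B t * G B t)" by blast
    define c' where "c' = (\<lambda>A C t. deriv (c A C) t + (\<Sum>B\<in>UNIV. c A B t * M B C t))"
    have "c' A B holomorphic_on S" for A B
      unfolding c'_def using c M S by (intro holomorphic_intros) auto
    moreover have "(deriv ^^ Suc m) (G A) t = (\<Sum>B\<in>UNIV. c' A B t * G B t)" if t: "t \<in> S" for A t
    proof -
      have cd: "(c A B has_field_derivative deriv (c A B) t) (at t)" for B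
        using c S(1) t holomorphic_derivI by blast
      have "(deriv ^^ Suc m) (G A) t = deriv (\<lambda>t. \<Sum>B\<in>UNIV. c A B t * G B t) t"
        by (simp, rule deriv_cong_ev)
          (use eq S(1) t in \<open>auto intro!: eventually_mono [OF eventually_nhds_in_open [of S t]]\<close>)
      also have "\<dots> = (\<Sum>B\<in>UNIV. deriv (c A B) t * G B t + (\<Sum>C\<in>UNIV. M B C t * G C t) * c A B t)"
        by (intro DERIV_imp_deriv DERIV_sum DERIV_mult cd G t)
      also have "\<dots> = (\<Sum>B\<in>UNIV. deriv (c A B) t * G B t) + (\<Sum>B\<in>UNIV. \<Sum>C\<in>UNIV. c A B t * M B C t * G C t)"
        by (simp add: sum.distrib sum_distrib_left sum_distrib_right mult_ac)
      also have "(\<Sum>B\<in>UNIV. \<Sum>C\<in>UNIV. c A B t * M B C t * G C t) = (\<Sum>C\<in>UNIV. \<Sum>B\<in>UNIV. c A B t * M B C t * G C t)"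
        by (rule sum.swap)
      finally show ?thesis
        by (simp add: c'_def sum.distrib distrib_right sum_distrib_right)
    qed
    ultimately show ?case by blast
  qed
  have "(deriv ^^ m) (G A) z = 0" for m
    using coeffs [of m] S(3) z by (metis (no_types, lifting) mult_zero_right sum.neutral)
  then show ?thesis
    using holomorphic_fun_eq_0_on_connected [OF holG S(1,2) _ S(3) t] by blast
qed

text \<open>Along the complex line through \<open>u0\<close> and \<open>u\<close> the system becomes
  an ordinary one; convexity makes the part of the line inside \<open>U\<close> connected.\<close>

lemma radial_ode_zero:
  fixes G :: "'r::finite \<Rightarrow> complex^'n \<Rightarrow> complex"
  assumes U: "open U" "convex U" "u0 \<in> U" "u \<in> U"
    and Om: "\<And>k A B. holo_fun U (Om k A B)" and G: "\<And>A. holo_fun U (G A)"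
    and eq: "\<And>k A u. u \<in> U \<Longrightarrow> pd k (G A) u = (\<Sum>B\<in>UNIV. Om k A B u * G B u)"
    and 0: "\<And>A. G A u0 = 0"
  shows "G A u = 0"
proof -
  define v where "v = u - u0"
  define S where "S = {s. u0 + s *s v \<in> U}"
  have S: "open S" "convex S" unfolding S_def using U open_line_set convex_line_set by blast+
  have "0 \<in> S" "1 \<in> S" using U by (auto simp: S_def v_def)
  have hol: "(\<lambda>s. f (u0 + s *s v)) holomorphic_on S" if "holo_fun U f" for f
    using holo_fun_along_line [OF that] S(1) unfolding S_def by (auto simp: holomorphic_on_open)
  have "(\<lambda>s. G A (u0 + s *s v)) 1 = 0"
  proof (rule linear_ode_zero [OF S(1) convex_connected [OF S(2)] \<open>0 \<in> S\<close>, where G = "\<lambda>A s. G A (u0 + s *s v)"])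
    show "(\<lambda>s. \<Sum>k\<in>UNIV. v $ k * Om k A B (u0 + s *s v)) holomorphic_on S" for A B
      by (intro holomorphic_intros hol Om)
    fix A t assume t: "t \<in> S"
    have "(\<Sum>k\<in>UNIV. v $ k * pd k (G A) (u0 + t *s v)) =
        (\<Sum>B\<in>UNIV. (\<Sum>k\<in>UNIV. v $ k * Om k A B (u0 + t *s v)) * G B (u0 + t *s v))"
      using t eq by (simp add: S_def sum_distrib_left sum_distrib_right mult.assoc) (rule sum.swap)
    then show "((\<lambda>s. G A (u0 + s *s v)) has_field_derivative
        (\<Sum>B\<in>UNIV. (\<Sum>k\<in>UNIV. v $ k * Om k A B (u0 + t *s v)) * G B (u0 + t *s v))) (at t)"
      using holo_fun_along_line [OF G, of u0 t v A] t by (simp add: S_def)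
  qed (use 0 \<open>1 \<in> S\<close> in auto)
  then show ?thesis by (simp add: v_def)
qed

lemma pd_zero_imp_const:
  fixes f :: "complex^'n \<Rightarrow> complex"
  assumes U: "open U" "convex U" "u0 \<in> U" "u \<in> U" and f: "holo_fun U f"
    and 0: "\<And>k u. u \<in> U \<Longrightarrow> pd k f u = 0"
  shows "f u = f u0"
proof -
  interpret holo_domain U by unfold_locales (rule U)
  have "(\<lambda>_::unit. \<lambda>v. f v - f u0) () u = 0"
    by (rule radial_ode_zero [OF U, where Om = "\<lambda>_ _ _ _. 0"])
      (auto intro!: holo_intros f simp: pd_diff f holo_fun_const 0)
  then show ?thesis by simp
qed

text \<open>Weierstrass' theorem on each slice gives separate holomorphy and convergence of the
  derivatives, the uniform limit gives continuity, and \<open>osgood\<close> concludes.\<close>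

lemma holo_uniform_limit:
  fixes S :: "nat \<Rightarrow> complex^'n \<Rightarrow> complex"
  assumes U: "open U" and S: "\<And>N. holo_fun U (S N)"
    and lim: "\<And>u. u \<in> U \<Longrightarrow> \<exists>r>0. cball u r \<subseteq> U \<and> uniform_limit (cball u r) S F sequentially"
  shows "holo_fun U F" and "u \<in> U \<Longrightarrow> (\<lambda>N. pd k (S N) u) \<longlonglongrightarrow> pd k F u"
proof -
  have slice: "\<exists>d. ((\<lambda>t. F (u + t *s axis k 1)) has_field_derivative d) (at 0) \<and> (\<lambda>N. pd k (S N) u) \<longlonglongrightarrow> d"
    if u: "u \<in> U" for u k
  proof -
    obtain r where r: "r > 0" "cball u r \<subseteq> U" "uniform_limit (cball u r) S F sequentially"
      using lim [OF u] by blast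
    have inU: "u + t *s axis k 1 \<in> cball u r" if "t \<in> cball 0 r" for t
      using that by (simp add: dist_norm)
    have unif: "uniform_limit (cball 0 r) (\<lambda>N t. S N (u + t *s axis k 1)) (\<lambda>t. F (u + t *s axis k 1)) sequentially"
      unfolding uniform_limit_iff
    proof (intro allI impI)
      fix e :: real assume "e > 0"
      with r(3) have "\<forall>\<^sub>F n in sequentially. \<forall>x\<in>cball u r. dist (S n x) (F x) < e"
        unfolding uniform_limit_iff by blast
      then show "\<forall>\<^sub>F n in sequentially. \<forall>t\<in>cball 0 r. dist (S n (u + t *s axis k 1)) (F (u + t *s axis k 1)) < e"
        by eventually_elim (use inU in blast)
    qed
    have d: "((\<lambda>t. S N (u + t *s axis k 1)) has_field_derivative pd k (S N) (u + t *s axis k 1)) (at t)"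
      if "t \<in> cball 0 r" for N t
      using holo_fun_slice [OF S] inU [OF that] r(2) by blast
    have "\<forall>\<^sub>F N in sequentially. continuous_on (cball 0 r) (\<lambda>t. S N (u + t *s axis k 1)) \<and>
        (\<forall>t\<in>ball 0 r. ((\<lambda>t. S N (u + t *s axis k 1)) has_field_derivative pd k (S N) (u + t *s axis k 1)) (at t))"
    proof (intro always_eventually allI conjI ballI)
      show "continuous_on (cball 0 r) (\<lambda>t. S N (u + t *s axis k 1))" for N
        by (rule continuous_at_imp_continuous_on) (blast intro: DERIV_isCont d)
    qed (use d in auto)
    from has_complex_derivative_uniform_limit [OF this unif _ r(1)]
    obtain g' where "\<And>t. t \<in> ball 0 r \<Longrightarrow> ((\<lambda>t. F (u + t *s axis k 1)) has_field_derivative g' t) (at t) \<and>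
        (\<lambda>N. pd k (S N) (u + t *s axis k 1)) \<longlonglongrightarrow> g' t" by auto
    from this [of 0] r(1) show ?thesis by auto
  qed
  show "holo_fun U F"
  proof (rule osgood [OF U])
    show "sepholo U F" unfolding sepholo_def field_differentiable_def using slice by blast
    show "continuous_on U F"
    proof (rule continuous_at_imp_continuous_on, rule ballI)
      fix u assume "u \<in> U"
      then obtain r where r: "r > 0" "cball u r \<subseteq> U" "uniform_limit (cball u r) S F sequentially"
        using lim by blast
      have "continuous_on (cball u r) F"
        by (rule uniform_limit_theorem [OF _ r(3)])
          (auto intro!: always_eventually continuous_on_subset [OF holo_fun_continuous_on [OF S] r(2)])
      then have "continuous_on (ball u r) F" by (rule continuous_on_subset) auto
      then show "isCont F u" using r(1) by (simp add: continuous_on_eq_continuous_at)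
    qed
  qed
  show "(\<lambda>N. pd k (S N) u) \<longlonglongrightarrow> pd k F u" if "u \<in> U"
    using slice [OF that, of k] pd_eqI by metis
qed

lemma continuous_on_cscale2 [continuous_intros]:
  fixes g :: "'p::topological_space \<Rightarrow> complex^'n"
  shows "continuous_on S f \<Longrightarrow> continuous_on S g \<Longrightarrow> continuous_on S (\<lambda>x. f x *s g x)"
  unfolding vector_scalar_mult_def by (intro continuous_intros)

text \<open>\<open>J\<close> integrates the form with coefficients \<open>\<psi>\<close> along the
  segment from \<open>u0\<close>. The form is not assumed closed, so only the radial component of
  the differential of \<open>J\<close> can be prescribed.\<close>

lemma radial_primitive:
  fixes \<psi> :: "'n::finite \<Rightarrow> complex^'n \<Rightarrow> complex"
  assumes U: "open U" "convex U" "u0 \<in> U" and \<psi>: "\<And>k. holo_fun U (\<psi> k)"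
  shows "\<exists>J. holo_fun U J \<and> J u0 = 0 \<and>
    (\<forall>u\<in>U. (\<Sum>k\<in>UNIV. (u - u0) $ k * pd k J u) = (\<Sum>k\<in>UNIV. (u - u0) $ k * \<psi> k u))"
proof -
  interpret holo_domain U by unfold_locales (rule U)
  define p where "p = (\<lambda>u (t::real). u0 + of_real t *s (u - u0))"
  define \<phi> where "\<phi> = (\<lambda>u t. \<Sum>k\<in>UNIV. (u - u0) $ k * \<psi> k (p u t))"
  define J where "J = (\<lambda>u. integral (cbox 0 1) (\<phi> u))"
  have pU: "p u t \<in> U" if "u \<in> U" "t \<in> cbox 0 1" for u t
  proof -
    have "p u t = (1 - t) *\<^sub>R u0 + t *\<^sub>R u"
      unfolding p_def by (simp add: vec_eq_iff) (simp add: scaleR_conv_of_real algebra_simps)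
    then show ?thesis using U that by (simp add: convexD_alt)
  qed
  have cont: "continuous_on (U \<times> cbox 0 1) (\<lambda>x. f (p (fst x) (snd x)))" if "holo_fun U f" for f
    by (rule continuous_on_compose2 [OF holo_fun_continuous_on [OF that]])
      (use pU in \<open>auto simp: p_def intro!: continuous_intros\<close>)
  have cont\<phi>: "continuous_on (U \<times> cbox 0 1) (\<lambda>(u, t). \<phi> u t)"
    unfolding \<phi>_def case_prod_unfold by (intro continuous_intros cont \<psi>)
  have int\<phi>: "\<phi> u integrable_on cbox 0 1" if "u \<in> U" for u
  proof (rule integrable_continuous)
    have "continuous_on (cbox 0 1) (\<lambda>t. (\<lambda>(u, t). \<phi> u t) (u, t))"
      by (rule continuous_on_compose2 [OF cont\<phi>]) (use that in \<open>auto intro!: continuous_intros\<close>)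
    then show "continuous_on (cbox 0 1) (\<phi> u)" by simp
  qed
  have "sepholo U J"
    unfolding sepholo_def
  proof (intro ballI allI)
    fix u l assume u: "u \<in> U"
    then obtain r where r: "r > 0" "cball u r \<subseteq> U" using U open_contains_cball by blast
    have inU: "u + s *s axis l 1 \<in> U" if "s \<in> ball 0 r" for s
    proof -
      have "dist u (u + s *s axis l 1) = norm s"
        by (simp add: dist_norm)
      then have "u + s *s axis l 1 \<in> cball u r" using that by simp
      then show ?thesis using r by blast
    qed
    define fx where "fx = (\<lambda>s (t::real). \<Sum>k\<in>UNIV. axis l 1 $ k * \<psi> k (p (u + s *s axis l 1) t) +
        (u + s *s axis l 1 - u0) $ k * (pd l (\<psi> k) (p (u + s *s axis l 1) t) * of_real t))"
    have "((\<lambda>s. integral (cbox 0 1) (\<phi> (u + s *s axis l 1))) has_field_derivative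
        integral (cbox 0 1) (fx 0)) (at 0 within ball 0 r)"
    proof (rule leibniz_rule_field_derivative)
      fix s :: complex and t :: real assume s: "s \<in> ball 0 r" and t: "t \<in> cbox 0 1"
      have pe: "p (u + s *s axis l 1) t = p u t + (of_real t * s) *s axis l 1" for s
        by (simp add: p_def vec_eq_iff algebra_simps)
      have "((\<lambda>s. \<psi> k (p (u + s *s axis l 1) t)) has_field_derivative
          pd l (\<psi> k) (p (u + s *s axis l 1) t) * of_real t) (at s)" for k
      proof -
        have "((\<lambda>s. \<psi> k (p u t + s *s axis l 1)) has_field_derivative
            pd l (\<psi> k) (p u t + (of_real t * s) *s axis l 1)) (at (of_real t * s))"
          by (rule holo_fun_slice [OF \<psi>]) (use pU [OF inU [OF s] t] pe in simp)
        then show ?thesis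
          unfolding pe
          by (rule DERIV_chain2 [where f = "\<lambda>s. \<psi> k (p u t + s *s axis l 1)" and g = "\<lambda>s. of_real t * s"])
            (auto intro!: derivative_eq_intros)
      qed
      moreover have "((\<lambda>s. (u + s *s axis l 1 - u0) $ k) has_field_derivative axis l 1 $ k) (at s)" for k
        by (auto intro!: derivative_eq_intros)
      ultimately have "((\<lambda>s. \<phi> (u + s *s axis l 1) t) has_field_derivative fx s t) (at s)"
        unfolding \<phi>_def fx_def
        by (intro DERIV_sum) (auto intro!: derivative_eq_intros simp: algebra_simps)
      then show "((\<lambda>s. \<phi> (u + s *s axis l 1) t) has_field_derivative fx s t) (at s within ball 0 r)"
        by (rule DERIV_subset) simp
    next
      have c: "continuous_on (ball 0 r \<times> cbox 0 1) (\<lambda>x. f (p (u + fst x *s axis l 1) (snd x)))" if "holo_fun U f" for f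
      proof -
        have "continuous_on (ball 0 r \<times> cbox 0 1) (\<lambda>x. (\<lambda>x. f (p (fst x) (snd x))) (u + fst x *s axis l 1, snd x))"
          by (rule continuous_on_compose2 [OF cont [OF that]]) (use inU in \<open>auto intro!: continuous_intros\<close>)
        then show ?thesis by simp
      qed
      show "continuous_on (ball 0 r \<times> cbox 0 1) (\<lambda>(s, t). fx s t)"
        unfolding fx_def case_prod_unfold
        by (intro continuous_intros c \<psi> holo_pd)
    qed (use int\<phi> inU r in auto)
    then have "(J \<circ> (\<lambda>s. u + s *s axis l 1) has_field_derivative integral (cbox 0 1) (fx 0)) (at 0)"
      using r(1) by (simp add: J_def o_def at_within_open [of 0 "ball 0 r"])
    then show "(\<lambda>t. J (u + t *s axis l 1)) field_differentiable (at 0)"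
      unfolding field_differentiable_def o_def by blast
  qed
  moreover have "continuous_on U J"
    unfolding J_def by (rule integral_continuous_on_param [OF cont\<phi>])
  ultimately have J: "holo_fun U J" using osgood [OF U(1)] by blast
  have "\<phi> u0 = (\<lambda>_. 0)" by (simp add: \<phi>_def fun_eq_iff)
  then have "J u0 = 0" by (simp add: J_def)
  moreover have "(\<Sum>k\<in>UNIV. (u - u0) $ k * pd k J u) = (\<Sum>k\<in>UNIV. (u - u0) $ k * \<psi> k u)" if u: "u \<in> U" for u
  proof -
    define v where "v = u - u0"
    define S where "S = {s. u0 + s *s v \<in> U}"
    have S: "open S" "convex S" unfolding S_def using U open_line_set convex_line_set by blast+
    have S01: "0 \<in> S" "1 \<in> S" using U u by (auto simp: S_def v_def)
    define g where "g = (\<lambda>s. \<Sum>k\<in>UNIV. v $ k * \<psi> k (u0 + s *s v))"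
    have hol: "(\<lambda>s. f (u0 + s *s v)) holomorphic_on S" if "holo_fun U f" for f
      using holo_fun_along_line [OF that] S(1) unfolding S_def by (auto simp: holomorphic_on_open)
    have "g holomorphic_on S" unfolding g_def by (intro holomorphic_intros hol \<psi>)
    then obtain \<Gamma> where "\<And>s. s \<in> S \<Longrightarrow> (\<Gamma> has_field_derivative g s) (at s within S)"
      using holomorphic_convex_primitive' [OF S(2,1)] by blast
    then have \<Gamma>: "(\<Gamma> has_field_derivative g s) (at s)" if "s \<in> S" for s
      using that S(1) by (metis at_within_open)
    \<comment> \<open>On a complex line through \<open>u0\<close> the integral is a one-variable
      primitive, so its derivative at the parameter \<open>1\<close> is the radial
      derivative.\<close>
    have J_line: "J (u0 + s *s v) = \<Gamma> s - \<Gamma> 0" if s: "s \<in> S" for s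
    proof -
      have ts: "s * of_real t \<in> S" if "t \<in> {0..1}" for t
        using convexD_alt [OF S(2) S01(1) s, of t] that by (simp add: scaleR_conv_of_real mult.commute)
      have "((\<lambda>t. \<phi> (u0 + s *s v) t) has_integral \<Gamma> (s * of_real 1) - \<Gamma> (s * of_real 0)) {0..1}"
      proof (rule fundamental_theorem_of_calculus)
        fix t :: real assume t: "t \<in> {0..1}"
        have "((\<lambda>t. \<Gamma> (s * t)) has_field_derivative g (s * of_real t) * s) (at (of_real t))"
          by (rule DERIV_chain2 [where f = \<Gamma> and g = "\<lambda>t. s * t", OF \<Gamma> [OF ts [OF t]]]) (auto intro!: derivative_eq_intros)
        from has_vector_derivative_real_field [OF this]
        have "((\<lambda>t. \<Gamma> (s * of_real t)) has_vector_derivative g (s * of_real t) * s) (at t within {0..1})" .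
        moreover have "g (s * of_real t) * s = \<phi> (u0 + s *s v) t"
          by (simp add: g_def \<phi>_def p_def sum_distrib_left mult_ac vec_eq_iff vector_smult_assoc)
        ultimately show "((\<lambda>t. \<Gamma> (s * of_real t)) has_vector_derivative \<phi> (u0 + s *s v) t) (at t within {0..1})"
          by simp
      qed simp
      then show ?thesis by (simp add: J_def integral_unique)
    qed
    have "((\<lambda>s. \<Gamma> s - \<Gamma> 0) has_field_derivative g 1) (at 1)"
      using \<Gamma> [OF S01(2)] by (auto intro!: derivative_eq_intros)
    then have "((\<lambda>s. J (u0 + s *s v)) has_field_derivative g 1) (at 1)"
      by (rule has_field_derivative_transform_within_open [OF _ S(1) S01(2)]) (simp add: J_line)
    moreover have "((\<lambda>s. J (u0 + s *s v)) has_field_derivative (\<Sum>k\<in>UNIV. v $ k * pd k J u)) (at 1)"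
      using holo_fun_along_line [OF J, of u0 1 v] u by (simp add: v_def)
    ultimately have "(\<Sum>k\<in>UNIV. v $ k * pd k J u) = g 1" by (rule DERIV_unique [symmetric])
    then show ?thesis by (simp add: g_def v_def)
  qed
  ultimately show ?thesis using J by blast
qed

text \<open>One constant for all segments from \<open>u0\<close> to points near \<open>u1\<close>:
  it is the \<open>C\<close> in the majorants of the Picard series and makes the convergence locally
  uniform.\<close>

lemma compact_ray_bound:
  fixes Om :: "'n::finite \<Rightarrow> 'r::finite \<Rightarrow> 'r \<Rightarrow> complex^'n \<Rightarrow> complex"
  assumes U: "open U" "convex U" "u0 \<in> U" "u1 \<in> U" and Om: "\<And>k A B. holo_fun U (Om k A B)"
  shows "\<exists>r C. r > 0 \<and> cball u1 r \<subseteq> U \<and> C \<ge> 0 \<and>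
    (\<forall>w\<in>cball u1 r. \<forall>t\<in>{0..1}. \<forall>A.
      (\<Sum>k\<in>UNIV. \<Sum>B\<in>UNIV. norm ((w - u0) $ k) * norm (Om k A B (u0 + of_real t *s (w - u0)))) \<le> C)"
proof -
  obtain r where r: "r > 0" "cball u1 r \<subseteq> U" using U open_contains_cball by blast
  define f where "f = (\<lambda>x. \<Sum>A\<in>UNIV. \<Sum>k\<in>UNIV. \<Sum>B\<in>UNIV. norm ((fst x - u0) $ k) *
      norm (Om k A B (u0 + of_real (snd x) *s (fst x - u0))))"
  have inU: "u0 + of_real t *s (w - u0) \<in> U" if "w \<in> U" "t \<in> {0..1}" for w t
  proof -
    have "u0 + of_real t *s (w - u0) = (1 - t) *\<^sub>R u0 + t *\<^sub>R w"
      by (simp add: vec_eq_iff) (simp add: scaleR_conv_of_real algebra_simps)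
    then show ?thesis using U that by (simp add: convexD_alt)
  qed
  have "continuous_on (cball u1 r \<times> {0..1}) (\<lambda>x. Om k A B (u0 + of_real (snd x) *s (fst x - u0)))" for k A B
    by (rule continuous_on_compose2 [OF holo_fun_continuous_on [OF Om]])
      (use inU r in \<open>auto intro!: continuous_intros\<close>)
  then have "continuous_on (cball u1 r \<times> {0..1}) f"
    unfolding f_def by (intro continuous_intros) auto
  then have "compact (f ` (cball u1 r \<times> {0..1}))"
    by (intro compact_continuous_image compact_Times) auto
  then obtain C where C: "\<And>x. x \<in> cball u1 r \<times> {0..1} \<Longrightarrow> norm (f x) \<le> C"
    using compact_imp_bounded bounded_iff by (metis imageI)
  have "(\<Sum>k\<in>UNIV. \<Sum>B\<in>UNIV. norm ((w - u0) $ k) * norm (Om k A B (u0 + of_real t *s (w - u0)))) \<le> max 0 C"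
    if wt: "w \<in> cball u1 r" "t \<in> {0..1}" for w t A
  proof -
    have "(\<Sum>k\<in>UNIV. \<Sum>B\<in>UNIV. norm ((w - u0) $ k) * norm (Om k A B (u0 + of_real t *s (w - u0)))) \<le> f (w, t)"
      unfolding f_def fst_conv snd_conv
      by (rule member_le_sum [of A UNIV]) (auto intro!: sum_nonneg)
    also have "\<dots> \<le> C" using C [of "(w, t)"] wt by auto
    finally show ?thesis by simp
  qed
  then show ?thesis using r by (intro exI [of _ r] exI [of _ "max 0 C"]) simp
qed

text \<open>The majorant of the iterate \<open>Suc m\<close> on a ray has as derivative
  \<open>C\<close> times the majorant of the iterate \<open>m\<close>.\<close>

lemma exp_majorant_has_derivative:
  "((\<lambda>t::real. c * C ^ Suc m * t ^ Suc m / fact (Suc m)) has_vector_derivative c * C ^ Suc m * t ^ m / fact m) (at t)"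
proof -
  have "((\<lambda>t::real. c * C ^ Suc m * t ^ Suc m / fact (Suc m)) has_field_derivative
      c * C ^ Suc m * (real (Suc m) * t ^ m) / fact (Suc m)) (at t)"
    by (rule DERIV_cdivide, rule DERIV_cmult) (use DERIV_pow [of "Suc m" t] in simp)
  moreover have "c * C ^ Suc m * (real (Suc m) * t ^ m) / fact (Suc m) = c * C ^ Suc m * t ^ m / fact m"
    by (simp add: field_simps del: of_nat_Suc)
  ultimately show ?thesis
    by (simp only: has_real_derivative_iff_has_vector_derivative)
qed

text \<open>
  The radial equation alone is solved by a Picard series; integrability then turns the remaining
  defects into solutions of a homogeneous radial equation.
\<close>

theorem linear_pfaffian_exists:
  fixes Om :: "'n::finite \<Rightarrow> 'r::finite \<Rightarrow> 'r \<Rightarrow> complex^'n \<Rightarrow> complex"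
  assumes U: "open U" "convex U" "u0 \<in> U" and Om: "\<And>k A B. holo_fun U (Om k A B)"
    and integrable: "\<And>Y u k l A. (\<And>A. holo_fun U (Y A)) \<Longrightarrow> u \<in> U \<Longrightarrow>
        (\<And>m A. pd m (Y A) u = (\<Sum>B\<in>UNIV. Om m A B u * Y B u)) \<Longrightarrow>
        pd l (\<lambda>v. \<Sum>B\<in>UNIV. Om k A B v * Y B v) u = pd k (\<lambda>v. \<Sum>B\<in>UNIV. Om l A B v * Y B v) u"
  shows "\<exists>F. (\<forall>A. holo_fun U (F A) \<and> F A u0 = c A) \<and>
    (\<forall>u\<in>U. \<forall>k A. pd k (F A) u = (\<Sum>B\<in>UNIV. Om k A B u * F B u))"
proof -
  interpret holo_domain U by unfold_locales (rule U)
  define R where "R = (\<lambda>\<psi>. SOME J. holo_fun U J \<and> J u0 = 0 \<and>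
    (\<forall>u\<in>U. (\<Sum>k\<in>UNIV. (u - u0) $ k * pd k J u) = (\<Sum>k\<in>UNIV. (u - u0) $ k * \<psi> k u)))"
  have R: "holo_fun U (R \<psi>) \<and> R \<psi> u0 = 0 \<and>
    (\<forall>u\<in>U. (\<Sum>k\<in>UNIV. (u - u0) $ k * pd k (R \<psi>) u) = (\<Sum>k\<in>UNIV. (u - u0) $ k * \<psi> k u))"
    if "\<And>k. holo_fun U (\<psi> k)" for \<psi> :: "'n \<Rightarrow> complex^'n \<Rightarrow> complex"
    using someI_ex [OF radial_primitive [OF U, of \<psi>, OF that]] unfolding R_def .
  \<comment> \<open>Picard iteration: each iterate is the radial primitive of the coefficient matrix
    applied to the previous one.\<close>
  define J where "J = rec_nat (\<lambda>A _. c A) (\<lambda>_ Jm A. R (\<lambda>k u. \<Sum>B\<in>UNIV. Om k A B u * Jm B u))"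
  have J0: "J 0 A = (\<lambda>_. c A)" for A by (simp add: J_def)
  have JS: "J (Suc m) A = R (\<lambda>k u. \<Sum>B\<in>UNIV. Om k A B u * J m B u)" for m A by (simp add: J_def)
  let ?\<psi> = "\<lambda>m A k u. \<Sum>B\<in>UNIV. Om k A B u * J m B u"
  have hJ: "holo_fun U (J m A)" for m A
  proof (induction m arbitrary: A)
    case 0 then show ?case by (simp add: J0 holo_fun_const)
  next
    case (Suc m)
    have "holo_fun U (?\<psi> m A k)" for k by (intro holo_intros Om Suc)
    from R [of "?\<psi> m A", OF this] show ?case unfolding JS by blast
  qed
  have hOJ: "holo_fun U (?\<psi> m A k)" for k A m by (intro holo_intros Om hJ)
  have RJ: "holo_fun U (J (Suc m) A) \<and> J (Suc m) A u0 = 0 \<and>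
    (\<forall>u\<in>U. (\<Sum>k\<in>UNIV. (u - u0) $ k * pd k (J (Suc m) A) u) = (\<Sum>k\<in>UNIV. (u - u0) $ k * ?\<psi> m A k u))" for m A
    unfolding JS by (rule R [of "?\<psi> m A", OF hOJ])
  have JS0: "J (Suc m) A u0 = 0" for m A using conjunct1 [OF conjunct2 [OF RJ]] .
  have rad: "(\<Sum>k\<in>UNIV. (u - u0) $ k * pd k (J (Suc m) A) u) =
      (\<Sum>k\<in>UNIV. (u - u0) $ k * (\<Sum>B\<in>UNIV. Om k A B u * J m B u))" if "u \<in> U" for m A u
    using bspec [OF conjunct2 [OF conjunct2 [OF RJ]] that] .
  define F where "F = (\<lambda>A u. \<Sum>m. J m A u)"
  define S where "S = (\<lambda>A N u. \<Sum>m<N. J m A u)"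
  have hS: "holo_fun U (S A N)" for A N unfolding S_def by (intro holo_intros hJ)
  have unif: "\<exists>r>0. cball u1 r \<subseteq> U \<and> uniform_limit (cball u1 r) (S A) (F A) sequentially" if u1: "u1 \<in> U" for u1 A
  proof -
    obtain r C where r: "r > 0" "cball u1 r \<subseteq> U" and C1: "C \<ge> 0"
      and C: "\<forall>w\<in>cball u1 r. \<forall>t\<in>{0..1}. \<forall>A.
      (\<Sum>k\<in>UNIV. \<Sum>B\<in>UNIV. norm ((w - u0) $ k) * norm (Om k A B (u0 + of_real t *s (w - u0)))) \<le> C"
      using compact_ray_bound [where Om = Om, OF U u1 Om] by (elim exE conjE) (rule that)
    define c0 where "c0 = (\<Sum>A\<in>UNIV. norm (c A))"
    have c0: "norm (c A) \<le> c0" for A unfolding c0_def by (rule member_le_sum) auto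
    have c0': "c0 \<ge> 0" unfolding c0_def by (rule sum_nonneg) simp
    \<comment> \<open>The power of \<open>t\<close> is kept in the estimate because integrating it
      along the ray produces the factorial.\<close>
    have bound: "norm (J m A (u0 + of_real t *s (w - u0))) \<le> c0 * C ^ m * t ^ m / fact m"
      if "w \<in> cball u1 r" "t \<in> {0..1}" for m A w and t :: real
      using that
    proof (induction m arbitrary: A t)
      case 0 then show ?case by (simp add: J0 c0)
    next
      case (Suc m)
      define v where "v = w - u0"
      define T where "T = {s. u0 + s *s v \<in> U}"
      have T: "open T" "convex T" unfolding T_def using U open_line_set convex_line_set by blast+
      have "w \<in> U" using Suc.prems r by blast
      then have "0 \<in> T" "1 \<in> T" using U by (auto simp: T_def v_def)
      then have inT: "of_real s \<in> T" if "s \<in> {0..1}" for s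
        using convexD_alt [OF T(2) \<open>0 \<in> T\<close> \<open>1 \<in> T\<close>, of s] that by (simp add: scaleR_conv_of_real)
      let ?f = "\<lambda>s::real. J (Suc m) A (u0 + of_real s *s v)"
      let ?f' = "\<lambda>s::real. \<Sum>k\<in>UNIV. v $ k * pd k (J (Suc m) A) (u0 + of_real s *s v)"
      have d: "(?f has_vector_derivative ?f' s) (at s)" if "s \<in> {0..1}" for s
        by (rule has_vector_derivative_real_field [OF holo_fun_along_line [OF hJ]])
          (use inT [OF that] in \<open>simp add: T_def\<close>)
      show ?case
      proof (cases "t = 0")
        case True then show ?thesis by (simp add: JS0)
      next
        case False
        then have t: "0 < t" "t \<le> 1" using Suc.prems by auto
        let ?\<phi> = "\<lambda>t::real. c0 * C ^ Suc m * t ^ Suc m / fact (Suc m)"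
        have "norm (?f t - ?f 0) \<le> ?\<phi> t - ?\<phi> 0"
        proof (rule differentiable_bound_general [OF t(1)])
          show "continuous_on {0..t} ?f"
          proof (rule continuous_at_imp_continuous_on, rule ballI)
            fix s assume "s \<in> {0..t}"
            then have "s \<in> {0..1}" using t by simp
            from has_vector_derivative_continuous [OF d [OF this]] show "isCont ?f s" .
          qed
          show "continuous_on {0..t} ?\<phi>"
            by (intro continuous_intros) auto
          fix s assume s: "0 < s" "s < t"
          show "(?f has_vector_derivative ?f' s) (at s)" using d s t by auto
          show "(?\<phi> has_vector_derivative c0 * C ^ Suc m * s ^ m / fact m) (at s)"
            by (rule exp_majorant_has_derivative)
          have sU: "u0 + of_real s *s v \<in> U" using inT s t unfolding T_def by auto
          \<comment> \<open>At \<open>u0 + s *s v\<close> both sides of \<open>rad\<close> carry the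
            factor \<open>s\<close>, which is cancelled because \<open>s\<close> is
            positive.\<close>
          have "of_real s * ?f' s = of_real s * (\<Sum>k\<in>UNIV. v $ k * (\<Sum>B\<in>UNIV. Om k A B (u0 + of_real s *s v) * J m B (u0 + of_real s *s v)))"
            using rad [OF sU] by (simp add: sum_distrib_left mult.assoc)
          then have "?f' s = (\<Sum>k\<in>UNIV. \<Sum>B\<in>UNIV. v $ k * (Om k A B (u0 + of_real s *s v) * J m B (u0 + of_real s *s v)))"
            using s by (simp only: mult_cancel_left of_real_eq_0_iff sum_distrib_left [symmetric]) simp
          also have "norm \<dots> \<le> (\<Sum>k\<in>UNIV. \<Sum>B\<in>UNIV. norm (v $ k) * norm (Om k A B (u0 + of_real s *s v)) * (c0 * C ^ m * s ^ m / fact m))"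
          proof (intro sum_norm_le order.trans [OF norm_sum sum_mono])
            fix k B
            have "norm (J m B (u0 + of_real s *s v)) \<le> c0 * C ^ m * s ^ m / fact m"
              using Suc.IH [of s B] Suc.prems s t by (simp add: v_def)
            then show "norm (v $ k * (Om k A B (u0 + of_real s *s v) * J m B (u0 + of_real s *s v)))
                \<le> norm (v $ k) * norm (Om k A B (u0 + of_real s *s v)) * (c0 * C ^ m * s ^ m / fact m)"
              by (simp only: norm_mult mult.assoc) (intro mult_left_mono, auto)
          qed
          also have "\<dots> = (\<Sum>k\<in>UNIV. \<Sum>B\<in>UNIV. norm (v $ k) * norm (Om k A B (u0 + of_real s *s v))) * (c0 * C ^ m * s ^ m / fact m)"
            by (simp only: sum_distrib_right)
          also have "\<dots> \<le> C * (c0 * C ^ m * s ^ m / fact m)"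
            unfolding v_def
          proof (rule mult_right_mono)
            show "(\<Sum>k\<in>UNIV. \<Sum>B\<in>UNIV. norm ((w - u0) $ k) * norm (Om k A B (u0 + of_real s *s (w - u0)))) \<le> C"
              using C Suc.prems(1) s t by simp
            show "0 \<le> c0 * C ^ m * s ^ m / fact m" using C1 c0' s by simp
          qed
          finally show "norm (?f' s) \<le> c0 * C ^ Suc m * s ^ m / fact m" by (simp add: mult_ac)
        qed
        then show ?thesis by (simp add: JS0 v_def)
      qed
    qed
    have "uniform_limit (cball u1 r) (\<lambda>N u. \<Sum>m<N. J m A u) (\<lambda>u. \<Sum>m. J m A u) sequentially"
    proof (rule Weierstrass_m_test)
      show "norm (J m A w) \<le> c0 * (inverse (fact m) * C ^ m)" if "w \<in> cball u1 r" for m w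
        using bound [OF that, of 1 m A] by (simp add: field_simps)
      show "summable (\<lambda>m. c0 * (inverse (fact m) * C ^ m))"
        by (intro summable_mult summable_exp)
    qed
    then show ?thesis using r unfolding S_def F_def by blast
  qed
  have hF: "holo_fun U (F A)" for A
    by (rule holo_uniform_limit(1) [where S = "S A" and F = "F A", OF U(1) hS unif])
  have limpd: "(\<lambda>N. pd k (S A N) u) \<longlonglongrightarrow> pd k (F A) u" if "u \<in> U" for k A u
    by (rule holo_uniform_limit(2) [where S = "S A" and F = "F A", OF U(1) hS unif that])
  have limS: "(\<lambda>N. S A N u) \<longlonglongrightarrow> F A u" if u: "u \<in> U" for A u
  proof -
    obtain r where "r > 0" "uniform_limit (cball u r) (S A) (F A) sequentially" using unif [OF u] by blast
    then show ?thesis by (intro tendsto_uniform_limitI) auto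
  qed
  have F0: "F A u0 = c A" for A
  proof -
    have "S A (Suc N) u0 = c A" for N unfolding S_def sum.lessThan_Suc_shift by (simp add: J0 JS0)
    then show ?thesis using LIMSEQ_unique [OF LIMSEQ_Suc [OF limS [OF U(3)]], of A "c A"] by simp
  qed
  have Frad: "(\<Sum>k\<in>UNIV. (u - u0) $ k * pd k (F A) u) = (\<Sum>k\<in>UNIV. (u - u0) $ k * (\<Sum>B\<in>UNIV. Om k A B u * F B u))"
    if u: "u \<in> U" for u A
  proof (rule LIMSEQ_unique)
    show "(\<lambda>N. \<Sum>k\<in>UNIV. (u - u0) $ k * pd k (S A (Suc N)) u) \<longlonglongrightarrow> (\<Sum>k\<in>UNIV. (u - u0) $ k * pd k (F A) u)"
      by (intro tendsto_intros LIMSEQ_Suc [OF limpd [OF u]])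
    have "(\<Sum>k\<in>UNIV. (u - u0) $ k * pd k (S A (Suc N)) u) = (\<Sum>k\<in>UNIV. (u - u0) $ k * (\<Sum>B\<in>UNIV. Om k A B u * S B N u))" for N
    proof -
      have "pd k (S A (Suc N)) u = (\<Sum>m<N. pd k (J (Suc m) A) u)" for k
        unfolding S_def sum.lessThan_Suc_shift J0
        by (simp add: pd_add pd_sum holo_fun_const holo_fun_sum hJ u)
      then have "(\<Sum>k\<in>UNIV. (u - u0) $ k * pd k (S A (Suc N)) u) = (\<Sum>m<N. \<Sum>k\<in>UNIV. (u - u0) $ k * pd k (J (Suc m) A) u)"
        by (simp add: sum_distrib_left) (rule sum.swap)
      also have "\<dots> = (\<Sum>m<N. \<Sum>k\<in>UNIV. (u - u0) $ k * (\<Sum>B\<in>UNIV. Om k A B u * J m B u))"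
        by (simp only: rad [OF u])
      also have "\<dots> = (\<Sum>k\<in>UNIV. (u - u0) $ k * (\<Sum>m<N. \<Sum>B\<in>UNIV. Om k A B u * J m B u))"
        by (subst sum.swap) (simp add: sum_distrib_left)
      also have "\<dots> = (\<Sum>k\<in>UNIV. (u - u0) $ k * (\<Sum>B\<in>UNIV. Om k A B u * S B N u))"
        unfolding S_def sum_distrib_left [of "Om _ A _ u"] by (simp only: sum.swap [of _ UNIV "{..<N}"])
      finally show ?thesis .
    qed
    then show "(\<lambda>N. \<Sum>k\<in>UNIV. (u - u0) $ k * pd k (S A (Suc N)) u) \<longlonglongrightarrow>
        (\<Sum>k\<in>UNIV. (u - u0) $ k * (\<Sum>B\<in>UNIV. Om k A B u * F B u))"
      by (simp only:) (intro tendsto_intros limS [OF u])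
  qed
  \<comment> \<open>The defect of the full system; so far only its radial component is known to
    vanish.\<close>
  define E where "E = (\<lambda>k A u. pd k (F A) u - (\<Sum>B\<in>UNIV. Om k A B u * F B u))"
  have hE: "holo_fun U (E k A)" for k A unfolding E_def by (intro holo_intros hF Om)
  have pdF: "pd k (F A) u = E k A u + (\<Sum>B\<in>UNIV. Om k A B u * F B u)" for k A u by (simp add: E_def)
  have curl: "pd l (E k A) u - pd k (E l A) u =
      (\<Sum>B\<in>UNIV. Om l A B u * E k B u) - (\<Sum>B\<in>UNIV. Om k A B u * E l B u)" if u: "u \<in> U" for k l A u
  proof -
    \<comment> \<open>\<open>F\<close> is not yet known to solve the system, so the integrability
      hypothesis is applied to this affine function, which at the single point \<open>u\<close> has
      the value of \<open>F\<close> and the derivatives that the system prescribes.\<close>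
    define Y where "Y = (\<lambda>A v. F A u + (\<Sum>m\<in>UNIV. (v $ m - u $ m) * (\<Sum>B\<in>UNIV. Om m A B u * F B u)))"
    have hY: "holo_fun U (Y A)" for A unfolding Y_def by (intro holo_intros)
    have Yu: "Y A u = F A u" for A by (simp add: Y_def)
    have pdY: "pd m (Y A) u = (\<Sum>B\<in>UNIV. Om m A B u * F B u)" for m A
    proof -
      have "pd m (Y A) u = (\<Sum>k\<in>UNIV. (if k = m then 1 else 0) * (\<Sum>B\<in>UNIV. Om k A B u * F B u))"
        unfolding Y_def by (simp add: pd_rules holo_intros u)
      also have "\<dots> = (\<Sum>B\<in>UNIV. Om m A B u * F B u)"
        by (simp add: if_distrib [of "\<lambda>c. c * _"] cong: if_cong)
      finally show ?thesis .
    qed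
    have D: "pd l (\<lambda>v. \<Sum>B\<in>UNIV. Om k A B v * f B v) u =
        (\<Sum>B\<in>UNIV. pd l (Om k A B) u * f B u + Om k A B u * pd l (f B) u)" if "\<And>B. holo_fun U (f B)" for k l f
      using that by (simp add: pd_rules holo_intros Om u)
    have I: "(\<Sum>B\<in>UNIV. pd l (Om k A B) u * F B u + Om k A B u * (\<Sum>C\<in>UNIV. Om l B C u * F C u)) =
        (\<Sum>B\<in>UNIV. pd k (Om l A B) u * F B u + Om l A B u * (\<Sum>C\<in>UNIV. Om k B C u * F C u))"
      using integrable [of Y u l k A] by (simp add: hY u pdY Yu D)
    have hsum: "holo_fun U (\<lambda>v. \<Sum>B\<in>UNIV. Om k A B v * F B v)" for k by (intro holo_intros Om hF)
    have "pd l (E k A) u = pd l (pd k (F A)) u - (\<Sum>B\<in>UNIV. pd l (Om k A B) u * F B u + Om k A B u * pd l (F B) u)" for k l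
      unfolding E_def using D [OF hF] by (simp add: pd_diff hsum holo_pd hF u)
    then have "pd l (E k A) u - pd k (E l A) u =
        (\<Sum>B\<in>UNIV. pd k (Om l A B) u * F B u + Om l A B u * pd k (F B) u) -
        (\<Sum>B\<in>UNIV. pd l (Om k A B) u * F B u + Om k A B u * pd l (F B) u)"
      using pd_commute [OF U(1) hF u, of k l] by simp
    then show ?thesis using I
      unfolding pdF distrib_left sum.distrib by algebra
  qed
  have radE: "(\<Sum>l\<in>UNIV. (u - u0) $ l * E l A u) = 0" if "u \<in> U" for u A
    using Frad [OF that] by (simp add: E_def right_diff_distrib sum_subtractf)
  \<comment> \<open>Differentiating the vanishing radial component in direction \<open>k\<close> and
    exchanging derivatives by \<open>curl\<close> leaves a linear radial equation for
    \<open>E k\<close>.\<close>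
  have E_ode: "E k A u + (\<Sum>l\<in>UNIV. (u - u0) $ l * pd l (E k A) u) =
      (\<Sum>l\<in>UNIV. (u - u0) $ l * (\<Sum>B\<in>UNIV. Om l A B u * E k B u))" if u: "u \<in> U" for k A u
  proof -
    have "pd k (\<lambda>u. \<Sum>l\<in>UNIV. (u $ l - u0 $ l) * E l A u) u = pd k (\<lambda>_. 0) u"
      by (rule pd_cong [OF U(1) u]) (use radE in simp)
    then have "(\<Sum>l\<in>UNIV. (if l = k then 1 else 0) * E l A u + (u - u0) $ l * pd k (E l A) u) = 0"
      by (simp add: pd_rules holo_intros hE u)
    then have 1: "E k A u + (\<Sum>l\<in>UNIV. (u - u0) $ l * pd k (E l A) u) = 0"
      by (simp add: sum.distrib if_distrib [of "\<lambda>c. c * _"] cong: if_cong)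
    have "pd k (E l A) u = pd l (E k A) u - (\<Sum>B\<in>UNIV. Om l A B u * E k B u) + (\<Sum>B\<in>UNIV. Om k A B u * E l B u)" for l
      using curl [OF u, of l k A] by (simp add: algebra_simps)
    then have "(\<Sum>l\<in>UNIV. (u - u0) $ l * pd k (E l A) u) =
        (\<Sum>l\<in>UNIV. (u - u0) $ l * pd l (E k A) u) - (\<Sum>l\<in>UNIV. (u - u0) $ l * (\<Sum>B\<in>UNIV. Om l A B u * E k B u))
        + (\<Sum>l\<in>UNIV. \<Sum>B\<in>UNIV. Om k A B u * ((u - u0) $ l * E l B u))"
      by (simp add: distrib_left right_diff_distrib sum.distrib sum_subtractf sum_distrib_left mult_ac)
    also have "(\<Sum>l\<in>UNIV. \<Sum>B\<in>UNIV. Om k A B u * ((u - u0) $ l * E l B u)) = (\<Sum>B\<in>UNIV. Om k A B u * (\<Sum>l\<in>UNIV. (u - u0) $ l * E l B u))"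
      by (subst sum.swap) (simp only: sum_distrib_left)
    also have "\<dots> = 0" by (simp only: radE [OF u] mult_zero_right sum.neutral_const)
    finally show ?thesis using 1 by algebra
  qed
  have "E k A u = 0" if u: "u \<in> U" for k A u
  proof -
    define v where "v = u - u0"
    define S where "S = {s. u0 + s *s v \<in> U}"
    have S: "open S" "convex S" unfolding S_def using U open_line_set convex_line_set by blast+
    have S01: "0 \<in> S" "1 \<in> S" using U u by (auto simp: S_def v_def)
    have hol: "(\<lambda>s. f (u0 + s *s v)) holomorphic_on S" if "holo_fun U f" for f
      using holo_fun_along_line [OF that] S(1) unfolding S_def by (auto simp: holomorphic_on_open)
    \<comment> \<open>The factor \<open>s\<close> absorbs the undifferentiated term of
      \<open>E_ode\<close>, which gives a regular linear equation with zero initial value.\<close>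
    have "(\<lambda>A s. s * E k A (u0 + s *s v)) A 1 = 0"
    proof (rule linear_ode_zero [where G = "\<lambda>A s. s * E k A (u0 + s *s v)" and z = 0 and S = S
          and M = "\<lambda>A B s. \<Sum>l\<in>UNIV. v $ l * Om l A B (u0 + s *s v)"])
      show "(\<lambda>s. \<Sum>k\<in>UNIV. v $ k * Om k A B (u0 + s *s v)) holomorphic_on S" for A B
        by (intro holomorphic_intros hol Om)
      fix A t assume t: "t \<in> S"
      then have tU: "u0 + t *s v \<in> U" by (simp add: S_def)
      have "((\<lambda>s. s * E k A (u0 + s *s v)) has_field_derivative
          1 * E k A (u0 + t *s v) + (\<Sum>l\<in>UNIV. v $ l * pd l (E k A) (u0 + t *s v)) * t) (at t)"
        by (intro DERIV_mult DERIV_ident holo_fun_along_line [OF hE tU])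
      moreover have "E k A (u0 + t *s v) + (\<Sum>l\<in>UNIV. v $ l * pd l (E k A) (u0 + t *s v)) * t =
          (\<Sum>B\<in>UNIV. (\<Sum>l\<in>UNIV. v $ l * Om l A B (u0 + t *s v)) * (t * E k B (u0 + t *s v)))"
      proof -
        have "(\<Sum>B\<in>UNIV. (\<Sum>l\<in>UNIV. v $ l * Om l A B (u0 + t *s v)) * (t * E k B (u0 + t *s v))) =
            (\<Sum>l\<in>UNIV. t * v $ l * (\<Sum>B\<in>UNIV. Om l A B (u0 + t *s v) * E k B (u0 + t *s v)))"
          by (simp only: sum_distrib_left sum_distrib_right) (subst sum.swap, simp only: mult_ac)
        also have "\<dots> = E k A (u0 + t *s v) + (\<Sum>l\<in>UNIV. t * v $ l * pd l (E k A) (u0 + t *s v))"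
          using E_ode [OF tU, of k A] by simp
        also have "(\<Sum>l\<in>UNIV. t * v $ l * pd l (E k A) (u0 + t *s v)) = (\<Sum>l\<in>UNIV. v $ l * pd l (E k A) (u0 + t *s v)) * t"
          by (simp add: sum_distrib_left sum_distrib_right mult_ac)
        finally show ?thesis by (rule sym)
      qed
      ultimately show "((\<lambda>s. s * E k A (u0 + s *s v)) has_field_derivative
          (\<Sum>B\<in>UNIV. (\<Sum>l\<in>UNIV. v $ l * Om l A B (u0 + t *s v)) * (t * E k B (u0 + t *s v)))) (at t)" by simp
    qed (use S S01 convex_connected in auto)
    then show ?thesis by (simp add: v_def)
  qed
  then have "pd k (F A) u = (\<Sum>B\<in>UNIV. Om k A B u * F B u)" if "u \<in> U" for k A u
    using that pdF by simp
  then show ?thesis using hF F0 by blast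
qed

corollary closed_form_primitive:
  fixes \<theta> :: "'n::finite \<Rightarrow> complex^'n \<Rightarrow> complex"
  assumes U: "open U" "convex U" "u0 \<in> U" and \<theta>: "\<And>k. holo_fun U (\<theta> k)"
    and closed: "\<And>u k l. u \<in> U \<Longrightarrow> pd l (\<theta> k) u = pd k (\<theta> l) u"
  shows "\<exists>f. holo_fun U f \<and> (\<forall>u\<in>U. \<forall>k. pd k f u = \<theta> k u)"
proof -
  interpret holo_domain U by unfold_locales (rule U)
  \<comment> \<open>Two unknowns turn the inhomogeneous equation into a linear system:
    \<open>False\<close> stays constantly \<open>1\<close> and \<open>True\<close> is the
    primitive.\<close>
  define Om where "Om = (\<lambda>k A B. if A \<and> \<not> B then \<theta> k else (\<lambda>_. 0))"
  have Om: "holo_fun U (Om k A B)" for k A B unfolding Om_def by (auto intro: \<theta> holo_fun_const)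
  have ev: "(\<Sum>B\<in>UNIV. Om k A B v * Y B v) = (if A then \<theta> k v * Y False v else 0)" for k A v and Y :: "bool \<Rightarrow> complex^'n \<Rightarrow> complex"
    by (simp add: Om_def UNIV_bool)
  have "\<exists>F. (\<forall>A. holo_fun U (F A) \<and> F A u0 = (if A then 0 else 1)) \<and>
    (\<forall>u\<in>U. \<forall>k A. pd k (F A) u = (\<Sum>B\<in>UNIV. Om k A B u * F B u))"
  proof (rule linear_pfaffian_exists [where Om = Om, OF U Om])
    fix Y u k l A
    assume Y: "\<And>A. holo_fun U (Y A)" and u: "u \<in> U"
      and pdY: "\<And>m A. pd m (Y A) u = (\<Sum>B\<in>UNIV. Om m A B u * Y B u)"
    have Y0: "pd m (Y False) u = 0" for m using pdY [of m False] unfolding ev by simp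
    have "pd l (\<lambda>v. \<theta> k v * Y False v) u = pd k (\<lambda>v. \<theta> l v * Y False v) u"
      using closed [OF u] by (simp add: pd_mult \<theta> Y u Y0)
    then show "pd l (\<lambda>v. \<Sum>B\<in>UNIV. Om k A B v * Y B v) u = pd k (\<lambda>v. \<Sum>B\<in>UNIV. Om l A B v * Y B v) u"
      unfolding ev by (cases A) simp_all
  qed
  then obtain F where FA: "\<forall>A. holo_fun U (F A) \<and> F A u0 = (if A then 0 else 1)"
    and FP: "\<forall>u\<in>U. \<forall>k A. pd k (F A) u = (\<Sum>B\<in>UNIV. Om k A B u * F B u)"
    by (elim exE conjE) (rule that)
  have pdF: "pd k (F A) u = (if A then \<theta> k u * F False u else 0)" if "u \<in> U" for k A u
    using FP that unfolding ev by simp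
  have "F False u = 1" if u: "u \<in> U" for u
  proof -
    have "F False u = F False u0"
      by (rule pd_zero_imp_const [OF U u]) (use FA pdF in auto)
    then show ?thesis using FA by simp
  qed
  then have "pd k (F True) u = \<theta> k u" if "u \<in> U" for k u using pdF [OF that, of k True] that by simp
  then show ?thesis using FA by (intro exI [of _ "F True"]) simp
qed

text \<open>The logarithmic differential of \<open>q\<close> is closed; half of its primitive
  exponentiates to a square root up to a constant factor.\<close>

corollary holo_sqrt_exists:
  fixes q :: "complex^'n \<Rightarrow> complex"
  assumes U: "open U" "convex U" "u0 \<in> U" and q: "holo_fun U q" "\<And>u. u \<in> U \<Longrightarrow> q u \<noteq> 0"
  shows "\<exists>a. holo_fun U a \<and> (\<forall>u\<in>U. (a u)\<^sup>2 = q u)"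
proof -
  interpret holo_domain U by unfold_locales (rule U)
  have hl: "holo_fun U (\<lambda>u. pd k q u / q u)" for k using q by (intro holo_intros) auto
  have "\<exists>f. holo_fun U f \<and> (\<forall>u\<in>U. \<forall>k. pd k f u = pd k q u / q u)"
  proof (rule closed_form_primitive [OF U, where \<theta> = "\<lambda>k u. pd k q u / q u", OF hl])
    fix u k l assume u: "u \<in> U"
    show "pd l (\<lambda>u. pd k q u / q u) u = pd k (\<lambda>u. pd l q u / q u) u"
      using pd_commute [OF U(1) q(1) u, of k l] by (simp add: pd_divide holo_pd q u mult_ac)
  qed
  then obtain f where f: "holo_fun U f" and "\<forall>u\<in>U. \<forall>k. pd k f u = pd k q u / q u"
    by (elim exE conjE) (rule that)
  then have pdf: "pd k f u = pd k q u / q u" if "u \<in> U" for k u using that by simp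
  have dexp: "((\<lambda>z. exp (c * z)) has_field_derivative exp (c * z) * c) (at z)" for c z :: complex
    by (auto intro!: derivative_eq_intros)
  have hexp: "holo_fun U (\<lambda>u. exp (c * f u))" for c
    by (rule holo_fun_compose [where g = "\<lambda>z. exp (c * z)", OF f])
      (unfold field_differentiable_def, rule exI, rule dexp)
  have pdexp: "pd k (\<lambda>u. exp (c * f u)) u = exp (c * f u) * c * (pd k q u / q u)" if u: "u \<in> U" for k c u
    using pd_compose [where g = "\<lambda>z. exp (c * z)", OF f u dexp] by (simp only: pdf [OF u])
  have "q u * exp (- 1 * f u) = q u0 * exp (- 1 * f u0)" if u: "u \<in> U" for u
  proof (rule pd_zero_imp_const [OF U u])
    show "holo_fun U (\<lambda>u. q u * exp (- 1 * f u))" by (intro holo_intros q hexp)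
    show "pd k (\<lambda>u. q u * exp (- 1 * f u)) u = 0" if "u \<in> U" for k u
      by (simp only: pd_mult [OF q(1) hexp that] pdexp [OF that]) (simp add: q that)
  qed
  then have eq: "q u = q u0 * exp (- f u0) * (exp (1 / 2 * f u))\<^sup>2" if "u \<in> U" for u
    using that by (simp add: exp_minus power2_eq_square exp_add [symmetric] field_simps)
  show ?thesis
    by (rule exI [of _ "\<lambda>u. csqrt (q u0 * exp (- f u0)) * exp (1 / 2 * f u)"])
      (intro conjI ballI holo_intros hexp, simp only: power_mult_distrib power2_csqrt eq)
qed

section \<open>Complex bilinear geometry\<close>

lemma bil_commute: "bil x y = bil y x"
  by (simp add: bil_def mult.commute)

lemma bil_simps [simp]:
  "bil 0 y = 0" "bil y 0 = 0" "bil (- x) y = - bil x y" "bil y (- x) = - bil y x"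
  "bil (c *s x) y = c * bil x y" "bil y (c *s x) = c * bil y x"
  by (simp_all add: bil_def sum_negf sum_distrib_left mult_ac)

lemma bil_add: "bil (x + z) y = bil x y + bil z y" "bil y (x + z) = bil y x + bil y z"
  by (simp_all add: bil_def sum.distrib algebra_simps)

lemma bil_diff: "bil (x - z) y = bil x y - bil z y" "bil y (x - z) = bil y x - bil y z"
  by (simp_all add: bil_def sum_subtractf algebra_simps)

lemma bil_sum: "bil (\<Sum>i\<in>I. f i) y = (\<Sum>i\<in>I. bil (f i) y)" "bil y (\<Sum>i\<in>I. f i) = (\<Sum>i\<in>I. bil y (f i))"
  by (induction I rule: infinite_finite_induct) (simp_all add: bil_add)

lemma bil_axis [simp]: "bil (axis i 1) y = y $ i" "bil y (axis i 1) = y $ i"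
  by (simp_all add: bil_def axis_def if_distrib [of "\<lambda>c. c * _"] if_distrib [of "(*) _"] cong: if_cong)

lemma bil_nondegenerate: "(\<And>z. bil y z = 0) \<Longrightarrow> y = 0"
  by (metis bil_axis(2) vec_eq_iff zero_index)

lemma bil_matrix_vector: "bil (A *v x) y = bil x (transpose A *v y)"
proof -
  have "bil (A *v x) y = (\<Sum>i\<in>UNIV. \<Sum>j\<in>UNIV. A $ i $ j * x $ j * y $ i)"
    by (simp add: bil_def matrix_vector_mult_def sum_distrib_right)
  also have "\<dots> = (\<Sum>j\<in>UNIV. \<Sum>i\<in>UNIV. A $ i $ j * x $ j * y $ i)" by (rule sum.swap)
  finally show ?thesis
    by (simp add: bil_def matrix_vector_mult_def sum_distrib_left transpose_def mult_ac)
qed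

lemma bil_orthogonal_matrix: "orthogonal_matrix A \<Longrightarrow> bil (A *v x) (A *v y) = bil x y"
  by (simp add: bil_matrix_vector matrix_vector_mul_assoc orthogonal_matrix_def)

lemma matrix_inv_mult:
  fixes A :: "complex^'n^'n"
  assumes "det A \<noteq> 0"
  shows "A ** matrix_inv A = mat 1" "matrix_inv A ** A = mat 1"
proof -
  have "\<exists>A'. A ** A' = mat 1 \<and> A' ** A = mat 1"
    using assms invertible_det_nz invertible_def by blast
  from someI_ex [OF this] show "A ** matrix_inv A = mat 1" "matrix_inv A ** A = mat 1"
    unfolding matrix_inv_def by auto
qed

lemma matrix_inv_mult_nth:
  fixes A :: "complex^'n^'n"
  assumes "det A \<noteq> 0"
  shows "(\<Sum>m\<in>UNIV. A $ i $ m * matrix_inv A $ m $ j) = (if i = j then 1 else 0)"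
    and "(\<Sum>m\<in>UNIV. matrix_inv A $ i $ m * A $ m $ j) = (if i = j then 1 else 0)"
  using matrix_inv_mult [OF assms] by (simp_all add: matrix_matrix_mult_def mat_def vec_eq_iff)

lemma matrix_inv_symmetric:
  fixes A :: "complex^'n^'n"
  assumes "det A \<noteq> 0" and sym: "\<And>i j. A $ i $ j = A $ j $ i"
  shows "matrix_inv A $ i $ j = matrix_inv A $ j $ i"
proof -
  have t: "transpose A = A" using sym by (simp add: transpose_def vec_eq_iff)
  have "transpose (matrix_inv A) ** A = mat 1"
    using arg_cong [OF matrix_inv_mult(1) [OF assms(1)], of transpose] by (simp add: matrix_transpose_mul t)
  then have "transpose (matrix_inv A) ** A ** matrix_inv A = matrix_inv A"
    by (simp only: matrix_mul_lid)
  then have "transpose (matrix_inv A) = matrix_inv A"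
    by (simp only: matrix_mul_assoc [symmetric] matrix_inv_mult(1) [OF assms(1)] matrix_mul_rid)
  then have "transpose (matrix_inv A) $ j $ i = matrix_inv A $ j $ i" by (simp only:)
  then show ?thesis by (simp only: transpose_def vec_lambda_beta)
qed

lemma sum_UNIV_sum_type:
  "(\<Sum>x\<in>(UNIV :: ('a::finite + 'b::finite) set). f x) = (\<Sum>a\<in>UNIV. f (Inl a)) + (\<Sum>b\<in>UNIV. f (Inr b))"
  by (simp add: UNIV_Plus_UNIV [symmetric] sum.Plus del: UNIV_Plus_UNIV)

lemma sum_delta_mult [simp]:
  fixes f :: "'n::finite \<Rightarrow> complex"
  shows "(\<Sum>m\<in>UNIV. (if m = k then c m else 0) * f m) = c k * f k"
    "(\<Sum>m\<in>UNIV. (if k = m then c m else 0) * f m) = c k * f k"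
    "(\<Sum>m\<in>UNIV. f m * (if m = k then c m else 0)) = f k * c k"
    "(\<Sum>m\<in>UNIV. f m * (if k = m then c m else 0)) = f k * c k"
  by (simp_all add: if_distrib [of "\<lambda>x. x * _"] if_distrib [of "(*) _"] cong: if_cong)

text \<open>The form has isotropic vectors, so independence of the \<open>T j\<close> comes from
  their Gram determinant. Together with the orthonormal \<open>N\<close> they form a basis, by the
  count of dimensions.\<close>

lemma gram_frame_complete:
  fixes T :: "'n::finite \<Rightarrow> complex^'m" and N :: "'b::finite \<Rightarrow> complex^'m"
  assumes card: "CARD('m) = CARD('n) + CARD('b)"
    and det: "det (\<chi> j k. bil (T j) (T k)) \<noteq> 0"
    and N: "\<And>\<alpha> \<beta>. bil (N \<alpha>) (N \<beta>) = (if \<alpha> = \<beta> then 1 else 0)" "\<And>\<alpha> j. bil (N \<alpha>) (T j) = 0"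
    and y: "\<And>j. bil y (T j) = 0" "\<And>\<alpha>. bil y (N \<alpha>) = 0"
  shows "y = 0"
proof -
  have "card (UNIV :: 'm set) = card (UNIV :: ('n + 'b) set)" using card by (simp add: card_UNIV_sum)
  then obtain \<phi> :: "'m \<Rightarrow> 'n + 'b" where \<phi>: "bij \<phi>"
    by (metis finite finite_same_card_bij)
  define V where "V = (\<lambda>x. case x of Inl j \<Rightarrow> T j | Inr \<alpha> \<Rightarrow> N \<alpha>)"
  define M where "M = (\<chi> i. V (\<phi> i))"
  have "\<forall>c. transpose M *v c = 0 \<longrightarrow> c = 0"
  proof (intro allI impI)
    fix c assume c: "transpose M *v c = 0"
    define d where "d = (\<lambda>x. c $ (inv \<phi> x))"
    have "(\<Sum>x\<in>UNIV. d x *s V x) = (\<Sum>i\<in>UNIV. d (\<phi> i) *s V (\<phi> i))"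
      using \<phi> by (intro sum.reindex_bij_betw [symmetric])
    also have "\<dots> = (\<Sum>i\<in>UNIV. c $ i *s M $ i)"
      using \<phi> by (simp add: d_def M_def bij_is_inj)
    also have "\<dots> = transpose M *v c"
      by (simp add: vec_eq_iff matrix_vector_mult_def transpose_def mult.commute)
    finally have z: "(\<Sum>x\<in>UNIV. d x *s V x) = 0" using c by simp
    have dN: "d (Inr \<alpha>) = 0" for \<alpha>
      using arg_cong [OF z, of "\<lambda>w. bil w (N \<alpha>)"]
      by (simp add: bil_add bil_sum sum_UNIV_sum_type V_def N bil_commute [of "T _"])
    have "(\<chi> j k. bil (T j) (T k)) *v (\<chi> j. d (Inl j)) = 0"
    proof -
      have "(\<Sum>j\<in>UNIV. d (Inl j) * bil (T j) (T k)) = 0" for k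
        using arg_cong [OF z, of "\<lambda>w. bil w (T k)"]
        by (simp add: bil_add bil_sum sum_UNIV_sum_type V_def dN)
      then show ?thesis
        by (simp add: matrix_vector_mult_def vec_eq_iff) (subst bil_commute, simp add: mult.commute)
    qed
    then have "(\<chi> j. d (Inl j)) = 0"
      using det by (metis invertible_det_nz invertible_left_inverse matrix_left_invertible_ker)
    then have "d (Inl j) = 0" for j by (metis vec_lambda_beta zero_index)
    then have "d x = 0" for x using dN by (cases x) auto
    then have "d (\<phi> i) = 0" for i by blast
    then show "c = 0" using \<phi> by (simp add: d_def vec_eq_iff bij_is_inj)
  qed
  then have "\<exists>B. B ** transpose M = mat 1" by (simp add: matrix_left_invertible_ker)
  then have "\<exists>B. B ** M = mat 1"
    by (metis matrix_left_right_inverse matrix_transpose_mul transpose_mat transpose_transpose)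
  then have inj: "M *v y = 0 \<Longrightarrow> y = 0" by (metis matrix_left_invertible_ker)
  have "(M *v y) $ i = bil (V (\<phi> i)) y" for i by (simp add: M_def matrix_vector_mult_def bil_def)
  moreover have "bil (V x) y = 0" for x
    using y by (cases x) (simp_all add: V_def bil_commute [of _ y])
  ultimately show "y = 0" using inj by (simp add: vec_eq_iff)
qed

text \<open>The orthogonal projection onto the span of \<open>T\<close>, written with the inverse
  Gram matrix because \<open>T\<close> is not orthonormal.\<close>

definition tangential :: "('n::finite \<Rightarrow> complex^'m) \<Rightarrow> complex^'m \<Rightarrow> complex^'m" where
  "tangential T y = (\<Sum>j\<in>UNIV. (\<Sum>k\<in>UNIV. matrix_inv (\<chi> j k. bil (T j) (T k)) $ j $ k * bil y (T k)) *s T j)"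

lemma bil_tangential:
  assumes det: "det (\<chi> j k. bil (T j) (T k)) \<noteq> 0"
  shows "bil (tangential T y) (T l) = bil y (T l)"
proof -
  let ?G = "\<chi> j k. bil (T j) (T k)"
  have sym: "matrix_inv ?G $ j $ k = matrix_inv ?G $ k $ j" for j k
    by (rule matrix_inv_symmetric [OF det]) (simp add: bil_commute)
  have "bil (tangential T y) (T l) = (\<Sum>j\<in>UNIV. \<Sum>k\<in>UNIV. matrix_inv ?G $ k $ j * ?G $ j $ l * bil y (T k))"
    unfolding tangential_def by (subst sym) (simp add: bil_sum sum_distrib_left sum_distrib_right mult_ac)
  also have "\<dots> = (\<Sum>k\<in>UNIV. (\<Sum>j\<in>UNIV. matrix_inv ?G $ k $ j * ?G $ j $ l) * bil y (T k))"
    by (subst sum.swap) (simp only: sum_distrib_right)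
  finally show ?thesis by (simp only: matrix_inv_mult_nth(2) [OF det]) simp
qed

lemma frame_expansion:
  fixes T :: "'n::finite \<Rightarrow> complex^'m" and N :: "'b::finite \<Rightarrow> complex^'m"
  assumes card: "CARD('m) = CARD('n) + CARD('b)"
    and det: "det (\<chi> j k. bil (T j) (T k)) \<noteq> 0"
    and N: "\<And>\<alpha> \<beta>. bil (N \<alpha>) (N \<beta>) = (if \<alpha> = \<beta> then 1 else 0)" "\<And>\<alpha> j. bil (N \<alpha>) (T j) = 0"
  shows "y = tangential T y + (\<Sum>\<alpha>\<in>UNIV. bil y (N \<alpha>) *s N \<alpha>)"
proof -
  have "y - (tangential T y + (\<Sum>\<alpha>\<in>UNIV. bil y (N \<alpha>) *s N \<alpha>)) = 0"
  proof (rule gram_frame_complete [where T = T and N = N, OF card det N])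
    show "bil (y - (tangential T y + (\<Sum>\<alpha>\<in>UNIV. bil y (N \<alpha>) *s N \<alpha>))) (T j) = 0" for j
      by (simp add: bil_diff bil_add bil_sum bil_tangential [OF det] N)
    have "bil (T j) (N \<beta>) = 0" for j \<beta> using N(2) [of \<beta> j] by (simp only: bil_commute)
    then have "bil (tangential T y) (N \<beta>) = 0" for \<beta>
      by (simp add: tangential_def bil_sum)
    then show "bil (y - (tangential T y + (\<Sum>\<alpha>\<in>UNIV. bil y (N \<alpha>) *s N \<alpha>))) (N \<beta>) = 0" for \<beta>
      by (simp add: bil_diff bil_add bil_sum N)
  qed
  then show ?thesis by simp
qed

text \<open>The right-hand side does not mention \<open>N\<close>: products of normal components are
  determined by products with the tangent vectors, so they are the same for every orthonormal normal
  frame.\<close>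

lemma frame_parseval:
  fixes T :: "'n::finite \<Rightarrow> complex^'m" and N :: "'b::finite \<Rightarrow> complex^'m"
  assumes card: "CARD('m) = CARD('n) + CARD('b)"
    and det: "det (\<chi> j k. bil (T j) (T k)) \<noteq> 0"
    and N: "\<And>\<alpha> \<beta>. bil (N \<alpha>) (N \<beta>) = (if \<alpha> = \<beta> then 1 else 0)" "\<And>\<alpha> j. bil (N \<alpha>) (T j) = 0"
  shows "(\<Sum>\<alpha>\<in>UNIV. bil (N \<alpha>) y * bil (N \<alpha>) z) = bil y z -
    (\<Sum>j\<in>UNIV. (\<Sum>k\<in>UNIV. matrix_inv (\<chi> j k. bil (T j) (T k)) $ j $ k * bil y (T k)) * bil z (T j))"
proof -
  have "bil y z = bil (tangential T y + (\<Sum>\<alpha>\<in>UNIV. bil y (N \<alpha>) *s N \<alpha>)) z"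
    by (rule arg_cong [OF frame_expansion [where T = T and N = N and y = y, OF card det N], of "\<lambda>w. bil w z"])
  also have "\<dots> = bil (tangential T y) z + (\<Sum>\<alpha>\<in>UNIV. bil (N \<alpha>) y * bil (N \<alpha>) z)"
    by (simp add: bil_add bil_sum bil_commute [of y])
  also have "bil (tangential T y) z = (\<Sum>j\<in>UNIV. (\<Sum>k\<in>UNIV. matrix_inv (\<chi> j k. bil (T j) (T k)) $ j $ k * bil y (T k)) * bil z (T j))"
    by (simp add: tangential_def bil_sum bil_commute [of z])
  finally show ?thesis by simp
qed

text \<open>Gram-Schmidt, where each step needs a non-isotropic vector in the remaining complement.
  The form is non-degenerate there, so by polarization not every vector of the complement is
  isotropic.\<close>

lemma orthonormal_normals_exist:
  fixes T :: "'n::finite \<Rightarrow> complex^'m"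
  assumes card: "CARD('m) = CARD('n) + CARD('b::finite)"
    and det: "det (\<chi> j k. bil (T j) (T k)) \<noteq> 0"
  shows "\<exists>N :: 'b \<Rightarrow> complex^'m. (\<forall>\<alpha> \<beta>. bil (N \<alpha>) (N \<beta>) = (if \<alpha> = \<beta> then 1 else 0)) \<and> (\<forall>\<alpha> j. bil (N \<alpha>) (T j) = 0)"
proof -
  have "\<exists>N :: 'b \<Rightarrow> complex^'m. (\<forall>\<alpha>\<in>S. \<forall>\<beta>\<in>S. bil (N \<alpha>) (N \<beta>) = (if \<alpha> = \<beta> then 1 else 0)) \<and> (\<forall>\<alpha>\<in>S. \<forall>j. bil (N \<alpha>) (T j) = 0)"
    if "finite S" for S
    using that
  proof (induction S rule: finite_induct)
    case empty then show ?case by simp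
  next
    case (insert \<gamma> S)
    then obtain N :: "'b \<Rightarrow> complex^'m" where
      N: "\<And>\<alpha> \<beta>. \<alpha> \<in> S \<Longrightarrow> \<beta> \<in> S \<Longrightarrow> bil (N \<alpha>) (N \<beta>) = (if \<alpha> = \<beta> then 1 else 0)"
        "\<And>\<alpha> j. \<alpha> \<in> S \<Longrightarrow> bil (N \<alpha>) (T j) = 0" by blast
    define W where "W = {w. (\<forall>j. bil w (T j) = 0) \<and> (\<forall>\<alpha>\<in>S. bil w (N \<alpha>) = 0)}"
    have "\<exists>w\<in>W. bil w w \<noteq> 0"
    proof (rule ccontr)
      assume "\<not> (\<exists>w\<in>W. bil w w \<noteq> 0)"
      then have iso: "bil w w = 0" if "w \<in> W" for w using that by blast
      have "card (UNIV :: 'm set) = card (UNIV :: ('n + 'b) set)" using card by (simp add: card_UNIV_sum)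
      then obtain \<phi> :: "'m \<Rightarrow> 'n + 'b" where \<phi>: "bij \<phi>"
        by (metis finite finite_same_card_bij)
      \<comment> \<open>Zero rows stand for the normals not yet chosen; the row of
        \<open>\<gamma>\<close> makes the matrix singular and so yields a nonzero vector of the
        complement.\<close>
      define V where "V = (\<lambda>x. case x of Inl j \<Rightarrow> T j | Inr \<alpha> \<Rightarrow> if \<alpha> \<in> S then N \<alpha> else 0)"
      define M where "M = (\<chi> i. V (\<phi> i))"
      have "row (inv \<phi> (Inr \<gamma>)) M = 0"
        using \<phi> insert.hyps by (simp add: row_def M_def V_def vec_eq_iff bij_is_surj surj_f_inv_f)
      then have "det M = 0" by (rule det_zero_row(2))
      then have "\<not> (\<exists>B. B ** M = mat 1)" using invertible_det_nz invertible_left_inverse by blast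
      then obtain x where x: "x \<noteq> 0" "M *v x = 0" unfolding matrix_left_invertible_ker by blast
      have Vx: "bil x (V y) = 0" for y
      proof -
        have "(M *v x) $ (inv \<phi> y) = bil (V y) x"
          using \<phi> by (simp add: M_def matrix_vector_mult_def bil_def bij_is_surj surj_f_inv_f)
        then show ?thesis using x by (simp add: bil_commute)
      qed
      have xT: "bil x (T j) = 0" for j using Vx [of "Inl j"] by (simp add: V_def)
      have xN: "bil x (N \<alpha>) = 0" if "\<alpha> \<in> S" for \<alpha> using Vx [of "Inr \<alpha>"] that by (simp add: V_def)
      have xW: "x \<in> W" using xT xN by (simp add: W_def)
      have "bil x z = 0" for z
      proof -
        \<comment> \<open>The component of \<open>z\<close> in the complement; \<open>x\<close> has
          the same product with \<open>z\<close> and with \<open>z'\<close>.\<close>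
        define z' where "z' = z - tangential T z - (\<Sum>\<alpha>\<in>S. bil z (N \<alpha>) *s N \<alpha>)"
        have "bil (T j) (N \<beta>) = 0" if "\<beta> \<in> S" for j \<beta> using N(2) [OF that, of j] by (simp only: bil_commute)
        then have tN: "bil (tangential T z) (N \<beta>) = 0" if "\<beta> \<in> S" for \<beta>
          using that by (simp add: tangential_def bil_sum)
        have "(\<Sum>\<alpha>\<in>S. bil z (N \<alpha>) * bil (N \<alpha>) (N \<beta>)) = bil z (N \<beta>)" if "\<beta> \<in> S" for \<beta>
        proof -
          have "(\<Sum>\<alpha>\<in>S. bil z (N \<alpha>) * bil (N \<alpha>) (N \<beta>)) = (\<Sum>\<alpha>\<in>S. if \<alpha> = \<beta> then bil z (N \<beta>) else 0)"
            using that N by (intro sum.cong) auto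
          then show ?thesis using that insert.hyps by simp
        qed
        then have "z' \<in> W" unfolding W_def z'_def
          by (simp add: bil_diff bil_sum bil_tangential [OF det] N tN)
        then have "x + z' \<in> W" using xW by (simp add: W_def bil_add)
        then have "bil x z' = 0" using iso [OF xW] iso [OF \<open>z' \<in> W\<close>] iso [of "x + z'"]
          by (simp add: bil_add bil_commute [of z' x])
        moreover have "bil x z' = bil x z"
          by (simp add: z'_def bil_diff bil_sum tangential_def xT xN)
        ultimately show ?thesis by simp
      qed
      then show False using bil_nondegenerate x by blast
    qed
    then obtain w where w: "w \<in> W" "bil w w \<noteq> 0" by blast
    define N' where "N' = N(\<gamma> := (1 / csqrt (bil w w)) *s w)"
    have "csqrt (bil w w) * csqrt (bil w w) = bil w w" by (metis power2_csqrt power2_eq_square)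
    then have N'\<gamma>: "bil (N' \<gamma>) (N' \<gamma>) = 1" using w by (simp add: N'_def field_simps)
    have N'S: "N' \<alpha> = N \<alpha>" if "\<alpha> \<in> S" for \<alpha> using that insert.hyps by (auto simp: N'_def)
    have N'W: "bil (N' \<gamma>) (N \<alpha>) = 0" "bil (N \<alpha>) (N' \<gamma>) = 0" if "\<alpha> \<in> S" for \<alpha>
      using that w by (auto simp: N'_def W_def bil_commute [of "N \<alpha>"])
    have N'T: "bil (N' \<gamma>) (T j) = 0" for j using w by (simp add: N'_def W_def)
    have "\<forall>\<alpha>\<in>insert \<gamma> S. \<forall>\<beta>\<in>insert \<gamma> S. bil (N' \<alpha>) (N' \<beta>) = (if \<alpha> = \<beta> then 1 else 0)"
      using N N'\<gamma> N'S N'W insert.hyps by auto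
    moreover have "\<forall>\<alpha>\<in>insert \<gamma> S. \<forall>j. bil (N' \<alpha>) (T j) = 0" using N N'S N'T by auto
    ultimately show ?case by blast
  qed
  from this [of UNIV] show ?thesis by simp
qed

text \<open>It will be applied to \<open>2n + 1\<close> vectors in dimension \<open>2n - 1\<close>,
  so \<open>M\<close> is rectangular. Spanning provides a left inverse \<open>L\<close> of
  \<open>M\<close>, and \<open>P = L ** M'\<close> is the transpose of the wanted matrix.\<close>

lemma orthogonal_matrix_of_gram:
  fixes F F' :: "'r::finite \<Rightarrow> complex^'m"
  assumes gram: "\<And>A B. bil (F A) (F B) = bil (F' A) (F' B)"
    and span: "\<And>y. (\<And>A. bil y (F A) = 0) \<Longrightarrow> y = 0"
    and span': "\<And>y. (\<And>A. bil y (F' A) = 0) \<Longrightarrow> y = 0"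
  shows "\<exists>Q. orthogonal_matrix Q \<and> (\<forall>A. F' A = Q *v F A)"
proof -
  define M where "M = (\<chi> A. F A)"
  define M' where "M' = (\<chi> A. F' A)"
  have "y = 0" if "M *v y = 0" for y
  proof (rule span)
    show "bil y (F A) = 0" for A
      using arg_cong [OF that, of "\<lambda>w. w $ A"] by (simp add: M_def matrix_vector_mult_def bil_def mult.commute)
  qed
  then obtain L where L: "L ** M = mat 1" using matrix_left_invertible_ker by blast
  have MM: "M ** transpose M = M' ** transpose M'"
    using gram by (simp add: M_def M'_def matrix_matrix_mult_def transpose_def vec_eq_iff bil_def)
  define P where "P = L ** M'"
  have "P ** transpose P = L ** (M' ** transpose M') ** transpose L"
    by (simp add: P_def matrix_transpose_mul matrix_mul_assoc)
  also have "\<dots> = (L ** M) ** (transpose (L ** M))"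
    by (simp add: MM [symmetric] matrix_transpose_mul matrix_mul_assoc)
  finally have PP: "P ** transpose P = mat 1" by (simp add: L)
  have Z: "(M ** P - M') ** transpose M' = 0"
  proof -
    have "M ** P ** transpose M' = M ** L ** (M' ** transpose M')" by (simp add: P_def matrix_mul_assoc)
    also have "\<dots> = M ** (L ** M) ** transpose M" by (simp add: MM [symmetric] matrix_mul_assoc)
    also have "\<dots> = M' ** transpose M'" by (simp add: L MM)
    finally show ?thesis by (simp add: matrix_matrix_mult_def vec_eq_iff left_diff_distrib sum_subtractf)
  qed
  have "(M ** P - M') $ A = 0" for A
  proof (rule span')
    show "bil ((M ** P - M') $ A) (F' B) = 0" for B
      using arg_cong [OF Z, of "\<lambda>w. w $ A $ B"] by (simp add: M'_def matrix_matrix_mult_def transpose_def bil_def)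
  qed
  then have MP: "(M ** P) $ A = M' $ A" for A by simp
  have "F' A = transpose P *v F A" for A
    using MP [of A] by (simp add: M_def M'_def matrix_matrix_mult_def matrix_vector_mult_def transpose_def vec_eq_iff mult.commute)
  moreover have "orthogonal_matrix (transpose P)"
    using PP matrix_left_right_inverse by (auto simp: orthogonal_matrix_def)
  ultimately show ?thesis by blast
qed

text \<open>A Householder reflection; the sign avoids an isotropic mirror normal.\<close>

lemma reflect_to_axis:
  fixes v :: "complex^'m"
  assumes "bil v v = 1"
  shows "\<exists>Q \<epsilon>. orthogonal_matrix Q \<and> \<epsilon> \<in> {1, -1} \<and> Q *v v = \<epsilon> *s axis i 1"
proof -
  obtain \<epsilon> :: complex where \<epsilon>: "\<epsilon> \<in> {1, -1}" "\<epsilon> * v $ i \<noteq> 1"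
  proof (cases "v $ i = 1")
    case True then show ?thesis using that [of "-1"] by simp
  next
    case False then show ?thesis using that [of 1] by simp
  qed
  define w where "w = v - \<epsilon> *s axis i 1"
  define c where "c = bil w w"
  have c: "c = 2 - 2 * (\<epsilon> * v $ i)"
    unfolding c_def w_def using \<epsilon>(1) by (auto simp: bil_diff assms algebra_simps)
  then have c0: "c \<noteq> 0" using \<epsilon> by simp
  define Q where "Q = (\<chi> a b. (if a = b then 1 else 0) - 2 * w $ a * w $ b / c)"
  have Qv: "Q *v y = y - (2 * bil w y / c) *s w" for y
  proof -
    have "(Q *v y) $ i = (y - (2 * bil w y / c) *s w) $ i" for i
    proof -
      have "(Q *v y) $ i = (\<Sum>j\<in>UNIV. (if i = j then 1 else 0) * y $ j - 2 * w $ i / c * (w $ j * y $ j))"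
        unfolding Q_def matrix_vector_mult_def by (simp add: left_diff_distrib mult.assoc)
      also have "\<dots> = y $ i - 2 * w $ i / c * bil w y"
        unfolding bil_def sum_subtractf sum_distrib_left [symmetric] by simp
      finally show ?thesis by simp
    qed
    then show ?thesis by (simp only: vec_eq_iff) simp
  qed
  have "Q *v (Q *v y) = y" for y
  proof -
    have "2 * bil w y / c + 2 * (bil w y - 2 * bil w y / c * c) / c = 0"
      using c0 by (simp add: field_simps)
    then have "2 * bil w (y - (2 * bil w y / c) *s w) / c = - (2 * bil w y / c)"
      by (simp add: bil_diff c_def [symmetric] add_eq_0_iff)
    then show ?thesis unfolding Qv by simp
  qed
  then have "(Q ** Q) *v y = mat 1 *v y" for y by (simp add: matrix_vector_mul_assoc [symmetric])
  then have "Q ** Q = mat 1" using matrix_eq by blast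
  moreover have "transpose Q = Q" by (simp add: Q_def transpose_def vec_eq_iff mult_ac)
  ultimately have "orthogonal_matrix Q" by (simp add: orthogonal_matrix_def)
  moreover have "bil w v = c / 2" unfolding c by (simp add: w_def bil_diff assms)
  then have one: "2 * bil w v / c = 1" using c0 by (simp add: field_simps)
  have "Q *v v = \<epsilon> *s axis i 1" unfolding Qv one by (simp add: w_def)
  ultimately show ?thesis using \<epsilon> by blast
qed

section \<open>Vector-valued holomorphic maps\<close>

lemma holo_map_nth [holo_intros]: "holo_map U x \<Longrightarrow> holo_fun U (\<lambda>u. x u $ i)"
  by (simp add: holo_map_def)

lemma vpd_nth: "vpd k x u $ i = pd k (\<lambda>v. x v $ i) u"
  by (simp add: vpd_def)

lemma holo_map_subset: "holo_map U f \<Longrightarrow> V \<subseteq> U \<Longrightarrow> holo_map V f"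
  unfolding holo_map_def using holo_fun_subset by blast

lemma holo_map_cscale [holo_intros]: "holo_fun U c \<Longrightarrow> holo_map U f \<Longrightarrow> holo_map U (\<lambda>u. c u *s f u)"
  unfolding holo_map_def by (simp add: holo_fun_mult)

lemma holo_map_add [holo_intros]: "holo_map U f \<Longrightarrow> holo_map U g \<Longrightarrow> holo_map U (\<lambda>u. f u + g u)"
  unfolding holo_map_def by (simp add: holo_fun_add)

lemma holo_map_diff [holo_intros]: "holo_map U f \<Longrightarrow> holo_map U g \<Longrightarrow> holo_map U (\<lambda>u. f u - g u)"
  unfolding holo_map_def by (simp add: holo_fun_diff)

lemma holo_map_sum [holo_intros]: "(\<And>i. i \<in> I \<Longrightarrow> holo_map U (f i)) \<Longrightarrow> holo_map U (\<lambda>u. \<Sum>i\<in>I. f i u)"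
  unfolding holo_map_def by (simp add: holo_fun_sum)

lemma holo_fun_bil [holo_intros]: "holo_map U f \<Longrightarrow> holo_map U g \<Longrightarrow> holo_fun U (\<lambda>u. bil (f u) (g u))"
  unfolding bil_def by (rule holo_fun_sum, rule holo_fun_mult) (simp_all add: holo_map_nth)

lemma holo_map_matrix: "holo_map U f \<Longrightarrow> holo_map U (\<lambda>u. A *v f u)"
  unfolding holo_map_def matrix_vector_mult_def vec_lambda_beta
  by (intro allI holo_fun_sum holo_fun_mult holo_fun_const) auto

lemma vpd_cong:
  assumes "open U" "u \<in> U" "\<And>v. v \<in> U \<Longrightarrow> f v = g v"
  shows "vpd k f u = vpd k g u"
  unfolding vec_eq_iff vpd_nth by (intro allI pd_cong [OF assms(1,2)]) (simp only: assms(3))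

lemma vpd_commute:
  assumes "open U" "holo_map U f" "u \<in> U"
  shows "vpd l (vpd k f) u = vpd k (vpd l f) u"
  unfolding vec_eq_iff vpd_nth
  by (intro allI pd_commute [OF assms(1) holo_map_nth [OF assms(2)] assms(3)])

context holo_domain
begin

lemma holo_vpd [holo_intros]: "holo_map U f \<Longrightarrow> holo_map U (vpd k f)"
  unfolding holo_map_def by (simp add: vpd_nth holo_pd)

lemma vpd_add: "holo_map U f \<Longrightarrow> holo_map U g \<Longrightarrow> u \<in> U \<Longrightarrow> vpd k (\<lambda>v. f v + g v) u = vpd k f u + vpd k g u"
  by (simp add: vec_eq_iff vpd_nth pd_add holo_map_nth)

lemma vpd_diff: "holo_map U f \<Longrightarrow> holo_map U g \<Longrightarrow> u \<in> U \<Longrightarrow> vpd k (\<lambda>v. f v - g v) u = vpd k f u - vpd k g u"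
  by (simp add: vec_eq_iff vpd_nth pd_diff holo_map_nth)

lemma vpd_cscale: "holo_fun U c \<Longrightarrow> holo_map U f \<Longrightarrow> u \<in> U \<Longrightarrow>
    vpd k (\<lambda>v. c v *s f v) u = pd k c u *s f u + c u *s vpd k f u"
  by (simp add: vec_eq_iff vpd_nth pd_mult holo_map_nth)

lemma vpd_sum: "(\<And>i. i \<in> I \<Longrightarrow> holo_map U (f i)) \<Longrightarrow> u \<in> U \<Longrightarrow>
    vpd k (\<lambda>v. \<Sum>i\<in>I. f i v) u = (\<Sum>i\<in>I. vpd k (f i) u)"
  by (simp add: vec_eq_iff vpd_nth pd_sum holo_map_nth)

lemma vpd_matrix: "holo_map U f \<Longrightarrow> u \<in> U \<Longrightarrow> vpd k (\<lambda>v. A *v f v) u = A *v vpd k f u"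
  by (simp add: vec_eq_iff vpd_nth matrix_vector_mult_def pd_sum pd_cmult holo_fun_mult holo_fun_const holo_map_nth)

lemma pd_bil: "holo_map U f \<Longrightarrow> holo_map U g \<Longrightarrow> u \<in> U \<Longrightarrow>
    pd k (\<lambda>v. bil (f v) (g v)) u = bil (vpd k f u) (g u) + bil (f u) (vpd k g u)"
  unfolding bil_def
  by (simp add: vpd_nth pd_sum pd_mult holo_fun_mult holo_map_nth sum.distrib)

lemma holo_det:
  assumes "\<And>i j. holo_fun U (\<lambda>u. A u $ i $ j)"
  shows "holo_fun U (\<lambda>u. det (A u :: complex^'m^'m))"
  unfolding det_def by (intro holo_fun_sum holo_fun_mult holo_fun_const holo_fun_prod assms)

text \<open>By Cramer's rule each entry is a quotient of determinants, which are polynomial in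
  matrix entries.\<close>

lemma holo_matrix_inv:
  assumes A: "\<And>i j. holo_fun U (\<lambda>u. A u $ i $ j)" and det: "\<And>u. u \<in> U \<Longrightarrow> det (A u :: complex^'m^'m) \<noteq> 0"
  shows "holo_fun U (\<lambda>u. matrix_inv (A u) $ i $ j)"
proof -
  have "holo_fun U (\<lambda>u. det (\<chi> a b. if b = i then axis j 1 $ a else A u $ a $ b) / det (A u))"
  proof (intro holo_fun_divide holo_det)
    show "holo_fun U (\<lambda>u. (\<chi> a b. if b = i then axis j 1 $ a else A u $ a $ b) $ k $ l)" for k l
      using A by (cases "l = i") (simp_all add: holo_fun_const)
  qed (use A det in auto)
  moreover have "det (\<chi> a b. if b = i then axis j 1 $ a else A u $ a $ b) / det (A u) = matrix_inv (A u) $ i $ j"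
    if "u \<in> U" for u
  proof -
    have "A u *v (\<chi> i. matrix_inv (A u) $ i $ j) = axis j 1"
      by (simp add: vec_eq_iff matrix_vector_mult_def matrix_inv_mult_nth(1) [OF det [OF that]] axis_def)
    then show ?thesis unfolding cramer [OF det [OF that]] by (simp add: vec_eq_iff)
  qed
  ultimately show ?thesis by (rule holo_fun_transfer [OF _ open_U])
qed

end

section \<open>Framed maps and conjugate nets\<close>

context holo_domain
begin

section \<open>Products of second derivatives determined by the metric\<close>

lemma metric_nth: "induced_metric x u $ j $ k = bil (vpd j x u) (vpd k x u)"
  by (simp add: induced_metric_def)

lemma holo_metric: "holo_map U x \<Longrightarrow> holo_fun U (\<lambda>u. induced_metric x u $ j $ k)"
  unfolding metric_nth by (intro holo_fun_bil holo_vpd)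

lemma pd_metric:
  assumes "holo_map U x" "u \<in> U"
  shows "pd k (\<lambda>v. induced_metric x v $ i $ j) u =
    bil (vpd k (vpd i x) u) (vpd j x u) + bil (vpd i x u) (vpd k (vpd j x) u)"
  unfolding metric_nth by (rule pd_bil [OF holo_vpd [OF assms(1)] holo_vpd [OF assms(1)] assms(2)])

text \<open>Of the six products in the expansion four cancel by symmetry of second derivatives. This
  is why tangential components of second derivatives are intrinsic.\<close>

lemma christoffel_first_kind:
  assumes "holo_map U x" "u \<in> U"
  shows "pd k (\<lambda>v. induced_metric x v $ j $ m) u + pd j (\<lambda>v. induced_metric x v $ k $ m) u -
      pd m (\<lambda>v. induced_metric x v $ j $ k) u = 2 * bil (vpd j (vpd k x) u) (vpd m x u)"
  unfolding pd_metric [OF assms]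
  using vpd_commute [OF open_U assms, of k j] vpd_commute [OF open_U assms, of m j]
    vpd_commute [OF open_U assms, of m k]
  by (simp only: bil_commute [of "vpd j x u"] bil_commute [of "vpd k x u"]) (simp add: bil_commute)

lemma dot_metric_eq:
  assumes x: "holo_map U x" and y: "holo_map U y" and eq: "\<And>u. u \<in> U \<Longrightarrow> induced_metric x u = induced_metric y u"
    and u: "u \<in> U"
  shows "bil (vpd j (vpd k x) u) (vpd m x u) = bil (vpd j (vpd k y) u) (vpd m y u)"
proof -
  have "pd k (\<lambda>v. induced_metric x v $ j $ m) u = pd k (\<lambda>v. induced_metric y v $ j $ m) u" for k j m
    by (rule pd_cong [OF open_U u]) (simp only: eq)
  then have "2 * bil (vpd j (vpd k x) u) (vpd m x u) = 2 * bil (vpd j (vpd k y) u) (vpd m y u)"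
    unfolding christoffel_first_kind [OF x u, symmetric] christoffel_first_kind [OF y u, symmetric] by simp
  then show ?thesis by simp
qed

text \<open>The Gauss equation without a curvature tensor: each side is a difference of derivatives
  of products of a second with a first derivative, and these products are intrinsic by
  \<open>dot_metric_eq\<close>.\<close>

lemma gauss_dot_eq:
  assumes x: "holo_map U x" and y: "holo_map U y" and eq: "\<And>u. u \<in> U \<Longrightarrow> induced_metric x u = induced_metric y u"
    and u: "u \<in> U"
  shows "bil (vpd j (vpd j x) u) (vpd k (vpd k x) u) - bil (vpd j (vpd k x) u) (vpd j (vpd k x) u) =
    bil (vpd j (vpd j y) u) (vpd k (vpd k y) u) - bil (vpd j (vpd k y) u) (vpd j (vpd k y) u)"
proof -
  have *: "bil (vpd j (vpd j x) u) (vpd k (vpd k x) u) - bil (vpd j (vpd k x) u) (vpd j (vpd k x) u) =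
      pd j (\<lambda>v. bil (vpd k (vpd k x) v) (vpd j x v)) u - pd k (\<lambda>v. bil (vpd j (vpd k x) v) (vpd j x v)) u"
    if x: "holo_map U x" for x :: "complex^'n \<Rightarrow> complex^'c"
  proof -
    have c: "vpd j (vpd k (vpd k x)) u = vpd k (vpd j (vpd k x)) u"
      by (rule vpd_commute [OF open_U holo_vpd [OF x] u])
    have c': "vpd k (vpd j x) u = vpd j (vpd k x) u" by (rule vpd_commute [OF open_U x u])
    show ?thesis
      unfolding pd_bil [OF holo_vpd [OF holo_vpd [OF x]] holo_vpd [OF x] u] c c'
      by (simp add: bil_commute)
  qed
  have 1: "pd j (\<lambda>v. bil (vpd k (vpd k x) v) (vpd j x v)) u = pd j (\<lambda>v. bil (vpd k (vpd k y) v) (vpd j y v)) u"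
    by (rule pd_cong [OF open_U u]) (rule dot_metric_eq [OF x y eq])
  have 2: "pd k (\<lambda>v. bil (vpd j (vpd k x) v) (vpd j x v)) u = pd k (\<lambda>v. bil (vpd j (vpd k y) v) (vpd j y v)) u"
    by (rule pd_cong [OF open_U u]) (rule dot_metric_eq [OF x y eq])
  show ?thesis unfolding * [OF x] * [OF y] 1 2 ..
qed

lemma christoffel_metric_eq:
  assumes eq: "\<And>u. u \<in> U \<Longrightarrow> induced_metric x u = induced_metric y u" and u: "u \<in> U"
  shows "christoffel (induced_metric x) l j k u = christoffel (induced_metric y) l j k u"
proof -
  have "pd k (\<lambda>v. induced_metric x v $ j $ m) u = pd k (\<lambda>v. induced_metric y v $ j $ m) u" for k j m
    by (rule pd_cong [OF open_U u]) (simp only: eq)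
  then show ?thesis unfolding christoffel_def eq [OF u] by (simp only:)
qed

end

text \<open>Serves \<open>x0\<close>, with one normal, as well as its deformations, with
  \<open>n - 1\<close> normals. The frame is a pointwise choice, so \<open>N\<close> is never
  differentiated in this locale.\<close>

locale framed_map = holo_domain U for U :: "(complex^'n::finite) set" +
  fixes x :: "complex^'n \<Rightarrow> complex^'m" and N :: "'b::finite \<Rightarrow> complex^'n \<Rightarrow> complex^'m"
  assumes card_frame: "CARD('m) = CARD('n) + CARD('b)"
    and holo_x: "holo_map U x"
    and det_x: "u \<in> U \<Longrightarrow> det (induced_metric x u) \<noteq> 0"
    and N_orthonormal: "u \<in> U \<Longrightarrow> bil (N \<alpha> u) (N \<beta> u) = (if \<alpha> = \<beta> then 1 else 0)"
    and N_normal: "u \<in> U \<Longrightarrow> bil (N \<alpha> u) (vpd j x u) = 0"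
begin

text \<open>The basis of the tangent space dual to the \<open>vpd m x\<close>; pairing with
  \<open>S k\<close> reads off tangential coefficients.\<close>

definition S :: "'n \<Rightarrow> complex^'n \<Rightarrow> complex^'m" where
  "S k u = (\<Sum>m\<in>UNIV. matrix_inv (induced_metric x u) $ k $ m *s vpd m x u)"

abbreviation "\<Gamma> \<equiv> christoffel (induced_metric x)"

lemma metric_alt: "induced_metric x u = (\<chi> j k. bil (vpd j x u) (vpd k x u))"
  by (simp add: induced_metric_def)

lemma holo_S: "holo_map U (S k)"
  unfolding S_def by (intro holo_map_sum holo_map_cscale holo_matrix_inv holo_metric holo_x holo_vpd det_x)

lemma S_vpd: "u \<in> U \<Longrightarrow> bil (S k u) (vpd m x u) = (if k = m then 1 else 0)"
  using matrix_inv_mult_nth(2) [OF det_x, of u k m] by (simp add: S_def bil_sum metric_nth)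

lemma S_N: "u \<in> U \<Longrightarrow> bil (S k u) (N \<alpha> u) = 0"
proof -
  assume u: "u \<in> U"
  have "bil (vpd m x u) (N \<alpha> u) = 0" for m using N_normal [OF u, of \<alpha> m] by (simp only: bil_commute)
  then show ?thesis by (simp add: S_def bil_sum)
qed

lemma S_S: "u \<in> U \<Longrightarrow> bil (S k u) (S l u) = matrix_inv (induced_metric x u) $ l $ k"
proof -
  assume u: "u \<in> U"
  have "bil (S k u) (S l u) = (\<Sum>m\<in>UNIV. matrix_inv (induced_metric x u) $ l $ m * bil (S k u) (vpd m x u))"
    by (simp add: S_def [of l] bil_sum)
  then show ?thesis by (simp add: S_vpd [OF u] if_distrib [of "(*) _"] cong: if_cong)
qed

lemma frame_eq_zero:
  assumes u: "u \<in> U" and "\<And>j. bil y (vpd j x u) = 0" "\<And>\<alpha>. bil y (N \<alpha> u) = 0"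
  shows "y = 0"
  by (rule gram_frame_complete [where T = "\<lambda>j. vpd j x u" and N = "\<lambda>\<alpha>. N \<alpha> u"])
    (use assms card_frame det_x [OF u] in \<open>auto simp: metric_alt N_orthonormal N_normal\<close>)

lemma frame_eqI:
  assumes u: "u \<in> U" and "\<And>j. bil y (vpd j x u) = bil z (vpd j x u)" "\<And>\<alpha>. bil y (N \<alpha> u) = bil z (N \<alpha> u)"
  shows "y = z"
  using frame_eq_zero [OF u, of "y - z"] assms by (simp add: bil_diff)

lemma expansion:
  assumes u: "u \<in> U"
  shows "y = (\<Sum>m\<in>UNIV. bil (S m u) y *s vpd m x u) + (\<Sum>\<alpha>\<in>UNIV. bil (N \<alpha> u) y *s N \<alpha> u)"
proof (rule frame_eqI [OF u])
  fix j
  have "bil y (vpd j x u) = (\<Sum>m\<in>UNIV. bil (S m u) y * bil (vpd m x u) (vpd j x u))"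
  proof -
    have "(\<Sum>m\<in>UNIV. bil (S m u) y * bil (vpd m x u) (vpd j x u)) =
        bil (\<Sum>m\<in>UNIV. induced_metric x u $ m $ j *s S m u) y"
      by (simp add: bil_sum metric_nth mult.commute)
    also have "(\<Sum>m\<in>UNIV. induced_metric x u $ m $ j *s S m u) = vpd j x u"
    proof (rule frame_eqI [OF u])
      show "bil (\<Sum>m\<in>UNIV. induced_metric x u $ m $ j *s S m u) (vpd i x u) = bil (vpd j x u) (vpd i x u)" for i
        by (simp add: bil_sum S_vpd [OF u] metric_nth if_distrib [of "(*) _"] cong: if_cong) (rule bil_commute)
      show "bil (\<Sum>m\<in>UNIV. induced_metric x u $ m $ j *s S m u) (N \<alpha> u) = bil (vpd j x u) (N \<alpha> u)" for \<alpha>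
        using N_normal [OF u, of \<alpha> j] by (simp add: bil_sum S_N [OF u] bil_commute [of "vpd j x u"])
    qed
    finally show ?thesis by (simp only: bil_commute)
  qed
  then show "bil y (vpd j x u) =
      bil ((\<Sum>m\<in>UNIV. bil (S m u) y *s vpd m x u) + (\<Sum>\<alpha>\<in>UNIV. bil (N \<alpha> u) y *s N \<alpha> u)) (vpd j x u)"
    by (simp add: bil_add bil_sum N_normal [OF u])
next
  fix \<alpha>
  have z: "bil (vpd m x u) (N \<alpha> u) = 0" for m using N_normal [OF u, of \<alpha> m] by (simp only: bil_commute)
  show "bil y (N \<alpha> u) =
      bil ((\<Sum>m\<in>UNIV. bil (S m u) y *s vpd m x u) + (\<Sum>\<alpha>\<in>UNIV. bil (N \<alpha> u) y *s N \<alpha> u)) (N \<alpha> u)"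
    by (simp add: bil_add bil_sum z N_orthonormal [OF u] if_distrib [of "(*) _"] cong: if_cong) (rule bil_commute)
qed

lemma christoffel_eq:
  assumes u: "u \<in> U"
  shows "\<Gamma> l j k u = bil (S l u) (vpd j (vpd k x) u)"
proof -
  have "\<Gamma> l j k u = (\<Sum>m\<in>UNIV. matrix_inv (induced_metric x u) $ l $ m * bil (vpd j (vpd k x) u) (vpd m x u))"
    unfolding christoffel_def christoffel_first_kind [OF holo_x u] by simp
  then show ?thesis by (simp add: S_def bil_sum bil_commute)
qed

lemma christoffel_sym: "u \<in> U \<Longrightarrow> \<Gamma> l j k u = \<Gamma> l k j u"
  unfolding christoffel_eq using vpd_commute [OF open_U holo_x, of u j k] by simp

lemma holo_christoffel: "holo_fun U (\<Gamma> l j k)"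
  by (rule holo_fun_transfer [OF holo_fun_bil [OF holo_S holo_vpd [OF holo_vpd [OF holo_x]]] open_U])
    (rule christoffel_eq [symmetric])

lemma normal_products:
  assumes u: "u \<in> U"
  shows "(\<Sum>\<alpha>\<in>UNIV. bil (N \<alpha> u) y * bil (N \<alpha> u) z) = bil y z -
    (\<Sum>j\<in>UNIV. (\<Sum>k\<in>UNIV. matrix_inv (induced_metric x u) $ j $ k * bil y (vpd k x u)) * bil z (vpd j x u))"
  unfolding metric_alt
  by (rule frame_parseval [where T = "\<lambda>j. vpd j x u" and N = "\<lambda>\<alpha>. N \<alpha> u"])
    (use card_frame det_x [OF u] in \<open>auto simp: metric_alt N_orthonormal [OF u] N_normal [OF u]\<close>)

end

locale conjugate_map = framed_map +
  assumes conj: "u \<in> U \<Longrightarrow> j \<noteq> k \<Longrightarrow> bil (N \<alpha> u) (vpd j (vpd k x) u) = 0"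
begin

lemma second_derivative:
  assumes "u \<in> U" "j \<noteq> k"
  shows "vpd j (vpd k x) u = (\<Sum>m\<in>UNIV. \<Gamma> m j k u *s vpd m x u)"
  by (subst expansion [OF assms(1)]) (simp add: conj [OF assms] christoffel_eq [OF assms(1)])

text \<open>When the tangential expansion of the mixed derivative is differentiated, normal
  components come only from the terms \<open>vpd l (vpd m x)\<close>, and conjugacy leaves
  \<open>m = l\<close>.\<close>

lemma third_derivative_normal:
  assumes u: "u \<in> U" and "j \<noteq> k"
  shows "bil (N \<alpha> u) (vpd l (vpd j (vpd k x)) u) = \<Gamma> l j k u * bil (N \<alpha> u) (vpd l (vpd l x) u)"
proof -
  have "vpd l (vpd j (vpd k x)) u = vpd l (\<lambda>v. \<Sum>m\<in>UNIV. \<Gamma> m j k v *s vpd m x v) u"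
    by (rule vpd_cong [OF open_U u]) (rule second_derivative [OF _ assms(2)])
  also have "\<dots> = (\<Sum>m\<in>UNIV. pd l (\<Gamma> m j k) u *s vpd m x u + \<Gamma> m j k u *s vpd l (vpd m x) u)"
    by (subst vpd_sum [OF _ u])
      (simp_all only: holo_map_cscale holo_christoffel holo_vpd holo_x vpd_cscale [OF holo_christoffel holo_vpd [OF holo_x] u])
  finally have "bil (N \<alpha> u) (vpd l (vpd j (vpd k x)) u) = (\<Sum>m\<in>UNIV. \<Gamma> m j k u * bil (N \<alpha> u) (vpd l (vpd m x) u))"
    by (simp add: bil_sum bil_add N_normal [OF u])
  also have "\<dots> = (\<Sum>m\<in>UNIV. if m = l then \<Gamma> l j k u * bil (N \<alpha> u) (vpd l (vpd l x) u) else 0)"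
    by (rule sum.cong) (auto simp: conj [OF u])
  finally show ?thesis by simp
qed

lemma christoffel_exchange:
  assumes u: "u \<in> U" and d: "j \<noteq> k" "l \<noteq> k"
  shows "\<Gamma> l j k u * bil (N \<alpha> u) (vpd l (vpd l x) u) = \<Gamma> j l k u * bil (N \<alpha> u) (vpd j (vpd j x) u)"
  unfolding third_derivative_normal [OF u d(1), symmetric] third_derivative_normal [OF u d(2), symmetric]
  by (simp only: vpd_commute [OF open_U holo_vpd [OF holo_x] u, of l j])

end

locale distinct_map = conjugate_map +
  assumes distinct: "u \<in> U \<Longrightarrow> j \<noteq> k \<Longrightarrow> k \<noteq> l \<Longrightarrow> j \<noteq> l \<Longrightarrow> christoffel (induced_metric x) l j k u = 0"
begin

text \<open>Once the symbols with distinct indices vanish, two families remain: \<open>p\<close>,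
  the coefficients of mixed second derivatives, and \<open>r\<close>, the tangential coefficients of
  pure ones.\<close>

definition p :: "'a \<Rightarrow> 'a \<Rightarrow> complex^'a \<Rightarrow> complex" where "p j k = \<Gamma> j j k"
definition r :: "'a \<Rightarrow> 'a \<Rightarrow> complex^'a \<Rightarrow> complex" where "r k l = \<Gamma> k l l"

lemma holo_p: "holo_fun U (p j k)" and holo_r: "holo_fun U (r j k)"
  unfolding p_def r_def by (rule holo_christoffel)+

lemma second_derivative_distinct:
  assumes u: "u \<in> U" and "j \<noteq> k"
  shows "vpd j (vpd k x) u = p j k u *s vpd j x u + p k j u *s vpd k x u"
proof -
  have "vpd j (vpd k x) u = (\<Sum>m\<in>UNIV. \<Gamma> m j k u *s vpd m x u)" by (rule second_derivative [OF assms])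
  also have "\<dots> = (\<Sum>m\<in>{j, k}. \<Gamma> m j k u *s vpd m x u)"
    by (rule sum.mono_neutral_right) (use distinct [OF u] \<open>j \<noteq> k\<close> in auto)
  finally show ?thesis
    using \<open>j \<noteq> k\<close> christoffel_sym [OF u, of k j k] by (simp add: p_def)
qed

lemma third_derivative_distinct:
  assumes u: "u \<in> U" and "j \<noteq> k"
  shows "vpd l (vpd j (vpd k x)) u = pd l (p j k) u *s vpd j x u + p j k u *s vpd l (vpd j x) u +
    (pd l (p k j) u *s vpd k x u + p k j u *s vpd l (vpd k x) u)"
proof -
  have "vpd l (vpd j (vpd k x)) u = vpd l (\<lambda>v. p j k v *s vpd j x v + p k j v *s vpd k x v) u"
    by (rule vpd_cong [OF open_U u]) (rule second_derivative_distinct [OF _ assms(2)])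
  also have "\<dots> = vpd l (\<lambda>v. p j k v *s vpd j x v) u + vpd l (\<lambda>v. p k j v *s vpd k x v) u"
    by (rule vpd_add [OF _ _ u]) (intro holo_map_cscale holo_p holo_vpd holo_x)+
  finally show ?thesis
    by (simp only: vpd_cscale [OF holo_p holo_vpd [OF holo_x] u])
qed

text \<open>Compares the components along \<open>vpd i x\<close> of a third derivative taken in two
  orders. It later eliminates the derivatives of \<open>p\<close>.\<close>

lemma darboux:
  assumes u: "u \<in> U" and d: "i \<noteq> k" "k \<noteq> l" "i \<noteq> l"
  shows "pd l (p i k) u + p i k u * p i l u = p k l u * p i k u + p l k u * p i l u"
proof -
  have "vpd l (vpd k (vpd i x)) u = vpd l (vpd i (vpd k x)) u"
    by (rule vpd_cong [OF open_U u]) (rule vpd_commute [OF open_U holo_x])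
  also have "\<dots> = vpd i (vpd l (vpd k x)) u" by (rule vpd_commute [OF open_U holo_vpd [OF holo_x] u])
  finally have "bil (S i u) (vpd l (vpd k (vpd i x)) u) = bil (S i u) (vpd i (vpd l (vpd k x)) u)" by simp
  moreover have "\<Gamma> i l k u = 0" "\<Gamma> i l i u = p i l u" "\<Gamma> i i l u = p i l u" "\<Gamma> i i k u = p i k u"
    using distinct [OF u, of l k i] d christoffel_sym [OF u, of i l i] by (auto simp: p_def)
  ultimately show ?thesis
    unfolding third_derivative_distinct [OF u d(1) [symmetric]] third_derivative_distinct [OF u d(2) [symmetric]]
    using d by (simp add: bil_add S_vpd [OF u] christoffel_eq [OF u, symmetric])
qed

end

section \<open>Hypersurfaces in conjugate coordinates\<close>

locale conjugate_net = distinct_map U x0 "\<lambda>_::unit. N0" for U x0 N0 +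
  assumes holo_N0: "holo_map U N0"
begin

definition h :: "'a \<Rightarrow> complex^'a \<Rightarrow> complex" where "h k u = bil (N0 u) (vpd k (vpd k x0) u)"
text \<open>An entry of the inverse metric, by \<open>S_S\<close>.\<close>

definition ginv :: "'a \<Rightarrow> 'a \<Rightarrow> complex^'a \<Rightarrow> complex" where "ginv k l u = bil (S k u) (S l u)"

lemma holo_h: "holo_fun U (h k)"
  unfolding h_def by (intro holo_fun_bil holo_N0 holo_vpd holo_x)

lemma ginv_sym: "ginv k l u = ginv l k u"
  unfolding ginv_def by (rule bil_commute)

lemma N0_N0: "u \<in> U \<Longrightarrow> bil (N0 u) (N0 u) = 1"
  using N_orthonormal [of u "()" "()"] by simp

lemma S_N0: "u \<in> U \<Longrightarrow> bil (S k u) (N0 u) = 0" "u \<in> U \<Longrightarrow> bil (N0 u) (S k u) = 0"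
  using S_N [of u k] by (auto simp: bil_commute)

text \<open>Weingarten's equation; conjugacy leaves a single term.\<close>

lemma vpd_N0:
  assumes u: "u \<in> U"
  shows "vpd l N0 u = - (h l u) *s S l u"
proof (rule frame_eqI [OF u])
  fix m
  have "pd l (\<lambda>v. bil (N0 v) (vpd m x0 v)) u = pd l (\<lambda>_. 0) u"
    by (rule pd_cong [OF open_U u]) (rule N_normal)
  then have "bil (vpd l N0 u) (vpd m x0 u) + bil (N0 u) (vpd l (vpd m x0) u) = 0"
    by (simp add: pd_bil [OF holo_N0 holo_vpd [OF holo_x] u])
  then show "bil (vpd l N0 u) (vpd m x0 u) = bil (- (h l u) *s S l u) (vpd m x0 u)"
    using conj [OF u, of l m] by (cases "l = m") (simp_all add: S_vpd [OF u] h_def add_eq_0_iff)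
next
  fix \<alpha>
  have "pd l (\<lambda>v. bil (N0 v) (N0 v)) u = pd l (\<lambda>_. 1) u"
    by (rule pd_cong [OF open_U u]) (rule N0_N0)
  then have "2 * bil (vpd l N0 u) (N0 u) = 0"
    by (simp add: pd_bil [OF holo_N0 holo_N0 u] bil_commute)
  then show "bil (vpd l N0 u) (N0 u) = bil (- (h l u) *s S l u) (N0 u)"
    by (simp add: S_N0 [OF u])
qed

text \<open>Comes from differentiating the duality relations of \<open>S k\<close>. For
  \<open>l\<close> different from \<open>k\<close> only two symbols with upper index
  \<open>k\<close> survive, whereas for \<open>l = k\<close> all the \<open>p k m\<close> would
  appear.\<close>

lemma vpd_S:
  assumes u: "u \<in> U" and kl: "k \<noteq> l"
  shows "vpd l (S k) u = (h l u * ginv k l u) *s N0 u - p k l u *s S k u - r k l u *s S l u"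
proof (rule frame_eqI [OF u])
  fix m
  have "pd l (\<lambda>v. bil (S k v) (vpd m x0 v)) u = pd l (\<lambda>_. if k = m then 1 else 0) u"
    by (rule pd_cong [OF open_U u]) (rule S_vpd)
  then have "bil (vpd l (S k) u) (vpd m x0 u) = - \<Gamma> k l m u"
    by (simp add: pd_bil [OF holo_S holo_vpd [OF holo_x] u] christoffel_eq [OF u] add_eq_0_iff2)
  moreover have "\<Gamma> k l m u = (if k = m then p k l u else 0) + (if l = m then r k l u else 0)"
    using distinct [OF u, of l m k] kl christoffel_sym [OF u, of k l k] by (auto simp: p_def r_def)
  ultimately show "bil (vpd l (S k) u) (vpd m x0 u) =
      bil ((h l u * ginv k l u) *s N0 u - p k l u *s S k u - r k l u *s S l u) (vpd m x0 u)"
    using N_normal [OF u, of m] by (simp add: bil_diff S_vpd [OF u])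
next
  fix \<alpha>
  have "pd l (\<lambda>v. bil (S k v) (N0 v)) u = pd l (\<lambda>_. 0) u"
    by (rule pd_cong [OF open_U u]) (rule S_N0)
  then have "bil (vpd l (S k) u) (N0 u) = h l u * ginv k l u"
    by (simp add: pd_bil [OF holo_S holo_N0 u] vpd_N0 [OF u] ginv_def)
  then show "bil (vpd l (S k) u) (N0 u) =
      bil ((h l u * ginv k l u) *s N0 u - p k l u *s S k u - r k l u *s S l u) (N0 u)"
    by (simp add: bil_diff S_N0 [OF u] N0_N0 [OF u])
qed

text \<open>Codazzi's equation, from exchanging derivatives in
  \<open>vpd l (vpd k (vpd k x0))\<close>; the term with \<open>r\<close> comes from the derivative
  of the normal.\<close>

lemma pd_h:
  assumes u: "u \<in> U" and kl: "k \<noteq> l"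
  shows "pd l (h k) u = p k l u * h k u - r l k u * h l u"
proof -
  have "pd l (h k) u = bil (vpd l N0 u) (vpd k (vpd k x0) u) + bil (N0 u) (vpd l (vpd k (vpd k x0)) u)"
    unfolding h_def by (rule pd_bil [OF holo_N0 holo_vpd [OF holo_vpd [OF holo_x]] u])
  also have "bil (vpd l N0 u) (vpd k (vpd k x0) u) = - r l k u * h l u"
    by (simp add: vpd_N0 [OF u] r_def christoffel_eq [OF u])
  also have "vpd l (vpd k (vpd k x0)) u = vpd k (vpd l (vpd k x0)) u"
    by (rule vpd_commute [OF open_U holo_vpd [OF holo_x] u])
  also have "bil (N0 u) (vpd k (vpd l (vpd k x0)) u) = p k l u * h k u"
    unfolding third_derivative_distinct [OF u kl [symmetric]]
    using conj [OF u kl] by (simp add: bil_add N_normal [OF u] h_def)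
  finally show ?thesis by simp
qed

end

text \<open>
  For a quadric the vector \<open>q\<close> is an affine image of \<open>x0\<close>, hence satisfies the same
  equations of the conjugate net.
\<close>

locale quadric_net = conjugate_net +
  fixes q :: "complex^'a \<Rightarrow> complex^'b" and \<sigma> :: "complex^'a \<Rightarrow> complex"
  assumes holo_q: "holo_map U q" and holo_\<sigma>: "holo_fun U \<sigma>"
    and q_eq: "u \<in> U \<Longrightarrow> q u = \<sigma> u *s N0 u" and \<sigma>_nz: "u \<in> U \<Longrightarrow> \<sigma> u \<noteq> 0"
    and q_second: "u \<in> U \<Longrightarrow> j \<noteq> k \<Longrightarrow>
      vpd j (vpd k q) u = christoffel (induced_metric x0) j j k u *s vpd j q u + christoffel (induced_metric x0) k k j u *s vpd k q u"
    and h_nz: "u \<in> U \<Longrightarrow> bil (N0 u) (vpd k (vpd k x0) u) \<noteq> 0"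
begin

lemma vpd_q: "u \<in> U \<Longrightarrow> vpd k q u = pd k \<sigma> u *s N0 u - (\<sigma> u * h k u) *s S k u"
proof -
  assume u: "u \<in> U"
  have "vpd k q u = vpd k (\<lambda>v. \<sigma> v *s N0 v) u"
    by (rule vpd_cong [OF open_U u]) (rule q_eq)
  then show ?thesis by (simp add: vpd_cscale [OF holo_\<sigma> holo_N0 u] vpd_N0 [OF u] vec_eq_iff)
qed

lemma pd_\<sigma>: "u \<in> U \<Longrightarrow> pd k \<sigma> u = bil (vpd k q u) (N0 u)"
  by (simp add: vpd_q bil_diff N0_N0 S_N0)

lemma vpd_q_vpd: "u \<in> U \<Longrightarrow> bil (vpd k q u) (vpd m x0 u) = (if k = m then - (\<sigma> u * h k u) else 0)"
  using N_normal [of u m] by (simp add: vpd_q bil_diff S_vpd)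

lemma pd_pd_\<sigma>:
  assumes u: "u \<in> U" and kl: "k \<noteq> l"
  shows "pd l (pd k \<sigma>) u = p k l u * pd k \<sigma> u + p l k u * pd l \<sigma> u + \<sigma> u * h k u * h l u * ginv k l u"
proof -
  have "pd l (pd k \<sigma>) u = pd l (\<lambda>v. bil (vpd k q v) (N0 v)) u"
    by (rule pd_cong [OF open_U u]) (rule pd_\<sigma>)
  also have "\<dots> = bil (vpd l (vpd k q) u) (N0 u) + bil (vpd k q u) (vpd l N0 u)"
    by (rule pd_bil [OF holo_vpd [OF holo_q] holo_N0 u])
  also have "bil (vpd l (vpd k q) u) (N0 u) = p k l u * pd k \<sigma> u + p l k u * pd l \<sigma> u"
    by (simp add: q_second [OF u kl [symmetric]] p_def [symmetric] bil_add pd_\<sigma> [OF u])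
  also have "bil (vpd k q u) (vpd l N0 u) = \<sigma> u * h k u * h l u * ginv k l u"
    by (simp add: vpd_q [OF u] vpd_N0 [OF u] bil_diff S_N0 [OF u] ginv_def)
  finally show ?thesis .
qed

text \<open>The product of \<open>vpd i q\<close> with \<open>vpd i x0\<close> is
  \<open>- (\<sigma> u * h i u)\<close> because \<open>q\<close> is normal, while its derivative
  also follows from the mixed second-order equations shared by \<open>q\<close> and
  \<open>x0\<close>. The relation expresses \<open>r k i\<close> through first derivatives of
  \<open>\<sigma>\<close>, which is where the quadric enters.\<close>

lemma pd_\<sigma>_h:
  assumes u: "u \<in> U" and ki: "k \<noteq> i"
  shows "pd k \<sigma> u * h i u - \<sigma> u * r k i u * h k u = p i k u * \<sigma> u * h i u"
proof -
  have "pd k (\<lambda>v. - (\<sigma> v * h i v)) u = pd k (\<lambda>v. bil (vpd i q v) (vpd i x0 v)) u"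
    by (rule pd_cong [OF open_U u]) (simp add: vpd_q_vpd)
  also have "\<dots> = bil (vpd k (vpd i q) u) (vpd i x0 u) + bil (vpd i q u) (vpd k (vpd i x0) u)"
    by (rule pd_bil [OF holo_vpd [OF holo_q] holo_vpd [OF holo_x] u])
  also have "\<dots> = - 2 * p i k u * \<sigma> u * h i u"
    using ki by (simp add: q_second [OF u ki] second_derivative_distinct [OF u ki] p_def [symmetric] bil_add vpd_q_vpd [OF u])
  finally have "- (pd k \<sigma> u * h i u) - \<sigma> u * (p i k u * h i u - r k i u * h k u) = - (2 * p i k u * \<sigma> u * h i u)"
    by (simp add: pd_minus pd_mult holo_fun_mult holo_\<sigma> holo_h u pd_h [OF u ki [symmetric]])
  then show ?thesis by algebra
qed

end

section \<open>The linear system of a solution\<close>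

lemma sum_split2:
  fixes f :: "'n::finite \<Rightarrow> complex"
  assumes "k \<noteq> l"
  shows "(\<Sum>m\<in>UNIV. f m) = f k + f l + (\<Sum>m\<in>UNIV - {k, l}. f m)"
proof -
  have "(\<Sum>m\<in>UNIV. f m) = f k + (\<Sum>m\<in>UNIV - {k}. f m)" by (simp add: sum.remove)
  also have "(\<Sum>m\<in>UNIV - {k}. f m) = f l + (\<Sum>m\<in>UNIV - {k} - {l}. f m)"
    using assms by (intro sum.remove) auto
  also have "UNIV - {k} - {l} = UNIV - {k, l}" by auto
  finally show ?thesis by (simp add: add.assoc)
qed

locale net_solution = quadric_net +
  fixes a :: "'a \<Rightarrow> complex^'a \<Rightarrow> complex"
  assumes holo_a: "holo_fun U (a j)" and a_nz: "u \<in> U \<Longrightarrow> a j u \<noteq> 0"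
    and pd_a': "u \<in> U \<Longrightarrow> j \<noteq> k \<Longrightarrow> pd k (a j) u / a j u = christoffel (induced_metric x0) j j k u"
    and unit: "u \<in> U \<Longrightarrow> (\<Sum>j\<in>UNIV. (bil (N0 u) (vpd j (vpd j x0) u))\<^sup>2 / (a j u)\<^sup>2) + 1 = 0"
begin

text \<open>In a deformation the numbers \<open>\<i> * B j\<close> are the components of the unit
  vector along the coordinate \<open>None\<close> with respect to the normalized joined vectors. The
  \<open>\<beta>\<close> are the rotation coefficients in the derivatives of
  \<open>B\<close>.\<close>

definition B :: "'a \<Rightarrow> complex^'a \<Rightarrow> complex" where "B j u = h j u / a j u"
definition \<beta> :: "'a \<Rightarrow> 'a \<Rightarrow> complex^'a \<Rightarrow> complex" where
  "\<beta> k m u = (if k = m then 0 else - (r k m u * a k u / a m u))"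

lemma pd_a: "u \<in> U \<Longrightarrow> j \<noteq> k \<Longrightarrow> pd k (a j) u = a j u * p j k u"
  using pd_a' [of u j k] a_nz [of u j] by (simp add: p_def field_simps)

lemma holo_B: "holo_fun U (B j)"
  unfolding B_def by (intro holo_fun_divide holo_h holo_a a_nz)

lemma holo_\<beta>: "holo_fun U (\<beta> k m)"
proof (cases "k = m")
  case True
  then have "\<beta> k m = (\<lambda>_. 0)" by (simp add: \<beta>_def fun_eq_iff)
  then show ?thesis by (simp only: holo_fun_const)
next
  case False
  then have "\<beta> k m = (\<lambda>u. - (r k m u * a k u / a m u))" by (simp add: \<beta>_def fun_eq_iff)
  then show ?thesis
    by (simp only:) (intro holo_fun_minus holo_fun_divide holo_fun_mult holo_r holo_a a_nz)
qed

lemma \<beta>_diag [simp]: "\<beta> k k u = 0"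
  by (simp add: \<beta>_def)

lemma B_nz: "u \<in> U \<Longrightarrow> B k u \<noteq> 0"
  using h_nz [of u k] a_nz [of u k] by (simp add: B_def h_def)

lemma h_B: "u \<in> U \<Longrightarrow> h k u = a k u * B k u"
  using a_nz [of u k] by (simp add: B_def)

lemma \<beta>_a: "u \<in> U \<Longrightarrow> k \<noteq> m \<Longrightarrow> a m u * \<beta> k m u = - (r k m u * a k u)"
  using a_nz [of u m] by (simp add: \<beta>_def)

lemma sum_B: "u \<in> U \<Longrightarrow> (\<Sum>m\<in>UNIV. B m u * B m u) = - 1"
  using unit [of u] by (simp add: B_def h_def power2_eq_square add_eq_0_iff2)

lemma pd_B:
  assumes u: "u \<in> U" and km: "k \<noteq> m"
  shows "pd k (B m) u = \<beta> k m u * B k u"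
proof -
  have "pd k (B m) u = (pd k (h m) u * a m u - h m u * pd k (a m) u) / (a m u * a m u)"
    unfolding B_def by (rule pd_divide [OF holo_h holo_a u a_nz [OF u]])
  also have "\<dots> = - (r k m u * h k u) / a m u"
    using a_nz [OF u, of m] km by (simp add: pd_h [OF u km [symmetric]] pd_a [OF u km [symmetric]] field_simps)
  also have "\<dots> = \<beta> k m u * B k u"
    using km a_nz [OF u, of k] by (simp add: \<beta>_def B_def)
  finally show ?thesis .
qed

text \<open>The differential system says nothing about this derivative; it comes from
  differentiating \<open>sum_B\<close> and dividing by \<open>B k\<close>.\<close>

lemma pd_B_diag:
  assumes u: "u \<in> U"
  shows "pd k (B k) u = - (\<Sum>m\<in>UNIV. \<beta> k m u * B m u)"
proof -
  have "pd k (\<lambda>v. \<Sum>m\<in>UNIV. B m v * B m v) u = pd k (\<lambda>_. - 1) u"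
    by (rule pd_cong [OF open_U u]) (rule sum_B)
  then have "(\<Sum>m\<in>UNIV. 2 * (B m u * pd k (B m) u)) = 0"
    by (simp add: pd_sum pd_mult holo_fun_mult holo_B u mult.commute)
  then have "(\<Sum>m\<in>UNIV. B m u * pd k (B m) u) = 0" by (simp add: sum_distrib_left [symmetric])
  then have "B k u * pd k (B k) u + (\<Sum>m\<in>UNIV - {k}. B m u * pd k (B m) u) = 0"
    by (simp add: sum.remove [of UNIV k])
  moreover have "(\<Sum>m\<in>UNIV - {k}. B m u * pd k (B m) u) = (\<Sum>m\<in>UNIV - {k}. B k u * (\<beta> k m u * B m u))"
    by (rule sum.cong) (auto simp: pd_B [OF u])
  moreover have "(\<Sum>m\<in>UNIV. \<beta> k m u * B m u) = (\<Sum>m\<in>UNIV - {k}. \<beta> k m u * B m u)"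
    by (simp add: sum.remove [of UNIV k])
  ultimately have "B k u * (pd k (B k) u + (\<Sum>m\<in>UNIV. \<beta> k m u * B m u)) = 0"
    by (simp add: sum_distrib_left distrib_left)
  then show ?thesis using B_nz [OF u, of k] by (simp add: add_eq_0_iff2)
qed

text \<open>The relation \<open>pd_\<sigma>_h\<close> divided by \<open>a m\<close>, which turns the
  symbol \<open>r\<close> into \<open>\<beta>\<close>.\<close>

lemma pd_\<sigma>_B:
  assumes u: "u \<in> U" and km: "k \<noteq> m"
  shows "pd k \<sigma> u * B m u + \<sigma> u * (\<beta> k m u * B k u) = p m k u * (\<sigma> u * B m u)"
proof -
  have "a m u * (pd k \<sigma> u * B m u + \<sigma> u * (\<beta> k m u * B k u)) =
      pd k \<sigma> u * h m u + \<sigma> u * (a m u * \<beta> k m u) * B k u"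
    by (simp add: h_B [OF u] algebra_simps)
  also have "\<dots> = pd k \<sigma> u * h m u - \<sigma> u * r k m u * h k u"
    unfolding \<beta>_a [OF u km] by (simp add: h_B [OF u])
  also have "\<dots> = a m u * (p m k u * (\<sigma> u * B m u))"
    unfolding pd_\<sigma>_h [OF u km] by (simp add: h_B [OF u])
  finally show ?thesis using a_nz [OF u, of m] by simp
qed

text \<open>Differentiate \<open>pd_\<sigma>_B\<close> in direction \<open>l\<close>:
  \<open>darboux\<close> removes the derivative of \<open>p\<close>, \<open>pd_pd_\<sigma>\<close>
  the second derivative of \<open>\<sigma>\<close>, and further instances of
  \<open>pd_\<sigma>_B\<close> the first derivatives. What is left has the nonzero factor
  \<open>\<sigma> u * B k u\<close>.\<close>

lemma pd_\<beta>:
  assumes u: "u \<in> U" and d: "k \<noteq> l" "k \<noteq> m" "l \<noteq> m"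
  shows "pd l (\<beta> k m) u = \<beta> l m u * \<beta> k l u - B m u * ginv k l u * h l u * a k u"
proof -
  have "pd l (\<lambda>v. pd k \<sigma> v * B m v + \<sigma> v * (\<beta> k m v * B k v)) u = pd l (\<lambda>v. p m k v * (\<sigma> v * B m v)) u"
    by (rule pd_cong [OF open_U u]) (rule pd_\<sigma>_B [OF _ d(2)])
  then have E: "pd l (pd k \<sigma>) u * B m u + pd k \<sigma> u * (\<beta> l m u * B l u) +
      (pd l \<sigma> u * (\<beta> k m u * B k u) + \<sigma> u * (pd l (\<beta> k m) u * B k u + \<beta> k m u * (\<beta> l k u * B l u))) =
      pd l (p m k) u * (\<sigma> u * B m u) + p m k u * (pd l \<sigma> u * B m u + \<sigma> u * (\<beta> l m u * B l u))"
    using d by (simp add: pd_add pd_mult holo_fun_mult holo_\<sigma> holo_\<beta> holo_B holo_p holo_pd u pd_B [OF u])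
  note C = pd_\<sigma>_B [OF u]
  have R: "pd l (p m k) u * (\<sigma> u * B m u) + p m k u * (pd l \<sigma> u * B m u + \<sigma> u * (\<beta> l m u * B l u)) =
      p k l u * (pd k \<sigma> u * B m u + \<sigma> u * (\<beta> k m u * B k u)) + p l k u * (pd l \<sigma> u * B m u + \<sigma> u * (\<beta> l m u * B l u))"
  proof -
    have "pd l (p m k) u * (\<sigma> u * B m u) + p m k u * (p m l u * (\<sigma> u * B m u)) =
      (pd l (p m k) u + p m k u * p m l u) * (\<sigma> u * B m u)" by (simp add: algebra_simps)
    also have "\<dots> = p k l u * (p m k u * (\<sigma> u * B m u)) + p l k u * (p m l u * (\<sigma> u * B m u))"
      using darboux [OF u, of m k l] d by (simp add: algebra_simps)
    finally show ?thesis using C d by simp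
  qed
  have "\<sigma> u * B k u * pd l (\<beta> k m) u + \<sigma> u * h k u * h l u * ginv k l u * B m u =
      \<beta> k m u * (p k l u * (\<sigma> u * B k u) - pd l \<sigma> u * B k u - \<sigma> u * (\<beta> l k u * B l u)) +
      \<beta> l m u * (p l k u * (\<sigma> u * B l u) - pd k \<sigma> u * B l u)"
    using E unfolding R pd_pd_\<sigma> [OF u d(1)] by (simp add: algebra_simps)
  also have "\<dots> = \<beta> l m u * (\<sigma> u * (\<beta> k l u * B k u))"
    unfolding C [OF d(1) [symmetric], symmetric] C [OF d(1), symmetric] by (simp add: algebra_simps)
  finally have "\<sigma> u * B k u * (pd l (\<beta> k m) u - (\<beta> l m u * \<beta> k l u - B m u * ginv k l u * h l u * a k u)) = 0"
    by (simp add: h_B [OF u, of k] algebra_simps)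
  then show ?thesis using \<sigma>_nz [OF u] B_nz [OF u, of k] by simp
qed

text \<open>The second derivative of \<open>B k\<close> in the directions \<open>k\<close> and
  \<open>l\<close> is computed in both orders, once through \<open>pd_B_diag\<close> and once
  through \<open>pd_B\<close>. This gives the two derivatives of \<open>\<beta>\<close> only as a
  sum, which is what integrability requires.\<close>

lemma pd_\<beta>_sym:
  assumes u: "u \<in> U" and d: "k \<noteq> l"
  shows "pd l (\<beta> k l) u + pd k (\<beta> l k) u + (\<Sum>m\<in>UNIV - {k, l}. \<beta> k m u * \<beta> l m u) =
    ginv k l u * a k u * a l u * (\<Sum>m\<in>UNIV - {k, l}. B m u * B m u)"
proof -
  let ?R = "UNIV - {k, l}"
  have "pd l (pd k (B k)) u = pd l (\<lambda>v. - (\<Sum>m\<in>UNIV. \<beta> k m v * B m v)) u"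
    by (rule pd_cong [OF open_U u]) (rule pd_B_diag)
  also have "\<dots> = - (\<Sum>m\<in>UNIV. pd l (\<beta> k m) u * B m u + \<beta> k m u * pd l (B m) u)"
    by (simp add: pd_minus pd_sum pd_mult holo_fun_sum holo_fun_mult holo_\<beta> holo_B u)
  also have "(\<Sum>m\<in>UNIV. pd l (\<beta> k m) u * B m u + \<beta> k m u * pd l (B m) u) =
      (pd l (\<beta> k l) u * B l u - \<beta> k l u * (\<beta> l k u * B k u + (\<Sum>m\<in>?R. \<beta> l m u * B m u))) +
      (\<Sum>m\<in>?R. pd l (\<beta> k m) u * B m u + \<beta> k m u * pd l (B m) u)"
  proof -
    have "pd l (\<beta> k k) u = 0"
      using pd_cong [OF open_U u, of "\<beta> k k" "\<lambda>_. 0" l] by simp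
    moreover have "pd l (B l) u = - (\<beta> l k u * B k u + (\<Sum>m\<in>?R. \<beta> l m u * B m u))"
      unfolding pd_B_diag [OF u] sum_split2 [OF d] by simp
    ultimately show ?thesis
      unfolding sum_split2 [OF d, of "\<lambda>m. pd l (\<beta> k m) u * B m u + \<beta> k m u * pd l (B m) u"] by simp (simp add: algebra_simps)
  qed
  also have "(\<Sum>m\<in>?R. pd l (\<beta> k m) u * B m u + \<beta> k m u * pd l (B m) u) =
      (\<Sum>m\<in>?R. \<beta> k l u * (\<beta> l m u * B m u) - ginv k l u * h l u * a k u * (B m u * B m u) + B l u * (\<beta> k m u * \<beta> l m u))"
    by (rule sum.cong) (use d in \<open>auto simp: pd_\<beta> [OF u] pd_B [OF u] algebra_simps\<close>)
  also have "\<dots> = \<beta> k l u * (\<Sum>m\<in>?R. \<beta> l m u * B m u) - ginv k l u * h l u * a k u * (\<Sum>m\<in>?R. B m u * B m u) +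
      B l u * (\<Sum>m\<in>?R. \<beta> k m u * \<beta> l m u)"
    by (simp only: sum.distrib sum_subtractf sum_distrib_left)
  finally have L: "pd l (pd k (B k)) u = - (pd l (\<beta> k l) u * B l u - \<beta> k l u * (\<beta> l k u * B k u + (\<Sum>m\<in>?R. \<beta> l m u * B m u)) +
      (\<beta> k l u * (\<Sum>m\<in>?R. \<beta> l m u * B m u) - ginv k l u * h l u * a k u * (\<Sum>m\<in>?R. B m u * B m u) +
      B l u * (\<Sum>m\<in>?R. \<beta> k m u * \<beta> l m u)))" .
  have "pd l (pd k (B k)) u = pd k (pd l (B k)) u" by (rule pd_commute [OF open_U holo_B u])
  also have "\<dots> = pd k (\<lambda>v. \<beta> l k v * B l v) u"
    by (rule pd_cong [OF open_U u]) (rule pd_B [OF _ d [symmetric]])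
  also have "\<dots> = pd k (\<beta> l k) u * B l u + \<beta> l k u * (\<beta> k l u * B k u)"
    by (simp add: pd_mult [OF holo_\<beta> holo_B u] pd_B [OF u d])
  finally have "B l u * (pd l (\<beta> k l) u + pd k (\<beta> l k) u + (\<Sum>m\<in>?R. \<beta> k m u * \<beta> l m u)) =
      B l u * (ginv k l u * a k u * a l u * (\<Sum>m\<in>?R. B m u * B m u))"
    unfolding L by (simp add: h_B [OF u, of l] algebra_simps)
  then show ?thesis using B_nz [OF u, of l] by simp
qed

text \<open>By \<open>aWW\<close> below this is \<open>a k\<close> times the product of
  \<open>W k\<close> and \<open>W l\<close>: the Gram matrix of the \<open>W l\<close> is the
  identity plus the matrix of the \<open>B k * B l\<close>.\<close>

definition C :: "'a \<Rightarrow> 'a \<Rightarrow> complex^'a \<Rightarrow> complex" where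
  "C k l u = (if l = k then a k u else 0) + h k u * B l u"

text \<open>\<open>Inl A\<close> indexes the columns of \<open>P\<close>, \<open>Inr l\<close> the vectors \<open>W\<^sub>l\<close>, one component at a time.\<close>

definition Om :: "'a \<Rightarrow> 'b + 'a \<Rightarrow> 'b + 'a \<Rightarrow> complex^'a \<Rightarrow> complex" where
  "Om k X Y u = (case X of
     Inl A \<Rightarrow> (case Y of Inl D \<Rightarrow> h k u * (N0 u $ A * S k u $ D - S k u $ A * N0 u $ D)
       | Inr m \<Rightarrow> S k u $ A * C k m u)
   | Inr l \<Rightarrow> (case Y of Inl D \<Rightarrow> - (C k l u * S k u $ D)
       | Inr m \<Rightarrow> (if m = k then \<beta> k l u else 0) - (if l = k then \<beta> k m u else 0)))"

lemma Om_antisym: "Om k X Y u = - Om k Y X u"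
  by (simp add: Om_def algebra_simps split: sum.split)

lemma holo_Om: "holo_fun U (Om k X Y)"
proof -
  have c: "holo_fun U (C k l)" for l
    unfolding C_def by (cases "l = k") (simp_all add: holo_fun_add holo_fun_mult holo_a holo_h holo_B holo_fun_const)
  have b: "holo_fun U (\<lambda>u. (if m = k then \<beta> k l u else 0) - (if l = k then \<beta> k m u else 0))" for l m
    by (cases "m = k"; cases "l = k") (simp_all add: holo_fun_diff holo_fun_minus holo_\<beta> holo_fun_const)
  show ?thesis
    unfolding Om_def
    by (cases X; cases Y; simp add: b)
      (intro holo_fun_minus holo_fun_mult holo_fun_diff holo_h holo_map_nth holo_N0 holo_S c)+
qed

text \<open>A solution \<open>F\<close> is one coordinate of the frame. \<open>Pv F\<close> is then
  a row of \<open>P\<close>, and \<open>Q F k\<close>, \<open>M F\<close>, \<open>E F\<close> are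
  the corresponding coordinates of \<open>P (S k)\<close>, of \<open>P N0\<close> and of the
  combination of the \<open>W l\<close> with coefficients \<open>B l\<close>; \<open>hb\<close>
  collects the \<open>W\<close> terms of the equation for \<open>P\<close>.\<close>

definition Pv :: "('b + 'a \<Rightarrow> complex^'a \<Rightarrow> complex) \<Rightarrow> complex^'a \<Rightarrow> complex^'b" where
  "Pv F u = (\<chi> A. F (Inl A) u)"
definition Q :: "('b + 'a \<Rightarrow> complex^'a \<Rightarrow> complex) \<Rightarrow> 'a \<Rightarrow> complex^'a \<Rightarrow> complex" where
  "Q F k u = bil (S k u) (Pv F u)"
definition M :: "('b + 'a \<Rightarrow> complex^'a \<Rightarrow> complex) \<Rightarrow> complex^'a \<Rightarrow> complex" where
  "M F u = bil (N0 u) (Pv F u)"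
definition E :: "('b + 'a \<Rightarrow> complex^'a \<Rightarrow> complex) \<Rightarrow> complex^'a \<Rightarrow> complex" where
  "E F u = (\<Sum>l\<in>UNIV. B l u * F (Inr l) u)"
definition hb :: "('b + 'a \<Rightarrow> complex^'a \<Rightarrow> complex) \<Rightarrow> 'a \<Rightarrow> complex^'a \<Rightarrow> complex" where
  "hb F k u = a k u * (F (Inr k) u + B k u * E F u)"

lemma Om_Inl:
  assumes "u \<in> U"
  shows "(\<Sum>Y\<in>UNIV. Om k (Inl A) Y u * F Y u) =
    h k u * (N0 u $ A * Q F k u - S k u $ A * M F u) + S k u $ A * hb F k u"
proof -
  have "(\<Sum>D\<in>UNIV. Om k (Inl A) (Inl D) u * F (Inl D) u) = h k u * (N0 u $ A * Q F k u - S k u $ A * M F u)"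
    by (simp add: Om_def Q_def M_def bil_def Pv_def sum_distrib_left sum_subtractf algebra_simps)
  moreover have "(\<Sum>m\<in>UNIV. Om k (Inl A) (Inr m) u * F (Inr m) u) = S k u $ A * hb F k u"
  proof -
    have "(\<Sum>m\<in>UNIV. Om k (Inl A) (Inr m) u * F (Inr m) u) =
        S k u $ A * (\<Sum>m\<in>UNIV. C k m u * F (Inr m) u)"
      by (simp add: Om_def sum_distrib_left mult.assoc)
    also have "(\<Sum>m\<in>UNIV. C k m u * F (Inr m) u) = a k u * F (Inr k) u + h k u * E F u"
      by (simp add: C_def E_def distrib_right sum.distrib mult.assoc sum_distrib_left)
    finally show ?thesis by (simp add: hb_def h_B [OF assms] algebra_simps)
  qed
  ultimately show ?thesis by (simp add: sum_UNIV_sum_type)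
qed

lemma Om_Inr:
  "(\<Sum>Y\<in>UNIV. Om k (Inr l) Y u * F Y u) =
    - (C k l u * Q F k u) + \<beta> k l u * F (Inr k) u - (if l = k then (\<Sum>m\<in>UNIV. \<beta> k m u * F (Inr m) u) else 0)"
proof -
  have "(\<Sum>D\<in>UNIV. Om k (Inr l) (Inl D) u * F (Inl D) u) = - (C k l u * Q F k u)"
    by (simp add: Om_def Q_def bil_def Pv_def sum_distrib_left sum_negf mult.assoc)
  moreover have "(\<Sum>m\<in>UNIV. Om k (Inr l) (Inr m) u * F (Inr m) u) =
      \<beta> k l u * F (Inr k) u - (if l = k then (\<Sum>m\<in>UNIV. \<beta> k m u * F (Inr m) u) else 0)"
    by (simp add: Om_def left_diff_distrib sum_subtractf)
  ultimately show ?thesis by (simp add: sum_UNIV_sum_type)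
qed

text \<open>The system is assumed at \<open>u\<close> only, which is the form of the integrability hypothesis of \<open>linear_pfaffian_exists\<close>.\<close>

lemma
  assumes u: "u \<in> U" and F: "\<And>X. holo_fun U (F X)"
    and pdF: "\<And>k X. pd k (F X) u = (\<Sum>Y\<in>UNIV. Om k X Y u * F Y u)"
  shows vpd_Pv: "vpd k (Pv F) u = (h k u * Q F k u) *s N0 u + (hb F k u - h k u * M F u) *s S k u"
    and pd_M: "pd k (M F) u = 0"
    and pd_Q: "k \<noteq> l \<Longrightarrow> pd l (Q F k) u = ginv k l u * hb F l u - p k l u * Q F k u - r k l u * Q F l u"
    and pd_E: "pd k (E F) u = 0"
    and pd_W: "k \<noteq> l \<Longrightarrow> pd l (F (Inr k)) u = \<beta> l k u * F (Inr l) u - h l u * B k u * Q F l u"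
    and pd_W_diag: "pd k (F (Inr k)) u = - ((a k u + h k u * B k u) * Q F k u) - (\<Sum>m\<in>UNIV. \<beta> k m u * F (Inr m) u)"
    and pd_hb: "k \<noteq> l \<Longrightarrow> pd l (hb F k) u = p k l u * hb F k u - r l k u * hb F l u - h k u * h l u * Q F l u"
proof -
  have holo_Pv: "holo_map U (Pv F)" unfolding holo_map_def Pv_def by (simp add: F)
  show P: "vpd k (Pv F) u = (h k u * Q F k u) *s N0 u + (hb F k u - h k u * M F u) *s S k u" for k
    unfolding vec_eq_iff vpd_nth by (simp add: Pv_def pdF Om_Inl [OF u]) (simp add: algebra_simps)
  have "pd k (M F) u = bil (vpd k N0 u) (Pv F u) + bil (N0 u) (vpd k (Pv F) u)" for k
    unfolding M_def by (rule pd_bil [OF holo_N0 holo_Pv u])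
  then show "pd k (M F) u = 0" for k
    by (simp add: P vpd_N0 [OF u] bil_add bil_diff N0_N0 [OF u] S_N0 [OF u] Q_def)
  show "pd l (Q F k) u = ginv k l u * hb F l u - p k l u * Q F k u - r k l u * Q F l u" if kl: "k \<noteq> l"
  proof -
    have "pd l (Q F k) u = bil (vpd l (S k) u) (Pv F u) + bil (S k u) (vpd l (Pv F) u)"
      unfolding Q_def by (rule pd_bil [OF holo_S holo_Pv u])
    then show ?thesis
      by (simp add: P vpd_S [OF u kl] bil_add bil_diff S_N0 [OF u] ginv_def [symmetric])
        (simp add: Q_def M_def algebra_simps)
  qed
  show W: "pd l (F (Inr k)) u = \<beta> l k u * F (Inr l) u - h l u * B k u * Q F l u" if "k \<noteq> l" for k l
    using that by (simp add: pdF Om_Inr C_def)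
  show Wd: "pd k (F (Inr k)) u = - ((a k u + h k u * B k u) * Q F k u) - (\<Sum>m\<in>UNIV. \<beta> k m u * F (Inr m) u)" for k
    by (simp add: pdF Om_Inr C_def)
  show E: "pd k (E F) u = 0" for k
  proof -
    have "pd k (E F) u = (\<Sum>m\<in>UNIV. pd k (B m) u * F (Inr m) u + B m u * pd k (F (Inr m)) u)"
      unfolding E_def by (simp add: pd_sum pd_mult holo_fun_mult holo_B F u)
    also have "\<dots> = (pd k (B k) u * F (Inr k) u + B k u * pd k (F (Inr k)) u) +
        (\<Sum>m\<in>UNIV - {k}. pd k (B m) u * F (Inr m) u + B m u * pd k (F (Inr m)) u)"
      by (simp add: sum.remove)
    \<comment> \<open>The rotation terms will cancel against those in \<open>pd k (B k)\<close> and
      \<open>pd k (F (Inr k))\<close>, and the rest cancels because \<open>sum_B\<close> has the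
      value \<open>- 1\<close>.\<close>
    also have "(\<Sum>m\<in>UNIV - {k}. pd k (B m) u * F (Inr m) u + B m u * pd k (F (Inr m)) u) =
        (\<Sum>m\<in>UNIV - {k}. B k u * (\<beta> k m u * F (Inr m) u) + F (Inr k) u * (\<beta> k m u * B m u) - h k u * Q F k u * (B m u * B m u))"
      by (rule sum.cong) (auto simp: pd_B [OF u] W algebra_simps)
    also have "\<dots> = B k u * (\<Sum>m\<in>UNIV. \<beta> k m u * F (Inr m) u) + F (Inr k) u * (\<Sum>m\<in>UNIV. \<beta> k m u * B m u)
        - h k u * Q F k u * ((\<Sum>m\<in>UNIV. B m u * B m u) - B k u * B k u)"
      by (simp add: sum.distrib sum_subtractf sum_distrib_left [symmetric] sum.remove [of UNIV k "\<lambda>m. \<beta> k m u * _ m"]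
          sum.remove [of UNIV k "\<lambda>m. B m u * B m u"])
    finally show ?thesis
      by (simp add: pd_B_diag [OF u] Wd sum_B [OF u] h_B [OF u] algebra_simps)
  qed
  show "pd l (hb F k) u = p k l u * hb F k u - r l k u * hb F l u - h k u * h l u * Q F l u" if kl: "k \<noteq> l"
  proof -
    have hE: "holo_fun U (E F)" unfolding E_def by (intro holo_fun_sum holo_fun_mult holo_B F)
    have "pd l (hb F k) u = pd l (a k) u * (F (Inr k) u + B k u * E F u) +
        a k u * (pd l (F (Inr k)) u + pd l (B k) u * E F u)"
      unfolding hb_def by (simp add: pd_add pd_mult holo_fun_add holo_fun_mult holo_a holo_B hE F u E)
    also have "\<dots> = p k l u * hb F k u + (a k u * \<beta> l k u) * (F (Inr l) u + B l u * E F u) - a k u * B k u * h l u * Q F l u"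
      using kl by (simp add: pd_a [OF u kl] W [OF kl] pd_B [OF u kl [symmetric]] hb_def algebra_simps)
    finally show ?thesis
      unfolding \<beta>_a [OF u kl [symmetric]] by (simp add: hb_def h_B [OF u, of k] algebra_simps)
  qed
qed

lemma pd_nth_N0: "u \<in> U \<Longrightarrow> pd l (\<lambda>v. N0 v $ A) u = - (h l u * S l u $ A)"
  using vpd_N0 [of u l] by (simp add: vec_eq_iff vpd_nth)

lemma pd_nth_S: "u \<in> U \<Longrightarrow> k \<noteq> l \<Longrightarrow>
    pd l (\<lambda>v. S k v $ A) u = h l u * ginv k l u * N0 u $ A - p k l u * S k u $ A - r k l u * S l u $ A"
  using vpd_S [of u k l] by (simp add: vec_eq_iff vpd_nth)

text \<open>The rows of \<open>P\<close> need the Codazzi equation and the derivatives of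
  \<open>S\<close>, \<open>Q\<close> and \<open>hb\<close>. The rows of \<open>W\<close> need
  \<open>pd_\<beta>\<close> when \<open>m\<close> is a third index, and
  \<open>pd_\<beta>_sym\<close> when \<open>m\<close> is \<open>k\<close> or
  \<open>l\<close>.\<close>

lemma integrable_system:
  assumes u: "u \<in> U" and F: "\<And>X. holo_fun U (F X)"
    and pdF: "\<And>k X. pd k (F X) u = (\<Sum>Y\<in>UNIV. Om k X Y u * F Y u)"
  shows "pd l (\<lambda>v. \<Sum>Y\<in>UNIV. Om k X Y v * F Y v) u = pd k (\<lambda>v. \<Sum>Y\<in>UNIV. Om l X Y v * F Y v) u"
proof (cases "k = l")
  case True then show ?thesis by simp
next
  case kl: False
  have hP: "holo_map U (Pv F)" unfolding holo_map_def Pv_def by (simp add: F)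
  have hQ: "holo_fun U (Q F k)" for k unfolding Q_def by (intro holo_fun_bil holo_S hP)
  have hM: "holo_fun U (M F)" unfolding M_def by (intro holo_fun_bil holo_N0 hP)
  have hE: "holo_fun U (E F)" unfolding E_def by (intro holo_fun_sum holo_fun_mult holo_B F)
  have hhb: "holo_fun U (hb F k)" for k unfolding hb_def by (intro holo_fun_mult holo_fun_add holo_a holo_B hE F)
  have hSn: "holo_fun U (\<lambda>v. S k v $ A)" and hNn: "holo_fun U (\<lambda>v. N0 v $ A)" for k A
    by (rule holo_map_nth [OF holo_S], rule holo_map_nth [OF holo_N0])
  note holo = hQ hM hE hhb hSn hNn holo_fun_mult holo_fun_add holo_fun_diff holo_fun_minus holo_fun_sum
    holo_h holo_a holo_B holo_\<beta> F holo_fun_const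
  note pds = pd_add pd_diff pd_mult pd_minus pd_sum
  note sys = pd_M [OF u F pdF] pd_Q [OF u F pdF] pd_hb [OF u F pdF] pd_W [OF u F pdF] pd_W_diag [OF u F pdF]
  show ?thesis
  proof (cases X)
    case (Inl A)
    have D: "pd l (\<lambda>v. \<Sum>Y\<in>UNIV. Om k X Y v * F Y v) u =
        pd l (h k) u * (N0 u $ A * Q F k u - S k u $ A * M F u) +
        h k u * (- (h l u * S l u $ A) * Q F k u + N0 u $ A * pd l (Q F k) u - pd l (\<lambda>v. S k v $ A) u * M F u) +
        (pd l (\<lambda>v. S k v $ A) u * hb F k u + S k u $ A * pd l (hb F k) u)" for k l
    proof -
      have "pd l (\<lambda>v. \<Sum>Y\<in>UNIV. Om k X Y v * F Y v) u =
          pd l (\<lambda>v. h k v * (N0 v $ A * Q F k v - S k v $ A * M F v) + S k v $ A * hb F k v) u"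
        unfolding Inl by (rule pd_cong [OF open_U u]) (rule Om_Inl)
      then show ?thesis by (simp add: pds holo u sys(1) pd_nth_N0 [OF u])
    qed
    show ?thesis
      unfolding D sys(2) [OF kl] sys(2) [OF kl [symmetric]] sys(3) [OF kl] sys(3) [OF kl [symmetric]]
        pd_nth_S [OF u kl] pd_nth_S [OF u kl [symmetric]] pd_h [OF u kl] pd_h [OF u kl [symmetric]] ginv_sym [of l k]
      by algebra
  next
    case (Inr m)
    let ?e = "\<lambda>k m v. - (C k m v * Q F k v) + \<beta> k m v * F (Inr k) v - (if m = k then (\<Sum>j\<in>UNIV. \<beta> k j v * F (Inr j) v) else 0)"
    have e_off: "pd l (?e k m) u = - ((pd l (h k) u * B m u + h k u * pd l (B m) u) * Q F k u) - h k u * B m u * pd l (Q F k) u +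
        pd l (\<beta> k m) u * F (Inr k) u + \<beta> k m u * pd l (F (Inr k)) u" if "m \<noteq> k" for k l m
      using that by (simp add: C_def pds holo u algebra_simps)
    have diag: "pd l (?e k k) u = pd k (?e l k) u" if kl: "k \<noteq> l" for k l
    proof -
      let ?R = "UNIV - {k, l}"
      define \<kappa> \<tau> Z \<omega> b2 where "\<kappa> = (\<Sum>m\<in>?R. \<beta> k m u * \<beta> l m u)" and "\<tau> = (\<Sum>m\<in>?R. \<beta> k m u * B m u)"
        and "Z = (\<Sum>m\<in>?R. B m u * F (Inr m) u)" and "\<omega> = (\<Sum>m\<in>?R. \<beta> l m u * F (Inr m) u)"
        and "b2 = (\<Sum>m\<in>?R. B m u * B m u)"
      have \<beta>0: "pd l (\<beta> k k) u = 0" using pd_cong [OF open_U u, of "\<beta> k k" "\<lambda>_. 0" l] by simp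
      have "pd l (?e k k) u = - ((pd l (a k) u + (pd l (h k) u * B k u + h k u * pd l (B k) u)) * Q F k u) -
          (a k u + h k u * B k u) * pd l (Q F k) u - (\<Sum>m\<in>UNIV. pd l (\<beta> k m) u * F (Inr m) u + \<beta> k m u * pd l (F (Inr m)) u)"
      proof -
        have "pd l (?e k k) u = pd l (\<lambda>v. - ((a k v + h k v * B k v) * Q F k v) - (\<Sum>j\<in>UNIV. \<beta> k j v * F (Inr j) v)) u"
          by (rule arg_cong [where f = "\<lambda>f. pd l f u"]) (simp add: C_def fun_eq_iff)
        then show ?thesis by (simp add: pds holo u)
      qed
      also have "(\<Sum>m\<in>UNIV. pd l (\<beta> k m) u * F (Inr m) u + \<beta> k m u * pd l (F (Inr m)) u) =
          pd l (\<beta> k l) u * F (Inr l) u + \<beta> k l u * pd l (F (Inr l)) u +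
          (\<Sum>m\<in>?R. pd l (\<beta> k m) u * F (Inr m) u + \<beta> k m u * pd l (F (Inr m)) u)"
        unfolding sum_split2 [OF kl, of "\<lambda>m. pd l (\<beta> k m) u * F (Inr m) u + \<beta> k m u * pd l (F (Inr m)) u"] by (simp add: \<beta>0)
      also have "(\<Sum>m\<in>?R. pd l (\<beta> k m) u * F (Inr m) u + \<beta> k m u * pd l (F (Inr m)) u) =
          (\<Sum>m\<in>?R. \<beta> k l u * (\<beta> l m u * F (Inr m) u) - ginv k l u * h l u * a k u * (B m u * F (Inr m) u) +
            F (Inr l) u * (\<beta> k m u * \<beta> l m u) - h l u * Q F l u * (\<beta> k m u * B m u))"
        by (rule sum.cong) (use kl in \<open>auto simp: pd_\<beta> [OF u] sys(4) algebra_simps\<close>)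
      also have "\<dots> = \<beta> k l u * \<omega> - ginv k l u * h l u * a k u * Z + F (Inr l) u * \<kappa> - h l u * Q F l u * \<tau>"
        by (simp only: sum.distrib sum_subtractf sum_distrib_left [symmetric] \<kappa>_def \<tau>_def Z_def \<omega>_def)
      finally have A1: "pd l (?e k k) u = - ((a k u * p k l u + ((p k l u * h k u - r l k u * h l u) * B k u + h k u * (\<beta> l k u * B l u))) * Q F k u) -
          (a k u + h k u * B k u) * (ginv k l u * hb F l u - p k l u * Q F k u - r k l u * Q F l u) -
          (pd l (\<beta> k l) u * F (Inr l) u + \<beta> k l u * pd l (F (Inr l)) u +
          (\<beta> k l u * \<omega> - ginv k l u * h l u * a k u * Z + F (Inr l) u * \<kappa> - h l u * Q F l u * \<tau>))"
        by (simp only: pd_a [OF u kl] pd_h [OF u kl] pd_B [OF u kl [symmetric]] sys(2) [OF kl])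
      have W: "pd l (F (Inr l)) u = - ((a l u + h l u * B l u) * Q F l u) - (\<beta> l k u * F (Inr k) u + \<omega>)"
        unfolding sys(5) sum_split2 [OF kl] \<omega>_def by simp
      have A2: "pd k (?e l k) u = - (((p l k u * h l u - r k l u * h k u) * B k u - h l u * (\<beta> k l u * B l u + \<tau>)) * Q F l u) -
          h l u * B k u * (ginv k l u * hb F k u - p l k u * Q F l u - r l k u * Q F k u) +
          pd k (\<beta> l k) u * F (Inr l) u + \<beta> l k u * (\<beta> k l u * F (Inr k) u - h k u * B l u * Q F k u)"
      proof -
        have "pd k (B k) u = - (\<beta> k l u * B l u + \<tau>)"
          unfolding pd_B_diag [OF u] sum_split2 [OF kl] \<tau>_def by simp
        then show ?thesis
          unfolding e_off [OF kl] by (simp add: pd_h [OF u kl [symmetric]] sys(2) [OF kl [symmetric]] sys(4) [OF kl [symmetric]] ginv_sym [of l k])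
            (simp add: algebra_simps)
      qed
      have S: "pd l (\<beta> k l) u + pd k (\<beta> l k) u + \<kappa> = ginv k l u * a k u * a l u * b2"
        unfolding \<kappa>_def b2_def by (rule pd_\<beta>_sym [OF u kl])
      have b: "B k u * B k u + B l u * B l u + b2 = - 1"
        using sum_B [OF u] unfolding sum_split2 [OF kl] b2_def .
      have e: "E F u = B k u * F (Inr k) u + B l u * F (Inr l) u + Z"
        unfolding E_def sum_split2 [OF kl] Z_def ..
      have ra: "a l u * \<beta> k l u = - (r k l u * a k u)" by (rule \<beta>_a [OF u kl])
      \<comment> \<open>Everything else cancels identically. The first group vanishes by
        \<open>\<beta>_a\<close>; the other two cancel each other by \<open>pd_\<beta>_sym\<close>
        and \<open>sum_B\<close>.\<close>
      have "pd l (?e k k) u - pd k (?e l k) u =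
          (a l u * \<beta> k l u + r k l u * a k u) * Q F l u
          - (pd l (\<beta> k l) u + pd k (\<beta> l k) u + \<kappa>) * F (Inr l) u
          - ginv k l u * a k u * a l u * (1 + B k u * B k u + B l u * B l u) * F (Inr l) u"
        unfolding A1 A2 W hb_def e h_B [OF u] by algebra
      also have "\<dots> = 0" unfolding S ra using b by algebra
      finally show ?thesis by simp
    qed
    have ee: "pd l (\<lambda>v. \<Sum>Y\<in>UNIV. Om k X Y v * F Y v) u = pd l (?e k m) u" for k l
      unfolding Inr Om_Inr ..
    show ?thesis
    proof (cases "m = k \<or> m = l")
      case True
      then show ?thesis unfolding ee using diag [OF kl] diag [OF kl [symmetric]] by auto
    next
      case False
      then have mk: "m \<noteq> k" "m \<noteq> l" by auto
      have g: "pd l (\<beta> k m) u = \<beta> l m u * \<beta> k l u - B m u * ginv k l u * h l u * a k u"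
        "pd k (\<beta> l m) u = \<beta> k m u * \<beta> l k u - B m u * ginv k l u * h k u * a l u"
        using pd_\<beta> [OF u, of k l m] pd_\<beta> [OF u, of l k m] kl mk ginv_sym [of l k u] by auto
      show ?thesis
        unfolding ee e_off [OF mk(1)] e_off [OF mk(2)] g pd_h [OF u kl] pd_h [OF u kl [symmetric]]
          pd_B [OF u mk(1) [symmetric]] pd_B [OF u mk(2) [symmetric]] sys(2) [OF kl] sys(2) [OF kl [symmetric]]
          sys(4) [OF kl] sys(4) [OF kl [symmetric]] ginv_sym [of l k] hb_def
        unfolding h_B [OF u] by algebra
    qed
  qed
qed

end

section \<open>Existence of deformations\<close>

context net_solution
begin

lemma solution_inner_const:
  assumes cv: "convex U" "u0 \<in> U" "u \<in> U"
    and F: "\<And>X. holo_fun U (F X)" "\<And>k X u. u \<in> U \<Longrightarrow> pd k (F X) u = (\<Sum>Y\<in>UNIV. Om k X Y u * F Y u)"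
    and G: "\<And>X. holo_fun U (G X)" "\<And>k X u. u \<in> U \<Longrightarrow> pd k (G X) u = (\<Sum>Y\<in>UNIV. Om k X Y u * G Y u)"
  shows "(\<Sum>X\<in>UNIV. F X u * G X u) = (\<Sum>X\<in>UNIV. F X u0 * G X u0)"
proof (rule pd_zero_imp_const [OF open_U cv])
  show "holo_fun U (\<lambda>u. \<Sum>X\<in>UNIV. F X u * G X u)" by (intro holo_fun_sum holo_fun_mult F G)
  fix k u assume u: "u \<in> U"
  have "pd k (\<lambda>u. \<Sum>X\<in>UNIV. F X u * G X u) u = (\<Sum>X\<in>UNIV. pd k (F X) u * G X u + F X u * pd k (G X) u)"
    by (simp add: pd_sum pd_mult holo_fun_mult F(1) G(1) u)
  also have "\<dots> = (\<Sum>X\<in>UNIV. \<Sum>Y\<in>UNIV. Om k X Y u * F Y u * G X u) + (\<Sum>X\<in>UNIV. \<Sum>Y\<in>UNIV. Om k X Y u * F X u * G Y u)"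
    by (simp add: F(2) G(2) u sum.distrib sum_distrib_left sum_distrib_right mult_ac)
  also have "(\<Sum>X\<in>UNIV. \<Sum>Y\<in>UNIV. Om k X Y u * F X u * G Y u) = (\<Sum>Y\<in>UNIV. \<Sum>X\<in>UNIV. Om k X Y u * F X u * G Y u)"
    by (rule sum.swap)
  also have "\<dots> = (\<Sum>Y\<in>UNIV. \<Sum>X\<in>UNIV. - (Om k Y X u * F X u * G Y u))"
    by (intro sum.cong refl) (subst Om_antisym, simp)
  finally show "pd k (\<lambda>u. \<Sum>X\<in>UNIV. F X u * G X u) u = 0" by (simp add: sum_negf)
qed

lemma holo_Pv: "(\<And>X. holo_fun U (F X)) \<Longrightarrow> holo_map U (Pv F)"
  unfolding holo_map_def Pv_def by simp

lemma orthogonal_frame_exists: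
  fixes c0 :: "'b + 'a \<Rightarrow> 'b + 'a \<Rightarrow> complex"
  assumes cv: "convex U" "u0 \<in> U" and c0: "\<And>c c'. (\<Sum>X\<in>UNIV. c0 c X * c0 c' X) = (if c = c' then 1 else 0)"
  shows "\<exists>F. (\<forall>c X. holo_fun U (F c X) \<and> F c X u0 = c0 c X) \<and>
    (\<forall>c. \<forall>u\<in>U. \<forall>k X. pd k (F c X) u = (\<Sum>Y\<in>UNIV. Om k X Y u * F c Y u)) \<and>
    (\<forall>u\<in>U. \<forall>X Y. (\<Sum>c\<in>UNIV. F c X u * F c Y u) = (if X = Y then 1 else 0))"
proof -
  have "\<forall>c. \<exists>F. (\<forall>X. holo_fun U (F X) \<and> F X u0 = c0 c X) \<and>
    (\<forall>u\<in>U. \<forall>k X. pd k (F X) u = (\<Sum>Y\<in>UNIV. Om k X Y u * F Y u))"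
    by (intro allI linear_pfaffian_exists [where Om = Om, OF open_U cv holo_Om])
      (rule integrable_system)
  from choice [OF this] obtain F where F: "\<forall>c. (\<forall>X. holo_fun U (F c X) \<and> F c X u0 = c0 c X) \<and>
    (\<forall>u\<in>U. \<forall>k X. pd k (F c X) u = (\<Sum>Y\<in>UNIV. Om k X Y u * F c Y u))" ..
  have hF: "holo_fun U (F c X)" and F0: "F c X u0 = c0 c X" for c X using F by simp_all
  have pdF: "pd k (F c X) u = (\<Sum>Y\<in>UNIV. Om k X Y u * F c Y u)" if "u \<in> U" for k c X u
    using F that by simp
  have "(\<Sum>c\<in>UNIV. F c X u * F c Y u) = (if X = Y then 1 else 0)" if u: "u \<in> U" for u X Y
  proof -
    \<comment> \<open>The conserved products are those of different solutions, the rows of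
      \<open>A\<close>; since \<open>A\<close> is square, its columns are orthonormal as
      well.\<close>
    define A where "A = (\<chi> c X. F c X u)"
    have "(\<Sum>X\<in>UNIV. F c X u * F c' X u) = (if c = c' then 1 else 0)" for c c'
      using solution_inner_const [OF cv u, of "F c" "F c'", OF hF pdF hF pdF] by (simp add: F0 c0)
    then have "A ** transpose A = mat 1"
      by (simp add: A_def matrix_matrix_mult_def transpose_def mat_def vec_eq_iff)
    then have "transpose A ** A = mat 1" using matrix_left_right_inverse by blast
    then have "(transpose A ** A) $ X $ Y = mat 1 $ X $ Y" by simp
    then show ?thesis by (simp add: A_def matrix_matrix_mult_def transpose_def mat_def)
  qed
  then show ?thesis using F by (intro exI [of _ F]) simp
qed

theorem deformation_exists:
  assumes cv: "convex U" "u0 \<in> U" and card: "CARD('c::finite) + 1 = CARD('a)"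
  shows "\<exists>y :: complex^'a \<Rightarrow> complex^('a + 'c). holo_map U y \<and>
    (\<forall>u\<in>U. \<forall>j k. bil (vpd j y u) (vpd k y u) = bil (vpd j x0 u) (vpd k x0 u)) \<and>
    (\<forall>u\<in>U. \<forall>j k. j \<noteq> k \<longrightarrow> vpd j (vpd k y) u = p j k u *s vpd j y u + p k j u *s vpd k y u) \<and>
    (\<forall>u\<in>U. \<forall>j. bil (vpd j (vpd j y) u) (vpd j (vpd j y) u) =
      bil (vpd j (vpd j x0) u) (vpd j (vpd j x0) u) + (a j u)\<^sup>2)"
proof -
  obtain i0 :: 'b where True by simp
  obtain j0 :: 'a where True by simp
  obtain Q1 \<epsilon>1 where Q1: "orthogonal_matrix Q1" "\<epsilon>1 \<in> {1, -1}" "Q1 *v N0 u0 = \<epsilon>1 *s axis i0 1"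
    using reflect_to_axis [OF N0_N0 [OF cv(2)], of i0] by blast
  \<comment> \<open>The factor \<open>\<i>\<close> makes this a unit vector, because
    \<open>sum_B\<close> has the value \<open>- 1\<close>.\<close>
  define w :: "complex^'a" where "w = (\<chi> j. \<i> * B j u0)"
  have "bil w w = 1"
  proof -
    have "bil w w = - (\<Sum>m\<in>UNIV. B m u0 * B m u0)"
      by (simp add: bil_def w_def sum_negf [symmetric] algebra_simps)
    then show ?thesis by (simp add: sum_B [OF cv(2)])
  qed
  then obtain Q2 \<epsilon>2 where Q2: "orthogonal_matrix Q2" "\<epsilon>2 \<in> {1, -1}" "Q2 *v w = \<epsilon>2 *s axis j0 1"
    using reflect_to_axis [of w j0] by blast
  \<comment> \<open>The initial frame is rotated so that the two constant vectors lie along the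
    coordinates \<open>Inl i0\<close> and \<open>Inr j0\<close>; the projection then just drops
    these coordinates.\<close>
  define c0 :: "'b + 'a \<Rightarrow> 'b + 'a \<Rightarrow> complex" where "c0 = (\<lambda>c X. case c of
      Inl i \<Rightarrow> (case X of Inl A \<Rightarrow> Q1 $ i $ A | Inr l \<Rightarrow> 0)
    | Inr j \<Rightarrow> (case X of Inl A \<Rightarrow> 0 | Inr l \<Rightarrow> Q2 $ j $ l))"
  have QQ: "(\<Sum>A\<in>UNIV. R $ i $ A * R $ i' $ A) = (if i = i' then 1 else 0)"
    if "orthogonal_matrix R" for R :: "complex^'x^'x" and i i'
  proof -
    have "(R ** transpose R) $ i $ i' = mat 1 $ i $ i'" using that by (simp add: orthogonal_matrix_def)
    then show ?thesis by (simp add: matrix_matrix_mult_def transpose_def mat_def)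
  qed
  have "(\<Sum>X\<in>UNIV. c0 c X * c0 c' X) = (if c = c' then 1 else 0)" for c c'
    by (cases c; cases c') (simp_all add: c0_def sum_UNIV_sum_type QQ [OF Q1(1)] QQ [OF Q2(1)])
  from orthogonal_frame_exists [OF cv this] obtain F where
    F: "\<forall>c X. holo_fun U (F c X) \<and> F c X u0 = c0 c X"
    and pdF': "\<forall>c. \<forall>u\<in>U. \<forall>k X. pd k (F c X) u = (\<Sum>Y\<in>UNIV. Om k X Y u * F c Y u)"
    and orth': "\<forall>u\<in>U. \<forall>X Y. (\<Sum>c\<in>UNIV. F c X u * F c Y u) = (if X = Y then 1 else 0)"
    by (elim exE conjE) (rule that)
  have hF: "holo_fun U (F c X)" and F0: "F c X u0 = c0 c X" for c X using F by simp_all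
  have pdF: "pd k (F c X) u = (\<Sum>Y\<in>UNIV. Om k X Y u * F c Y u)" if "u \<in> U" for k c X u
    using pdF' that by simp
  have orth: "(\<Sum>c\<in>UNIV. F c X u * F c Y u) = (if X = Y then 1 else 0)" if "u \<in> U" for u X Y
    using orth' that by simp
  have Mc: "M (F c) u = (if c = Inl i0 then \<epsilon>1 else 0)" if u: "u \<in> U" for c u
  proof -
    have "M (F c) u = M (F c) u0"
    proof (rule pd_zero_imp_const [OF open_U cv u])
      show "holo_fun U (M (F c))" unfolding M_def by (intro holo_fun_bil holo_N0 holo_Pv hF)
      show "pd k (M (F c)) u = 0" if "u \<in> U" for k u by (rule pd_M [OF that hF pdF [OF that]])
    qed
    also have "\<dots> = (case c of Inl i \<Rightarrow> (Q1 *v N0 u0) $ i | Inr j \<Rightarrow> 0)"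
      by (simp add: M_def bil_def Pv_def F0 c0_def matrix_vector_mult_def mult.commute split: sum.split)
    finally show ?thesis unfolding Q1(3) by (simp add: axis_def split: sum.split)
  qed
  have Ec: "E (F c) u = (if c = Inr j0 then - \<i> * \<epsilon>2 else 0)" if u: "u \<in> U" for c u
  proof -
    have "E (F c) u = E (F c) u0"
    proof (rule pd_zero_imp_const [OF open_U cv u])
      show "holo_fun U (E (F c))" unfolding E_def by (intro holo_fun_sum holo_fun_mult holo_B hF)
      show "pd k (E (F c)) u = 0" if "u \<in> U" for k u by (rule pd_E [OF that hF pdF [OF that]])
    qed
    also have "\<dots> = (case c of Inl i \<Rightarrow> 0 | Inr j \<Rightarrow> - \<i> * (Q2 *v w) $ j)"
      by (simp add: E_def F0 c0_def matrix_vector_mult_def w_def sum_distrib_left mult_ac split: sum.split)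
    finally show ?thesis unfolding Q2(3) by (simp add: axis_def split: sum.split)
  qed
  \<comment> \<open>Pairing the constant vector \<open>P N0\<close> with the orthonormal columns
    shows that the dropped coordinate \<open>Inl i0\<close> carries \<open>N0\<close> up to sign.
    The same argument with the \<open>B l\<close> describes \<open>Inr j0\<close>.\<close>
  have dropN: "\<epsilon>1 * F (Inl i0) X u = (case X of Inl A \<Rightarrow> N0 u $ A | Inr l \<Rightarrow> 0)" if u: "u \<in> U" for X u
  proof -
    have "\<epsilon>1 * F (Inl i0) X u = (\<Sum>c\<in>UNIV. M (F c) u * F c X u)"
      by (simp add: Mc [OF u] if_distrib [of "\<lambda>x. x * _"] cong: if_cong)
    also have "\<dots> = (\<Sum>c\<in>UNIV. \<Sum>A\<in>UNIV. N0 u $ A * (F c (Inl A) u * F c X u))"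
      by (simp add: M_def bil_def Pv_def sum_distrib_right mult.assoc)
    also have "\<dots> = (\<Sum>A\<in>UNIV. N0 u $ A * (\<Sum>c\<in>UNIV. F c (Inl A) u * F c X u))"
      by (subst sum.swap) (simp only: sum_distrib_left)
    finally show ?thesis by (simp add: orth [OF u] split: sum.split)
  qed
  have dropB: "- \<i> * \<epsilon>2 * F (Inr j0) X u = (case X of Inl A \<Rightarrow> 0 | Inr l \<Rightarrow> B l u)" if u: "u \<in> U" for X u
  proof -
    have "- \<i> * \<epsilon>2 * F (Inr j0) X u = (\<Sum>c\<in>UNIV. E (F c) u * F c X u)"
      by (simp add: Ec [OF u] if_distrib [of "\<lambda>x. x * _"] cong: if_cong)
    also have "\<dots> = (\<Sum>c\<in>UNIV. \<Sum>l\<in>UNIV. B l u * (F c (Inr l) u * F c X u))"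
      by (simp add: E_def sum_distrib_right mult.assoc)
    also have "\<dots> = (\<Sum>l\<in>UNIV. B l u * (\<Sum>c\<in>UNIV. F c (Inr l) u * F c X u))"
      by (subst sum.swap) (simp only: sum_distrib_left)
    finally show ?thesis by (simp add: orth [OF u] split: sum.split)
  qed
  define K where "K = (UNIV :: ('b + 'a) set) - {Inl i0, Inr j0}"
  have "card K = CARD('b + 'a) - card {Inl i0 :: 'b + 'a, Inr j0}"
    unfolding K_def by (rule card_Diff_subset) auto
  then have "card K = card (UNIV :: ('a + 'c) set)" using card_frame card by simp
  then obtain \<kappa> :: "'a + 'c \<Rightarrow> 'b + 'a" where \<kappa>: "bij_betw \<kappa> UNIV K"
    by (metis finite finite_same_card_bij)
  have \<kappa>K: "\<kappa> i \<noteq> Inl i0" "\<kappa> i \<noteq> Inr j0" for i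
    using bij_betwE [OF \<kappa>] by (auto simp: K_def)
  have kept: "(\<Sum>i\<in>UNIV. F (\<kappa> i) X u * F (\<kappa> i) Y u) = (if X = Y then 1 else 0) -
      F (Inl i0) X u * F (Inl i0) Y u - F (Inr j0) X u * F (Inr j0) Y u" if u: "u \<in> U" for u X Y
  proof -
    have "(\<Sum>i\<in>UNIV. F (\<kappa> i) X u * F (\<kappa> i) Y u) = (\<Sum>c\<in>K. F c X u * F c Y u)"
      by (rule sum.reindex_bij_betw [OF \<kappa>])
    moreover have "(\<Sum>c\<in>UNIV. F c X u * F c Y u) = (\<Sum>c\<in>K. F c X u * F c Y u) + (\<Sum>c\<in>{Inl i0, Inr j0}. F c X u * F c Y u)"
      unfolding K_def by (rule sum.subset_diff) auto
    ultimately show ?thesis by (simp add: orth [OF u])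
  qed
  have \<epsilon>: "\<epsilon>1 * \<epsilon>1 = 1" "\<epsilon>2 * \<epsilon>2 = 1" using Q1(2) Q2(2) by auto
  \<comment> \<open>After the projection \<open>P\<close> preserves products up to the
    \<open>N0\<close> components, so it is isometric on tangent vectors.\<close>
  have PP: "(\<Sum>i\<in>UNIV. bil v (Pv (F (\<kappa> i)) u) * bil z (Pv (F (\<kappa> i)) u)) = bil v z - bil v (N0 u) * bil z (N0 u)"
    if u: "u \<in> U" for u v z
  proof -
    have dB: "F (Inr j0) (Inl A) u = 0" for A
      using dropB [OF u, of "Inl A"] Q2(2) by auto
    have dN: "F (Inl i0) (Inl A) u = \<epsilon>1 * N0 u $ A" for A
    proof -
      have "\<epsilon>1 * (\<epsilon>1 * F (Inl i0) (Inl A) u) = \<epsilon>1 * N0 u $ A" using dropN [OF u, of "Inl A"] by simp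
      then show ?thesis by (simp only: mult.assoc [symmetric] \<epsilon>(1) mult_1)
    qed
    have "(\<Sum>i\<in>UNIV. F (\<kappa> i) (Inl A) u * F (\<kappa> i) (Inl D) u) = (if A = D then 1 else 0) - N0 u $ A * N0 u $ D" for A D
    proof -
      have "\<epsilon>1 * N0 u $ A * (\<epsilon>1 * N0 u $ D) = (\<epsilon>1 * \<epsilon>1) * (N0 u $ A * N0 u $ D)" by (simp only: mult_ac)
      then show ?thesis unfolding kept [OF u] dN dB by (simp add: \<epsilon>(1))
    qed
    moreover have "(\<Sum>i\<in>UNIV. bil v (Pv (F (\<kappa> i)) u) * bil z (Pv (F (\<kappa> i)) u)) =
        (\<Sum>A\<in>UNIV. \<Sum>D\<in>UNIV. v $ A * z $ D * (\<Sum>i\<in>UNIV. F (\<kappa> i) (Inl A) u * F (\<kappa> i) (Inl D) u))"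
    proof -
      have "(\<Sum>i\<in>UNIV. bil v (Pv (F (\<kappa> i)) u) * bil z (Pv (F (\<kappa> i)) u)) =
          (\<Sum>i\<in>UNIV. \<Sum>A\<in>UNIV. \<Sum>D\<in>UNIV. v $ A * z $ D * (F (\<kappa> i) (Inl A) u * F (\<kappa> i) (Inl D) u))"
        by (simp add: bil_def Pv_def sum_product mult_ac)
      also have "\<dots> = (\<Sum>A\<in>UNIV. \<Sum>i\<in>UNIV. \<Sum>D\<in>UNIV. v $ A * z $ D * (F (\<kappa> i) (Inl A) u * F (\<kappa> i) (Inl D) u))"
        by (rule sum.swap)
      also have "\<dots> = (\<Sum>A\<in>UNIV. \<Sum>D\<in>UNIV. \<Sum>i\<in>UNIV. v $ A * z $ D * (F (\<kappa> i) (Inl A) u * F (\<kappa> i) (Inl D) u))"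
        by (rule sum.cong [OF refl], rule sum.swap)
      finally show ?thesis by (simp only: sum_distrib_left)
    qed
    ultimately have "(\<Sum>i\<in>UNIV. bil v (Pv (F (\<kappa> i)) u) * bil z (Pv (F (\<kappa> i)) u)) =
        (\<Sum>A\<in>UNIV. \<Sum>D\<in>UNIV. v $ A * z $ D * ((if A = D then 1 else 0) - N0 u $ A * N0 u $ D))" by simp
    also have "\<dots> = (\<Sum>A\<in>UNIV. \<Sum>D\<in>UNIV. (v $ A * z $ D) * (if A = D then 1 else 0)) -
        (\<Sum>A\<in>UNIV. \<Sum>D\<in>UNIV. (v $ A * N0 u $ A) * (z $ D * N0 u $ D))"
      by (simp only: right_diff_distrib sum_subtractf mult_ac)
    finally show ?thesis by (simp add: bil_def sum_product)
  qed
  have PW: "(\<Sum>i\<in>UNIV. bil v (Pv (F (\<kappa> i)) u) * F (\<kappa> i) (Inr l) u) = 0" if u: "u \<in> U" for u v l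
  proof -
    have dN: "F (Inl i0) (Inr l) u = 0" and dB: "F (Inr j0) (Inl A) u = 0" for A
      using dropN [OF u, of "Inr l"] dropB [OF u, of "Inl A"] Q1(2) Q2(2) by auto
    have z: "(\<Sum>i\<in>UNIV. F (\<kappa> i) (Inl A) u * F (\<kappa> i) (Inr l) u) = 0" for A
      unfolding kept [OF u] dN dB by simp
    have "(\<Sum>i\<in>UNIV. bil v (Pv (F (\<kappa> i)) u) * F (\<kappa> i) (Inr l) u) =
        (\<Sum>i\<in>UNIV. \<Sum>A\<in>UNIV. v $ A * (F (\<kappa> i) (Inl A) u * F (\<kappa> i) (Inr l) u))"
      by (simp add: bil_def Pv_def sum_distrib_right mult.assoc)
    also have "\<dots> = (\<Sum>A\<in>UNIV. v $ A * (\<Sum>i\<in>UNIV. F (\<kappa> i) (Inl A) u * F (\<kappa> i) (Inr l) u))"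
      by (subst sum.swap) (simp only: sum_distrib_left)
    finally show ?thesis by (simp add: z)
  qed
  have WW: "(\<Sum>i\<in>UNIV. F (\<kappa> i) (Inr l) u * F (\<kappa> i) (Inr l) u) = 1 + B l u * B l u" if u: "u \<in> U" for u l
  proof -
    have dN: "F (Inl i0) (Inr l) u = 0" using dropN [OF u, of "Inr l"] Q1(2) by auto
    have "(- \<i> * \<epsilon>2 * F (Inr j0) (Inr l) u) * (- \<i> * \<epsilon>2 * F (Inr j0) (Inr l) u) =
        - ((\<epsilon>2 * \<epsilon>2) * (F (Inr j0) (Inr l) u * F (Inr j0) (Inr l) u))" by (simp add: algebra_simps)
    then have "F (Inr j0) (Inr l) u * F (Inr j0) (Inr l) u = - (B l u * B l u)"
      unfolding dropB [OF u] \<epsilon> by simp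
    then show ?thesis unfolding kept [OF u] dN by simp
  qed
  have hbk: "hb (F (\<kappa> i)) k u = a k u * F (\<kappa> i) (Inr k) u" if "u \<in> U" for i k u
    using Ec [OF that, of "\<kappa> i"] \<kappa>K(2) [of i] by (simp add: hb_def)
  have pd\<theta>: "pd k (\<lambda>u. bil (f u) (Pv (F (\<kappa> i)) u)) u = bil (vpd k f u) (Pv (F (\<kappa> i)) u) +
      h k u * Q (F (\<kappa> i)) k u * bil (f u) (N0 u) + a k u * F (\<kappa> i) (Inr k) u * bil (f u) (S k u)"
    if u: "u \<in> U" and f: "holo_map U f" for f i k u
  proof -
    have "M (F (\<kappa> i)) u = 0" using Mc [OF u, of "\<kappa> i"] \<kappa>K(1) [of i] by simp
    then show ?thesis
      unfolding pd_bil [OF f holo_Pv [OF hF] u] vpd_Pv [OF u hF pdF [OF u]] hbk [OF u]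
      by (simp add: bil_add mult.assoc)
  qed
  have N0X: "bil (vpd j x0 u) (N0 u) = 0" if "u \<in> U" for j u
    using N_normal [OF that, of j] by (simp only: bil_commute)
  have SX: "bil (vpd j x0 u) (S k u) = (if j = k then 1 else 0)" if "u \<in> U" for j k u
    using S_vpd [OF that, of k j] by (auto simp: bil_commute)
  \<comment> \<open>The coordinates of the images of \<open>vpd j x0\<close> under \<open>P\<close>,
    to be integrated to the map. Closedness holds because \<open>\<theta>'\<close> has no
    off-diagonal term besides the symmetric second derivative of \<open>x0\<close>.\<close>
  define \<theta> where "\<theta> = (\<lambda>i j u. bil (vpd j x0 u) (Pv (F (\<kappa> i)) u))"
  have h\<theta>: "holo_fun U (\<theta> i j)" for i j unfolding \<theta>_def by (intro holo_fun_bil holo_vpd holo_x holo_Pv hF)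
  have \<theta>': "pd k (\<theta> i j) u = bil (vpd k (vpd j x0) u) (Pv (F (\<kappa> i)) u) +
      (if j = k then a k u * F (\<kappa> i) (Inr k) u else 0)" if u: "u \<in> U" for i j k u
    unfolding \<theta>_def pd\<theta> [OF u holo_vpd [OF holo_x]] by (simp add: N0X [OF u] SX [OF u])
  have "\<forall>i. \<exists>f. holo_fun U f \<and> (\<forall>u\<in>U. \<forall>j. pd j f u = \<theta> i j u)"
  proof (intro allI closed_form_primitive [OF open_U cv] h\<theta>)
    show "pd l (\<theta> i k) u = pd k (\<theta> i l) u" if "u \<in> U" for i u k l
      unfolding \<theta>' [OF that] using vpd_commute [OF open_U holo_x that, of k l] by auto
  qed
  from choice [OF this] obtain f where f: "\<forall>i. holo_fun U (f i) \<and> (\<forall>u\<in>U. \<forall>j. pd j (f i) u = \<theta> i j u)" ..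
  define y :: "complex^'a \<Rightarrow> complex^('a + 'c)" where "y = (\<lambda>u. \<chi> i. f i u)"
  have hy: "holo_map U y" using f by (simp add: holo_map_def y_def)
  have y1: "vpd j y u $ i = \<theta> i j u" if "u \<in> U" for j u i using f that by (simp add: y_def vpd_nth)
  have y2: "vpd k (vpd j y) u $ i = bil (vpd k (vpd j x0) u) (Pv (F (\<kappa> i)) u) +
      (if j = k then a k u * F (\<kappa> i) (Inr k) u else 0)" if u: "u \<in> U" for j k u i
  proof -
    have "vpd k (vpd j y) u $ i = pd k (\<theta> i j) u"
      unfolding vpd_nth [of k] by (rule pd_cong [OF open_U u]) (rule y1)
    then show ?thesis using \<theta>' [OF u] by simp
  qed
  show ?thesis
  proof (intro exI [of _ y] conjI ballI allI impI hy)
    fix u assume u: "u \<in> U"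
    show "bil (vpd j y u) (vpd k y u) = bil (vpd j x0 u) (vpd k x0 u)" for j k
      unfolding bil_def [of "vpd j y u"] y1 [OF u] \<theta>_def PP [OF u] by (simp add: N0X [OF u])
    show "vpd j (vpd k y) u = p j k u *s vpd j y u + p k j u *s vpd k y u" if jk: "j \<noteq> k" for j k
      unfolding vec_eq_iff using jk
      by (simp add: y1 [OF u] y2 [OF u] \<theta>_def second_derivative_distinct [OF u jk] bil_add)
    show "bil (vpd j (vpd j y) u) (vpd j (vpd j y) u) = bil (vpd j (vpd j x0) u) (vpd j (vpd j x0) u) + (a j u)\<^sup>2" for j
    proof -
      let ?Y = "vpd j (vpd j x0) u"
      have "bil (vpd j (vpd j y) u) (vpd j (vpd j y) u) =
          (\<Sum>i\<in>UNIV. bil ?Y (Pv (F (\<kappa> i)) u) * bil ?Y (Pv (F (\<kappa> i)) u) +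
            2 * a j u * (bil ?Y (Pv (F (\<kappa> i)) u) * F (\<kappa> i) (Inr j) u) +
            a j u * a j u * (F (\<kappa> i) (Inr j) u * F (\<kappa> i) (Inr j) u))"
        unfolding bil_def [of "vpd j (vpd j y) u"] y2 [OF u] by (simp add: algebra_simps)
      also have "\<dots> = bil ?Y ?Y - h j u * h j u + a j u * a j u * (1 + B j u * B j u)"
        unfolding sum.distrib sum_distrib_left [symmetric] PP [OF u] PW [OF u] WW [OF u]
        by (simp add: h_def bil_commute)
      finally show ?thesis by (simp add: h_B [OF u] power2_eq_square algebra_simps)
    qed
  qed
qed

end

section \<open>Uniqueness up to congruence\<close>

text \<open>The reverse of the construction: from a map whose second-order products match
  \<open>a\<close>, a solution of the same linear system is recovered. The condition
  \<open>spanning\<close> is the form in which non-degeneracy of the joined forms is used.\<close>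

locale solution_map = net_solution U x0 N0 q \<sigma> a + Y: distinct_map U y N'
  for U x0 N0 q \<sigma> a y N' +
  assumes metric_eq: "u \<in> U \<Longrightarrow> induced_metric y u = induced_metric x0 u"
    and second_products: "u \<in> U \<Longrightarrow> bil (vpd j (vpd j y) u) (vpd k (vpd k y) u) =
      bil (vpd j (vpd j x0) u) (vpd k (vpd k x0) u) + (if j = k then (a j u)\<^sup>2 else 0)"
    and spanning: "u \<in> U \<Longrightarrow> (\<And>m. bil v (vpd m y u) = 0) \<Longrightarrow>
      (\<And>l. bil v (vpd l (vpd l y) u) = 0) \<Longrightarrow> v = 0"
begin

lemma Y_dot: "u \<in> U \<Longrightarrow> bil (vpd j y u) (vpd k y u) = bil (vpd j x0 u) (vpd k x0 u)"
  using metric_eq [of u] by (simp add: metric_nth [symmetric])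

lemma Y_dot2: "u \<in> U \<Longrightarrow> bil (vpd j (vpd k y) u) (vpd m y u) = bil (vpd j (vpd k x0) u) (vpd m x0 u)"
  by (rule dot_metric_eq [OF Y.holo_x holo_x metric_eq])

lemma Y_christoffel: "u \<in> U \<Longrightarrow> christoffel (induced_metric y) l j k u = \<Gamma> l j k u"
  by (rule christoffel_metric_eq [OF metric_eq])

lemma Y_p: "u \<in> U \<Longrightarrow> Y.p j k u = p j k u" and Y_r: "u \<in> U \<Longrightarrow> Y.r j k u = r j k u"
  by (simp_all add: Y.p_def p_def Y.r_def r_def Y_christoffel)

text \<open>The transversal part of the pure second derivative, divided by \<open>a l\<close>; its
  coordinates will be the unknowns \<open>Inr l\<close>.\<close>

definition W where "W l u = (1 / a l u) *s (vpd l (vpd l y) u - (\<Sum>m\<in>UNIV. \<Gamma> m l l u *s vpd m y u))"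

text \<open>The columns of the linear map that sends each \<open>vpd j x0\<close> to
  \<open>vpd j y\<close> and \<open>N0\<close> to zero.\<close>

definition PA where "PA A u = (\<Sum>j\<in>UNIV. S j u $ A *s vpd j y u)"

lemma holo_W: "holo_map U (W l)"
  unfolding W_def
  by (intro holo_map_cscale holo_map_diff holo_map_sum holo_vpd Y.holo_x holo_christoffel holo_fun_divide holo_fun_const holo_a a_nz)

lemma holo_PA: "holo_map U (PA A)"
  unfolding PA_def by (intro holo_map_cscale holo_map_sum holo_vpd Y.holo_x holo_map_nth holo_S)

lemma aW: "u \<in> U \<Longrightarrow> vpd l (vpd l y) u = a l u *s W l u + (\<Sum>m\<in>UNIV. \<Gamma> m l l u *s vpd m y u)"
  using a_nz [of u l] by (simp add: W_def vec_eq_iff)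

lemma christoffel_dot: "u \<in> U \<Longrightarrow> (\<Sum>m\<in>UNIV. \<Gamma> m j k u * bil (vpd m x0 u) (vpd i x0 u)) = bil (vpd j (vpd k x0) u) (vpd i x0 u)"
proof -
  assume u: "u \<in> U"
  have "bil (vpd j (vpd k x0) u) (vpd i x0 u) =
      bil ((\<Sum>m\<in>UNIV. bil (S m u) (vpd j (vpd k x0) u) *s vpd m x0 u) + (\<Sum>\<alpha>\<in>(UNIV::unit set). bil (N0 u) (vpd j (vpd k x0) u) *s N0 u)) (vpd i x0 u)"
    by (rule arg_cong [OF expansion [OF u], of "\<lambda>w. bil w (vpd i x0 u)"])
  then show ?thesis using N_normal [OF u, of i] by (simp add: bil_add bil_sum christoffel_eq [OF u])
qed

lemma W_vpd: "u \<in> U \<Longrightarrow> bil (W l u) (vpd m y u) = 0"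
  by (simp add: W_def bil_diff bil_sum Y_dot Y_dot2 christoffel_dot)

text \<open>Both pure second derivatives are decomposed in \<open>second_products\<close>; their
  tangential parts agree because the metrics do, and only the transversal parts remain.\<close>

lemma W_W: "u \<in> U \<Longrightarrow> bil (W l u) (W m u) = (if l = m then 1 else 0) + B l u * B m u"
proof -
  assume u: "u \<in> U"
  have "bil (vpd l (vpd l y) u) (vpd m (vpd m y) u) =
      a l u * a m u * bil (W l u) (W m u) + (\<Sum>k\<in>UNIV. \<Sum>j\<in>UNIV. \<Gamma> k m m u * (\<Gamma> j l l u * bil (vpd j x0 u) (vpd k x0 u)))"
  proof -
    have z: "bil (vpd k y u) (W l u) = 0" for k l using W_vpd [OF u, of l k] by (simp only: bil_commute)
    show ?thesis unfolding aW [OF u]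
      by (simp add: bil_add bil_sum W_vpd [OF u] z Y_dot [OF u] sum_distrib_left mult_ac)
  qed
  moreover have "bil (vpd l (vpd l x0) u) (vpd m (vpd m x0) u) =
      h l u * h m u + (\<Sum>k\<in>UNIV. \<Sum>j\<in>UNIV. \<Gamma> k m m u * (\<Gamma> j l l u * bil (vpd j x0 u) (vpd k x0 u)))"
  proof -
    have z: "bil (vpd k x0 u) (N0 u) = 0" for k using N_normal [OF u, of k] by (simp only: bil_commute)
    have e: "vpd l (vpd l x0) u = (\<Sum>m\<in>UNIV. \<Gamma> m l l u *s vpd m x0 u) + h l u *s N0 u" for l
      using expansion [OF u, of "vpd l (vpd l x0) u"] by (simp add: christoffel_eq [OF u] h_def)
    show ?thesis
      unfolding e by (simp add: bil_add bil_sum N_normal [OF u] z N0_N0 [OF u] sum_distrib_left mult_ac)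
  qed
  ultimately have "a l u * a m u * bil (W l u) (W m u) = h l u * h m u + (if l = m then (a l u)\<^sup>2 else 0)"
    using second_products [OF u, of l m] by simp
  also have "\<dots> = a l u * a m u * ((if l = m then 1 else 0) + B l u * B m u)"
    by (simp add: h_B [OF u] power2_eq_square algebra_simps)
  finally show ?thesis using a_nz [OF u] by simp
qed

lemma Y_eq_zero:
  assumes u: "u \<in> U" and "\<And>m. bil v (vpd m y u) = 0" "\<And>l. bil v (W l u) = 0"
  shows "v = 0"
  by (rule spanning [OF u]) (use assms in \<open>simp_all add: aW [OF u] bil_add bil_sum\<close>)

lemma Y_eqI:
  assumes u: "u \<in> U" and "\<And>m. bil v (vpd m y u) = bil w (vpd m y u)" "\<And>l. bil v (W l u) = bil w (W l u)"
  shows "v = w"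
  using Y_eq_zero [OF u, of "v - w"] assms by (simp add: bil_diff)

lemma PA_W: "u \<in> U \<Longrightarrow> bil (PA A u) (W l u) = 0"
proof -
  assume u: "u \<in> U"
  have "bil (vpd k y u) (W l u) = 0" for k using W_vpd [OF u, of l k] by (simp only: bil_commute)
  then show ?thesis by (simp add: PA_def bil_sum)
qed

lemma dual_expansion: "u \<in> U \<Longrightarrow> v = (\<Sum>m\<in>UNIV. bil (vpd m x0 u) v *s S m u) + bil (N0 u) v *s N0 u"
proof (rule frame_eqI)
  assume u: "u \<in> U" then show "u \<in> U" .
  show "bil v (vpd j x0 u) = bil ((\<Sum>m\<in>UNIV. bil (vpd m x0 u) v *s S m u) + bil (N0 u) v *s N0 u) (vpd j x0 u)" for j
    by (simp add: bil_add bil_sum S_vpd [OF u] N_normal [OF u] bil_commute [of v])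
  show "bil v (N0 u) = bil ((\<Sum>m\<in>UNIV. bil (vpd m x0 u) v *s S m u) + bil (N0 u) v *s N0 u) (N0 u)"
    by (simp add: bil_add bil_sum S_N0 [OF u] N0_N0 [OF u] bil_commute [of v])
qed

lemma PA_vpd: "u \<in> U \<Longrightarrow> bil (PA A u) (vpd m y u) = vpd m x0 u $ A"
proof -
  assume u: "u \<in> U"
  have "vpd m x0 u $ A = ((\<Sum>j\<in>UNIV. bil (vpd j x0 u) (vpd m x0 u) *s S j u) + bil (N0 u) (vpd m x0 u) *s N0 u) $ A"
    by (rule arg_cong [OF dual_expansion [OF u]])
  then show ?thesis by (simp add: PA_def bil_sum Y_dot [OF u] N_normal [OF u] mult.commute)
qed

lemma vpd_sum_PA: "u \<in> U \<Longrightarrow> (\<Sum>A\<in>UNIV. vpd m x0 u $ A *s PA A u) = vpd m y u"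
proof -
  assume u: "u \<in> U"
  have "(\<Sum>A\<in>UNIV. vpd m x0 u $ A *s PA A u) $ i = (\<Sum>j\<in>UNIV. bil (S j u) (vpd m x0 u) * vpd j y u $ i)" for i
    unfolding PA_def bil_def
    by (simp add: sum_distrib_left sum_distrib_right mult_ac) (rule sum.swap)
  then show ?thesis by (simp add: vec_eq_iff S_vpd [OF u] if_distrib [of "\<lambda>x. x * _"] cong: if_cong)
qed

lemma vpd_W_zero: "u \<in> U \<Longrightarrow> bil (vpd m y u) (W l u) = 0"
  using W_vpd [of u l m] by (simp only: bil_commute)

lemma aWW: "u \<in> U \<Longrightarrow> a k u * bil (W k u) (W l u) = C k l u"
  by (simp add: W_W C_def h_B algebra_simps)

lemma second_W: "u \<in> U \<Longrightarrow> bil (vpd k (vpd m y) u) (W l u) = (if k = m then C k l u else 0)"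
  by (cases "k = m") (simp_all add: aW Y.second_derivative_distinct bil_add bil_sum vpd_W_zero aWW)

lemma vpd_W_vpd:
  assumes u: "u \<in> U"
  shows "bil (vpd k (W l) u) (vpd m y u) = - (if k = m then C k l u else 0)"
proof -
  have "pd k (\<lambda>v. bil (W l v) (vpd m y v)) u = pd k (\<lambda>_. 0) u"
    by (rule pd_cong [OF open_U u]) (rule W_vpd)
  then have "bil (vpd k (W l) u) (vpd m y u) = - bil (W l u) (vpd k (vpd m y) u)"
    by (simp add: pd_bil [OF holo_W holo_vpd [OF Y.holo_x] u] add_eq_0_iff2)
  then show ?thesis using second_W [OF u, of k m l] by (simp only: bil_commute)
qed

lemma YS_W: "u \<in> U \<Longrightarrow> bil (Y.S k u) (W l u) = 0"
  by (simp add: Y.S_def bil_sum vpd_W_zero)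

text \<open>Vectors are identified by their products with the \<open>vpd m y\<close> and the
  \<open>W l\<close>; these follow by differentiating \<open>PA_vpd\<close> and
  \<open>PA_W\<close>.\<close>

lemma vpd_PA:
  assumes u: "u \<in> U"
  shows "vpd k (PA A) u = (h k u * N0 u $ A) *s Y.S k u + (S k u $ A * a k u) *s W k u"
proof (rule Y_eqI [OF u])
  fix m
  have "pd k (\<lambda>v. bil (PA A v) (vpd m y v)) u = pd k (\<lambda>v. vpd m x0 v $ A) u"
    by (rule pd_cong [OF open_U u]) (rule PA_vpd)
  then have 1: "bil (vpd k (PA A) u) (vpd m y u) + bil (PA A u) (vpd k (vpd m y) u) = vpd k (vpd m x0) u $ A"
    by (simp add: pd_bil [OF holo_PA holo_vpd [OF Y.holo_x] u] vpd_nth)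
  have "vpd k (vpd m x0) u $ A = ((\<Sum>j\<in>UNIV. bil (vpd j x0 u) (vpd k (vpd m x0) u) *s S j u) + bil (N0 u) (vpd k (vpd m x0) u) *s N0 u) $ A"
    by (rule arg_cong [OF dual_expansion [OF u]])
  also have "\<dots> = bil (PA A u) (vpd k (vpd m y) u) + bil (N0 u) (vpd k (vpd m x0) u) * N0 u $ A"
    by (simp add: PA_def bil_sum Y_dot2 [OF u] bil_commute [of "vpd _ y u"] bil_commute [of "vpd _ x0 u"] mult.commute)
  finally have "bil (vpd k (PA A) u) (vpd m y u) = bil (N0 u) (vpd k (vpd m x0) u) * N0 u $ A"
    using 1 by simp
  then show "bil (vpd k (PA A) u) (vpd m y u) =
      bil ((h k u * N0 u $ A) *s Y.S k u + (S k u $ A * a k u) *s W k u) (vpd m y u)"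
    using conj [OF u, of k m] by (cases "k = m") (simp_all add: bil_add Y.S_vpd [OF u] W_vpd [OF u] h_def)
next
  fix l
  have "pd k (\<lambda>v. bil (PA A v) (W l v)) u = pd k (\<lambda>_. 0) u"
    by (rule pd_cong [OF open_U u]) (rule PA_W)
  then have 1: "bil (vpd k (PA A) u) (W l u) = - bil (PA A u) (vpd k (W l) u)"
    by (simp add: pd_bil [OF holo_PA holo_W u] add_eq_0_iff2)
  have "bil (PA A u) (vpd k (W l) u) = (\<Sum>j\<in>UNIV. S j u $ A * bil (vpd k (W l) u) (vpd j y u))"
    by (simp add: PA_def bil_sum bil_commute)
  also have "\<dots> = - (S k u $ A * C k l u)"
    unfolding vpd_W_vpd [OF u] by (simp add: sum_negf if_distrib [of "(*) _"] cong: if_cong)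
  finally show "bil (vpd k (PA A) u) (W l u) =
      bil ((h k u * N0 u $ A) *s Y.S k u + (S k u $ A * a k u) *s W k u) (W l u)"
    using 1 by (simp add: bil_add YS_W [OF u] mult.assoc aWW [OF u])
qed

text \<open>Exchanges derivatives in \<open>vpd k (vpd l (vpd l y))\<close>: one order
  differentiates the decomposition \<open>aW\<close>, the other the mixed second-order
  equation.\<close>

lemma vpd_W_off:
  assumes u: "u \<in> U" and kl: "k \<noteq> l"
  shows "bil (vpd k (W l) u) (W m u) = \<beta> k l u * bil (W k u) (W m u)"
proof -
  have hG: "holo_map U (\<lambda>v. \<Sum>m\<in>UNIV. \<Gamma> m l l v *s vpd m y v)"
    by (intro holo_map_sum holo_map_cscale holo_christoffel holo_vpd Y.holo_x)
  have "vpd k (vpd l (vpd l y)) u = vpd k (\<lambda>v. a l v *s W l v + (\<Sum>m\<in>UNIV. \<Gamma> m l l v *s vpd m y v)) u"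
    by (rule vpd_cong [OF open_U u]) (rule aW)
  also have "\<dots> = (pd k (a l) u *s W l u + a l u *s vpd k (W l) u) +
      (\<Sum>m\<in>UNIV. pd k (\<Gamma> m l l) u *s vpd m y u + \<Gamma> m l l u *s vpd k (vpd m y) u)"
    by (simp add: vpd_add [OF holo_map_cscale [OF holo_a holo_W] hG u] vpd_cscale [OF holo_a holo_W u]
        vpd_sum [OF holo_map_cscale [OF holo_christoffel holo_vpd [OF Y.holo_x]] u]
        vpd_cscale [OF holo_christoffel holo_vpd [OF Y.holo_x] u])
  finally have "bil (vpd k (vpd l (vpd l y)) u) (W m u) =
      pd k (a l) u * bil (W l u) (W m u) + a l u * bil (vpd k (W l) u) (W m u) + r k l u * C k m u"
    by (simp add: bil_add bil_sum vpd_W_zero [OF u] second_W [OF u] r_def if_distrib [of "(*) _"] cong: if_cong)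
  moreover have "vpd k (vpd l (vpd l y)) u = vpd l (vpd k (vpd l y)) u"
    by (rule vpd_commute [OF open_U holo_vpd [OF Y.holo_x] u])
  moreover have "bil (vpd l (vpd k (vpd l y)) u) (W m u) = p l k u * C l m u"
    unfolding Y.third_derivative_distinct [OF u kl]
    using kl by (simp add: bil_add vpd_W_zero [OF u] second_W [OF u] Y_p [OF u])
  ultimately have "a l u * bil (vpd k (W l) u) (W m u) + r k l u * (a k u * bil (W k u) (W m u)) = 0"
    using kl by (simp add: pd_a [OF u kl [symmetric]] aWW [OF u, symmetric] algebra_simps)
  then have "a l u * bil (vpd k (W l) u) (W m u) = - (r k l u * (a k u * bil (W k u) (W m u)))"
    by (simp only: eq_neg_iff_add_eq_0)
  also have "\<dots> = a l u * (\<beta> k l u * bil (W k u) (W m u))"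
    using \<beta>_a [OF u kl] by algebra
  finally show ?thesis using a_nz [OF u, of l] by simp
qed

lemma pd_WW:
  assumes u: "u \<in> U"
  shows "bil (vpd k (W l) u) (W m u) + bil (vpd k (W m) u) (W l u) = pd k (B l) u * B m u + B l u * pd k (B m) u"
proof -
  have "pd k (\<lambda>v. bil (W l v) (W m v)) u = pd k (\<lambda>v. (if l = m then 1 else 0) + B l v * B m v) u"
    by (rule pd_cong [OF open_U u]) (rule W_W)
  then show ?thesis
    by (simp add: pd_bil [OF holo_W holo_W u] pd_add pd_mult holo_fun_const holo_fun_mult holo_B u
        bil_commute [of "W l u" "vpd k (W m) u"])
qed

lemma vpd_W:
  assumes u: "u \<in> U"
  shows "vpd k (W l) u = - (C k l u) *s Y.S k u + \<beta> k l u *s W k u - (if l = k then (\<Sum>m\<in>UNIV. \<beta> k m u *s W m u) else 0)"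
proof (rule Y_eqI [OF u])
  fix m
  show "bil (vpd k (W l) u) (vpd m y u) =
      bil (- (C k l u) *s Y.S k u + \<beta> k l u *s W k u - (if l = k then (\<Sum>m\<in>UNIV. \<beta> k m u *s W m u) else 0)) (vpd m y u)"
    by (cases "l = k") (simp_all add: vpd_W_vpd [OF u] bil_add bil_diff bil_sum Y.S_vpd [OF u] W_vpd [OF u])
next
  fix m
  show "bil (vpd k (W l) u) (W m u) =
      bil (- (C k l u) *s Y.S k u + \<beta> k l u *s W k u - (if l = k then (\<Sum>m\<in>UNIV. \<beta> k m u *s W m u) else 0)) (W m u)"
  proof (cases "l = k")
    case False
    then show ?thesis
      using vpd_W_off [OF u, of k l m] by (simp add: bil_add bil_diff YS_W [OF u])
  next
    case True
    have s: "(\<Sum>j\<in>UNIV. \<beta> k j u * bil (W j u) (W m u)) = \<beta> k m u - pd k (B k) u * B m u"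
      by (simp add: W_W [OF u] distrib_left sum.distrib pd_B_diag [OF u] sum_distrib_right mult.assoc)
    \<comment> \<open>The exchange of derivatives does not reach the diagonal; the Gram matrix is
      known, so \<open>pd_WW\<close> moves the derivative to the other factor, where
      \<open>vpd_W_off\<close> applies.\<close>
    have "bil (vpd k (W k) u) (W m u) = - (\<beta> k m u - pd k (B k) u * B m u)"
    proof (cases "m = k")
      case True
      then show ?thesis using pd_WW [OF u, of k k k] by simp
    next
      case False
      then have "bil (vpd k (W k) u) (W m u) = pd k (B k) u * B m u + B k u * (\<beta> k m u * B k u) - \<beta> k m u * (1 + B k u * B k u)"
        using pd_WW [OF u, of k k m] vpd_W_off [OF u, of k m k] pd_B [OF u, of k m] by (simp add: W_W [OF u] eq_diff_eq)
      then show ?thesis by (simp add: algebra_simps)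
    qed
    then show ?thesis using True by (simp add: bil_diff bil_add bil_sum YS_W [OF u] s)
  qed
qed

text \<open>The vector of the \<open>B l\<close> lies in the kernel of the Gram matrix of the
  \<open>W l\<close> because \<open>sum_B\<close> has the value \<open>- 1\<close>, so the
  combination is orthogonal to a spanning family.\<close>

lemma B_W: "u \<in> U \<Longrightarrow> (\<Sum>l\<in>UNIV. B l u *s W l u) = 0"
proof (rule Y_eq_zero)
  assume u: "u \<in> U" then show "u \<in> U" .
  show "bil (\<Sum>l\<in>UNIV. B l u *s W l u) (vpd m y u) = 0" for m by (simp add: bil_sum W_vpd [OF u])
  have "(\<Sum>l\<in>UNIV. B l u * (B l u * B m u)) = (\<Sum>l\<in>UNIV. B l u * B l u) * B m u" for m
    by (simp only: sum_distrib_right mult.assoc)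
  then show "bil (\<Sum>l\<in>UNIV. B l u *s W l u) (W m u) = 0" for m
    by (simp add: bil_sum W_W [OF u] distrib_left sum.distrib sum_B [OF u])
qed

definition FV where "FV X u = (case X of Inl A \<Rightarrow> PA A u | Inr l \<Rightarrow> W l u)"

lemma holo_FV: "holo_fun U (\<lambda>u. FV X u $ i)"
  unfolding FV_def by (cases X) (simp_all add: holo_map_nth holo_PA holo_W)

text \<open>Each coordinate of the vectors \<open>FV X\<close> solves the system with both constants
  \<open>M\<close> and \<open>E\<close> equal to zero, because the vectors already live in the
  projected space.\<close>

lemma pd_FV:
  assumes u: "u \<in> U"
  shows "pd k (\<lambda>u. FV X u $ i) u = (\<Sum>Y\<in>UNIV. Om k X Y u * FV Y u $ i)"
proof -
  let ?F = "\<lambda>X u. FV X u $ i"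
  have YS: "Y.S k u = (\<Sum>j\<in>UNIV. bil (S k u) (S j u) *s vpd j y u)" for k
    unfolding Y.S_def metric_eq [OF u] by (subst bil_commute) (simp only: S_S [OF u])
  have PAi: "PA A u $ i = (\<Sum>j\<in>UNIV. S j u $ A * vpd j y u $ i)" for A by (simp add: PA_def)
  have swap: "bil v (Pv ?F u) = (\<Sum>j\<in>UNIV. bil v (S j u) * vpd j y u $ i)" for v
  proof -
    have "bil v (Pv ?F u) = (\<Sum>A\<in>UNIV. \<Sum>j\<in>UNIV. v $ A * S j u $ A * vpd j y u $ i)"
      by (simp add: bil_def Pv_def FV_def PAi sum_distrib_left mult.assoc)
    also have "\<dots> = (\<Sum>j\<in>UNIV. \<Sum>A\<in>UNIV. v $ A * S j u $ A * vpd j y u $ i)" by (rule sum.swap)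
    finally show ?thesis by (simp add: bil_def sum_distrib_right)
  qed
  have Qi: "Q ?F k u = Y.S k u $ i" for k unfolding Q_def swap YS by simp
  have Mi: "M ?F u = 0" unfolding M_def swap by (simp add: S_N0 [OF u])
  have "E ?F u = (\<Sum>l\<in>UNIV. B l u *s W l u) $ i" by (simp add: E_def FV_def)
  then have Ei: "E ?F u = 0" by (simp add: B_W [OF u])
  show ?thesis
  proof (cases X)
    case (Inl A)
    have "pd k (\<lambda>u. FV X u $ i) u = vpd k (PA A) u $ i" by (simp add: Inl FV_def vpd_nth)
    then show ?thesis unfolding Inl Om_Inl [OF u, of k A ?F] Qi Mi hb_def Ei vpd_PA [OF u]
      by (simp add: FV_def)
  next
    case (Inr l)
    have "pd k (\<lambda>u. FV X u $ i) u = vpd k (W l) u $ i" by (simp add: Inr FV_def vpd_nth)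
    then show ?thesis unfolding Inr Om_Inr [of k l _ ?F] Qi vpd_W [OF u]
      by (cases "l = k") (simp_all add: FV_def)
  qed
qed

lemma FV_span: "u \<in> U \<Longrightarrow> (\<And>X. bil v (FV X u) = 0) \<Longrightarrow> v = 0"
proof (rule Y_eq_zero)
  assume u: "u \<in> U" and *: "\<And>X. bil v (FV X u) = 0"
  show "u \<in> U" by (rule u)
  have "bil v (PA A u) = 0" for A using * [of "Inl A"] by (simp add: FV_def)
  then show "bil v (vpd m y u) = 0" for m
    unfolding vpd_sum_PA [OF u, symmetric] by (simp add: bil_sum)
  show "bil v (W l u) = 0" for l using * [of "Inr l"] by (simp add: FV_def)
qed

text \<open>The right-hand side contains nothing of \<open>y\<close>, so two maps with the same
  \<open>a\<close> have frames with equal Gram matrices.\<close>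

lemma FV_gram: "u \<in> U \<Longrightarrow> bil (FV X u) (FV Y u) = (case X of
    Inl A \<Rightarrow> (case Y of Inl D \<Rightarrow> (\<Sum>j\<in>UNIV. S j u $ D * vpd j x0 u $ A) | Inr m \<Rightarrow> 0)
  | Inr l \<Rightarrow> (case Y of Inl D \<Rightarrow> 0 | Inr m \<Rightarrow> (if l = m then 1 else 0) + B l u * B m u))"
proof -
  assume u: "u \<in> U"
  have "bil (PA A u) (PA D u) = (\<Sum>j\<in>UNIV. S j u $ D * vpd j x0 u $ A)" for A D
    by (simp add: PA_def [of D] bil_sum PA_vpd [OF u])
  moreover have "bil (W l u) (PA D u) = 0" for l D using PA_W [OF u, of D l] by (simp only: bil_commute)
  ultimately show ?thesis
    by (cases X; cases Y) (simp_all add: FV_def PA_W [OF u] W_W [OF u])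
qed

end

text \<open>Equal Gram matrices give an orthogonal matrix matching the frames at \<open>u0\<close>;
  uniqueness for the linear system carries the match over \<open>U\<close>, so the differentials of
  the maps correspond.\<close>

theorem solution_maps_congruent:
  assumes y: "solution_map U x0 N0 q \<sigma> a y N1" and z: "solution_map U x0 N0 q \<sigma> a z N2"
    and cv: "convex U" "u0 \<in> U"
  shows "congruent_on U y z"
proof -
  interpret Y: solution_map U x0 N0 q \<sigma> a y N1 by (rule y)
  interpret Z: solution_map U x0 N0 q \<sigma> a z N2 by (rule z)
  have "\<exists>R. orthogonal_matrix R \<and> (\<forall>X. Z.FV X u0 = R *v Y.FV X u0)"
    by (rule orthogonal_matrix_of_gram)
      (simp_all only: Y.FV_gram [OF cv(2)] Z.FV_gram [OF cv(2)] Y.FV_span [OF cv(2)] Z.FV_span [OF cv(2)])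
  then obtain R where R: "orthogonal_matrix R" "\<And>X. Z.FV X u0 = R *v Y.FV X u0" by blast
  have FVR: "Z.FV X u = R *v Y.FV X u" if u: "u \<in> U" for X u
  proof -
    have "Z.FV X u $ i - (\<Sum>j\<in>UNIV. R $ i $ j * Y.FV X u $ j) = 0" for i
    proof (rule radial_ode_zero [where Om = Y.Om and U = U and ?u0.0 = u0
          and G = "\<lambda>X u. Z.FV X u $ i - (\<Sum>j\<in>UNIV. R $ i $ j * Y.FV X u $ j)"])
      show "holo_fun U (\<lambda>u. Z.FV X u $ i - (\<Sum>j\<in>UNIV. R $ i $ j * Y.FV X u $ j))" for X
        by (intro holo_fun_diff holo_fun_sum holo_fun_mult holo_fun_const Y.holo_FV Z.holo_FV)
      fix k X u assume u: "u \<in> U"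
      have "pd k (\<lambda>u. Z.FV X u $ i - (\<Sum>j\<in>UNIV. R $ i $ j * Y.FV X u $ j)) u =
          pd k (\<lambda>u. Z.FV X u $ i) u - (\<Sum>j\<in>UNIV. R $ i $ j * pd k (\<lambda>u. Y.FV X u $ j) u)"
        by (simp add: Y.pd_diff Y.pd_sum Y.pd_cmult holo_fun_sum holo_fun_mult holo_fun_const Y.holo_FV Z.holo_FV u)
      also have "\<dots> = (\<Sum>Z\<in>UNIV. Y.Om k X Z u * Z.FV Z u $ i) - (\<Sum>j\<in>UNIV. \<Sum>Z\<in>UNIV. Y.Om k X Z u * (R $ i $ j * Y.FV Z u $ j))"
        by (simp add: Y.pd_FV [OF u] Z.pd_FV [OF u] sum_distrib_left mult_ac)
      also have "\<dots> = (\<Sum>Z\<in>UNIV. Y.Om k X Z u * (Z.FV Z u $ i - (\<Sum>j\<in>UNIV. R $ i $ j * Y.FV Z u $ j)))"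
        by (subst sum.swap) (simp add: sum_distrib_left right_diff_distrib sum_subtractf)
      finally show "pd k (\<lambda>u. Z.FV X u $ i - (\<Sum>j\<in>UNIV. R $ i $ j * Y.FV X u $ j)) u =
          (\<Sum>Z\<in>UNIV. Y.Om k X Z u * (Z.FV Z u $ i - (\<Sum>j\<in>UNIV. R $ i $ j * Y.FV Z u $ j)))" .
    qed (use cv u Y.open_U Y.holo_Om R(2) in \<open>simp_all add: matrix_vector_mult_def\<close>)
    then show ?thesis by (simp add: vec_eq_iff matrix_vector_mult_def)
  qed
  have dz: "vpd m z u = R *v vpd m y u" if u: "u \<in> U" for m u
  proof -
    have "Z.PA A u = R *v Y.PA A u" for A using FVR [OF u, of "Inl A"] by (simp add: Y.FV_def Z.FV_def)
    then have "vpd m z u = (\<Sum>A\<in>UNIV. vpd m x0 u $ A *s (R *v Y.PA A u))"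
      using Z.vpd_sum_PA [OF u, of m] by simp
    also have "\<dots> = R *v (\<Sum>A\<in>UNIV. vpd m x0 u $ A *s Y.PA A u)"
    proof -
      have "(\<Sum>A\<in>UNIV. vpd m x0 u $ A *s (R *v Y.PA A u)) $ i = (R *v (\<Sum>A\<in>UNIV. vpd m x0 u $ A *s Y.PA A u)) $ i" for i
        by (simp add: matrix_vector_mult_def sum_distrib_left mult_ac) (rule sum.swap)
      then show ?thesis by (simp only: vec_eq_iff) simp
    qed
    finally show ?thesis unfolding Y.vpd_sum_PA [OF u] .
  qed
  have hd: "holo_map U (\<lambda>u. z u - R *v y u)"
    by (intro holo_map_diff holo_map_matrix Y.Y.holo_x Z.Y.holo_x)
  have "(z u - R *v y u) $ i = (z u0 - R *v y u0) $ i" if u: "u \<in> U" for u i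
  proof (rule pd_zero_imp_const [OF Y.open_U cv u])
    show "holo_fun U (\<lambda>u. (z u - R *v y u) $ i)" by (rule holo_map_nth [OF hd])
    fix k u assume u: "u \<in> U"
    have "vpd k (\<lambda>u. z u - R *v y u) u = 0"
      by (simp add: Y.vpd_diff Y.vpd_matrix holo_map_matrix Y.Y.holo_x Z.Y.holo_x u dz)
    then show "pd k (\<lambda>u. (z u - R *v y u) $ i) u = 0" by (simp add: vec_eq_iff vpd_nth)
  qed
  then have "z u = R *v y u + (z u0 - R *v y u0)" if "u \<in> U" for u
    using that by (simp add: vec_eq_iff algebra_simps)
  then show ?thesis unfolding congruent_on_def using R(1) by blast
qed

section \<open>Quadrics\<close>

lemma sum_UNIV_option: "(\<Sum>x\<in>(UNIV :: ('k::finite option) set). f x) = f None + (\<Sum>j\<in>UNIV. f (Some j))"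
  by (simp add: UNIV_option_conv sum.reindex)

text \<open>\<open>K\<close> is the form of the sphere pulled back along \<open>M\<close>;
  non-degeneracy of the quadric becomes triviality of its kernel.\<close>

lemma quadric_symmetric_form:
  fixes Qs :: "(complex^'k::finite) set"
  assumes "quadric Qs"
  shows "\<exists>K. (\<forall>i j. K $ i $ j = K $ j $ i) \<and> (\<forall>v. K *v v = 0 \<longrightarrow> v = 0) \<and>
    (\<forall>X\<in>Qs. bil (hom_coords X) (K *v hom_coords X) = 0)"
proof -
  obtain M :: "complex^('k option)^('k option)" where M: "invertible M"
    and Qs: "Qs = {X. sphere_form (M *v hom_coords X) = 0}"
    using assms unfolding quadric_def by blast
  define J :: "complex^('k option)^('k option)" where "J = (\<chi> i j. if i = j then (if i = None then - 1 else 1) else 0)"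
  have Jv: "(J *v v) $ i = (if i = None then - 1 else 1) * v $ i" for v i
    by (simp add: J_def matrix_vector_mult_def if_distrib [of "\<lambda>x. x * _"] cong: if_cong)
  have form: "sphere_form Y = bil Y (J *v Y)" for Y
    by (simp add: sphere_form_def bil_def Jv sum_UNIV_option power2_eq_square)
  have Mker: "v = 0" if "M *v v = 0" for v
    using M that by (metis invertible_left_inverse matrix_left_invertible_ker)
  have MTker: "v = 0" if "transpose M *v v = 0" for v
  proof -
    have "\<exists>B. B ** transpose M = mat 1"
      using M by (metis invertible_right_inverse matrix_transpose_mul transpose_mat)
    then show ?thesis using that matrix_left_invertible_ker by blast
  qed
  define K where "K = transpose M ** (J ** M)"
  have Kv: "K *v v = transpose M *v (J *v (M *v v))" for v
    by (simp add: K_def matrix_vector_mul_assoc)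
  have Jker: "v = 0" if J0: "J *v v = 0" for v
  proof -
    have "v $ i = 0" for i using Jv [of v i] J0 by (cases "i = None") simp_all
    then show ?thesis by (simp add: vec_eq_iff)
  qed
  have "K *v v = 0 \<longrightarrow> v = 0" for v
    unfolding Kv by (rule impI, rule Mker, rule Jker, rule MTker)
  moreover have "transpose K = K"
  proof -
    have "transpose J = J" by (simp add: J_def transpose_def vec_eq_iff)
    then show ?thesis by (simp add: K_def matrix_transpose_mul matrix_mul_assoc)
  qed
  then have "transpose K $ i $ j = K $ i $ j" for i j by simp
  then have "K $ i $ j = K $ j $ i" for i j by (simp add: transpose_def)
  moreover have "bil v (K *v v) = sphere_form (M *v v)" for v
    unfolding form Kv bil_matrix_vector ..
  ultimately show ?thesis unfolding Qs by (intro exI [of _ K]) simp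
qed

lemma quadric_piece_conjugate_map:
  assumes "quadric_piece U x0 N0"
  shows "conjugate_map U x0 (\<lambda>_::unit. N0)"
  using assms unfolding quadric_piece_def unit_normal_def conjugate_system_def sff_def
  by unfold_locales auto

lemma quadric_piece_conjugate_net:
  assumes qp: "quadric_piece U x0 N0"
    and distinct: "\<And>u j k l. u \<in> U \<Longrightarrow> j \<noteq> k \<Longrightarrow> k \<noteq> l \<Longrightarrow> j \<noteq> l \<Longrightarrow> christoffel (induced_metric x0) l j k u = 0"
  shows "conjugate_net U x0 N0"
proof -
  interpret conjugate_map U x0 "\<lambda>_::unit. N0" by (rule quadric_piece_conjugate_map [OF qp])
  show ?thesis
    by unfold_locales (use qp distinct in \<open>auto simp: quadric_piece_def unit_normal_def\<close>)
qed

text \<open>\<open>q\<close> is half the gradient of the quadratic polynomial of the quadric. It is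
  normal to \<open>x0\<close> and, as an affine function of \<open>x0\<close>, satisfies the same
  mixed second-order equations.\<close>

lemma quadric_piece_quadric_net:
  assumes qp: "quadric_piece U x0 N0"
    and distinct: "\<And>u j k l. u \<in> U \<Longrightarrow> j \<noteq> k \<Longrightarrow> k \<noteq> l \<Longrightarrow> j \<noteq> l \<Longrightarrow> christoffel (induced_metric x0) l j k u = 0"
  shows "\<exists>q \<sigma>. quadric_net U x0 N0 q \<sigma>"
proof -
  interpret conjugate_net U x0 N0 by (rule quadric_piece_conjugate_net [OF assms])
  obtain Qs where "quadric Qs" and Qs: "x0 ` U \<subseteq> Qs" using qp unfolding quadric_piece_def by blast
  then obtain K where Ksym: "\<forall>i j. K $ i $ j = K $ j $ i" and Kker': "\<forall>v. K *v v = 0 \<longrightarrow> v = 0"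
    and KQ: "\<forall>X\<in>Qs. bil (hom_coords X) (K *v hom_coords X) = 0"
    using quadric_symmetric_form [OF \<open>quadric Qs\<close>] by (elim exE conjE) (rule that)
  have Kker: "v = 0" if "K *v v = 0" for v using Kker' that by simp
  have Kbil: "bil v (K *v w) = bil w (K *v v)" for v w
  proof -
    have "transpose K = K" unfolding transpose_def vec_eq_iff using Ksym by simp
    then show ?thesis using bil_matrix_vector [of K w v] by (simp add: bil_commute [of v "K *v w"])
  qed
  define H where "H = (\<lambda>u. hom_coords (x0 u))"
  \<comment> \<open>Directions have homogenizing coordinate \<open>0\<close>; \<open>res\<close>
    forgets that coordinate.\<close>
  define inc :: "complex^('a option) \<Rightarrow> complex^('a option option)"
    where "inc = (\<lambda>v. \<chi> i. case i of None \<Rightarrow> 0 | Some j \<Rightarrow> v $ j)"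
  define res :: "complex^('a option option) \<Rightarrow> complex^('a option)" where "res = (\<lambda>w. \<chi> i. w $ Some i)"
  have inc_bil: "bil (inc v) w = bil v (res w)" for v w
    by (simp add: inc_def res_def bil_def sum_UNIV_option [where 'k = "'a option"])
  have H_bil: "bil (H u) w = w $ None + bil (x0 u) (res w)" for u w
    by (simp add: H_def hom_coords_def res_def bil_def sum_UNIV_option [where 'k = "'a option"])
  have HH: "bil (H u) (K *v H u) = 0" if "u \<in> U" for u using KQ Qs that by (auto simp: H_def)
  define A where "A = (\<chi> i j. K $ Some i $ Some j)"
  define b where "b = (\<chi> i. K $ Some i $ None)"
  define q where "q = (\<lambda>u. b + A *v x0 u)"
  have resH: "res (K *v H u) = q u" for u
    by (simp add: res_def q_def A_def b_def H_def hom_coords_def matrix_vector_mult_def vec_eq_iff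
        sum_UNIV_option [where 'k = "'a option"])
  have resinc: "res (K *v inc v) = A *v v" for v
    by (simp add: res_def A_def inc_def matrix_vector_mult_def vec_eq_iff sum_UNIV_option [where 'k = "'a option"])
  have holo_q: "holo_map U q"
    unfolding q_def by (intro holo_map_add holo_map_matrix holo_x) (simp add: holo_map_def holo_fun_const)
  have vb: "vpd k (\<lambda>_. b) u = 0" for k u by (simp add: vec_eq_iff vpd_nth)
  have hb: "holo_map U (\<lambda>_. b)" by (simp add: holo_map_def holo_fun_const)
  have vq: "vpd k q u = A *v vpd k x0 u" if "u \<in> U" for k u
    unfolding q_def by (simp add: vpd_add [OF hb holo_map_matrix [OF holo_x] that] vpd_matrix [OF holo_x that] vb)
  have vvq: "vpd j (vpd k q) u = A *v vpd j (vpd k x0) u" if u: "u \<in> U" for j k u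
  proof -
    have "vpd j (vpd k q) u = vpd j (\<lambda>v. A *v vpd k x0 v) u" by (rule vpd_cong [OF open_U u]) (rule vq)
    then show ?thesis by (simp add: vpd_matrix [OF holo_vpd [OF holo_x] u])
  qed
  have holo_H: "holo_map U H"
    unfolding holo_map_def
  proof
    show "holo_fun U (\<lambda>u. H u $ i)" for i
      by (cases i) (simp_all add: H_def hom_coords_def holo_fun_const holo_map_nth holo_x)
  qed
  have vH: "vpd k H u = inc (vpd k x0 u)" for k u
    by (simp add: vec_eq_iff vpd_nth H_def hom_coords_def inc_def split: option.split)
  have qX: "bil (q u) (vpd k x0 u) = 0" if u: "u \<in> U" for k u
  proof -
    have "pd k (\<lambda>u. bil (H u) (K *v H u)) u = pd k (\<lambda>_. 0) u" by (rule pd_cong [OF open_U u]) (rule HH)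
    then have "bil (vpd k H u) (K *v H u) + bil (H u) (K *v vpd k H u) = 0"
      by (simp add: pd_bil [OF holo_H holo_map_matrix [OF holo_H] u] vpd_matrix [OF holo_H u])
    then have "bil (vpd k H u) (K *v H u) = 0" using Kbil [of "H u" "vpd k H u"] by simp
    then have "bil (vpd k x0 u) (q u) = 0" by (simp only: vH inc_bil resH)
    then show ?thesis by (simp only: bil_commute)
  qed
  define \<sigma> where "\<sigma> = (\<lambda>u. bil (q u) (N0 u))"
  have q_eq: "q u = \<sigma> u *s N0 u" if u: "u \<in> U" for u
    by (rule frame_eqI [OF u]) (simp_all add: qX [OF u] N_normal [OF u] N0_N0 [OF u] \<sigma>_def)
  have \<sigma>_nz: "\<sigma> u \<noteq> 0" if u: "u \<in> U" for u
  proof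
    \<comment> \<open>Then the whole vector \<open>K *v H u\<close> would vanish, since its
      coordinate \<open>None\<close> is forced to zero by the equation of the quadric.\<close>
    assume "\<sigma> u = 0"
    then have "q u = 0" using q_eq [OF u] by simp
    then have r: "res (K *v H u) = 0" using resH by simp
    then have "(K *v H u) $ None = 0" using HH [OF u] H_bil [of u "K *v H u"] by simp
    moreover have "(K *v H u) $ Some i = 0" for i using r by (simp add: res_def vec_eq_iff)
    ultimately have "(K *v H u) $ i = 0" for i by (cases i) auto
    then have "K *v H u = 0" by (simp add: vec_eq_iff)
    then have "H u = 0" by (rule Kker)
    then have "H u $ None = 0" by simp
    then show False by (simp add: H_def hom_coords_def)
  qed
  have qd: "bil (vpd k q u) (vpd m x0 u) = - (\<sigma> u * bil (N0 u) (vpd k (vpd m x0) u))" if u: "u \<in> U" for k m u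
  proof -
    have "pd k (\<lambda>v. bil (q v) (vpd m x0 v)) u = pd k (\<lambda>_. 0) u" by (rule pd_cong [OF open_U u]) (rule qX)
    then show ?thesis
      by (simp add: pd_bil [OF holo_q holo_vpd [OF holo_x] u] add_eq_0_iff2 q_eq [OF u])
  qed
  have h_nz: "bil (N0 u) (vpd k (vpd k x0) u) \<noteq> 0" if u: "u \<in> U" for k u
  proof
    assume h0: "bil (N0 u) (vpd k (vpd k x0) u) = 0"
    define \<tau> where "\<tau> = bil (vpd k q u) (N0 u) / \<sigma> u"
    have "vpd k q u = \<tau> *s q u"
    proof (rule frame_eqI [OF u])
      show "bil (vpd k q u) (vpd m x0 u) = bil (\<tau> *s q u) (vpd m x0 u)" for m
        using h0 conj [OF u, of k m] by (cases "k = m") (simp_all add: qd [OF u] qX [OF u])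
      show "bil (vpd k q u) (N0 u) = bil (\<tau> *s q u) (N0 u)"
        using \<sigma>_nz [OF u] by (simp add: \<tau>_def \<sigma>_def)
    qed
    \<comment> \<open>If \<open>h k\<close> were zero, \<open>vpd k q\<close> would be a multiple of
      \<open>q\<close> and this vector would lie in the kernel of \<open>K\<close>. Its coordinate
      \<open>None\<close> then gives \<open>\<tau> = 0\<close>, and \<open>vpd k x0\<close> would
      vanish.\<close>
    define Z where "Z = inc (vpd k x0 u) - \<tau> *s H u"
    have KZ: "K *v Z = K *v inc (vpd k x0 u) - \<tau> *s (K *v H u)"
      by (simp add: Z_def matrix_vector_mult_diff_distrib vector_scalar_commute)
    have "res (K *v Z) = vpd k q u - \<tau> *s q u"
    proof -
      have "res (K *v Z) = res (K *v inc (vpd k x0 u)) - \<tau> *s res (K *v H u)"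
        unfolding KZ by (simp add: res_def vec_eq_iff)
      then show ?thesis by (simp only: resinc resH vq [OF u])
    qed
    then have r: "res (K *v Z) = 0" using \<open>vpd k q u = \<tau> *s q u\<close> by simp
    have "bil (H u) (K *v Z) = bil Z (K *v H u)" by (rule Kbil)
    also have "\<dots> = 0"
      unfolding Z_def using HH [OF u] qX [OF u, of k] by (simp add: bil_diff inc_bil resH bil_commute [of _ "q u"])
    finally have "(K *v Z) $ None = 0" using H_bil [of u "K *v Z"] r by simp
    moreover have "(K *v Z) $ Some i = 0" for i using r by (simp add: res_def vec_eq_iff)
    ultimately have "(K *v Z) $ i = 0" for i by (cases i) auto
    then have "K *v Z = 0" by (simp add: vec_eq_iff)
    then have Z0: "Z = 0" by (rule Kker)
    then have "Z $ None = 0" by simp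
    then have "\<tau> = 0" by (simp add: Z_def inc_def H_def hom_coords_def)
    then have "inc (vpd k x0 u) = 0" using Z0 by (simp add: Z_def)
    then have "inc (vpd k x0 u) $ Some i = 0" for i by simp
    then have "vpd k x0 u = 0" by (simp add: inc_def vec_eq_iff)
    then show False using S_vpd [OF u, of k k] by simp
  qed
  have "quadric_net U x0 N0 q \<sigma>"
  proof unfold_locales
    show "holo_fun U \<sigma>" unfolding \<sigma>_def by (intro holo_fun_bil holo_q holo_N0)
    show "vpd j (vpd k q) u = \<Gamma> j j k u *s vpd j q u + \<Gamma> k k j u *s vpd k q u" if "u \<in> U" "j \<noteq> k" for u j k
      unfolding vvq [OF that(1)] vq [OF that(1)] second_derivative_distinct [OF that] p_def
      by (simp add: matrix_vector_right_distrib vector_scalar_commute)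
  qed (use holo_q q_eq \<sigma>_nz h_nz in auto)
  then show ?thesis by blast
qed

section \<open>Conjugate deformations\<close>

text \<open>The squared length of the joined vector by \<open>joined_dot\<close>, expressed without
  any normal frame.\<close>

definition joined_square :: "(complex^'n \<Rightarrow> complex^'k) \<Rightarrow> (complex^'n \<Rightarrow> complex^'m) \<Rightarrow> 'n \<Rightarrow> complex^'n \<Rightarrow> complex" where
  "joined_square x0 x j u = bil (vpd j (vpd j x) u) (vpd j (vpd j x) u) - bil (vpd j (vpd j x0) u) (vpd j (vpd j x0) u)"

lemma bil_joined_vec:
  "bil (joined_vec N0 x0 N x j u) (joined_vec N0 x0 N x k u) =
    (\<Sum>\<alpha>\<in>UNIV. sff (N \<alpha>) x j j u * sff (N \<alpha>) x k k u) - sff N0 x0 j j u * sff N0 x0 k k u"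
  by (simp add: bil_def joined_vec_def sum_UNIV_option algebra_simps)

locale deformed_net = X0: conjugate_map U x0 "\<lambda>_::unit. N0" + framed_map U x N
  for U :: "(complex^'n::finite) set" and x0 N0 :: "complex^'n \<Rightarrow> complex^('n option)"
    and x :: "complex^'n \<Rightarrow> complex^('n + 'a::finite)" and N :: "'a \<Rightarrow> complex^'n \<Rightarrow> complex^('n + 'a)" +
  assumes metric_eq: "u \<in> U \<Longrightarrow> induced_metric x u = induced_metric x0 u"
begin

lemma dot2: "u \<in> U \<Longrightarrow> bil (vpd j (vpd k x) u) (vpd m x u) = bil (vpd j (vpd k x0) u) (vpd m x0 u)"
  by (rule X0.dot_metric_eq [OF holo_x X0.holo_x metric_eq])

text \<open>Products of normal parts are full products minus tangential corrections; the corrections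
  involve only the metric and cancel.\<close>

lemma normal_products_diff:
  assumes u: "u \<in> U"
  shows "(\<Sum>\<alpha>\<in>UNIV. bil (N \<alpha> u) (vpd i (vpd j x) u) * bil (N \<alpha> u) (vpd k (vpd l x) u)) -
      bil (N0 u) (vpd i (vpd j x0) u) * bil (N0 u) (vpd k (vpd l x0) u) =
    bil (vpd i (vpd j x) u) (vpd k (vpd l x) u) - bil (vpd i (vpd j x0) u) (vpd k (vpd l x0) u)"
  using normal_products [OF u, of "vpd i (vpd j x) u" "vpd k (vpd l x) u"]
    X0.normal_products [OF u, of "vpd i (vpd j x0) u" "vpd k (vpd l x0) u"]
  by (simp add: metric_eq [OF u] dot2 [OF u])

lemma joined_dot:
  assumes u: "u \<in> U"
  shows "bil (joined_vec N0 x0 N x j u) (joined_vec N0 x0 N x k u) =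
    bil (vpd j (vpd j x) u) (vpd k (vpd k x) u) - bil (vpd j (vpd j x0) u) (vpd k (vpd k x0) u)"
  unfolding bil_joined_vec sff_def by (rule normal_products_diff [OF u])

lemma joined_orthogonal:
  assumes u: "u \<in> U" and jk: "j \<noteq> k" and conj: "\<And>\<alpha>. bil (N \<alpha> u) (vpd j (vpd k x) u) = 0"
  shows "bil (joined_vec N0 x0 N x j u) (joined_vec N0 x0 N x k u) = 0"
  unfolding joined_dot [OF u]
  using X0.gauss_dot_eq [OF holo_x X0.holo_x metric_eq u, of j k] normal_products_diff [OF u, of j k j k]
  by (simp add: conj X0.conj [OF u jk] algebra_simps)

end

locale conjugate_deformation = deformed_net U x0 N0 x N + X: conjugate_map U x N
  for U :: "(complex^'n::finite) set" and x0 N0 :: "complex^'n \<Rightarrow> complex^('n option)"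
    and x :: "complex^'n \<Rightarrow> complex^('n + 'a::finite)" and N :: "'a \<Rightarrow> complex^'n \<Rightarrow> complex^('n + 'a)" +
  assumes nondegenerate: "u \<in> U \<Longrightarrow> (\<Sum>j\<in>UNIV. c j *s joined_vec N0 x0 N x j u) = 0 \<Longrightarrow> c j = 0"
begin

lemma distinct_zero:
  assumes u: "u \<in> U" and d: "j \<noteq> k" "k \<noteq> l" "j \<noteq> l"
  shows "christoffel (induced_metric x0) l j k u = 0"
proof -
  let ?G = "christoffel (induced_metric x0)"
  have G: "christoffel (induced_metric x) l j k u = ?G l j k u" for l j k
    by (rule X0.christoffel_metric_eq [OF metric_eq u])
  \<comment> \<open>The exchange relation holds with the same symbols for the normals of
    \<open>x\<close> and of \<open>x0\<close>, so it is a linear relation between two joined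
    vectors.\<close>
  define c where "c = (\<lambda>i. if i = l then ?G l j k u else if i = j then - ?G j l k u else 0)"
  have "(\<Sum>i\<in>UNIV. c i *s joined_vec N0 x0 N x i u) =
      ?G l j k u *s joined_vec N0 x0 N x l u - ?G j l k u *s joined_vec N0 x0 N x j u"
  proof -
    have "(\<Sum>i\<in>UNIV. c i *s joined_vec N0 x0 N x i u) = (\<Sum>i\<in>{l, j}. c i *s joined_vec N0 x0 N x i u)"
      by (rule sum.mono_neutral_right) (auto simp: c_def)
    then show ?thesis using d by (simp add: c_def)
  qed
  also have "\<dots> = 0"
    using X.christoffel_exchange [OF u d(1) d(2) [symmetric]] X0.christoffel_exchange [OF u d(1) d(2) [symmetric]]
    by (simp add: vec_eq_iff joined_vec_def sff_def G split: option.split)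
  finally have "c l = 0" by (rule nondegenerate [OF u])
  then show ?thesis by (simp add: c_def)
qed

end

lemma conjugate_deformation_iff:
  assumes net: "conjugate_map U x0 (\<lambda>_::unit. N0)"
  shows "x \<in> (conjugate_deformations U x0 N0 :: (complex^'n::finite \<Rightarrow> complex^('n + 'a::finite)) set) \<longleftrightarrow>
    (\<exists>N. conjugate_deformation U x0 N0 x N)"
proof
  interpret X0: conjugate_map U x0 "\<lambda>_::unit. N0" by (rule net)
  assume "x \<in> conjugate_deformations U x0 N0"
  then obtain N where d: "deformation U x0 x" and N: "normal_frame U x N" "\<forall>\<alpha>. conjugate_system U (N \<alpha>) x"
    "nondegenerate_joined U N0 x0 N x" unfolding conjugate_deformations_def by blast
  have "conjugate_deformation U x0 N0 x N"
  proof unfold_locales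
    show "CARD('n + 'a) = CARD('n) + CARD('a)" by simp
    show "holo_map U x" using d by (simp add: deformation_def)
    show m: "induced_metric x u = induced_metric x0 u" if "u \<in> U" for u using d that by (simp add: deformation_def)
    show "det (induced_metric x u) \<noteq> 0" if "u \<in> U" for u using m [OF that] X0.det_x [OF that] by simp
    show "bil (N \<alpha> u) (N \<beta> u) = (if \<alpha> = \<beta> then 1 else 0)" if "u \<in> U" for u \<alpha> \<beta>
      using N(1) that by (simp add: normal_frame_def)
    show "bil (N \<alpha> u) (vpd j x u) = 0" if "u \<in> U" for u \<alpha> j
      using N(1) that by (simp add: normal_frame_def)
    show "bil (N \<alpha> u) (vpd j (vpd k x) u) = 0" if "u \<in> U" "j \<noteq> k" for u \<alpha> j k
      using N(2) that by (simp add: conjugate_system_def sff_def)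
    show "c j = 0" if "u \<in> U" "(\<Sum>j\<in>UNIV. c j *s joined_vec N0 x0 N x j u) = 0" for u c j
      using N(3) that by (simp add: nondegenerate_joined_def)
  qed
  then show "\<exists>N. conjugate_deformation U x0 N0 x N" by blast
next
  assume "\<exists>N. conjugate_deformation U x0 N0 x N"
  then obtain N where "conjugate_deformation U x0 N0 x N" by blast
  then interpret conjugate_deformation U x0 N0 x N .
  have "deformation U x0 x" by (simp add: deformation_def holo_x metric_eq)
  moreover have "normal_frame U x N" by (simp add: normal_frame_def N_orthonormal N_normal)
  moreover have "\<forall>\<alpha>. conjugate_system U (N \<alpha>) x" by (simp add: conjugate_system_def sff_def X.conj)
  moreover have "nondegenerate_joined U N0 x0 N x" unfolding nondegenerate_joined_def using nondegenerate by blast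
  ultimately show "x \<in> conjugate_deformations U x0 N0" unfolding conjugate_deformations_def by blast
qed

lemma corresponds_iff:
  fixes x :: "complex^'n::finite \<Rightarrow> complex^('n + 'a::finite)"
  assumes net: "conjugate_map U x0 (\<lambda>_::unit. N0)" and d: "deformation U x0 x"
  shows "corresponds U x0 N0 x a \<longleftrightarrow> (\<exists>N. normal_frame U x N) \<and> (\<forall>u\<in>U. \<forall>j. (a j u)\<^sup>2 = joined_square x0 x j u)"
proof -
  interpret X0: conjugate_map U x0 "\<lambda>_::unit. N0" by (rule net)
  have "bil (joined_vec N0 x0 N x j u) (joined_vec N0 x0 N x j u) = joined_square x0 x j u"
    if N: "normal_frame U x N" and u: "u \<in> U" for N j u
  proof -
    interpret deformed_net U x0 N0 x N
    proof unfold_locales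
      show "CARD('n + 'a) = CARD('n) + CARD('a)" by simp
      show "holo_map U x" using d by (simp add: deformation_def)
      show m: "induced_metric x u = induced_metric x0 u" if "u \<in> U" for u using d that by (simp add: deformation_def)
      show "det (induced_metric x u) \<noteq> 0" if "u \<in> U" for u using m [OF that] X0.det_x [OF that] by simp
    qed (use N in \<open>auto simp: normal_frame_def\<close>)
    show ?thesis using joined_dot [OF u, of j j] by (simp add: joined_square_def)
  qed
  then have eq: "(\<forall>u\<in>U. \<forall>j. (a j u)\<^sup>2 = bil (joined_vec N0 x0 N x j u) (joined_vec N0 x0 N x j u)) \<longleftrightarrow>
      (\<forall>u\<in>U. \<forall>j. (a j u)\<^sup>2 = joined_square x0 x j u)" if "normal_frame U x N" for N
    using that by simp
  show ?thesis unfolding corresponds_def by (simp add: eq cong: conj_cong)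
qed

text \<open>An isotropic \<open>V j\<close> would be orthogonal to a whole basis. After
  normalization the vectors are the rows of an orthogonal matrix, and the last claim says that its
  columns have length one.\<close>

lemma independent_orthogonal:
  fixes V :: "'n::finite \<Rightarrow> complex^'b"
  assumes card: "CARD('n) = CARD('b)" and orth: "\<forall>j k. j \<noteq> k \<longrightarrow> bil (V j) (V k) = 0"
    and indep: "\<forall>c. (\<Sum>j\<in>UNIV. c j *s V j) = 0 \<longrightarrow> (\<forall>j. c j = 0)"
  shows "bil (V j) (V j) \<noteq> 0"
    and "(\<And>j. bil v (V j) = 0) \<Longrightarrow> v = 0"
    and "(\<And>j. (a j)\<^sup>2 = bil (V j) (V j)) \<Longrightarrow> (\<Sum>j\<in>UNIV. (V j $ i)\<^sup>2 / (a j)\<^sup>2) = 1"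
proof -
  obtain \<phi> :: "'b \<Rightarrow> 'n" where \<phi>: "bij \<phi>" using card by (metis finite finite_same_card_bij)
  define H where "H = (\<chi> i. V (\<phi> i))"
  have "\<forall>c. transpose H *v c = 0 \<longrightarrow> c = 0"
  proof (intro allI impI)
    fix c assume c: "transpose H *v c = 0"
    define d where "d = (\<lambda>j. c $ inv \<phi> j)"
    have "(\<Sum>j\<in>UNIV. d j *s V j) = (\<Sum>i\<in>UNIV. d (\<phi> i) *s V (\<phi> i))"
      using \<phi> by (intro sum.reindex_bij_betw [symmetric])
    also have "\<dots> = transpose H *v c"
      using \<phi> by (simp add: d_def H_def bij_is_inj vec_eq_iff matrix_vector_mult_def transpose_def mult.commute)
    finally have "d j = 0" for j using indep c by simp
    then have "d (\<phi> i) = 0" for i by simp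
    then show "c = 0" using \<phi> by (simp add: d_def bij_is_inj vec_eq_iff)
  qed
  then have "\<exists>B. B ** transpose H = mat 1" by (simp add: matrix_left_invertible_ker)
  then have "\<exists>B. B ** H = mat 1"
    by (metis matrix_left_right_inverse matrix_transpose_mul transpose_mat transpose_transpose)
  then have ker: "H *v v = 0 \<Longrightarrow> v = 0" for v unfolding matrix_left_invertible_ker by simp
  show span: "v = 0" if v: "\<And>j. bil v (V j) = 0" for v
  proof (rule ker)
    have "(H *v v) $ i = bil v (V (\<phi> i))" for i
      by (simp add: H_def matrix_vector_mult_def bil_def mult.commute)
    then show "H *v v = 0" by (simp add: vec_eq_iff v)
  qed
  show nz: "bil (V j) (V j) \<noteq> 0" for j
  proof
    assume 0: "bil (V j) (V j) = 0"
    have "V j = 0"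
    proof (rule span)
      show "bil (V j) (V k) = 0" for k using 0 orth by (cases "j = k") auto
    qed
    have "(\<Sum>i\<in>UNIV. (if i = j then 1 else 0) *s V i) = 0"
      by (rule sum.neutral) (auto simp: \<open>V j = 0\<close>)
    from mp [OF spec [OF indep, of "\<lambda>i. if i = j then 1 else 0"] this]
    have "(if j = j then 1 else 0 :: complex) = 0" by (rule spec)
    then show False by simp
  qed
  show "(\<Sum>j\<in>UNIV. (V j $ i)\<^sup>2 / (a j)\<^sup>2) = 1" if a: "\<And>j. (a j)\<^sup>2 = bil (V j) (V j)"
  proof -
    have anz: "a j \<noteq> 0" for j using a [of j] nz [of j] by auto
    define R where "R = (\<chi> i. (1 / a (\<phi> i)) *s V (\<phi> i))"
    have "bil ((1 / a j) *s V j) ((1 / a k) *s V k) = (if j = k then 1 else 0)" for j k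
    proof (cases "j = k")
      case True
      have "bil (V j) (V j) = a j * a j" using a [of j] by (simp add: power2_eq_square)
      then show ?thesis using True anz [of j] by simp
    next
      case False
      then show ?thesis by (simp add: orth)
    qed
    then have "bil (R $ i) (R $ j) = (if i = j then 1 else 0)" for i j
      unfolding R_def vec_lambda_beta using \<phi> by (simp add: bij_is_inj inj_eq)
    then have "R ** transpose R = mat 1"
      by (simp add: matrix_matrix_mult_def transpose_def mat_def vec_eq_iff bil_def)
    then have "transpose R ** R = mat 1" using matrix_left_right_inverse by blast
    then have "(transpose R ** R) $ i $ i = mat 1 $ i $ i" by simp
    then have "(\<Sum>k\<in>UNIV. (V (\<phi> k) $ i)\<^sup>2 / (a (\<phi> k))\<^sup>2) = 1"
      by (simp add: matrix_matrix_mult_def transpose_def mat_def R_def power2_eq_square)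
    moreover have "(\<Sum>j\<in>UNIV. (V j $ i)\<^sup>2 / (a j)\<^sup>2) = (\<Sum>k\<in>UNIV. (V (\<phi> k) $ i)\<^sup>2 / (a (\<phi> k))\<^sup>2)"
      using \<phi> by (intro sum.reindex_bij_betw [symmetric])
    ultimately show ?thesis by simp
  qed
qed

context conjugate_deformation
begin

lemma distinct_map_x0: "distinct_map U x0 (\<lambda>_::unit. N0)"
  by unfold_locales (rule distinct_zero)

lemma distinct_map_x: "distinct_map U x N"
proof unfold_locales
  fix u and j k l :: 'n assume u: "u \<in> U" and d: "j \<noteq> k" "k \<noteq> l" "j \<noteq> l"
  show "christoffel (induced_metric x) l j k u = 0"
    using X0.christoffel_metric_eq [OF metric_eq u, of l j k] distinct_zero [OF u d] by simp
qed

context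
  assumes card: "CARD('a) + 1 = CARD('n)"
begin

lemma joined_facts:
  assumes u: "u \<in> U"
  shows "joined_square x0 x j u \<noteq> 0"
    and "(\<And>j. bil v (joined_vec N0 x0 N x j u) = 0) \<Longrightarrow> v = 0"
    and "(\<And>j. (a j)\<^sup>2 = joined_square x0 x j u) \<Longrightarrow> (\<Sum>j\<in>UNIV. (sff N0 x0 j j u)\<^sup>2 / (a j)\<^sup>2) + 1 = 0"
proof -
  have c: "CARD('n) = CARD('a option)" using card by (simp add: eq_commute)
  have orth: "\<forall>j k. j \<noteq> k \<longrightarrow> bil (joined_vec N0 x0 N x j u) (joined_vec N0 x0 N x k u) = 0"
  proof (intro allI impI)
    fix j k :: 'n assume jk: "j \<noteq> k"
    show "bil (joined_vec N0 x0 N x j u) (joined_vec N0 x0 N x k u) = 0"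
      by (rule joined_orthogonal [OF u jk]) (rule X.conj [OF u jk])
  qed
  have indep: "\<forall>c. (\<Sum>j\<in>UNIV. c j *s joined_vec N0 x0 N x j u) = 0 \<longrightarrow> (\<forall>j. c j = 0)"
    by (intro allI impI nondegenerate [OF u])
  note I = independent_orthogonal [where V = "\<lambda>j. joined_vec N0 x0 N x j u", OF c orth indep]
  have sq: "bil (joined_vec N0 x0 N x j u) (joined_vec N0 x0 N x j u) = joined_square x0 x j u" for j
    by (simp add: joined_dot [OF u] joined_square_def)
  show "joined_square x0 x j u \<noteq> 0" using I(1) [of j] sq by simp
  show "v = 0" if "\<And>j. bil v (joined_vec N0 x0 N x j u) = 0" by (rule I(2) [OF that])
  show "(\<Sum>j\<in>UNIV. (sff N0 x0 j j u)\<^sup>2 / (a j)\<^sup>2) + 1 = 0" if a: "\<And>j. (a j)\<^sup>2 = joined_square x0 x j u"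
  proof -
    \<comment> \<open>The column \<open>None\<close> gives the algebraic equation; the factor
      \<open>\<i>\<close> in \<open>joined_vec\<close> accounts for the sign.\<close>
    have "(\<Sum>j\<in>UNIV. (joined_vec N0 x0 N x j u $ None)\<^sup>2 / (a j)\<^sup>2) = 1"
      by (rule I(3)) (simp add: a sq)
    then have "- (\<Sum>j\<in>UNIV. (sff N0 x0 j j u)\<^sup>2 / (a j)\<^sup>2) = 1"
      by (simp add: joined_vec_def power_mult_distrib sum_negf)
    then show ?thesis by (simp only: neg_eq_iff_add_eq_0)
  qed
qed

text \<open>The third derivative is rewritten through the mixed second derivative
  \<open>vpd k (vpd j x)\<close>. The terms containing a tangent vector are intrinsic and cancel in
  the difference; the factor \<open>2\<close> comes from squaring the length.\<close>

lemma pd_joined_square: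
  assumes u: "u \<in> U" and jk: "j \<noteq> k"
  shows "pd k (joined_square x0 x j) u = 2 * christoffel (induced_metric x0) j j k u * joined_square x0 x j u"
proof -
  interpret D0: distinct_map U x0 "\<lambda>_::unit. N0" by (rule distinct_map_x0)
  interpret D: distinct_map U x N by (rule distinct_map_x)
  have third: "vpd k (vpd j (vpd j y)) u = vpd j (vpd k (vpd j y)) u" if "holo_map U y" for y :: "complex^'n \<Rightarrow> complex^'m"
    by (rule vpd_commute [OF X0.open_U X0.holo_vpd [OF that] u])
  have peq: "D.p j k v = D0.p j k v" if "v \<in> U" for j k v
    unfolding D.p_def D0.p_def by (rule X0.christoffel_metric_eq [OF metric_eq that])
  have dpeq: "pd i (D.p j k) u = pd i (D0.p j k) u" for i j k
    by (rule pd_cong [OF X0.open_U u]) (rule peq)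
  have dot: "bil (vpd m x u) (vpd j (vpd j x) u) = bil (vpd m x0 u) (vpd j (vpd j x0) u)" for m
    using dot2 [OF u, of j j m] by (simp only: bil_commute)
  have hsq: "holo_fun U (\<lambda>u. bil (vpd j (vpd j y) u) (vpd j (vpd j y) u))" if "holo_map U y" for y :: "complex^'n \<Rightarrow> complex^'m"
    by (intro holo_fun_bil X0.holo_vpd that)
  have pdsq: "pd k (\<lambda>u. bil (vpd j (vpd j y) u) (vpd j (vpd j y) u)) u = 2 * bil (vpd k (vpd j (vpd j y)) u) (vpd j (vpd j y) u)"
    if "holo_map U y" for y :: "complex^'n \<Rightarrow> complex^'m"
    unfolding X0.pd_bil [OF X0.holo_vpd [OF X0.holo_vpd [OF that]] X0.holo_vpd [OF X0.holo_vpd [OF that]] u]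
    by (simp add: bil_commute)
  have "pd k (joined_square x0 x j) u = 2 * bil (vpd j (vpd k (vpd j x)) u) (vpd j (vpd j x) u) -
      2 * bil (vpd j (vpd k (vpd j x0)) u) (vpd j (vpd j x0) u)"
    unfolding joined_square_def
    by (simp add: X0.pd_diff [OF hsq [OF holo_x] hsq [OF X0.holo_x] u] pdsq [OF holo_x] pdsq [OF X0.holo_x]
        third [OF holo_x] third [OF X0.holo_x])
  also have "\<dots> = 2 * D0.p j k u * joined_square x0 x j u"
    unfolding D.third_derivative_distinct [OF u jk [symmetric]] D0.third_derivative_distinct [OF u jk [symmetric]]
      D.second_derivative_distinct [OF u jk] D0.second_derivative_distinct [OF u jk]
    by (simp add: bil_add dot dpeq peq [OF u] joined_square_def algebra_simps)
  finally show ?thesis by (simp add: D0.p_def)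
qed

lemma solution_exists:
  assumes cv: "convex U" "u0 \<in> U"
  shows "\<exists>a\<in>solutions U x0 N0. \<forall>u\<in>U. \<forall>j. (a j u)\<^sup>2 = joined_square x0 x j u"
proof -
  have hq: "holo_fun U (joined_square x0 x j)" for j
    unfolding joined_square_def by (intro holo_fun_diff holo_fun_bil X0.holo_vpd holo_x X0.holo_x)
  have "\<forall>j. \<exists>a. holo_fun U a \<and> (\<forall>u\<in>U. (a u)\<^sup>2 = joined_square x0 x j u)"
    by (intro allI holo_sqrt_exists [OF X0.open_U cv] hq joined_facts(1))
  from choice [OF this] obtain a where a: "\<forall>j. holo_fun U (a j) \<and> (\<forall>u\<in>U. (a j u)\<^sup>2 = joined_square x0 x j u)" ..
  have ha: "holo_fun U (a j)" for j using a by simp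
  have sq: "(a j u)\<^sup>2 = joined_square x0 x j u" if "u \<in> U" for j u using a that by simp
  have nz: "a j u \<noteq> 0" if "u \<in> U" for j u using sq [OF that, of j] joined_facts(1) [OF that, of j] by auto
  have "pd k (a j) u / a j u = christoffel (induced_metric x0) j j k u" if u: "u \<in> U" and jk: "j \<noteq> k" for u j k
  proof -
    have "pd k (\<lambda>u. (a j u)\<^sup>2) u = pd k (joined_square x0 x j) u"
      by (rule pd_cong [OF X0.open_U u]) (rule sq)
    then have "2 * a j u * pd k (a j) u = 2 * christoffel (induced_metric x0) j j k u * (a j u)\<^sup>2"
      unfolding X0.pd_power2 [OF ha u] pd_joined_square [OF u jk] sq [OF u] .
    then show ?thesis using nz [OF u, of j] by (simp add: field_simps power2_eq_square)
  qed
  moreover have "(\<Sum>j\<in>UNIV. (sff N0 x0 j j u)\<^sup>2 / (a j u)\<^sup>2) + 1 = 0" if "u \<in> U" for u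
    by (rule joined_facts(3) [OF that]) (rule sq [OF that])
  ultimately have "a \<in> solutions U x0 N0" unfolding solutions_def using ha nz by simp
  then show ?thesis using sq by (intro bexI [of _ a]) simp_all
qed

lemma solution_map_of_solution:
  assumes net: "quadric_net U x0 N0 q \<sigma>" and a: "a \<in> solutions U x0 N0"
    and sq: "\<And>u j. u \<in> U \<Longrightarrow> (a j u)\<^sup>2 = joined_square x0 x j u"
  shows "solution_map U x0 N0 q \<sigma> a x N"
proof -
  note fx = framed_map_axioms
  interpret quadric_net U x0 N0 q \<sigma> by (rule net)
  interpret NS: net_solution U x0 N0 q \<sigma> a
    by unfold_locales (use a in \<open>auto simp: solutions_def sff_def\<close>)
  interpret D: distinct_map U x N by (rule distinct_map_x)
  show ?thesis
  proof unfold_locales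
    show "induced_metric x u = induced_metric x0 u" if "u \<in> U" for u by (rule metric_eq [OF that])
    show "bil (vpd j (vpd j x) u) (vpd k (vpd k x) u) =
        bil (vpd j (vpd j x0) u) (vpd k (vpd k x0) u) + (if j = k then (a j u)\<^sup>2 else 0)" if u: "u \<in> U" for u j k
    proof (cases "j = k")
      case True then show ?thesis using sq [OF u] by (simp add: joined_square_def)
    next
      case False
      have "bil (joined_vec N0 x0 N x j u) (joined_vec N0 x0 N x k u) = 0"
        by (rule joined_orthogonal [OF u False]) (rule X.conj [OF u False])
      then show ?thesis using False by (simp add: joined_dot [OF u])
    qed
    show "v = 0" if u: "u \<in> U" and t: "\<And>m. bil v (vpd m x u) = 0" and n: "\<And>l. bil v (vpd l (vpd l x) u) = 0" for u v
    proof -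
      \<comment> \<open>\<open>v\<close> is normal to \<open>x\<close>; its normal coordinates,
        extended by \<open>0\<close> in the slot \<open>None\<close>, are orthogonal to every joined
        vector.\<close>
      define w where "w = (\<chi> i. case i of None \<Rightarrow> 0 | Some \<alpha> \<Rightarrow> bil (N \<alpha> u) v)"
      have Sv: "bil (framed_map.S x m u) v = 0" for m
      proof -
        have "bil (vpd m x u) v = 0" for m using t [of m] by (simp only: bil_commute [of v])
        then show ?thesis by (simp add: framed_map.S_def [OF fx] bil_sum)
      qed
      have vexp: "v = (\<Sum>\<alpha>\<in>UNIV. bil (N \<alpha> u) v *s N \<alpha> u)"
        using framed_map.expansion [OF fx u, of v] by (simp add: Sv)
      have e: "bil v z = (\<Sum>\<alpha>\<in>UNIV. bil (N \<alpha> u) v * bil (N \<alpha> u) z)" for z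
        by (rule trans [OF arg_cong [OF vexp, of "\<lambda>w. bil w z"]]) (simp add: bil_sum)
      have "bil w (joined_vec N0 x0 N x j u) = 0" for j
        using n [of j] unfolding e bil_def [of w] sum_UNIV_option by (simp add: w_def joined_vec_def sff_def)
      then have "w = 0" by (rule joined_facts(2) [OF u])
      then have "w $ Some \<alpha> = 0" for \<alpha> by simp
      then have nv: "bil (N \<alpha> u) v = 0" for \<alpha> by (simp add: w_def)
      show "v = 0" by (rule trans [OF vexp]) (simp add: nv)
    qed
  qed
qed

end

end

section \<open>Realization of solutions and the correspondence of classes\<close>

lemma conjugate_deformations_christoffel_zero:
  fixes x :: "complex^'n::finite \<Rightarrow> complex^('n + 'a::finite)"
  assumes qp: "quadric_piece U x0 N0" and x: "x \<in> conjugate_deformations U x0 N0"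
    and "u \<in> U" "j \<noteq> k" "k \<noteq> l" "j \<noteq> l"
  shows "christoffel (induced_metric x0) l j k u = 0"
proof -
  obtain N where "conjugate_deformation U x0 N0 x N"
    using x unfolding conjugate_deformation_iff [OF quadric_piece_conjugate_map [OF qp]] by blast
  then interpret conjugate_deformation U x0 N0 x N .
  show ?thesis by (rule distinct_zero [OF assms(3-)])
qed

lemma congruent_on_second_derivative:
  assumes U: "open U" and x: "holo_map U x" and c: "congruent_on U x y" and u: "u \<in> U"
  shows "bil (vpd j (vpd j y) u) (vpd j (vpd j y) u) = bil (vpd j (vpd j x) u) (vpd j (vpd j x) u)"
proof -
  interpret holo_domain U by unfold_locales (rule U)
  obtain A c where A: "orthogonal_matrix A" and y: "\<And>u. u \<in> U \<Longrightarrow> y u = A *v x u + c"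
    using c unfolding congruent_on_def by blast
  have hc: "holo_map U (\<lambda>_. c)" by (simp add: holo_map_def holo_fun_const)
  have vc: "vpd k (\<lambda>_. c) u = 0" for k u by (simp add: vec_eq_iff vpd_nth)
  have 1: "vpd k y u = A *v vpd k x u" if u: "u \<in> U" for k u
  proof -
    have "vpd k y u = vpd k (\<lambda>u. A *v x u + c) u" by (rule vpd_cong [OF open_U u]) (rule y)
    then show ?thesis by (simp add: vpd_add [OF holo_map_matrix [OF x] hc u] vpd_matrix [OF x u] vc)
  qed
  have "vpd j (vpd j y) u = vpd j (\<lambda>u. A *v vpd j x u) u" by (rule vpd_cong [OF open_U u]) (rule 1)
  then show ?thesis by (simp add: vpd_matrix [OF holo_vpd [OF x] u] bil_orthogonal_matrix [OF A])
qed

lemma conjugate_deformation_solution: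
  fixes x :: "complex^'n::finite \<Rightarrow> complex^('n + 'a::finite)"
  assumes card: "CARD('a) + 1 = CARD('n)" and qp: "quadric_piece U x0 N0" and cv: "convex U"
    and x: "x \<in> conjugate_deformations U x0 N0"
  shows "\<exists>a\<in>solutions U x0 N0. \<forall>u\<in>U. \<forall>j. (a j u)\<^sup>2 = joined_square x0 x j u"
proof -
  obtain N where "conjugate_deformation U x0 N0 x N"
    using x unfolding conjugate_deformation_iff [OF quadric_piece_conjugate_map [OF qp]] by blast
  then interpret conjugate_deformation U x0 N0 x N .
  obtain u0 where "u0 \<in> U" using qp unfolding quadric_piece_def by blast
  then show ?thesis by (rule solution_exists [OF card cv])
qed

lemma conjugate_deformations_congruent:
  fixes x y :: "complex^'n::finite \<Rightarrow> complex^('n + 'a::finite)"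
  assumes card: "CARD('a) + 1 = CARD('n)" and qp: "quadric_piece U x0 N0" and cv: "convex U"
    and x: "x \<in> conjugate_deformations U x0 N0" and y: "y \<in> conjugate_deformations U x0 N0"
    and eq: "\<And>u j. u \<in> U \<Longrightarrow> joined_square x0 x j u = joined_square x0 y j u"
  shows "congruent_on U x y"
proof -
  obtain u0 where u0: "u0 \<in> U" using qp unfolding quadric_piece_def by blast
  obtain N1 N2 where N: "conjugate_deformation U x0 N0 x N1" "conjugate_deformation U x0 N0 y N2"
    using x y unfolding conjugate_deformation_iff [OF quadric_piece_conjugate_map [OF qp]] by blast
  obtain q \<sigma> where net: "quadric_net U x0 N0 q \<sigma>"
    using quadric_piece_quadric_net [OF qp conjugate_deformations_christoffel_zero [OF qp x]] by blast
  obtain a where a: "a \<in> solutions U x0 N0" "\<forall>u\<in>U. \<forall>j. (a j u)\<^sup>2 = joined_square x0 x j u"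
    using conjugate_deformation_solution [OF card qp cv x] by blast
  have "solution_map U x0 N0 q \<sigma> a x N1"
    by (rule conjugate_deformation.solution_map_of_solution [OF N(1) card net a(1)]) (simp add: a(2))
  moreover have "solution_map U x0 N0 q \<sigma> a y N2"
    by (rule conjugate_deformation.solution_map_of_solution [OF N(2) card net a(1)]) (simp add: a(2) eq)
  ultimately show ?thesis by (rule solution_maps_congruent [OF _ _ cv u0])
qed

lemma normal_frame_exists:
  fixes y :: "complex^'n::finite \<Rightarrow> complex^('n + 'a::finite)"
  assumes det: "\<And>u. u \<in> U \<Longrightarrow> det (induced_metric y u) \<noteq> 0"
  shows "\<exists>N. normal_frame U y N"
proof -
  have "\<forall>u. \<exists>Nu :: 'a \<Rightarrow> complex^('n + 'a). u \<in> U \<longrightarrow>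
      (\<forall>\<alpha> \<beta>. bil (Nu \<alpha>) (Nu \<beta>) = (if \<alpha> = \<beta> then 1 else 0)) \<and> (\<forall>\<alpha> j. bil (Nu \<alpha>) (vpd j y u) = 0)"
  proof
    fix u show "\<exists>Nu :: 'a \<Rightarrow> complex^('n + 'a). u \<in> U \<longrightarrow>
      (\<forall>\<alpha> \<beta>. bil (Nu \<alpha>) (Nu \<beta>) = (if \<alpha> = \<beta> then 1 else 0)) \<and> (\<forall>\<alpha> j. bil (Nu \<alpha>) (vpd j y u) = 0)"
    proof (cases "u \<in> U")
      case True
      have "det (\<chi> j k. bil (vpd j y u) (vpd k y u)) \<noteq> 0"
        using det [OF True] by (simp add: induced_metric_def)
      from orthonormal_normals_exist [where T = "\<lambda>j. vpd j y u" and 'b = 'a, OF _ this]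
      show ?thesis by simp
    qed simp
  qed
  from choice [OF this] obtain Nf :: "complex^'n \<Rightarrow> 'a \<Rightarrow> complex^('n + 'a)" where Nf: "\<forall>u. u \<in> U \<longrightarrow>
      (\<forall>\<alpha> \<beta>. bil (Nf u \<alpha>) (Nf u \<beta>) = (if \<alpha> = \<beta> then 1 else 0)) \<and> (\<forall>\<alpha> j. bil (Nf u \<alpha>) (vpd j y u) = 0)" ..
  then have "normal_frame U y (\<lambda>\<alpha> u. Nf u \<alpha>)" by (simp add: normal_frame_def)
  then show ?thesis by (rule exI [of _ "\<lambda>\<alpha> u. Nf u \<alpha>"])
qed

text \<open>The joined vectors are orthogonal by the Gauss equations, so their independence reduces
  to non-vanishing squares.\<close>

lemma conjugate_deformationI:
  fixes y :: "complex^'n::finite \<Rightarrow> complex^('n + 'a::finite)"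
  assumes qp: "quadric_piece U x0 N0" and d: "deformation U x0 y" and N: "normal_frame U y N"
    and conj: "\<And>\<alpha>. conjugate_system U (N \<alpha>) y"
    and nz: "\<And>u j. u \<in> U \<Longrightarrow> joined_square x0 y j u \<noteq> 0"
  shows "y \<in> conjugate_deformations U x0 N0"
proof -
  interpret X0: conjugate_map U x0 "\<lambda>_::unit. N0" by (rule quadric_piece_conjugate_map [OF qp])
  have metric: "induced_metric y u = induced_metric x0 u" if "u \<in> U" for u using d that by (simp add: deformation_def)
  have Nt: "bil (N \<alpha> u) (vpd j (vpd k y) u) = 0" if "u \<in> U" "j \<noteq> k" for u \<alpha> j k
    using conj that by (simp add: conjugate_system_def sff_def)
  interpret DN: deformed_net U x0 N0 y N
  proof unfold_locales
    show "CARD('n + 'a) = CARD('n) + CARD('a)" by simp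
    show "holo_map U y" using d by (simp add: deformation_def)
    show "det (induced_metric y u) \<noteq> 0" if "u \<in> U" for u using X0.det_x [OF that] metric [OF that] by simp
  qed (use N metric in \<open>auto simp: normal_frame_def\<close>)
  have orth: "bil (joined_vec N0 x0 N y j u) (joined_vec N0 x0 N y k u) = (if j = k then joined_square x0 y j u else 0)"
    if u: "u \<in> U" for j k u
  proof (cases "j = k")
    case True then show ?thesis by (simp add: DN.joined_dot [OF u] joined_square_def)
  next
    case False
    have "bil (joined_vec N0 x0 N y j u) (joined_vec N0 x0 N y k u) = 0"
      by (rule DN.joined_orthogonal [OF u False]) (rule Nt [OF u False])
    then show ?thesis using False by simp
  qed
  have "conjugate_deformation U x0 N0 y N"
  proof unfold_locales
    show "bil (N \<alpha> u) (vpd j (vpd k y) u) = 0" if "u \<in> U" "j \<noteq> k" for u \<alpha> j k by (rule Nt [OF that])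
    fix u c j assume u: "u \<in> U" and c: "(\<Sum>j\<in>UNIV. c j *s joined_vec N0 x0 N y j u) = 0"
    have "bil (\<Sum>j\<in>UNIV. c j *s joined_vec N0 x0 N y j u) (joined_vec N0 x0 N y j u) = c j * joined_square x0 y j u"
      by (simp add: bil_sum orth [OF u])
    then show "c j = 0" using c nz [OF u, of j] by simp
  qed
  then show ?thesis
    unfolding conjugate_deformation_iff [OF quadric_piece_conjugate_map [OF qp]] by blast
qed

lemma conjugate_deformations_subset:
  assumes x: "x \<in> conjugate_deformations U x0 N0" and V: "V \<subseteq> U"
  shows "x \<in> conjugate_deformations V x0 N0"
proof -
  obtain N where "deformation U x0 x" "normal_frame U x N" "\<forall>\<alpha>. conjugate_system U (N \<alpha>) x"
    "nondegenerate_joined U N0 x0 N x" using x unfolding conjugate_deformations_def by blast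
  moreover from this have "deformation V x0 x" "normal_frame V x N" "\<forall>\<alpha>. conjugate_system V (N \<alpha>) x"
    using V holo_map_subset [OF _ V, of x]
    unfolding deformation_def normal_frame_def conjugate_system_def by (simp_all add: subset_iff)
  moreover have "nondegenerate_joined V N0 x0 N x"
    using \<open>nondegenerate_joined U N0 x0 N x\<close> unfolding nondegenerate_joined_def
    by (intro ballI) (drule bspec, erule subsetD [OF V], assumption)
  ultimately show ?thesis unfolding conjugate_deformations_def by blast
qed

lemma conjugate_deformation_of_solution:
  assumes card: "CARD('a::finite) + 1 = CARD('n::finite)" and qp: "quadric_piece U x0 N0" and cv: "convex U"
    and distinct: "\<And>u j k l. u \<in> U \<Longrightarrow> j \<noteq> k \<Longrightarrow> k \<noteq> l \<Longrightarrow> j \<noteq> l \<Longrightarrow> christoffel (induced_metric x0) l j k u = 0"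
    and a: "a \<in> solutions U x0 N0"
  shows "\<exists>y \<in> (conjugate_deformations U x0 N0 :: (complex^'n \<Rightarrow> complex^('n + 'a)) set).
    \<forall>u\<in>U. \<forall>j. (a j u)\<^sup>2 = joined_square x0 y j u"
proof -
  obtain u0 where u0: "u0 \<in> U" using qp unfolding quadric_piece_def by blast
  obtain q \<sigma> where "quadric_net U x0 N0 q \<sigma>"
    using quadric_piece_quadric_net [OF qp distinct] by blast
  then interpret quadric_net U x0 N0 q \<sigma> .
  interpret NS: net_solution U x0 N0 q \<sigma> a
    by unfold_locales (use a in \<open>auto simp: solutions_def sff_def\<close>)
  from NS.deformation_exists [where 'c = 'a, OF cv u0 card]
  obtain y :: "complex^'n \<Rightarrow> complex^('n + 'a)" where y: "holo_map U y"
    and m: "\<forall>u\<in>U. \<forall>j k. bil (vpd j y u) (vpd k y u) = bil (vpd j x0 u) (vpd k x0 u)"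
    and t: "\<forall>u\<in>U. \<forall>j k. j \<noteq> k \<longrightarrow> vpd j (vpd k y) u = p j k u *s vpd j y u + p k j u *s vpd k y u"
    and sq: "\<forall>u\<in>U. \<forall>j. bil (vpd j (vpd j y) u) (vpd j (vpd j y) u) =
      bil (vpd j (vpd j x0) u) (vpd j (vpd j x0) u) + (a j u)\<^sup>2"
    by (elim exE conjE) (rule that)
  have metric: "induced_metric y u = induced_metric x0 u" if "u \<in> U" for u
    using m that by (simp add: vec_eq_iff metric_nth)
  obtain N :: "'a \<Rightarrow> complex^'n \<Rightarrow> complex^('n + 'a)" where N: "normal_frame U y N"
    using normal_frame_exists [of U y] det_x metric by auto
  have "conjugate_system U (N \<alpha>) y" for \<alpha>
    using t N by (simp add: conjugate_system_def sff_def normal_frame_def bil_add)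
  moreover have "joined_square x0 y j u \<noteq> 0" if "u \<in> U" for u j
    using sq NS.a_nz [OF that, of j] that by (simp add: joined_square_def)
  ultimately have "y \<in> conjugate_deformations U x0 N0"
    using conjugate_deformationI [OF qp _ N] y metric by (simp add: deformation_def)
  then show ?thesis using sq by (intro bexI [of _ y]) (simp_all add: joined_square_def)
qed

text \<open>The quotient has square one, hence vanishing derivative, and is constant on the convex
  domain.\<close>

lemma equal_squares_sign:
  fixes a b :: "complex^'n \<Rightarrow> complex"
  assumes U: "open U" "convex U" and a: "holo_fun U a" "\<And>u. u \<in> U \<Longrightarrow> a u \<noteq> 0" and b: "holo_fun U b"
    and eq: "\<And>u. u \<in> U \<Longrightarrow> (b u)\<^sup>2 = (a u)\<^sup>2"
  shows "\<exists>\<epsilon>\<in>{1, -1}. \<forall>u\<in>U. b u = \<epsilon> * a u"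
proof (cases "U = {}")
  case False
  then obtain u0 where u0: "u0 \<in> U" by blast
  interpret holo_domain U by unfold_locales (rule U)
  define f where "f = (\<lambda>u. b u / a u)"
  have hf: "holo_fun U f" unfolding f_def by (intro holo_fun_divide a b)
  have f2: "(f u)\<^sup>2 = 1" if "u \<in> U" for u using eq [OF that] a(2) [OF that] by (simp add: f_def power_divide)
  have "f u = f u0" if u: "u \<in> U" for u
  proof (rule pd_zero_imp_const [OF U u0 u hf])
    fix k u assume u: "u \<in> U"
    have "pd k (\<lambda>u. (f u)\<^sup>2) u = pd k (\<lambda>_. 1) u" by (rule pd_cong [OF open_U u]) (rule f2)
    then have "2 * f u * pd k f u = 0" by (simp add: pd_power2 [OF hf u])
    moreover have "f u \<noteq> 0" using f2 [OF u] by auto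
    ultimately show "pd k f u = 0" by simp
  qed
  moreover have "f u0 \<in> {1, -1}" using f2 [OF u0] by (simp add: power2_eq_1_iff)
  ultimately show ?thesis using a(2) by (intro bexI [of _ "f u0"]) (auto simp: f_def field_simps)
qed auto

text \<open>Both quotients are classified by the functions \<open>joined_square x0 x j\<close>,
  which equal the squares of \<open>a j\<close>: congruence means equality of these functions, and
  sign changes are exactly the fibres of squaring.\<close>

theorem correspondence_bij:
  assumes card: "CARD('a::finite) + 1 = CARD('n::finite)" and qp: "quadric_piece U x0 N0" and cv: "convex U"
    and distinct: "\<And>u j k l. u \<in> U \<Longrightarrow> j \<noteq> k \<Longrightarrow> k \<noteq> l \<Longrightarrow> j \<noteq> l \<Longrightarrow> christoffel (induced_metric x0) l j k u = 0"
  shows "bij_betw (correspondence U x0 N0)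
    ((conjugate_deformations U x0 N0 :: (complex^'n \<Rightarrow> complex^('n + 'a)) set) //
      congruence_rel U (conjugate_deformations U x0 N0))
    (solutions U x0 N0 // sign_rel U (solutions U x0 N0))"
proof -
  define D where "D = (conjugate_deformations U x0 N0 :: (complex^'n \<Rightarrow> complex^('n + 'a)) set)"
  define Sol where "Sol = solutions U x0 N0"
  have U: "open U" using qp by (simp add: quadric_piece_def)
  have Dd: "deformation U x0 x" "\<exists>N. normal_frame U x N" if "x \<in> D" for x
    using that unfolding D_def conjugate_deformations_def by blast+
  define eqS where "eqS = (\<lambda>(x :: complex^'n \<Rightarrow> complex^('n + 'a)) (y :: complex^'n \<Rightarrow> complex^('n + 'a)). \<forall>u\<in>U. \<forall>j. joined_square x0 x j u = joined_square x0 y j u)"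
  define cor where "cor = (\<lambda>(x :: complex^'n \<Rightarrow> complex^('n + 'a)) a. \<forall>u\<in>U. \<forall>j. (a j u :: complex)\<^sup>2 = joined_square x0 x j u)"
  have cong_iff: "congruent_on U x y \<longleftrightarrow> eqS x y" if x: "x \<in> D" and y: "y \<in> D" for x y
  proof
    assume "congruent_on U x y"
    then show "eqS x y" unfolding eqS_def joined_square_def
      using congruent_on_second_derivative [OF U _ \<open>congruent_on U x y\<close>] Dd(1) [OF x] by (simp add: deformation_def)
  next
    assume "eqS x y"
    then show "congruent_on U x y"
      by (intro conjugate_deformations_congruent [OF card qp cv]) (use x y in \<open>simp_all add: D_def eqS_def\<close>)
  qed
  have cl: "congruence_rel U D `` {x} = {y \<in> D. eqS x y}" if "x \<in> D" for x
    unfolding congruence_rel_def using cong_iff that by auto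
  have cor_iff: "corresponds U x0 N0 x a \<longleftrightarrow> cor x a" if "x \<in> D" for x a
    using corresponds_iff [OF quadric_piece_conjugate_map [OF qp] Dd(1) [OF that]] Dd(2) [OF that] by (simp add: cor_def)
  have corcl: "correspondence U x0 N0 (congruence_rel U D `` {x}) = {a \<in> Sol. cor x a}" if x: "x \<in> D" for x
  proof -
    have "(\<exists>y\<in>{y \<in> D. eqS x y}. corresponds U x0 N0 y a) \<longleftrightarrow> cor x a" for a
    proof
      assume "\<exists>y\<in>{y \<in> D. eqS x y}. corresponds U x0 N0 y a"
      then show "cor x a" using cor_iff by (auto simp: cor_def eqS_def)
    next
      assume "cor x a"
      then show "\<exists>y\<in>{y \<in> D. eqS x y}. corresponds U x0 N0 y a"
        using x by (intro bexI [of _ x]) (simp_all add: cor_iff eqS_def)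
    qed
    then show ?thesis unfolding correspondence_def cl [OF x] Sol_def by simp
  qed
  have sign: "sign_rel U Sol `` {a} = {b \<in> Sol. \<forall>u\<in>U. \<forall>j. (b j u)\<^sup>2 = (a j u)\<^sup>2}" if a: "a \<in> Sol" for a
  proof -
    have "(\<forall>j. \<exists>\<epsilon>\<in>{1, -1}. \<forall>u\<in>U. b j u = \<epsilon> * a j u) \<longleftrightarrow> (\<forall>u\<in>U. \<forall>j. (b j u)\<^sup>2 = (a j u)\<^sup>2)" if b: "b \<in> Sol" for b
    proof
      assume l: "\<forall>j. \<exists>\<epsilon>\<in>{1, -1}. \<forall>u\<in>U. b j u = \<epsilon> * a j u"
      show "\<forall>u\<in>U. \<forall>j. (b j u)\<^sup>2 = (a j u)\<^sup>2"
      proof (intro ballI allI)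
        fix u j assume u: "u \<in> U"
        from l obtain \<epsilon> where "\<epsilon> \<in> {1, -1}" "\<forall>u\<in>U. b j u = \<epsilon> * a j u" by blast
        then show "(b j u)\<^sup>2 = (a j u)\<^sup>2" using u by auto
      qed
    next
      assume r: "\<forall>u\<in>U. \<forall>j. (b j u)\<^sup>2 = (a j u)\<^sup>2"
      show "\<forall>j. \<exists>\<epsilon>\<in>{1, -1}. \<forall>u\<in>U. b j u = \<epsilon> * a j u"
        by (intro allI equal_squares_sign [OF U cv]) (use a b r in \<open>simp_all add: Sol_def solutions_def\<close>)
    qed
    then show ?thesis unfolding sign_rel_def using a by auto
  qed
  have ex: "\<exists>a\<in>Sol. cor x a" if "x \<in> D" for x
    using conjugate_deformation_solution [OF card qp cv] that unfolding D_def Sol_def cor_def by blast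
  have ex': "\<exists>x\<in>D. cor x a" if "a \<in> Sol" for a
    using conjugate_deformation_of_solution [where 'a = 'a, OF card qp cv distinct] that
    unfolding D_def Sol_def cor_def by blast
  have key: "correspondence U x0 N0 (congruence_rel U D `` {x}) = sign_rel U Sol `` {a}"
    if "x \<in> D" "a \<in> Sol" "cor x a" for x a
    unfolding corcl [OF that(1)] sign [OF that(2)] using that(3) by (simp add: cor_def)
  have "bij_betw (correspondence U x0 N0) (D // congruence_rel U D) (Sol // sign_rel U Sol)"
    unfolding bij_betw_def
  proof
    show "inj_on (correspondence U x0 N0) (D // congruence_rel U D)"
    proof (rule inj_onI)
      fix X Y assume X: "X \<in> D // congruence_rel U D" and Y: "Y \<in> D // congruence_rel U D"
        and eq: "correspondence U x0 N0 X = correspondence U x0 N0 Y"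
      obtain x where x: "x \<in> D" "X = congruence_rel U D `` {x}" using X by (rule quotientE)
      obtain y where y: "y \<in> D" "Y = congruence_rel U D `` {y}" using Y by (rule quotientE)
      obtain a where a: "a \<in> Sol" "cor x a" using ex [OF x(1)] by blast
      then have "a \<in> correspondence U x0 N0 Y" using eq corcl [OF x(1)] x(2) by auto
      then have "cor y a" using corcl [OF y(1)] y(2) by auto
      then have "eqS x z \<longleftrightarrow> eqS y z" for z using a(2) by (simp add: cor_def eqS_def)
      then show "X = Y" unfolding x(2) y(2) cl [OF x(1)] cl [OF y(1)] by simp
    qed
    show "correspondence U x0 N0 ` (D // congruence_rel U D) = Sol // sign_rel U Sol"
    proof (intro equalityI subsetI)
      fix Z assume "Z \<in> correspondence U x0 N0 ` (D // congruence_rel U D)"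
      then obtain X where X: "X \<in> D // congruence_rel U D" and Z: "Z = correspondence U x0 N0 X" by blast
      obtain x where x: "x \<in> D" "X = congruence_rel U D `` {x}" using X by (rule quotientE)
      obtain a where a: "a \<in> Sol" "cor x a" using ex [OF x(1)] by blast
      show "Z \<in> Sol // sign_rel U Sol" unfolding Z x(2) key [OF x(1) a] using a(1) by (rule quotientI)
    next
      fix Z assume "Z \<in> Sol // sign_rel U Sol"
      then obtain a where a: "a \<in> Sol" and Z: "Z = sign_rel U Sol `` {a}" by (rule quotientE)
      obtain x where x: "x \<in> D" "cor x a" using ex' [OF a] by blast
      show "Z \<in> correspondence U x0 N0 ` (D // congruence_rel U D)"
        unfolding Z key [OF x(1) a x(2), symmetric] using x(1) by (intro imageI quotientI)
    qed
  qed
  then show ?thesis unfolding D_def Sol_def .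
qed

section \<open>Warped spherical coordinates\<close>

locale chart = holo_domain V for V :: "(complex^'n::finite) set" +
  fixes \<iota> :: "nat \<Rightarrow> 'n"
  assumes enum: "bij_betw \<iota> {1..CARD('n)} UNIV"
begin

lemma enum_eq_iff: "k \<in> {1..CARD('n)} \<Longrightarrow> m \<in> {1..CARD('n)} \<Longrightarrow> \<iota> k = \<iota> m \<longleftrightarrow> k = m"
  using enum unfolding bij_betw_def inj_on_def by blast

lemma enum_cases: obtains m where "m \<in> {1..CARD('n)}" "l = \<iota> m"
  using enum unfolding bij_betw_def by blast

lemma cosprod_last: "cosprod \<iota> u CARD('n) = 1"
  by (simp add: cosprod_def)

lemma cosprod_step:
  assumes "k \<in> {1..CARD('n)}"
  shows "cosprod \<iota> u (k - 1) = cos (u $ \<iota> k) * cosprod \<iota> u k"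
  using assms by (simp add: cosprod_def prod.atLeast_Suc_atMost)

lemma holo_cos: "holo_fun V (\<lambda>u. cos (u $ i))" and holo_sin: "holo_fun V (\<lambda>u. sin (u $ i))"
  by (rule holo_fun_compose [OF holo_fun_coord]; simp add: field_differentiable_at_cos field_differentiable_at_sin)+

lemma pd_cos: "pd k (\<lambda>u. cos (u $ i)) u = (if i = k then - sin (u $ i) else 0)"
  and pd_sin: "pd k (\<lambda>u. sin (u $ i)) u = (if i = k then cos (u $ i) else 0)"
  by (rule pd_coord_compose, simp)+

lemma holo_cosprod: "holo_fun V (\<lambda>u. cosprod \<iota> u k)"
  unfolding cosprod_def by (intro holo_fun_prod holo_cos)

lemma pd_cosprod_step:
  assumes "k \<in> {1..CARD('n)}" "m \<in> {1..CARD('n)}" "u \<in> V"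
  shows "pd (\<iota> m) (\<lambda>u. cosprod \<iota> u (k - 1)) u =
    (if m = k then - sin (u $ \<iota> k) else 0) * cosprod \<iota> u k + cos (u $ \<iota> k) * pd (\<iota> m) (\<lambda>u. cosprod \<iota> u k) u"
  unfolding cosprod_step [OF assms(1)] pd_mult [OF holo_cos holo_cosprod assms(3)] pd_cos
  using enum_eq_iff [OF assms(1,2)] by auto

lemma pd_cosprod_low:
  assumes u: "u \<in> V" and m: "m \<in> {1..CARD('n)}" and k: "k \<le> CARD('n)" and mk: "m \<le> k"
  shows "pd (\<iota> m) (\<lambda>u. cosprod \<iota> u k) u = 0"
  using k mk
proof (induction k rule: inc_induct)
  case base show ?case by (simp add: cosprod_last)
next
  case (step k)
  then show ?case using pd_cosprod_step [of "Suc k" m u] u m by simp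
qed

lemma holo_warped:
  assumes "\<And>u. u \<in> V \<Longrightarrow> (G has_field_derivative G1 (u $ \<iota> k)) (at (u $ \<iota> k))"
  shows "holo_fun V (\<lambda>u. G (u $ \<iota> k))"
  by (rule holo_fun_compose [OF holo_fun_coord]) (use assms in \<open>auto simp: field_differentiable_def\<close>)

lemma pd_warped_low:
  assumes u: "u \<in> V" and m: "m \<in> {1..CARD('n)}" and k: "k \<in> {1..CARD('n)}" and mk: "m \<le> k"
    and G: "\<And>u. u \<in> V \<Longrightarrow> (G has_field_derivative G1 (u $ \<iota> k)) (at (u $ \<iota> k))"
  shows "pd (\<iota> m) (\<lambda>u. cosprod \<iota> u k * G (u $ \<iota> k)) u = (if m = k then cosprod \<iota> u k * G1 (u $ \<iota> k) else 0)"
proof -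
  have "pd (\<iota> m) (\<lambda>u. G (u $ \<iota> k)) u = (if m = k then G1 (u $ \<iota> k) else 0)"
    using pd_coord_compose [OF G [OF u], of "\<iota> m"] enum_eq_iff [OF k m] by (simp add: eq_commute)
  moreover have "pd (\<iota> m) (\<lambda>u. cosprod \<iota> u k) u = 0"
    by (rule pd_cosprod_low [OF u m _ mk]) (use k in simp)
  ultimately show ?thesis
    by (simp add: pd_mult [OF holo_cosprod holo_warped [OF G] u])
qed

lemma open_projection: "open ((\<lambda>u. u $ i) ` V)"
proof -
  have "linear (\<lambda>u :: complex^'n. u $ i)" by (rule bounded_linear.linear [OF bounded_linear_vec_nth])
  moreover have "surj (\<lambda>u :: complex^'n. u $ i)"
    by (rule surjI [where f = "\<lambda>c. \<chi> _. c"]) simp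
  ultimately show ?thesis by (rule open_surjective_linear_image [OF open_U])
qed

end

text \<open>The index starts at \<open>2\<close> because \<open>cosprod \<iota> u k\<close> with
  \<open>1 \<le> k\<close> contains no cosine of the first coordinate, which may vanish.\<close>

locale regular_chart = chart V \<iota> for V :: "(complex^'n::finite) set" and \<iota> :: "nat \<Rightarrow> 'n" +
  assumes cos_nz: "u \<in> V \<Longrightarrow> 2 \<le> m \<Longrightarrow> m \<le> CARD('n) \<Longrightarrow> cos (u $ \<iota> m) \<noteq> 0"
begin

lemma cosprod_nz: "u \<in> V \<Longrightarrow> 1 \<le> k \<Longrightarrow> cosprod \<iota> u k \<noteq> 0"
  unfolding cosprod_def using cos_nz by (simp add: prod_zero_iff)

lemma pd_cosprod_high:
  assumes u: "u \<in> V" and m: "m \<in> {1..CARD('n)}" and k: "1 \<le> k" "k < m"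
  shows "pd (\<iota> m) (\<lambda>u. cosprod \<iota> u k) u = - tan (u $ \<iota> m) * cosprod \<iota> u k"
proof -
  have "k \<le> CARD('n)" using k m by simp
  then show ?thesis using k
  proof (induction k rule: inc_induct)
    case base then show ?case using m by simp
  next
    case (step k)
    have c: "cos (u $ \<iota> m) \<noteq> 0" using cos_nz [OF u] m step by simp
    have s: "Suc k \<in> {1..CARD('n)}" using step by simp
    have st: "cosprod \<iota> u k = cos (u $ \<iota> (Suc k)) * cosprod \<iota> u (Suc k)" using cosprod_step [OF s, of u] by simp
    show ?case
    proof (cases "m = Suc k")
      case True
      have "pd (\<iota> m) (\<lambda>u. cosprod \<iota> u (Suc k)) u = 0"
        by (rule pd_cosprod_low [OF u m]) (use s True in auto)
      then show ?thesis using pd_cosprod_step [OF s m u] st c True by (simp add: tan_def)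
    next
      case False
      then have "pd (\<iota> m) (\<lambda>u. cosprod \<iota> u (Suc k)) u = - tan (u $ \<iota> m) * cosprod \<iota> u (Suc k)"
        using step by simp
      then show ?thesis using pd_cosprod_step [OF s m u] st False by simp
    qed
  qed
qed

lemma pd_warped:
  assumes u: "u \<in> V" and m: "m \<in> {1..CARD('n)}" and k: "k \<in> {1..CARD('n)}"
    and G: "\<And>u. u \<in> V \<Longrightarrow> (G has_field_derivative G1 (u $ \<iota> k)) (at (u $ \<iota> k))"
  shows "pd (\<iota> m) (\<lambda>u. cosprod \<iota> u k * G (u $ \<iota> k)) u =
    (if m < k then 0 else if m = k then cosprod \<iota> u k * G1 (u $ \<iota> k) else - tan (u $ \<iota> m) * (cosprod \<iota> u k * G (u $ \<iota> k)))"
proof (cases "m \<le> k")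
  case True
  then show ?thesis using pd_warped_low [OF u m k True G] by auto
next
  case False
  have "pd (\<iota> m) (\<lambda>u. G (u $ \<iota> k)) u = 0"
    using pd_coord_compose [OF G [OF u], of "\<iota> m"] enum_eq_iff [OF k m] False by simp
  moreover have "pd (\<iota> m) (\<lambda>u. cosprod \<iota> u k) u = - tan (u $ \<iota> m) * cosprod \<iota> u k"
    by (rule pd_cosprod_high [OF u m]) (use k False in simp_all)
  ultimately show ?thesis using False
    by (simp add: pd_mult [OF holo_cosprod holo_warped [OF G] u])
qed

lemma holo_tan: "2 \<le> m \<Longrightarrow> m \<le> CARD('n) \<Longrightarrow> holo_fun V (\<lambda>u. tan (u $ \<iota> m))"
  unfolding tan_def by (intro holo_fun_divide holo_sin holo_cos cos_nz)

lemma pd_tan: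
  assumes "2 \<le> m" "m \<le> CARD('n)" "u \<in> V"
  shows "pd k (\<lambda>u. tan (u $ \<iota> m)) u = (if \<iota> m = k then 1 + (tan (u $ \<iota> m))\<^sup>2 else 0)"
proof -
  have c: "cos (u $ \<iota> m) \<noteq> 0" by (rule cos_nz [OF assms(3,1,2)])
  have "(tan has_field_derivative inverse ((cos (u $ \<iota> m))\<^sup>2)) (at (u $ \<iota> m))" by (rule DERIV_tan [OF c])
  moreover have "inverse ((cos (u $ \<iota> m))\<^sup>2) = 1 + (tan (u $ \<iota> m))\<^sup>2"
  proof -
    have "(tan (u $ \<iota> m))\<^sup>2 = (1 - (cos (u $ \<iota> m))\<^sup>2) / (cos (u $ \<iota> m))\<^sup>2"
      by (simp add: tan_def power_divide sin_squared_eq)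
    then show ?thesis using c by (simp add: inverse_eq_divide diff_divide_distrib)
  qed
  ultimately show ?thesis using pd_coord_compose by metis
qed

end

text \<open>The common shape of the spherical coordinates and of the explicit family: each component
  is a one-variable function of the coordinate at its level times the cosines of the higher
  coordinates.\<close>

locale warped_map = regular_chart V \<iota> for V :: "(complex^'n::finite) set" and \<iota> :: "nat \<Rightarrow> 'n" +
  fixes Y :: "complex^'n \<Rightarrow> complex^'m::finite" and lev :: "'m \<Rightarrow> nat" and G G1 G2 :: "'m \<Rightarrow> complex \<Rightarrow> complex"
  assumes lev: "lev i \<in> {1..CARD('n)}"
    and Y_nth: "u \<in> V \<Longrightarrow> Y u $ i = cosprod \<iota> u (lev i) * G i (u $ \<iota> (lev i))"
    and G: "u \<in> V \<Longrightarrow> (G i has_field_derivative G1 i (u $ \<iota> (lev i))) (at (u $ \<iota> (lev i)))"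
    and G1: "u \<in> V \<Longrightarrow> (G1 i has_field_derivative G2 i (u $ \<iota> (lev i))) (at (u $ \<iota> (lev i)))"
begin

lemma holo_Y: "holo_map V Y"
  unfolding holo_map_def
proof
  fix i
  show "holo_fun V (\<lambda>u. Y u $ i)"
    by (rule holo_fun_transfer [OF holo_fun_mult [OF holo_cosprod [of "lev i"] holo_warped [OF G [of _ i]]] open_U])
      (simp_all add: Y_nth)
qed

lemma vpd_Y:
  assumes u: "u \<in> V" and m: "m \<in> {1..CARD('n)}"
  shows "vpd (\<iota> m) Y u $ i = (if m < lev i then 0
    else if m = lev i then cosprod \<iota> u (lev i) * G1 i (u $ \<iota> (lev i)) else - tan (u $ \<iota> m) * Y u $ i)"
proof -
  have "vpd (\<iota> m) Y u $ i = pd (\<iota> m) (\<lambda>u. cosprod \<iota> u (lev i) * G i (u $ \<iota> (lev i))) u"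
    unfolding vpd_nth by (rule pd_cong [OF open_U u]) (rule Y_nth)
  then show ?thesis using pd_warped [OF u m lev G] by (simp add: Y_nth [OF u])
qed

lemma vpd_mixed:
  assumes u: "u \<in> V" and m: "m \<in> {1..CARD('n)}" and l: "l \<in> {1..CARD('n)}" and ml: "m < l"
  shows "vpd (\<iota> l) (vpd (\<iota> m) Y) u = - tan (u $ \<iota> l) *s vpd (\<iota> m) Y u"
proof -
  have "pd (\<iota> l) (\<lambda>u. vpd (\<iota> m) Y u $ i) u = - tan (u $ \<iota> l) * vpd (\<iota> m) Y u $ i" for i
  proof -
    consider "m < lev i" | "m = lev i" | "lev i < m" by linarith
    then show ?thesis
    proof cases
      case 1
      have "pd (\<iota> l) (\<lambda>u. vpd (\<iota> m) Y u $ i) u = pd (\<iota> l) (\<lambda>_. 0) u"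
        by (rule pd_cong [OF open_U u]) (simp add: vpd_Y [OF _ m] 1)
      then show ?thesis by (simp add: vpd_Y [OF u m] 1)
    next
      case 2
      have "pd (\<iota> l) (\<lambda>u. vpd (\<iota> m) Y u $ i) u = pd (\<iota> l) (\<lambda>u. cosprod \<iota> u (lev i) * G1 i (u $ \<iota> (lev i))) u"
        by (rule pd_cong [OF open_U u]) (simp add: vpd_Y [OF _ m] 2 [symmetric])
      then show ?thesis using pd_warped [OF u l lev [of i] G1 [of _ i]] ml by (simp add: vpd_Y [OF u m] 2 [symmetric])
    next
      case 3
      have m2: "2 \<le> m" "m \<le> CARD('n)" using 3 lev [of i] m by auto
      have "pd (\<iota> l) (\<lambda>u. vpd (\<iota> m) Y u $ i) u = pd (\<iota> l) (\<lambda>u. - (tan (u $ \<iota> m) * Y u $ i)) u"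
        by (rule pd_cong [OF open_U u]) (use 3 in \<open>simp add: vpd_Y [OF _ m]\<close>)
      also have "\<dots> = - (tan (u $ \<iota> m) * vpd (\<iota> l) Y u $ i)"
        using pd_mult [OF holo_tan [OF m2] holo_map_nth [OF holo_Y] u] pd_minus [OF holo_fun_mult [OF holo_tan [OF m2] holo_map_nth [OF holo_Y]] u]
          enum_eq_iff [OF m l] ml
        by (simp add: pd_tan [OF m2 u] vpd_nth)
      finally show ?thesis using 3 ml by (simp add: vpd_Y [OF u m] vpd_Y [OF u l])
    qed
  qed
  then show ?thesis by (simp add: vec_eq_iff vpd_nth)
qed

text \<open>A component of level below \<open>m\<close> depends on the \<open>m\<close>-th
  coordinate only through a factor cosine, hence the value \<open>- Y u $ i\<close>.\<close>

lemma vpd_pure: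
  assumes u: "u \<in> V" and m: "m \<in> {1..CARD('n)}"
  shows "vpd (\<iota> m) (vpd (\<iota> m) Y) u $ i = (if m < lev i then 0
    else if m = lev i then cosprod \<iota> u (lev i) * G2 i (u $ \<iota> (lev i)) else - Y u $ i)"
proof -
  consider "m < lev i" | "m = lev i" | "lev i < m" by linarith
  then show ?thesis
  proof cases
    case 1
    have "pd (\<iota> m) (\<lambda>u. vpd (\<iota> m) Y u $ i) u = pd (\<iota> m) (\<lambda>_. 0) u"
      by (rule pd_cong [OF open_U u]) (simp add: vpd_Y [OF _ m] 1)
    then show ?thesis by (simp add: vpd_nth [of _ "vpd (\<iota> m) Y"] 1)
  next
    case 2
    have "pd (\<iota> m) (\<lambda>u. vpd (\<iota> m) Y u $ i) u = pd (\<iota> m) (\<lambda>u. cosprod \<iota> u (lev i) * G1 i (u $ \<iota> (lev i))) u"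
      by (rule pd_cong [OF open_U u]) (simp add: vpd_Y [OF _ m] 2 [symmetric])
    then show ?thesis using pd_warped [OF u m lev [of i] G1 [of _ i]]
      by (simp add: vpd_nth [of _ "vpd (\<iota> m) Y"] 2 [symmetric])
  next
    case 3
    have m2: "2 \<le> m" "m \<le> CARD('n)" using 3 lev [of i] m by auto
    have "pd (\<iota> m) (\<lambda>u. vpd (\<iota> m) Y u $ i) u = pd (\<iota> m) (\<lambda>u. - (tan (u $ \<iota> m) * Y u $ i)) u"
      by (rule pd_cong [OF open_U u]) (use 3 in \<open>simp add: vpd_Y [OF _ m]\<close>)
    also have "\<dots> = - ((1 + (tan (u $ \<iota> m))\<^sup>2) * Y u $ i + tan (u $ \<iota> m) * vpd (\<iota> m) Y u $ i)"
      using pd_mult [OF holo_tan [OF m2] holo_map_nth [OF holo_Y] u] pd_minus [OF holo_fun_mult [OF holo_tan [OF m2] holo_map_nth [OF holo_Y]] u]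
      by (simp add: pd_tan [OF m2 u] vpd_nth)
    also have "\<dots> = - Y u $ i" using 3 by (simp add: vpd_Y [OF u m] algebra_simps power2_eq_square)
    finally show ?thesis using 3 by (simp add: vpd_nth [of _ "vpd (\<iota> m) Y"])
  qed
qed

lemma mixed_tangential:
  assumes u: "u \<in> V" and jk: "j \<noteq> k" and N: "\<And>i. bil v (vpd i Y u) = 0"
  shows "bil v (vpd j (vpd k Y) u) = 0"
proof -
  obtain l m where l: "l \<in> {1..CARD('n)}" "j = \<iota> l" and m: "m \<in> {1..CARD('n)}" "k = \<iota> m"
    by (metis enum_cases)
  consider "m < l" | "l < m" using jk l m by (metis linorder_neqE_nat)
  then show ?thesis
  proof cases
    case 1 then show ?thesis using vpd_mixed [OF u m(1) l(1)] N l m by simp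
  next
    case 2
    have "vpd j (vpd k Y) u = vpd k (vpd j Y) u" by (rule vpd_commute [OF open_U holo_Y u])
    then show ?thesis using vpd_mixed [OF u l(1) m(1) 2] N l m by simp
  qed
qed

lemma sum_split_level:
  "(\<Sum>i\<in>UNIV. if m < lev i then 0 else if m = lev i then f i else g i) =
    (\<Sum>i | lev i = m. f i) + (\<Sum>i | lev i < m. g i :: complex)"
proof -
  have "(\<Sum>i\<in>UNIV. if m < lev i then 0 else if m = lev i then f i else g i) =
      (\<Sum>i\<in>UNIV. (if lev i = m then f i else 0) + (if lev i < m then g i else 0))"
    by (rule sum.cong) auto
  then show ?thesis by (simp add: sum.distrib sum.If_cases)
qed

end

text \<open>
  For a map of this shape the metric is determined by \<open>\<alpha> k\<close>; the quantities \<open>p k\<close> cancel.  The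
  spherical coordinates themselves have \<open>p k = 0\<close> for \<open>k > 0\<close>, the explicit family has
  \<open>p k = z k * a 0\<close>.
\<close>

definition level_sum :: "(nat \<Rightarrow> complex) \<Rightarrow> (nat \<Rightarrow> 'n::finite) \<Rightarrow> complex^'n \<Rightarrow> nat \<Rightarrow> complex" where
  "level_sum \<alpha> \<iota> u m = \<alpha> 0 * (cosprod \<iota> u 0)\<^sup>2 + (\<Sum>k\<in>{1..<m}. \<alpha> k * (cosprod \<iota> u k)\<^sup>2 * (sin (u $ \<iota> k))\<^sup>2)"

locale telescoping_map = warped_map V \<iota> Y lev G G1 G2
  for V :: "(complex^'n::finite) set" and \<iota> :: "nat \<Rightarrow> 'n" and Y :: "complex^'n \<Rightarrow> complex^'m::finite"
    and lev :: "'m \<Rightarrow> nat" and G G1 G2 :: "'m \<Rightarrow> complex \<Rightarrow> complex" +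
  fixes \<alpha> p :: "nat \<Rightarrow> complex"
  assumes p0: "p 0 = \<alpha> 0"
    and G_G: "u \<in> V \<Longrightarrow> k \<in> {1..CARD('n) - 1} \<Longrightarrow> (\<Sum>i | lev i = k. (G i (u $ \<iota> k))\<^sup>2) =
      p (k - 1) * (cos (u $ \<iota> k))\<^sup>2 + \<alpha> k * (sin (u $ \<iota> k))\<^sup>2 - p k"
    and G_G1: "u \<in> V \<Longrightarrow> k \<in> {1..CARD('n) - 1} \<Longrightarrow> (\<Sum>i | lev i = k. G i (u $ \<iota> k) * G1 i (u $ \<iota> k)) =
      (\<alpha> k - p (k - 1)) * sin (u $ \<iota> k) * cos (u $ \<iota> k)"
    and G1_G1: "u \<in> V \<Longrightarrow> k \<in> {1..CARD('n)} \<Longrightarrow> (\<Sum>i | lev i = k. (G1 i (u $ \<iota> k))\<^sup>2) =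
      \<alpha> k * (cos (u $ \<iota> k))\<^sup>2 + p (k - 1) * (sin (u $ \<iota> k))\<^sup>2"
begin

text \<open>By \<open>cosprod_step\<close> the term with \<open>p (m - 1)\<close> contributed by
  level \<open>m\<close> cancels the remainder left by the lower levels.\<close>

lemma partial_square:
  assumes u: "u \<in> V" and m: "m \<in> {1..CARD('n)}"
  shows "(\<Sum>i | lev i < m. (Y u $ i)\<^sup>2) = level_sum \<alpha> \<iota> u m - p (m - 1) * (cosprod \<iota> u (m - 1))\<^sup>2"
proof -
  have "1 \<le> m" "m \<le> CARD('n)" using m by auto
  then show ?thesis
  proof (induction m rule: dec_induct)
    case base
    have "(\<Sum>i | lev i < 1. (Y u $ i)\<^sup>2) = 0"
    proof (rule sum.neutral, rule ballI)
      fix i assume "i \<in> {i. lev i < 1}"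
      then show "(Y u $ i)\<^sup>2 = 0" using lev [of i] by simp
    qed
    then show ?case by (simp only:) (simp add: level_sum_def p0)
  next
    case (step m)
    have m: "m \<in> {1..CARD('n) - 1}" "m \<in> {1..CARD('n)}" using step by auto
    have "{i. lev i < Suc m} = {i. lev i < m} \<union> {i. lev i = m}" by auto
    then have "(\<Sum>i | lev i < Suc m. (Y u $ i)\<^sup>2) = (\<Sum>i | lev i < m. (Y u $ i)\<^sup>2) + (\<Sum>i | lev i = m. (Y u $ i)\<^sup>2)"
      by (simp add: sum.union_disjoint disjoint_iff)
    also have "(\<Sum>i | lev i = m. (Y u $ i)\<^sup>2) = (cosprod \<iota> u m)\<^sup>2 * (\<Sum>i | lev i = m. (G i (u $ \<iota> m))\<^sup>2)"
      by (simp add: Y_nth [OF u] power_mult_distrib sum_distrib_left)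
    finally show ?case
      using step by (simp add: G_G [OF u m(1)] level_sum_def cosprod_step [OF m(2), simplified] power_mult_distrib algebra_simps)
  qed
qed

text \<open>For \<open>m > 1\<close> the contributions of \<open>p (m - 1)\<close> cancel after
  writing the sine as tangent times cosine; \<open>m = 1\<close> is separate because the cosine of
  the first coordinate may vanish, and there \<open>p 0\<close> is
  \<open>\<alpha> 0\<close>.\<close>

lemma metric_off:
  assumes u: "u \<in> V" and m: "m \<in> {1..CARD('n)}" and l: "l \<in> {1..CARD('n)}" and ml: "m < l"
  shows "bil (vpd (\<iota> l) Y u) (vpd (\<iota> m) Y u) = - tan (u $ \<iota> l) *
    (if m = 1 then (cosprod \<iota> u 1)\<^sup>2 * (\<alpha> 1 - \<alpha> 0) * sin (u $ \<iota> 1) * cos (u $ \<iota> 1)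
     else (cosprod \<iota> u m)\<^sup>2 * \<alpha> m * sin (u $ \<iota> m) * cos (u $ \<iota> m) - tan (u $ \<iota> m) * level_sum \<alpha> \<iota> u m)"
proof -
  have m': "m \<in> {1..CARD('n) - 1}" using m l ml by auto
  have "bil (vpd (\<iota> l) Y u) (vpd (\<iota> m) Y u) = (\<Sum>i\<in>UNIV. if m < lev i then 0
      else if m = lev i then - tan (u $ \<iota> l) * (cosprod \<iota> u m)\<^sup>2 * (G i (u $ \<iota> m) * G1 i (u $ \<iota> m))
      else tan (u $ \<iota> l) * tan (u $ \<iota> m) * (Y u $ i)\<^sup>2)"
    unfolding bil_def
    by (rule sum.cong) (use ml in \<open>auto simp: vpd_Y [OF u m] vpd_Y [OF u l] Y_nth [OF u] power2_eq_square\<close>)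
  also have "\<dots> = - tan (u $ \<iota> l) * (cosprod \<iota> u m)\<^sup>2 * ((\<alpha> m - p (m - 1)) * sin (u $ \<iota> m) * cos (u $ \<iota> m)) +
      tan (u $ \<iota> l) * tan (u $ \<iota> m) * (level_sum \<alpha> \<iota> u m - p (m - 1) * (cosprod \<iota> u (m - 1))\<^sup>2)"
    unfolding sum_split_level by (simp only: sum_distrib_left [symmetric] G_G1 [OF u m'] partial_square [OF u m])
  also have "\<dots> = - tan (u $ \<iota> l) *
      (if m = 1 then (cosprod \<iota> u 1)\<^sup>2 * (\<alpha> 1 - \<alpha> 0) * sin (u $ \<iota> 1) * cos (u $ \<iota> 1)
       else (cosprod \<iota> u m)\<^sup>2 * \<alpha> m * sin (u $ \<iota> m) * cos (u $ \<iota> m) - tan (u $ \<iota> m) * level_sum \<alpha> \<iota> u m)"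
  proof (cases "m = 1")
    case True
    then show ?thesis by (simp add: p0 level_sum_def)
  next
    case False
    then have "cos (u $ \<iota> m) \<noteq> 0" using cos_nz [OF u] m by simp
    then have s: "sin (u $ \<iota> m) = tan (u $ \<iota> m) * cos (u $ \<iota> m)" by (simp add: tan_def)
    show ?thesis unfolding cosprod_step [OF m] if_not_P [OF False] s by (simp add: algebra_simps power2_eq_square)
  qed
  finally show ?thesis .
qed

lemma metric_diag:
  assumes u: "u \<in> V" and m: "m \<in> {1..CARD('n)}"
  shows "bil (vpd (\<iota> m) Y u) (vpd (\<iota> m) Y u) =
    (if m = 1 then (cosprod \<iota> u 1)\<^sup>2 * (\<alpha> 1 * (cos (u $ \<iota> 1))\<^sup>2 + \<alpha> 0 * (sin (u $ \<iota> 1))\<^sup>2)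
     else (cosprod \<iota> u m)\<^sup>2 * \<alpha> m * (cos (u $ \<iota> m))\<^sup>2 + (tan (u $ \<iota> m))\<^sup>2 * level_sum \<alpha> \<iota> u m)"
proof -
  have "bil (vpd (\<iota> m) Y u) (vpd (\<iota> m) Y u) = (\<Sum>i\<in>UNIV. if m < lev i then 0
      else if m = lev i then (cosprod \<iota> u m)\<^sup>2 * (G1 i (u $ \<iota> m))\<^sup>2 else (tan (u $ \<iota> m))\<^sup>2 * (Y u $ i)\<^sup>2)"
    unfolding bil_def by (rule sum.cong) (auto simp: vpd_Y [OF u m] power2_eq_square)
  also have "\<dots> = (cosprod \<iota> u m)\<^sup>2 * (\<alpha> m * (cos (u $ \<iota> m))\<^sup>2 + p (m - 1) * (sin (u $ \<iota> m))\<^sup>2) +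
      (tan (u $ \<iota> m))\<^sup>2 * (level_sum \<alpha> \<iota> u m - p (m - 1) * (cosprod \<iota> u (m - 1))\<^sup>2)"
    unfolding sum_split_level by (simp only: sum_distrib_left [symmetric] G1_G1 [OF u m] partial_square [OF u m])
  also have "\<dots> = (if m = 1 then (cosprod \<iota> u 1)\<^sup>2 * (\<alpha> 1 * (cos (u $ \<iota> 1))\<^sup>2 + \<alpha> 0 * (sin (u $ \<iota> 1))\<^sup>2)
     else (cosprod \<iota> u m)\<^sup>2 * \<alpha> m * (cos (u $ \<iota> m))\<^sup>2 + (tan (u $ \<iota> m))\<^sup>2 * level_sum \<alpha> \<iota> u m)"
  proof (cases "m = 1")
    case True
    then show ?thesis by (simp add: p0 level_sum_def)
  next
    case False
    then have "cos (u $ \<iota> m) \<noteq> 0" using cos_nz [OF u] m by simp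
    then have s: "sin (u $ \<iota> m) = tan (u $ \<iota> m) * cos (u $ \<iota> m)" by (simp add: tan_def)
    show ?thesis unfolding cosprod_step [OF m] if_not_P [OF False] s by (simp add: algebra_simps power2_eq_square)
  qed
  finally show ?thesis .
qed

text \<open>\<open>J\<close> is the excess over the spherical coordinates, for which it is zero (see
  \<open>X_pure_square\<close>); it becomes the joined square of the explicit family.\<close>

lemma pure_square:
  assumes u: "u \<in> V" and m: "m \<in> {1..CARD('n)}"
    and E: "(\<Sum>i | lev i = m. (G2 i (u $ \<iota> m))\<^sup>2) = p (m - 1) * (cos (u $ \<iota> m))\<^sup>2 + \<alpha> m * (sin (u $ \<iota> m))\<^sup>2 + J"
  shows "bil (vpd (\<iota> m) (vpd (\<iota> m) Y) u) (vpd (\<iota> m) (vpd (\<iota> m) Y) u) =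
    level_sum \<alpha> \<iota> u (Suc m) + (cosprod \<iota> u m)\<^sup>2 * J"
proof -
  have "bil (vpd (\<iota> m) (vpd (\<iota> m) Y) u) (vpd (\<iota> m) (vpd (\<iota> m) Y) u) = (\<Sum>i\<in>UNIV. if m < lev i then 0
      else if m = lev i then (cosprod \<iota> u m)\<^sup>2 * (G2 i (u $ \<iota> m))\<^sup>2 else (Y u $ i)\<^sup>2)"
    unfolding bil_def by (rule sum.cong) (auto simp: vpd_pure [OF u m] power2_eq_square)
  also have "\<dots> = (cosprod \<iota> u m)\<^sup>2 * (p (m - 1) * (cos (u $ \<iota> m))\<^sup>2 + \<alpha> m * (sin (u $ \<iota> m))\<^sup>2 + J) +
      (level_sum \<alpha> \<iota> u m - p (m - 1) * (cosprod \<iota> u (m - 1))\<^sup>2)"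
    unfolding sum_split_level by (simp only: sum_distrib_left [symmetric] E partial_square [OF u m])
  finally show ?thesis using m unfolding cosprod_step [OF m]
    by (simp add: level_sum_def power_mult_distrib algebra_simps)
qed

end

text \<open>The formulas for the metric contain \<open>\<alpha>\<close> but neither \<open>p\<close>
  nor the one-variable functions.\<close>

lemma telescoping_metric_eq:
  assumes "telescoping_map V \<iota> Y lev G G1 G2 \<alpha> p" "telescoping_map V \<iota> Z lev' H H1 H2 \<alpha> p'" and u: "u \<in> V"
  shows "induced_metric Y u = induced_metric Z u"
proof -
  interpret Y: telescoping_map V \<iota> Y lev G G1 G2 \<alpha> p by (rule assms(1))
  interpret Z: telescoping_map V \<iota> Z lev' H H1 H2 \<alpha> p' by (rule assms(2))
  have "bil (vpd j Y u) (vpd k Y u) = bil (vpd j Z u) (vpd k Z u)" for j k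
  proof -
    obtain l m where l: "l \<in> {1..CARD('a)}" "j = \<iota> l" and m: "m \<in> {1..CARD('a)}" "k = \<iota> m"
      by (metis Y.enum_cases)
    consider "m < l" | "l < m" | "l = m" by linarith
    then show ?thesis
    proof cases
      case 1 then show ?thesis unfolding l m by (simp only: Y.metric_off [OF u m(1) l(1)] Z.metric_off [OF u m(1) l(1)])
    next
      case 2
      then have "bil (vpd k Y u) (vpd j Y u) = bil (vpd k Z u) (vpd j Z u)"
        unfolding l m by (simp only: Y.metric_off [OF u l(1) m(1)] Z.metric_off [OF u l(1) m(1)])
      then show ?thesis by (simp only: bil_commute)
    next
      case 3 then show ?thesis unfolding l m by (simp only: Y.metric_diag [OF u m(1)] Z.metric_diag [OF u m(1)])
    qed
  qed
  then show ?thesis by (simp add: induced_metric_def)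
qed

section \<open>Spherical coordinates on a central quadric\<close>

context chart
begin

definition pos :: "'n \<Rightarrow> nat" where "pos = the_inv_into {1..CARD('n)} \<iota>"

lemma pos_enum: "k \<in> {1..CARD('n)} \<Longrightarrow> pos (\<iota> k) = k"
  unfolding pos_def by (rule the_inv_into_f_f) (use enum in \<open>simp_all add: bij_betw_def\<close>)

lemma enum_pos: "\<iota> (pos j) = j"
  unfolding pos_def by (rule f_the_inv_into_f_bij_betw [OF enum]) simp

lemma pos_range: "pos j \<in> {1..CARD('n)}"
  by (rule enum_cases [of j]) (simp add: pos_enum)

lemma sum_enum: "(\<Sum>j\<in>UNIV. f j) = (\<Sum>k\<in>{1..CARD('n)}. f (\<iota> k))"
  by (rule sum.reindex_bij_betw [OF enum, symmetric])

lemma level_sum_one: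
  assumes "1 \<le> m" "m \<le> Suc CARD('n)"
  shows "level_sum (\<lambda>_. 1) \<iota> u m = (cosprod \<iota> u (m - 1))\<^sup>2"
  using assms
proof (induction m rule: dec_induct)
  case base show ?case by (simp add: level_sum_def)
next
  case (step m)
  have m: "m \<in> {1..CARD('n)}" using step by simp
  have "level_sum (\<lambda>_. 1) \<iota> u (Suc m) = level_sum (\<lambda>_. 1) \<iota> u m + (cosprod \<iota> u m)\<^sup>2 * (sin (u $ \<iota> m))\<^sup>2"
    using m by (simp add: level_sum_def)
  also have "\<dots> = (cosprod \<iota> u m)\<^sup>2 * (1 - (sin (u $ \<iota> m))\<^sup>2) + (cosprod \<iota> u m)\<^sup>2 * (sin (u $ \<iota> m))\<^sup>2"
    using step cosprod_step [OF m] by (simp add: power_mult_distrib cos_squared_eq)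
  finally show ?case by (simp add: algebra_simps)
qed

end

locale spherical_domain = chart U \<iota> for U :: "(complex^'n::finite) set" and \<iota> :: "nat \<Rightarrow> 'n" +
  fixes a :: "nat \<Rightarrow> complex"
  assumes a_nz: "j \<le> CARD('n) \<Longrightarrow> a j \<noteq> 0"
    and det_spherical: "u \<in> U \<Longrightarrow> det (induced_metric (spherical a \<iota>) u) \<noteq> 0"
begin

abbreviation "X \<equiv> spherical a \<iota>"

text \<open>The coordinate \<open>None\<close> has level \<open>1\<close> and not \<open>0\<close>:
  the cosine of the first coordinate in \<open>cosprod \<iota> u 0\<close> is counted as its
  one-variable function.\<close>

definition slev :: "'n option \<Rightarrow> nat" where
  "slev i = (case i of None \<Rightarrow> 1 | Some j \<Rightarrow> pos j)"

definition semi :: "'n option \<Rightarrow> nat" where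
  "semi i = (case i of None \<Rightarrow> 0 | Some j \<Rightarrow> pos j)"

definition sG :: "'n option \<Rightarrow> complex \<Rightarrow> complex" where
  "sG i t = csqrt (a (semi i)) * (if i = None then cos t else sin t)"

definition sG1 :: "'n option \<Rightarrow> complex \<Rightarrow> complex" where
  "sG1 i t = csqrt (a (semi i)) * (if i = None then - sin t else cos t)"

lemma slev_range: "slev i \<in> {1..CARD('n)}"
  using pos_range by (cases i) (simp_all add: slev_def Suc_leI)

lemma semi_range: "semi i \<le> CARD('n)"
  using pos_range by (cases i) (simp_all add: semi_def)

lemma sG_deriv: "(sG i has_field_derivative sG1 i t) (at t)"
  unfolding sG_def sG1_def by (cases "i = None") (auto intro!: derivative_eq_intros)

lemma sG1_deriv: "(sG1 i has_field_derivative - sG i t) (at t)"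
  unfolding sG_def sG1_def by (cases "i = None") (auto intro!: derivative_eq_intros)

lemma X_None: "X u $ None = csqrt (a 0) * cosprod \<iota> u 0"
  by (simp add: spherical_def axis_def)

lemma X_Some:
  assumes k: "k \<in> {1..CARD('n)}"
  shows "X u $ Some (\<iota> k) = csqrt (a k) * cosprod \<iota> u k * sin (u $ \<iota> k)"
proof -
  have "X u $ Some (\<iota> k) = (\<Sum>m\<in>{1..CARD('n)}. csqrt (a m) * cosprod \<iota> u m * sin (u $ \<iota> m) * (if \<iota> k = \<iota> m then 1 else 0))"
    by (simp add: spherical_def axis_def)
  also have "\<dots> = (\<Sum>m\<in>{1..CARD('n)}. if m = k then csqrt (a k) * cosprod \<iota> u k * sin (u $ \<iota> k) else 0)"
    by (rule sum.cong) (use enum_eq_iff [OF k] in auto)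
  finally show ?thesis using k by simp
qed

lemma X_nth: "X u $ i = cosprod \<iota> u (slev i) * sG i (u $ \<iota> (slev i))"
proof (cases i)
  case None
  then show ?thesis using cosprod_step [of 1 u] by (simp add: X_None slev_def sG_def semi_def Suc_leI)
next
  case (Some j)
  then show ?thesis using X_Some [OF pos_range, of u j] by (simp add: enum_pos slev_def sG_def semi_def)
qed

lemma sum_slev:
  assumes "k \<in> {1..CARD('n)}"
  shows "(\<Sum>i | slev i = k. f i) = (if k = 1 then f None else 0) + (f (Some (\<iota> k)) :: complex)"
proof -
  have "slev i = k \<longleftrightarrow> (i = None \<and> k = 1) \<or> i = Some (\<iota> k)" for i
    using pos_enum [OF assms] enum_pos by (cases i) (auto simp: slev_def)
  then have "{i. slev i = k} = (if k = 1 then {None, Some (\<iota> k)} else {Some (\<iota> k)})" by auto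
  then show ?thesis by simp
qed

text \<open>A zero would make \<open>cosprod \<iota> u 1\<close> vanish and with it the whole
  derivative in the first coordinate, against the determinant condition.\<close>

lemma cos_nonzero:
  assumes u: "u \<in> U" and m: "2 \<le> m" "m \<le> CARD('n)"
  shows "cos (u $ \<iota> m) \<noteq> 0"
proof
  assume c: "cos (u $ \<iota> m) = 0"
  have 1: "1 \<in> {1..CARD('n)}" by (simp add: Suc_leI)
  have "cosprod \<iota> u 1 = 0" unfolding cosprod_def using c m by (intro prod_zero) auto
  moreover have "pd (\<iota> 1) (\<lambda>u. X u $ i) u = (if 1 = slev i then cosprod \<iota> u (slev i) * sG1 i (u $ \<iota> (slev i)) else 0)" for i
    unfolding X_nth by (rule pd_warped_low [OF u 1 slev_range _ sG_deriv]) (use slev_range [of i] in simp)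
  ultimately have "vpd (\<iota> 1) X u $ i = 0" for i unfolding vpd_nth by (auto split: if_splits)
  then have "vpd (\<iota> 1) X u = 0" by (simp add: vec_eq_iff)
  then have "row (\<iota> 1) (induced_metric X u) = 0"
    by (simp add: row_def induced_metric_def vec_eq_iff bil_def)
  then show False using det_spherical [OF u] det_zero_row by blast
qed

sublocale telescoping_map U \<iota> X slev sG sG1 "\<lambda>i t. - sG i t" a "\<lambda>k. if k = 0 then a 0 else 0"
proof unfold_locales
  fix u k assume u: "u \<in> U"
  show "(\<Sum>i | slev i = k. (sG i (u $ \<iota> k))\<^sup>2) = (if k - 1 = 0 then a 0 else 0) * (cos (u $ \<iota> k))\<^sup>2 +
      a k * (sin (u $ \<iota> k))\<^sup>2 - (if k = 0 then a 0 else 0)"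
    "(\<Sum>i | slev i = k. sG i (u $ \<iota> k) * sG1 i (u $ \<iota> k)) =
      (a k - (if k - 1 = 0 then a 0 else 0)) * sin (u $ \<iota> k) * cos (u $ \<iota> k)" if k: "k \<in> {1..CARD('n) - 1}"
  proof -
    have k': "k \<in> {1..CARD('n)}" using k by auto
    have sq: "csqrt z * (csqrt z * w) = z * w" for z w by (metis mult.assoc power2_csqrt power2_eq_square)
    show "(\<Sum>i | slev i = k. (sG i (u $ \<iota> k))\<^sup>2) = (if k - 1 = 0 then a 0 else 0) * (cos (u $ \<iota> k))\<^sup>2 +
      a k * (sin (u $ \<iota> k))\<^sup>2 - (if k = 0 then a 0 else 0)"
      using k' by (auto simp: sum_slev sG_def semi_def pos_enum [OF k'] power_mult_distrib)
    show "(\<Sum>i | slev i = k. sG i (u $ \<iota> k) * sG1 i (u $ \<iota> k)) =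
      (a k - (if k - 1 = 0 then a 0 else 0)) * sin (u $ \<iota> k) * cos (u $ \<iota> k)"
      using k' by (auto simp: sum_slev sG_def sG1_def semi_def pos_enum [OF k'] algebra_simps sq)
  qed
  show "(\<Sum>i | slev i = k. (sG1 i (u $ \<iota> k))\<^sup>2) = a k * (cos (u $ \<iota> k))\<^sup>2 +
      (if k - 1 = 0 then a 0 else 0) * (sin (u $ \<iota> k))\<^sup>2" if k: "k \<in> {1..CARD('n)}"
    using k by (auto simp: sum_slev sG1_def semi_def pos_enum [OF k] power_mult_distrib)
next
  show "((\<lambda>t. sG1 i t) has_field_derivative - sG i (u $ \<iota> (slev i))) (at (u $ \<iota> (slev i)))" for i u
    by (rule sG1_deriv)
qed (use slev_range X_nth sG_deriv sG1_deriv cos_nonzero in simp_all)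

lemma X_pure:
  assumes u: "u \<in> U" and m: "m \<in> {1..CARD('n)}"
  shows "vpd (\<iota> m) (vpd (\<iota> m) X) u $ i = (if m < slev i then 0 else - X u $ i)"
  using vpd_pure [OF u m, of i] by (simp add: X_nth)

lemma X_pure_square:
  assumes u: "u \<in> U" and m: "m \<in> {1..CARD('n)}"
  shows "bil (vpd (\<iota> m) (vpd (\<iota> m) X) u) (vpd (\<iota> m) (vpd (\<iota> m) X) u) = level_sum a \<iota> u (Suc m)"
proof -
  have "(\<Sum>i | slev i = m. (- sG i (u $ \<iota> m))\<^sup>2) =
      (if m - 1 = 0 then a 0 else 0) * (cos (u $ \<iota> m))\<^sup>2 + a m * (sin (u $ \<iota> m))\<^sup>2 + 0"
    using m by (auto simp: sum_slev sG_def semi_def pos_enum [OF m] power_mult_distrib)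
  from pure_square [OF u m this] show ?thesis by simp
qed

text \<open>The gradient of the quadric, hence a multiple of the unit normal.\<close>

definition grad :: "complex^'n \<Rightarrow> complex^('n option)" where
  "grad u = (\<chi> i. X u $ i / a (semi i))"

lemma sum_squares:
  "(\<Sum>i | slev i \<le> m. c (semi i) * (X u $ i)\<^sup>2) = level_sum (\<lambda>k. c k * a k) \<iota> u (Suc m)"
  if m: "m \<in> {1..CARD('n)}"
proof -
  have "{i. slev i \<le> m} = insert None (Some ` \<iota> ` {1..m})"
  proof (intro set_eqI iffI)
    fix i assume i: "i \<in> {i. slev i \<le> m}"
    show "i \<in> insert None (Some ` \<iota> ` {1..m})"
    proof (cases i)
      case (Some j)
      have "j = \<iota> (pos j)" by (simp add: enum_pos)
      moreover have "pos j \<in> {1..m}" using i Some pos_range [of j] by (simp add: slev_def)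
      ultimately show ?thesis using Some by blast
    qed simp
  next
    fix i assume "i \<in> insert None (Some ` \<iota> ` {1..m})"
    then show "i \<in> {i. slev i \<le> m}" using m pos_enum by (auto simp: slev_def)
  qed
  moreover have "inj_on (\<lambda>k. Some (\<iota> k)) {1..m}"
    by (rule inj_onI) (use m enum_eq_iff in auto)
  ultimately have "(\<Sum>i | slev i \<le> m. c (semi i) * (X u $ i)\<^sup>2) =
      c (semi None) * (X u $ None)\<^sup>2 + (\<Sum>k\<in>{1..m}. c (semi (Some (\<iota> k))) * (X u $ Some (\<iota> k))\<^sup>2)"
    by (simp add: image_image sum.reindex image_iff)
  also have "(\<Sum>k\<in>{1..m}. c (semi (Some (\<iota> k))) * (X u $ Some (\<iota> k))\<^sup>2) =
      (\<Sum>k\<in>{1..m}. c k * a k * (cosprod \<iota> u k)\<^sup>2 * (sin (u $ \<iota> k))\<^sup>2)"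
    by (rule sum.cong) (use m in \<open>auto simp: X_Some semi_def pos_enum power_mult_distrib\<close>)
  finally show ?thesis
    by (simp add: level_sum_def X_None semi_def power_mult_distrib atLeastLessThanSuc_atLeastAtMost)
qed

lemma level_sum_cong: "(\<And>k. k < m \<Longrightarrow> c k = d k) \<Longrightarrow> 1 \<le> m \<Longrightarrow> level_sum c \<iota> u m = level_sum d \<iota> u m"
  unfolding level_sum_def by (intro arg_cong2 [where f = "(+)"] sum.cong) simp_all

lemma sum_squares_one:
  assumes m: "m \<in> {1..CARD('n)}"
  shows "(\<Sum>i | slev i \<le> m. (X u $ i)\<^sup>2 / a (semi i)) = (cosprod \<iota> u m)\<^sup>2"
proof -
  have "level_sum (\<lambda>k. 1 / a k * a k) \<iota> u (Suc m) = level_sum (\<lambda>_. 1) \<iota> u (Suc m)"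
    by (rule level_sum_cong) (use m a_nz in auto)
  also have "\<dots> = (cosprod \<iota> u m)\<^sup>2" using level_sum_one [of "Suc m" u] m by simp
  finally show ?thesis using sum_squares [OF m, of "\<lambda>k. 1 / a k" u] by simp
qed

lemma card_range: "CARD('n) \<in> {1..CARD('n)}"
  by (simp add: Suc_leI)

lemma slev_le: "{i. slev i \<le> CARD('n)} = UNIV"
  using slev_range by auto

lemma quadric_equation: "(\<Sum>i\<in>UNIV. (X u $ i)\<^sup>2 / a (semi i)) = 1"
  using sum_squares_one [OF card_range, of u] by (simp add: slev_le cosprod_last)

lemma in_central_quadric: "X u \<in> central_quadric a \<iota>"
proof -
  have "(\<Sum>k\<in>{1..CARD('n)}. (X u $ Some (\<iota> k))\<^sup>2 / a (semi (Some (\<iota> k)))) =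
      (\<Sum>k\<in>{1..CARD('n)}. (X u $ Some (\<iota> k))\<^sup>2 / a k)"
    by (rule sum.cong) (simp_all add: semi_def pos_enum)
  then show ?thesis using quadric_equation [of u]
    unfolding sum_UNIV_option sum_enum by (simp add: central_quadric_def semi_def)
qed

lemma grad_square: "bil (grad u) (grad u) = level_sum (\<lambda>k. 1 / a k) \<iota> u (Suc CARD('n))"
proof -
  have "level_sum (\<lambda>k. 1 / (a k)\<^sup>2 * a k) \<iota> u (Suc CARD('n)) = level_sum (\<lambda>k. 1 / a k) \<iota> u (Suc CARD('n))"
    by (rule level_sum_cong) (auto simp: power2_eq_square)
  then show ?thesis using sum_squares [OF card_range, of "\<lambda>k. 1 / (a k)\<^sup>2" u]
    by (simp add: slev_le bil_def grad_def power2_eq_square)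
qed

lemma grad_tangent:
  assumes u: "u \<in> U"
  shows "bil (grad u) (vpd j X u) = 0"
proof -
  have h: "holo_fun U (\<lambda>u. X u $ i)" for i using holo_map_nth [OF holo_Y] .
  define c where "c = (\<lambda>i. 1 / a (semi i))"
  have "pd j (\<lambda>u. \<Sum>i\<in>UNIV. c i * (X u $ i)\<^sup>2) u = pd j (\<lambda>_. 1) u"
    by (rule pd_cong [OF open_U u]) (use quadric_equation in \<open>simp add: c_def\<close>)
  moreover have "pd j (\<lambda>u. \<Sum>i\<in>UNIV. c i * (X u $ i)\<^sup>2) u = (\<Sum>i\<in>UNIV. c i * (2 * X u $ i * pd j (\<lambda>u. X u $ i) u))"
    by (subst pd_sum [OF _ u], intro holo_fun_mult holo_fun_const holo_fun_power h)
      (simp add: pd_cmult [OF holo_fun_power [OF h] u] pd_power2 [OF h u])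
  moreover have "\<dots> = 2 * bil (grad u) (vpd j X u)"
    by (simp add: bil_def grad_def vpd_nth sum_distrib_left c_def mult.assoc)
  ultimately show ?thesis by simp
qed

text \<open>The second derivative is \<open>- X\<close> truncated to the levels up to
  \<open>m\<close>, so the product is a partial sum of the equation of the quadric.\<close>

lemma grad_pure:
  assumes u: "u \<in> U" and m: "m \<in> {1..CARD('n)}"
  shows "bil (grad u) (vpd (\<iota> m) (vpd (\<iota> m) X) u) = - (cosprod \<iota> u m)\<^sup>2"
proof -
  have "bil (grad u) (vpd (\<iota> m) (vpd (\<iota> m) X) u) = (\<Sum>i\<in>UNIV. if slev i \<le> m then - ((X u $ i)\<^sup>2 / a (semi i)) else 0)"
    unfolding bil_def by (rule sum.cong) (auto simp: X_pure [OF u m] grad_def power2_eq_square)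
  also have "\<dots> = - (\<Sum>i | slev i \<le> m. (X u $ i)\<^sup>2 / a (semi i))"
    by (simp add: sum.If_cases sum_negf)
  finally show ?thesis by (simp only: sum_squares_one [OF m])
qed

lemma quadric_central: "quadric (central_quadric a \<iota>)"
proof -
  define c :: "'n option option \<Rightarrow> complex" where "c = (\<lambda>j. case j of None \<Rightarrow> 1 | Some i \<Rightarrow> 1 / csqrt (a (semi i)))"
  define M :: "complex^('n option option)^('n option option)" where "M = (\<chi> i j. if i = j then c i else 0)"
  have "c j \<noteq> 0" for j using a_nz [OF semi_range] by (cases j) (simp_all add: c_def)
  then have "det M \<noteq> 0" by (subst det_diagonal) (simp_all add: M_def)
  then have "invertible M" by (simp add: invertible_det_nz)
  moreover have "sphere_form (M *v hom_coords X) = (\<Sum>i\<in>UNIV. (X $ i)\<^sup>2 / a (semi i)) - 1" for X :: "complex^('n option)"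
  proof -
    have "(M *v v) $ j = c j * v $ j" for v j
      by (simp add: M_def matrix_vector_mult_def if_distrib [of "\<lambda>x. x * _"] cong: if_cong)
    then show ?thesis by (simp add: sphere_form_def hom_coords_def c_def power_divide)
  qed
  moreover have "(\<Sum>i\<in>UNIV. (X $ i)\<^sup>2 / a (semi i)) = (X $ None)\<^sup>2 / a 0 + (\<Sum>k\<in>{1..CARD('n)}. (X $ Some (\<iota> k))\<^sup>2 / a k)"
    for X :: "complex^('n option)"
  proof -
    have "(\<Sum>k\<in>{1..CARD('n)}. (X $ Some (\<iota> k))\<^sup>2 / a (semi (Some (\<iota> k)))) = (\<Sum>k\<in>{1..CARD('n)}. (X $ Some (\<iota> k))\<^sup>2 / a k)"
      by (rule sum.cong) (simp_all add: semi_def pos_enum)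
    then show ?thesis unfolding sum_UNIV_option sum_enum by (simp add: semi_def)
  qed
  ultimately show ?thesis unfolding quadric_def central_quadric_def
    by (intro exI [of _ M]) simp
qed

end

section \<open>The conjugate net of spherical coordinates\<close>

locale spherical_net = spherical_domain U \<iota> a
  for U :: "(complex^'n::finite) set" and \<iota> :: "nat \<Rightarrow> 'n" and a :: "nat \<Rightarrow> complex" +
  fixes N0 :: "complex^'n \<Rightarrow> complex^('n option)"
  assumes nonempty: "U \<noteq> {}" and normal: "unit_normal U (spherical a \<iota>) N0"
begin

lemma quadric_piece_spherical: "quadric_piece U X N0"
proof -
  have "conjugate_system U N0 X"
    unfolding conjugate_system_def sff_def
    by (intro ballI allI impI mixed_tangential) (use normal in \<open>auto simp: unit_normal_def\<close>)
  then show ?thesis unfolding quadric_piece_def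
    using open_U nonempty holo_Y quadric_central in_central_quadric det_spherical normal by blast
qed

sublocale N: conjugate_map U X "\<lambda>_::unit. N0"
  by (rule quadric_piece_conjugate_map [OF quadric_piece_spherical])

lemma christoffel_spherical:
  assumes u: "u \<in> U" and m: "m \<in> {1..CARD('n)}" and l: "l \<in> {1..CARD('n)}" and ml: "m < l"
  shows "christoffel (induced_metric X) (\<iota> m) (\<iota> m) (\<iota> l) u = - tan (u $ \<iota> l)"
    and "christoffel (induced_metric X) (\<iota> l) (\<iota> l) (\<iota> m) u = 0"
proof -
  have "christoffel (induced_metric X) i (\<iota> l) (\<iota> m) u = - tan (u $ \<iota> l) * (if i = \<iota> m then 1 else 0)" for i
    unfolding N.christoffel_eq [OF u] vpd_mixed [OF u m l ml] by (simp add: N.S_vpd [OF u])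
  then show "christoffel (induced_metric X) (\<iota> m) (\<iota> m) (\<iota> l) u = - tan (u $ \<iota> l)"
    "christoffel (induced_metric X) (\<iota> l) (\<iota> l) (\<iota> m) u = 0"
    using enum_eq_iff [OF l m] ml N.christoffel_sym [OF u] by simp_all
qed

text \<open>The unit normal is a multiple of the gradient, known only up to sign, so squares are
  compared; the factor \<open>level_sum\<close> is the square of the gradient.\<close>

lemma sff_spherical:
  assumes u: "u \<in> U" and m: "m \<in> {1..CARD('n)}"
  shows "level_sum (\<lambda>k. 1 / a k) \<iota> u (Suc CARD('n)) * (sff N0 X (\<iota> m) (\<iota> m) u)\<^sup>2 = (cosprod \<iota> u m) ^ 4"
    and "level_sum (\<lambda>k. 1 / a k) \<iota> u (Suc CARD('n)) \<noteq> 0"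
proof -
  define \<sigma> where "\<sigma> = bil (N0 u) (grad u)"
  have S: "bil (N.S k u) (grad u) = 0" for k
  proof -
    have "bil (vpd j X u) (grad u) = 0" for j using grad_tangent [OF u, of j] by (simp only: bil_commute)
    then show ?thesis by (simp add: N.S_def bil_sum)
  qed
  have g: "grad u = \<sigma> *s N0 u"
    using N.expansion [OF u, of "grad u"] by (simp add: S \<sigma>_def)
  have s: "level_sum (\<lambda>k. 1 / a k) \<iota> u (Suc CARD('n)) = \<sigma>\<^sup>2"
    using N.N_orthonormal [OF u] by (simp add: grad_square [symmetric] g power2_eq_square)
  have h: "\<sigma> * sff N0 X (\<iota> m) (\<iota> m) u = - (cosprod \<iota> u m)\<^sup>2"
    using grad_pure [OF u m] by (simp add: g sff_def)
  have "(\<sigma> * sff N0 X (\<iota> m) (\<iota> m) u)\<^sup>2 = (cosprod \<iota> u m) ^ 4" unfolding h by simp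
  then show "level_sum (\<lambda>k. 1 / a k) \<iota> u (Suc CARD('n)) * (sff N0 X (\<iota> m) (\<iota> m) u)\<^sup>2 = (cosprod \<iota> u m) ^ 4"
    by (simp add: s power_mult_distrib)
  have "\<sigma> \<noteq> 0" using h cosprod_nz [OF u, of m] m by auto
  then show "level_sum (\<lambda>k. 1 / a k) \<iota> u (Suc CARD('n)) \<noteq> 0" by (simp add: s)
qed

end

subsection \<open>Separation of variables\<close>

text \<open>The equation in \<open>separation_constants\<close> solved for \<open>w k\<close>, with
  \<open>\<beta>\<close> in place of the squares of the unknowns; constancy is proved in
  \<open>pd_separation\<close>.\<close>

primrec separation_function :: "(nat \<Rightarrow> 'n::finite) \<Rightarrow> (nat \<Rightarrow> complex) \<Rightarrow> ('n \<Rightarrow> complex^'n \<Rightarrow> complex) \<Rightarrow>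
    nat \<Rightarrow> complex^'n \<Rightarrow> complex" where
  "separation_function \<iota> a \<beta> 0 u = 1 / a 0"
| "separation_function \<iota> a \<beta> (Suc k) u = (cosprod \<iota> u (Suc k))\<^sup>2 / \<beta> (\<iota> (Suc k)) u +
    (sin (u $ \<iota> (Suc k)))\<^sup>2 / a (Suc k) + separation_function \<iota> a \<beta> k u * (cos (u $ \<iota> (Suc k)))\<^sup>2"

context spherical_net
begin

text \<open>By \<open>cosprod_step\<close> the cosine in the recursion turns \<open>cosprod\<close>
  at \<open>m\<close> into \<open>cosprod\<close> at \<open>m - 1\<close>. At the top index the
  left-hand side is the algebraic equation up to the factor \<open>level_sum\<close>.\<close>

lemma separation_telescope:
  assumes "1 \<le> m" "m \<le> Suc CARD('n)"
  shows "level_sum (\<lambda>k. 1 / a k) \<iota> u m + (\<Sum>k\<in>{1..<m}. (cosprod \<iota> u k) ^ 4 / \<beta> (\<iota> k) u) =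
    separation_function \<iota> a \<beta> (m - 1) u * (cosprod \<iota> u (m - 1))\<^sup>2"
  using assms
proof (induction m rule: dec_induct)
  case base show ?case by (simp add: level_sum_def)
next
  case (step m)
  have m: "m \<in> {1..CARD('n)}" using step by simp
  then obtain k where k: "m = Suc k" by (cases m) auto
  have "level_sum (\<lambda>k. 1 / a k) \<iota> u (Suc m) + (\<Sum>k\<in>{1..<Suc m}. (cosprod \<iota> u k) ^ 4 / \<beta> (\<iota> k) u) =
      separation_function \<iota> a \<beta> k u * (cosprod \<iota> u k)\<^sup>2 + (cosprod \<iota> u m)\<^sup>2 * (sin (u $ \<iota> m))\<^sup>2 / a m +
      (cosprod \<iota> u m) ^ 4 / \<beta> (\<iota> m) u"
    using step m k by (simp add: level_sum_def algebra_simps)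
  also have "cosprod \<iota> u k = cos (u $ \<iota> m) * cosprod \<iota> u m" using cosprod_step [OF m, of u] k by simp
  finally show ?case unfolding k by (simp add: power_mult_distrib algebra_simps power4_eq_xxxx power2_eq_square)
qed

context
  fixes b assumes b: "b \<in> solutions U X N0"
begin

lemma solution_facts:
  shows holo_b: "holo_fun U (b j)" and b_nz: "u \<in> U \<Longrightarrow> b j u \<noteq> 0"
    and pd_b: "u \<in> U \<Longrightarrow> l \<in> {1..CARD('n)} \<Longrightarrow> m \<in> {1..CARD('n)} \<Longrightarrow> l \<noteq> m \<Longrightarrow>
      pd (\<iota> l) (b (\<iota> m)) u = (if m < l then - tan (u $ \<iota> l) * b (\<iota> m) u else 0)"
proof -
  show "holo_fun U (b j)" and nz: "u \<in> U \<Longrightarrow> b j u \<noteq> 0" for j u using b by (simp_all add: solutions_def)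
  assume u: "u \<in> U" and l: "l \<in> {1..CARD('n)}" and m: "m \<in> {1..CARD('n)}" and lm: "l \<noteq> m"
  have "pd (\<iota> l) (b (\<iota> m)) u / b (\<iota> m) u = christoffel (induced_metric X) (\<iota> m) (\<iota> m) (\<iota> l) u"
    using b u enum_eq_iff [OF m l] lm by (simp add: solutions_def)
  moreover have "christoffel (induced_metric X) (\<iota> m) (\<iota> m) (\<iota> l) u = (if m < l then - tan (u $ \<iota> l) else 0)"
    using christoffel_spherical(1) [OF u m l] christoffel_spherical(2) [OF u l m] lm by auto
  ultimately show "pd (\<iota> l) (b (\<iota> m)) u = (if m < l then - tan (u $ \<iota> l) * b (\<iota> m) u else 0)"
    using nz [OF u, of "\<iota> m"] by (auto simp: field_simps)
qed

abbreviation "\<omega> \<equiv> separation_function \<iota> a (\<lambda>j u. (b j u)\<^sup>2)"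

lemma separation_last:
  assumes u: "u \<in> U"
  shows "\<omega> CARD('n) u = 0"
proof -
  let ?s = "level_sum (\<lambda>k. 1 / a k) \<iota> u (Suc CARD('n))"
  have s: "?s \<noteq> 0" by (rule sff_spherical(2) [OF u card_range])
  have "(\<Sum>j\<in>UNIV. (sff N0 X j j u)\<^sup>2 / (b j u)\<^sup>2) + 1 = 0" using b u by (simp add: solutions_def)
  then have "?s * ((\<Sum>k\<in>{1..CARD('n)}. (sff N0 X (\<iota> k) (\<iota> k) u)\<^sup>2 / (b (\<iota> k) u)\<^sup>2) + 1) = 0"
    unfolding sum_enum by simp
  moreover have "?s * (\<Sum>k\<in>{1..CARD('n)}. (sff N0 X (\<iota> k) (\<iota> k) u)\<^sup>2 / (b (\<iota> k) u)\<^sup>2) =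
      (\<Sum>k\<in>{1..CARD('n)}. (cosprod \<iota> u k) ^ 4 / (b (\<iota> k) u)\<^sup>2)"
    unfolding sum_distrib_left by (rule sum.cong) (simp_all only: times_divide_eq_right sff_spherical(1) [OF u])
  ultimately have "?s + (\<Sum>k\<in>{1..CARD('n)}. (cosprod \<iota> u k) ^ 4 / (b (\<iota> k) u)\<^sup>2) = 0"
    by (simp add: distrib_left add.commute)
  then show ?thesis using separation_telescope [of "Suc CARD('n)" u "\<lambda>j u. (b j u)\<^sup>2"]
    by (simp add: cosprod_last atLeastLessThanSuc_atLeastAtMost)
qed

lemma separation_Suc: "\<omega> (Suc k) = (\<lambda>u. (cosprod \<iota> u (Suc k) / b (\<iota> (Suc k)) u)\<^sup>2 +
    (1 / a (Suc k)) * (sin (u $ \<iota> (Suc k)))\<^sup>2 + \<omega> k u * (cos (u $ \<iota> (Suc k)))\<^sup>2)"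
  by (simp add: power_divide fun_eq_iff)

lemma holo_separation: "holo_fun U (\<omega> k)"
proof (induction k)
  case 0
  have "\<omega> 0 = (\<lambda>_. 1 / a 0)" by (simp add: fun_eq_iff)
  then show ?case by (simp add: holo_fun_const)
next
  case (Suc k)
  then show ?case unfolding separation_Suc
    by (intro holo_fun_add holo_fun_mult holo_fun_divide holo_fun_power holo_cosprod holo_sin holo_cos holo_fun_const holo_b b_nz)
qed

text \<open>Numerator and denominator of
  \<open>cosprod \<iota> u (Suc k) / b (\<iota> (Suc k)) u\<close> have the same logarithmic
  derivative in every other direction, so their quotient contributes nothing.\<close>

lemma pd_separation_step:
  assumes u: "u \<in> U" and k: "Suc k \<le> CARD('n)" and l: "l \<in> {1..CARD('n)}" "l \<noteq> Suc k"
  shows "pd (\<iota> l) (\<omega> (Suc k)) u = (cos (u $ \<iota> (Suc k)))\<^sup>2 * pd (\<iota> l) (\<omega> k) u"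
proof -
  let ?m = "Suc k"
  have m: "?m \<in> {1..CARD('n)}" using k by simp
  have ml: "\<iota> ?m \<noteq> \<iota> l" using enum_eq_iff [OF m l(1)] l(2) by simp
  define f where "f = (\<lambda>u. cosprod \<iota> u ?m / b (\<iota> ?m) u)"
  have hf: "holo_fun U f" unfolding f_def by (intro holo_fun_divide holo_cosprod holo_b b_nz)
  have "pd (\<iota> l) (\<lambda>u. cosprod \<iota> u ?m) u = (if ?m < l then - tan (u $ \<iota> l) * cosprod \<iota> u ?m else 0)"
    using pd_cosprod_high [OF u l(1), of ?m] pd_cosprod_low [OF u l(1) k] l(2) by auto
  then have f0: "pd (\<iota> l) f u = 0"
    unfolding f_def by (simp add: pd_divide [OF holo_cosprod holo_b u b_nz [OF u]] pd_b [OF u l(1) m l(2)])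
  have "\<omega> ?m = (\<lambda>u. (f u)\<^sup>2 + (1 / a ?m) * (sin (u $ \<iota> ?m))\<^sup>2 + \<omega> k u * (cos (u $ \<iota> ?m))\<^sup>2)"
    unfolding f_def by (rule separation_Suc)
  moreover have "pd (\<iota> l) \<dots> u = (cos (u $ \<iota> ?m))\<^sup>2 * pd (\<iota> l) (\<omega> k) u"
  proof -
    have hs: "holo_fun U (\<lambda>u. (sin (u $ \<iota> ?m))\<^sup>2)" and hc: "holo_fun U (\<lambda>u. (cos (u $ \<iota> ?m))\<^sup>2)"
      by (intro holo_fun_power holo_sin holo_cos)+
    note h = holo_fun_power [OF hf, of 2] holo_fun_mult [OF holo_fun_const hs, of "1 / a ?m"]
    show ?thesis
      unfolding pd_add [OF holo_fun_add [OF h] holo_fun_mult [OF holo_separation hc] u] pd_add [OF h u]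
        pd_mult [OF holo_separation hc u] pd_cmult [OF hs u] pd_power2 [OF hf u] pd_power2 [OF holo_sin u] pd_power2 [OF holo_cos u]
      by (simp add: f0 pd_sin pd_cos ml)
  qed
  ultimately show ?thesis by simp
qed

text \<open>The recursion does not control the derivative in its own direction, so it is approached
  from both ends: upwards from the constant \<open>\<omega> 0\<close> for \<open>k < l\<close>, and
  downwards from \<open>separation_last\<close> for \<open>l \<le> k\<close>, dividing by the
  squared cosine.\<close>

lemma pd_separation:
  assumes k: "k \<le> CARD('n)" and u: "u \<in> U"
  shows "pd j (\<omega> k) u = 0"
proof -
  obtain l where l: "l \<in> {1..CARD('n)}" "j = \<iota> l" by (rule enum_cases)
  have up: "pd (\<iota> l) (\<omega> k) u = 0" if "k < l" for k
    using that
  proof (induction k)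
    case 0
    have "\<omega> 0 = (\<lambda>_. 1 / a 0)" by (simp add: fun_eq_iff)
    then show ?case by simp
  next
    case (Suc k)
    then show ?case using pd_separation_step [OF u _ l(1), of k] l(1) by (simp del: separation_function.simps)
  qed
  have "pd (\<iota> l) (\<omega> k) u = 0" if "l \<le> k"
    using k that
  proof (induction k rule: inc_induct)
    case base
    have "pd (\<iota> l) (\<omega> CARD('n)) u = pd (\<iota> l) (\<lambda>_. 0) u"
      by (rule pd_cong [OF open_U u]) (rule separation_last)
    then show ?case by simp
  next
    case (step k)
    have "cos (u $ \<iota> (Suc k)) \<noteq> 0" using cos_nz [OF u, of "Suc k"] step l(1) by simp
    then show ?case using pd_separation_step [OF u _ l(1), of k] step by (simp del: separation_function.simps)
  qed
  then show ?thesis using up [of k] l(2) by (cases "k < l") auto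
qed

lemma separation_constants_exist:
  assumes cv: "convex U" and u0: "u0 \<in> U"
  shows "separation_constants U a \<iota> b (\<lambda>k. \<omega> k u0)"
  unfolding separation_constants_def
proof (intro conjI ballI)
  fix u k assume u: "u \<in> U" and k: "k \<in> {1..CARD('n)}"
  have c: "\<omega> j u0 = \<omega> j u" if "j \<le> CARD('n)" for j
    using pd_zero_imp_const [OF open_U cv u0 u holo_separation] pd_separation [OF that] by simp
  obtain i where i: "k = Suc i" using k by (cases k) auto
  have 1: "\<omega> k u0 = \<omega> k u" "\<omega> (k - 1) u0 = \<omega> i u" using c [of k] c [of "k - 1"] k i by auto
  show "(b (\<iota> k) u)\<^sup>2 * (\<omega> k u0 - \<omega> (k - 1) u0 * (cos (u $ \<iota> k))\<^sup>2 - (sin (u $ \<iota> k))\<^sup>2 / a k) = (cosprod \<iota> u k)\<^sup>2"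
    using b_nz [OF u, of "\<iota> k"] unfolding 1 unfolding i by simp
qed (simp_all add: separation_last [OF u0])

end

end

section \<open>The explicit family\<close>

lemma polar_deriv:
  fixes f g :: "complex \<Rightarrow> complex"
  assumes f: "(f has_field_derivative A / f t) (at t)" and g: "(g has_field_derivative r / (f t)\<^sup>2) (at t)" and nz: "f t \<noteq> 0"
  shows "((\<lambda>t. f t * cos (g t)) has_field_derivative (A * cos (g t) - r * sin (g t)) / f t) (at t)"
    and "((\<lambda>t. f t * sin (g t)) has_field_derivative (A * sin (g t) + r * cos (g t)) / f t) (at t)"
  using f g by (auto intro!: derivative_eq_intros simp: nz field_simps power2_eq_square)

text \<open>For the planar curve with polar radius \<open>f\<close> and angle \<open>g\<close>,
  \<open>A\<close> is \<open>f\<close> times its derivative and \<open>r\<close> is the squared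
  radius times the angular velocity. The hypothesis on \<open>L\<close> says that the radial
  acceleration is \<open>- L t / f t\<close>; the angular one is \<open>r1 / f t\<close>.\<close>

lemma polar_deriv2:
  fixes f g A r :: "complex \<Rightarrow> complex"
  assumes f: "(f has_field_derivative A t / f t) (at t)" and g: "(g has_field_derivative r t / (f t)\<^sup>2) (at t)" and nz: "f t \<noteq> 0"
    and A: "(A has_field_derivative A1) (at t)" and r: "(r has_field_derivative r1) (at t)"
    and L: "(r t)\<^sup>2 + (A t)\<^sup>2 = (f t)\<^sup>2 * (A1 + L)"
  shows "((\<lambda>t. (A t * cos (g t) - r t * sin (g t)) / f t) has_field_derivative (- L * cos (g t) - r1 * sin (g t)) / f t) (at t)"
    and "((\<lambda>t. (A t * sin (g t) + r t * cos (g t)) / f t) has_field_derivative (- L * sin (g t) + r1 * cos (g t)) / f t) (at t)"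
proof -
  have L': "L = ((r t)\<^sup>2 + (A t)\<^sup>2) / (f t)\<^sup>2 - A1" using L nz by (simp add: field_simps)
  show "((\<lambda>t. (A t * cos (g t) - r t * sin (g t)) / f t) has_field_derivative (- L * cos (g t) - r1 * sin (g t)) / f t) (at t)"
    "((\<lambda>t. (A t * sin (g t) + r t * cos (g t)) / f t) has_field_derivative (- L * sin (g t) + r1 * cos (g t)) / f t) (at t)"
    using f g A r nz unfolding L' by (auto intro!: derivative_eq_intros simp: field_simps power2_eq_square)
qed

lemma rotation_square:
  fixes A r :: complex
  shows "((A * cos t - r * sin t) / d)\<^sup>2 + ((A * sin t + r * cos t) / d)\<^sup>2 = (A\<^sup>2 + r\<^sup>2) / d\<^sup>2"
proof -
  have "(A * c - r * s)\<^sup>2 + (A * s + r * c)\<^sup>2 = (A\<^sup>2 + r\<^sup>2) * (s\<^sup>2 + c\<^sup>2)" for c s :: complex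
    by (simp add: power2_eq_square algebra_simps)
  from this [of "cos t" "sin t"] show ?thesis by (simp add: power_divide add_divide_distrib [symmetric])
qed

lemma sqrt_deriv:
  fixes f :: "complex \<Rightarrow> complex"
  assumes S: "open S" "f holomorphic_on S" "t \<in> S" and R: "\<And>t. t \<in> S \<Longrightarrow> (f t)\<^sup>2 = R t"
    and R': "(R has_field_derivative R') (at t)"
  shows "2 * f t * deriv f t = R'"
proof -
  have "((\<lambda>t. (f t)\<^sup>2) has_field_derivative 2 * f t * deriv f t) (at t)"
    using holomorphic_derivI [OF S(2,1,3)] by (auto intro!: derivative_eq_intros)
  moreover have "((\<lambda>t. (f t)\<^sup>2) has_field_derivative R') (at t)"
    by (rule has_field_derivative_transform_within_open [OF R' S(1,3)]) (simp add: R)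
  ultimately show ?thesis by (rule DERIV_unique)
qed

lemma radicand_deriv:
  "((\<lambda>t. \<gamma> + \<delta> * (sin t)\<^sup>2) has_field_derivative 2 * \<delta> * sin t * cos t) (at (t :: complex))"
  by (auto intro!: derivative_eq_intros)

text \<open>The algebra behind \<open>curve_square\<close>: \<open>S\<close> is the squared sine,
  \<open>p\<close> and \<open>q\<close> are consecutive parameters, and \<open>y\<close> is the
  squared derivative of \<open>r\<close>.\<close>

lemma curve_identity:
  fixes p q c S :: complex
  assumes F: "p - q + (c - p) * S \<noteq> 0" and R: "R = (p - q) * c + (c - p) * q * S" "R \<noteq> 0"
    and y: "R * y = (c - p)\<^sup>2 * q\<^sup>2 * S * (1 - S)"
  shows "((p + (c - p) * S)\<^sup>2 + y) / (p - q + (c - p) * S) = p + (c - p) * S + p * q * c / R"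
proof -
  have "((p + (c - p) * S)\<^sup>2 + y) * R = ((p + (c - p) * S) * R + p * q * c) * (p - q + (c - p) * S)"
    using y unfolding R by algebra
  then show ?thesis using F R(2) by (simp add: divide_simps mult.commute)
qed

locale explicit_map = spherical_net V \<iota> a N0
  for V :: "(complex^'n::finite) set" and \<iota> :: "nat \<Rightarrow> 'n" and a :: "nat \<Rightarrow> complex"
    and N0 :: "complex^'n \<Rightarrow> complex^('n option)" +
  fixes e :: "nat \<Rightarrow> 'm::finite" and z :: "nat \<Rightarrow> complex" and Y :: "complex^'n \<Rightarrow> complex^'m"
    and f r g :: "nat \<Rightarrow> complex \<Rightarrow> complex" and s h :: "complex \<Rightarrow> complex"
  assumes e: "bij_betw e {0..2 * CARD('n) - 2} UNIV" and z0: "z 0 = 1"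
    and holo_f: "k \<in> {1..CARD('n) - 1} \<Longrightarrow> f k holomorphic_on (\<lambda>u. u $ \<iota> k) ` V"
    and holo_r: "k \<in> {1..CARD('n) - 1} \<Longrightarrow> r k holomorphic_on (\<lambda>u. u $ \<iota> k) ` V"
    and f_square: "k \<in> {1..CARD('n) - 1} \<Longrightarrow> t \<in> (\<lambda>u. u $ \<iota> k) ` V \<Longrightarrow> (f k t)\<^sup>2 = radf a z k t"
    and radf_nz: "k \<in> {1..CARD('n) - 1} \<Longrightarrow> t \<in> (\<lambda>u. u $ \<iota> k) ` V \<Longrightarrow> radf a z k t \<noteq> 0"
    and r_square: "k \<in> {1..CARD('n) - 1} \<Longrightarrow> t \<in> (\<lambda>u. u $ \<iota> k) ` V \<Longrightarrow> (r k t)\<^sup>2 = radg a z k t"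
    and g_deriv: "k \<in> {1..CARD('n) - 1} \<Longrightarrow> t \<in> (\<lambda>u. u $ \<iota> k) ` V \<Longrightarrow>
      (g k has_field_derivative r k t / radf a z k t) (at t)"
    and holo_s: "s holomorphic_on (\<lambda>u. u $ \<iota> CARD('n)) ` V"
    and s_square: "t \<in> (\<lambda>u. u $ \<iota> CARD('n)) ` V \<Longrightarrow> (s t)\<^sup>2 = radh CARD('n) a z t"
    and h_deriv: "t \<in> (\<lambda>u. u $ \<iota> CARD('n)) ` V \<Longrightarrow> (h has_field_derivative s t) (at t)"
    and Y_eq: "u \<in> V \<Longrightarrow> Y u = (\<Sum>k\<in>{1..CARD('n)-1}. (cosprod \<iota> u k * f k (u $ \<iota> k)) *s
              (cos (g k (u $ \<iota> k)) *s axis (e (2*k-2)) 1 + sin (g k (u $ \<iota> k)) *s axis (e (2*k-1)) 1))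
           + h (u $ \<iota> CARD('n)) *s axis (e (2*CARD('n)-2)) 1"
begin

definition epos :: "'m \<Rightarrow> nat" where "epos = the_inv_into {0..2 * CARD('n) - 2} e"

text \<open>Two coordinates per level, except for a single one at the last level.\<close>

definition elev :: "'m \<Rightarrow> nat" where "elev i = epos i div 2 + 1"

definition p :: "nat \<Rightarrow> complex" where "p k = z k * a 0"

text \<open>Half the derivative of \<open>radf\<close>, hence \<open>f k\<close> times its
  derivative.\<close>

definition A :: "nat \<Rightarrow> complex \<Rightarrow> complex" where "A k t = (a k - p (k - 1)) * sin t * cos t"

text \<open>Minus \<open>f k\<close> times the radial acceleration of the planar curve at level
  \<open>k\<close>, by \<open>L_identity\<close> and \<open>polar_deriv2\<close>.\<close>

definition L :: "nat \<Rightarrow> complex \<Rightarrow> complex" where "L k t = p (k - 1) + (a k - p (k - 1)) * (sin t)\<^sup>2"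

definition eG :: "'m \<Rightarrow> complex \<Rightarrow> complex" where
  "eG i t = (if elev i = CARD('n) then h t
    else if even (epos i) then f (elev i) t * cos (g (elev i) t) else f (elev i) t * sin (g (elev i) t))"

definition eG1 :: "'m \<Rightarrow> complex \<Rightarrow> complex" where
  "eG1 i t = (let k = elev i in if k = CARD('n) then s t
    else if even (epos i) then (A k t * cos (g k t) - r k t * sin (g k t)) / f k t
    else (A k t * sin (g k t) + r k t * cos (g k t)) / f k t)"

definition eG2 :: "'m \<Rightarrow> complex \<Rightarrow> complex" where
  "eG2 i t = (let k = elev i in if k = CARD('n) then deriv s t
    else if even (epos i) then (- L k t * cos (g k t) - deriv (r k) t * sin (g k t)) / f k t
    else (- L k t * sin (g k t) + deriv (r k) t * cos (g k t)) / f k t)"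

lemma epos_e: "j \<le> 2 * CARD('n) - 2 \<Longrightarrow> epos (e j) = j"
  unfolding epos_def by (rule the_inv_into_f_f) (use e in \<open>simp_all add: bij_betw_def\<close>)

lemma e_epos: "e (epos i) = i"
  unfolding epos_def by (rule f_the_inv_into_f_bij_betw [OF e]) simp

lemma epos_range: "epos i \<le> 2 * CARD('n) - 2"
  using bij_betw_the_inv_into [OF e] unfolding epos_def bij_betw_def by auto

lemma card_pos: "0 < CARD('n)"
  by simp

lemma elev_range: "elev i \<in> {1..CARD('n)}"
proof -
  have "x \<le> 2 * c - 2 \<Longrightarrow> 0 < c \<Longrightarrow> x div 2 + 1 \<le> c" for x c :: nat by presburger
  from this [OF epos_range [of i] card_pos] show ?thesis by (simp add: elev_def)
qed

lemma elev_last: "elev i = CARD('n) \<longleftrightarrow> epos i = 2 * CARD('n) - 2"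
proof -
  have "x \<le> 2 * c - 2 \<Longrightarrow> 0 < c \<Longrightarrow> x div 2 + 1 = c \<longleftrightarrow> x = 2 * c - 2" for x c :: nat by presburger
  from this [OF epos_range [of i] card_pos] show ?thesis by (simp add: elev_def)
qed

lemma elev_low: "elev i \<noteq> CARD('n) \<Longrightarrow> elev i \<in> {1..CARD('n) - 1}"
  using elev_range [of i] by auto

lemma sum_elev_low:
  assumes k: "k \<in> {1..CARD('n) - 1}"
  shows "(\<Sum>i | elev i = k. \<phi> i) = \<phi> (e (2 * k - 2)) + (\<phi> (e (2 * k - Suc 0)) :: complex)"
proof -
  have "i \<in> {i. elev i = k} \<longleftrightarrow> i = e (2 * k - 2) \<or> i = e (2 * k - Suc 0)" for i
  proof
    assume "i \<in> {i. elev i = k}"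
    then have "epos i = 2 * k - 2 \<or> epos i = 2 * k - Suc 0" by (auto simp: elev_def)
    then show "i = e (2 * k - 2) \<or> i = e (2 * k - Suc 0)" using e_epos [of i] by auto
  next
    assume "i = e (2 * k - 2) \<or> i = e (2 * k - Suc 0)"
    then have "epos i = 2 * k - 2 \<or> epos i = 2 * k - Suc 0" using k by (auto simp: epos_e)
    then show "i \<in> {i. elev i = k}" using k by (auto simp: elev_def)
  qed
  then have "{i. elev i = k} = {e (2 * k - 2), e (2 * k - Suc 0)}" by blast
  moreover have "e (2 * k - 2) \<noteq> e (2 * k - Suc 0)"
  proof
    assume eq: "e (2 * k - 2) = e (2 * k - Suc 0)"
    have le: "2 * k - 2 \<le> 2 * CARD('n) - 2" "2 * k - Suc 0 \<le> 2 * CARD('n) - 2" "2 * k - 2 \<noteq> 2 * k - Suc 0"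
      using k by auto
    show False using epos_e [OF le(1)] epos_e [OF le(2)] le(3) unfolding eq by simp
  qed
  ultimately show ?thesis by simp
qed

lemma sum_elev_last: "(\<Sum>i | elev i = CARD('n). \<phi> i) = (\<phi> (e (2 * CARD('n) - 2)) :: complex)"
proof -
  have "{i. elev i = CARD('n)} = {e (2 * CARD('n) - 2)}"
    unfolding elev_last using e_epos by (auto simp: epos_e) metis
  then show ?thesis by simp
qed

lemma elev_e:
  assumes "k \<in> {1..CARD('n) - 1}"
  shows "elev (e (2 * k - 2)) = k" "elev (e (2 * k - Suc 0)) = k" "even (epos (e (2 * k - 2)))" "\<not> even (epos (e (2 * k - Suc 0)))"
    "k \<noteq> CARD('n)"
proof -
  obtain i where "k = Suc i" using assms by (cases k) auto
  then show "elev (e (2 * k - 2)) = k" "elev (e (2 * k - Suc 0)) = k" "even (epos (e (2 * k - 2)))" "\<not> even (epos (e (2 * k - Suc 0)))"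
    "k \<noteq> CARD('n)"
    using assms by (simp_all add: elev_def epos_e)
qed

lemma eG_e:
  assumes "k \<in> {1..CARD('n) - 1}"
  shows "eG (e (2 * k - 2)) t = f k t * cos (g k t)"
    and "eG (e (2 * k - Suc 0)) t = f k t * sin (g k t)"
    and "eG1 (e (2 * k - 2)) t = (A k t * cos (g k t) - r k t * sin (g k t)) / f k t"
    and "eG1 (e (2 * k - Suc 0)) t = (A k t * sin (g k t) + r k t * cos (g k t)) / f k t"
    and "eG2 (e (2 * k - 2)) t = (- L k t * cos (g k t) - deriv (r k) t * sin (g k t)) / f k t"
    and "eG2 (e (2 * k - Suc 0)) t = (- L k t * sin (g k t) + deriv (r k) t * cos (g k t)) / f k t"
  unfolding eG_def eG1_def eG2_def Let_def elev_e(1,2) [OF assms] using elev_e(3,4,5) [OF assms] by simp_all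

lemma radf_alt: "radf a z k t = p (k - 1) - p k + (a k - p (k - 1)) * (sin t)\<^sup>2"
  by (simp add: radf_def p_def algebra_simps)

lemma radg_alt: "radg a z k t = (p (k - 1) - p k) * a k + (a k - p (k - 1)) * p k * (sin t)\<^sup>2"
  by (simp add: radg_def p_def algebra_simps)

lemma radh_alt: "radh CARD('n) a z t = a CARD('n) + (p (CARD('n) - 1) - a CARD('n)) * (sin t)\<^sup>2"
  by (simp add: radh_def p_def algebra_simps)

lemma p_0: "p 0 = a 0"
  by (simp add: p_def z0)

context
  fixes k t assumes k: "k \<in> {1..CARD('n) - 1}" and t: "t \<in> (\<lambda>u. u $ \<iota> k) ` V"
begin

lemma f_nz: "f k t \<noteq> 0"
  using f_square [OF k t] radf_nz [OF k t] by auto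

lemma f_deriv: "(f k has_field_derivative A k t / f k t) (at t)"
proof -
  have "(radf a z k has_field_derivative 2 * (a k - p (k - 1)) * sin t * cos t) (at t)"
    using radicand_deriv [of "p (k - 1) - p k" "a k - p (k - 1)" t] by (simp add: radf_alt [abs_def])
  from sqrt_deriv [OF open_projection holo_f [OF k] t f_square [OF k] this]
  have "2 * (f k t * deriv (f k) t) = 2 * A k t" by (simp only: A_def mult.assoc)
  then have "deriv (f k) t = A k t / f k t" using f_nz by (simp add: field_simps)
  then show ?thesis using holomorphic_derivI [OF holo_f [OF k] open_projection t] by simp
qed

lemma g_deriv': "(g k has_field_derivative r k t / (f k t)\<^sup>2) (at t)"
  using g_deriv [OF k t] f_square [OF k t] by simp

lemma r_deriv: "r k t * deriv (r k) t = (a k - p (k - 1)) * p k * sin t * cos t"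
proof -
  have "(radg a z k has_field_derivative 2 * ((a k - p (k - 1)) * p k) * sin t * cos t) (at t)"
    using radicand_deriv [of "(p (k - 1) - p k) * a k" "(a k - p (k - 1)) * p k" t] by (simp add: radg_alt [abs_def])
  from sqrt_deriv [OF open_projection holo_r [OF k] t r_square [OF k] this]
  have "2 * (r k t * deriv (r k) t) = 2 * ((a k - p (k - 1)) * p k * sin t * cos t)" by (simp only: mult.assoc)
  then show ?thesis by simp
qed

lemma A_deriv: "(A k has_field_derivative (a k - p (k - 1)) * ((cos t)\<^sup>2 - (sin t)\<^sup>2)) (at t)"
  unfolding A_def by (auto intro!: derivative_eq_intros simp: algebra_simps power2_eq_square)

text \<open>The origin of \<open>radg\<close>: the angular velocity is chosen so that the planar
  curve at level \<open>k\<close> has the speed which the metric requires.\<close>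

lemma A_r_square: "(A k t)\<^sup>2 + (r k t)\<^sup>2 = (f k t)\<^sup>2 * (a k * (cos t)\<^sup>2 + p (k - 1) * (sin t)\<^sup>2)"
  unfolding A_def f_square [OF k t] r_square [OF k t] radf_alt radg_alt
  by (simp add: power_mult_distrib cos_squared_eq) (simp add: algebra_simps power2_eq_square)

lemma L_identity: "(r k t)\<^sup>2 + (A k t)\<^sup>2 = (f k t)\<^sup>2 * ((a k - p (k - 1)) * ((cos t)\<^sup>2 - (sin t)\<^sup>2) + L k t)"
  using A_r_square by (simp add: L_def cos_squared_eq algebra_simps)

lemma curve_square:
  assumes nz: "radg a z k t \<noteq> 0"
  shows "((L k t)\<^sup>2 + (deriv (r k) t)\<^sup>2) / (f k t)\<^sup>2 =
    p (k - 1) * (cos t)\<^sup>2 + a k * (sin t)\<^sup>2 + p (k - 1) * p k * a k / radg a z k t"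
proof -
  have "radg a z k t * (deriv (r k) t)\<^sup>2 = (r k t * deriv (r k) t)\<^sup>2"
    by (simp add: r_square [OF k t] power_mult_distrib)
  then have y: "radg a z k t * (deriv (r k) t)\<^sup>2 = (a k - p (k - 1))\<^sup>2 * (p k)\<^sup>2 * (sin t)\<^sup>2 * (1 - (sin t)\<^sup>2)"
    unfolding r_deriv by (simp add: power_mult_distrib cos_squared_eq)
  have "p (k - 1) - p k + (a k - p (k - 1)) * (sin t)\<^sup>2 \<noteq> 0" using radf_nz [OF k t] by (simp add: radf_alt)
  from curve_identity [OF this radg_alt nz y] show ?thesis
    unfolding L_def f_square [OF k t] radf_alt by (simp add: cos_squared_eq algebra_simps)
qed

end

lemma projectionI: "u \<in> V \<Longrightarrow> u $ \<iota> k \<in> (\<lambda>u. u $ \<iota> k) ` V"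
  by (rule imageI)

lemma Y_component:
  assumes u: "u \<in> V"
  shows "Y u $ i = cosprod \<iota> u (elev i) * eG i (u $ \<iota> (elev i))"
proof -
  have ax: "axis (e j) 1 $ i = (if j = epos i then 1 else (0 :: complex))" if "j \<le> 2 * CARD('n) - 2" for j
    using epos_e [OF that] e_epos [of i] by (auto simp: axis_def)
  have low: "(\<Sum>k\<in>{1..CARD('n)-1}. (cosprod \<iota> u k * f k (u $ \<iota> k)) *
      (cos (g k (u $ \<iota> k)) * axis (e (2*k-2)) 1 $ i + sin (g k (u $ \<iota> k)) * axis (e (2*k-1)) 1 $ i)) =
    (\<Sum>k\<in>{1..CARD('n)-1}. if k = elev i then cosprod \<iota> u k * f k (u $ \<iota> k) *
      (if even (epos i) then cos (g k (u $ \<iota> k)) else sin (g k (u $ \<iota> k))) else 0)"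
  proof (rule sum.cong)
    fix k assume k: "k \<in> {1..CARD('n) - 1}"
    then have "0 < k" by simp
    moreover have "0 < k \<Longrightarrow> (2 * k - 2 = x \<longleftrightarrow> k = x div 2 + 1 \<and> even x) \<and> (2 * k - 1 = x \<longleftrightarrow> k = x div 2 + 1 \<and> odd x)"
      for x k :: nat by presburger
    ultimately have 1: "2 * k - 2 = epos i \<longleftrightarrow> k = elev i \<and> even (epos i)" "2 * k - 1 = epos i \<longleftrightarrow> k = elev i \<and> odd (epos i)"
      unfolding elev_def by auto
    show "(cosprod \<iota> u k * f k (u $ \<iota> k)) *
      (cos (g k (u $ \<iota> k)) * axis (e (2*k-2)) 1 $ i + sin (g k (u $ \<iota> k)) * axis (e (2*k-1)) 1 $ i) =
      (if k = elev i then cosprod \<iota> u k * f k (u $ \<iota> k) *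
      (if even (epos i) then cos (g k (u $ \<iota> k)) else sin (g k (u $ \<iota> k))) else 0)"
      using ax [of "2 * k - 2", unfolded 1(1)] ax [of "2 * k - 1", unfolded 1(2)] k by auto
  qed simp
  have "Y u $ i = (\<Sum>k\<in>{1..CARD('n)-1}. (cosprod \<iota> u k * f k (u $ \<iota> k)) *
      (cos (g k (u $ \<iota> k)) * axis (e (2*k-2)) 1 $ i + sin (g k (u $ \<iota> k)) * axis (e (2*k-1)) 1 $ i)) +
      h (u $ \<iota> CARD('n)) * axis (e (2*CARD('n)-2)) 1 $ i"
    unfolding Y_eq [OF u] by (simp add: distrib_left mult.assoc)
  also have "\<dots> = cosprod \<iota> u (elev i) * eG i (u $ \<iota> (elev i))"
  proof (cases "elev i = CARD('n)")
    case True
    have "(\<Sum>k\<in>{1..CARD('n)-1}. if k = CARD('n) then cosprod \<iota> u k * f k (u $ \<iota> k) *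
      (if even (epos i) then cos (g k (u $ \<iota> k)) else sin (g k (u $ \<iota> k))) else 0) = 0"
      by (intro sum.neutral ballI if_not_P elev_e(5))
    then show ?thesis unfolding low using True elev_last [of i] by (simp add: ax eG_def cosprod_last)
  next
    case False
    then show ?thesis unfolding low using elev_low [OF False] elev_last [of i] by (simp add: ax eG_def)
  qed
  finally show ?thesis .
qed

sublocale Y: telescoping_map V \<iota> Y elev eG eG1 eG2 a p
proof unfold_locales
  fix u i assume u: "u \<in> V"
  let ?k = "elev i" let ?t = "u $ \<iota> ?k"
  have t: "?t \<in> (\<lambda>u. u $ \<iota> ?k) ` V" by (rule projectionI [OF u])
  show "(eG i has_field_derivative eG1 i ?t) (at ?t)"
  proof (cases "?k = CARD('n)")
    case True
    then show ?thesis using h_deriv [of ?t] t by (simp add: eG_def [abs_def] eG1_def)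
  next
    case False
    note k = elev_low [OF False]
    show ?thesis using polar_deriv [OF f_deriv [OF k t] g_deriv' [OF k t] f_nz [OF k t]] False
      unfolding eG_def [abs_def] eG1_def by (cases "even (epos i)") (simp_all add: Let_def)
  qed
  show "(eG1 i has_field_derivative eG2 i ?t) (at ?t)"
  proof (cases "?k = CARD('n)")
    case True
    then show ?thesis using holomorphic_derivI [OF holo_s open_projection, of ?t] t
      by (simp add: eG1_def [abs_def] eG2_def)
  next
    case False
    note k = elev_low [OF False]
    show ?thesis
      using polar_deriv2 [OF f_deriv [OF k t] g_deriv' [OF k t] f_nz [OF k t] A_deriv [OF k t]
          holomorphic_derivI [OF holo_r [OF k] open_projection t] L_identity [OF k t]] False
      unfolding eG1_def [abs_def] eG2_def by (cases "even (epos i)") (simp_all add: Let_def)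
  qed
next
  fix u k assume u: "u \<in> V" and k: "k \<in> {1..CARD('n) - 1}"
  let ?t = "u $ \<iota> k"
  have t: "?t \<in> (\<lambda>u. u $ \<iota> k) ` V" by (rule projectionI [OF u])
  have "(\<Sum>i | elev i = k. (eG i ?t)\<^sup>2) = (f k ?t)\<^sup>2 * ((sin (g k ?t))\<^sup>2 + (cos (g k ?t))\<^sup>2)"
    unfolding sum_elev_low [OF k] eG_e [OF k] by (simp only: power_mult_distrib distrib_left add.commute)
  then show "(\<Sum>i | elev i = k. (eG i ?t)\<^sup>2) = p (k - 1) * (cos ?t)\<^sup>2 + a k * (sin ?t)\<^sup>2 - p k"
    by (simp add: f_square [OF k t] radf_alt cos_squared_eq algebra_simps)
  have "(\<Sum>i | elev i = k. eG i ?t * eG1 i ?t) = A k ?t * ((sin (g k ?t))\<^sup>2 + (cos (g k ?t))\<^sup>2)"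
    unfolding sum_elev_low [OF k] eG_e [OF k] using f_nz [OF k t]
    by (simp add: algebra_simps power2_eq_square add_divide_distrib diff_divide_distrib del: sin_cos_squared_add sin_cos_squared_add2 sin_cos_squared_add3)
  then show "(\<Sum>i | elev i = k. eG i ?t * eG1 i ?t) = (a k - p (k - 1)) * sin ?t * cos ?t"
    by (simp add: A_def)
next
  fix u k assume u: "u \<in> V" and k: "k \<in> {1..CARD('n)}"
  let ?t = "u $ \<iota> k"
  have t: "?t \<in> (\<lambda>u. u $ \<iota> k) ` V" by (rule projectionI [OF u])
  show "(\<Sum>i | elev i = k. (eG1 i ?t)\<^sup>2) = a k * (cos ?t)\<^sup>2 + p (k - 1) * (sin ?t)\<^sup>2"
  proof (cases "k = CARD('n)")
    case True
    have "elev (e (2 * CARD('n) - 2)) = CARD('n)" by (simp add: elev_last epos_e)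
    then show ?thesis using t unfolding True sum_elev_last
      by (simp add: eG1_def s_square radh_alt cos_squared_eq algebra_simps)
  next
    case False
    then have k': "k \<in> {1..CARD('n) - 1}" using k by auto
    show ?thesis unfolding sum_elev_low [OF k'] eG_e [OF k'] rotation_square A_r_square [OF k' t]
      using f_nz [OF k' t] by simp
  qed
qed (use elev_range Y_component p_0 in simp_all)

lemma metric_Y: "u \<in> V \<Longrightarrow> induced_metric Y u = induced_metric X u"
  by (rule telescoping_metric_eq [OF Y.telescoping_map_axioms telescoping_map_axioms])

text \<open>The joined square is the excess \<open>J\<close> of \<open>pure_square\<close> times a
  power of \<open>cosprod\<close>. Below the last level \<open>J\<close> comes from
  \<open>curve_square\<close>; at the last level the curve is straight and only
  \<open>deriv s\<close> contributes.\<close>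

lemma joined_square_Y:
  assumes u: "u \<in> V"
  shows "k \<in> {1..CARD('n) - 1} \<Longrightarrow> radg a z k (u $ \<iota> k) \<noteq> 0 \<Longrightarrow>
      joined_square X Y (\<iota> k) u = (cosprod \<iota> u k)\<^sup>2 * (p (k - 1) * p k * a k / radg a z k (u $ \<iota> k))"
    and "radh CARD('n) a z (u $ \<iota> CARD('n)) \<noteq> 0 \<Longrightarrow>
      joined_square X Y (\<iota> CARD('n)) u = - p (CARD('n) - 1) * a CARD('n) / radh CARD('n) a z (u $ \<iota> CARD('n))"
proof -
  assume k: "k \<in> {1..CARD('n) - 1}" and nz: "radg a z k (u $ \<iota> k) \<noteq> 0"
  have k': "k \<in> {1..CARD('n)}" using k by auto
  let ?t = "u $ \<iota> k"
  have t: "?t \<in> (\<lambda>u. u $ \<iota> k) ` V" by (rule projectionI [OF u])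
  have "(\<Sum>i | elev i = k. (eG2 i ?t)\<^sup>2) =
      p (k - 1) * (cos ?t)\<^sup>2 + a k * (sin ?t)\<^sup>2 + p (k - 1) * p k * a k / radg a z k ?t"
    unfolding sum_elev_low [OF k] curve_square [OF k t nz, symmetric]
    unfolding eG_e [OF k] rotation_square by simp
  from Y.pure_square [OF u k' this]
  show "joined_square X Y (\<iota> k) u = (cosprod \<iota> u k)\<^sup>2 * (p (k - 1) * p k * a k / radg a z k (u $ \<iota> k))"
    by (simp add: joined_square_def X_pure_square [OF u k'])
next
  let ?n = "CARD('n)" let ?t = "u $ \<iota> CARD('n)"
  assume nz: "radh CARD('n) a z (u $ \<iota> CARD('n)) \<noteq> 0"
  have t: "?t \<in> (\<lambda>u. u $ \<iota> ?n) ` V" by (rule projectionI [OF u])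
  define S where "S = (sin ?t)\<^sup>2"
  have "(radh ?n a z has_field_derivative 2 * (p (?n - 1) - a ?n) * sin ?t * cos ?t) (at ?t)"
    using radicand_deriv [of "a ?n" "p (?n - 1) - a ?n" ?t] by (simp add: radh_alt [abs_def])
  from sqrt_deriv [OF open_projection holo_s t s_square this]
  have "2 * (s ?t * deriv s ?t) = 2 * ((p (?n - 1) - a ?n) * sin ?t * cos ?t)" by (simp only: mult.assoc)
  then have "s ?t * deriv s ?t = (p (?n - 1) - a ?n) * sin ?t * cos ?t" by simp
  then have "(s ?t * deriv s ?t)\<^sup>2 = ((p (?n - 1) - a ?n) * sin ?t * cos ?t)\<^sup>2" by simp
  then have d: "radh ?n a z ?t * (deriv s ?t)\<^sup>2 = (p (?n - 1) - a ?n)\<^sup>2 * S * (1 - S)"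
    by (simp add: power_mult_distrib s_square [OF t] S_def cos_squared_eq)
  have R: "radh ?n a z ?t = a ?n + (p (?n - 1) - a ?n) * S" by (simp add: radh_alt S_def)
  have "(deriv s ?t)\<^sup>2 = p (?n - 1) * (1 - S) + a ?n * S + - p (?n - 1) * a ?n / radh ?n a z ?t"
  proof -
    have "radh ?n a z ?t * (deriv s ?t)\<^sup>2 = radh ?n a z ?t * (p (?n - 1) * (1 - S) + a ?n * S) - p (?n - 1) * a ?n"
      unfolding d unfolding R by (simp add: algebra_simps power2_eq_square)
    then show ?thesis using nz by (simp add: field_simps)
  qed
  moreover have "elev (e (2 * ?n - 2)) = ?n" by (simp add: elev_last epos_e)
  ultimately have "(\<Sum>i | elev i = ?n. (eG2 i ?t)\<^sup>2) =
      p (?n - 1) * (cos ?t)\<^sup>2 + a ?n * (sin ?t)\<^sup>2 + - p (?n - 1) * a ?n / radh ?n a z ?t"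
    unfolding sum_elev_last by (simp add: eG2_def S_def cos_squared_eq)
  from Y.pure_square [OF u card_range this]
  show "joined_square X Y (\<iota> ?n) u = - p (?n - 1) * a ?n / radh ?n a z ?t"
    by (simp add: joined_square_def X_pure_square [OF u card_range] cosprod_last)
qed

end

section \<open>Separation constants and regularity of the explicit family\<close>

context explicit_map
begin

definition W :: "nat \<Rightarrow> complex" where
  "W k = (if k = CARD('n) then 0 else 1 / (a 0 * z k))"

context
  assumes regular: "peterson_regular a \<iota> V z"
begin

lemma p_nz: "k < CARD('n) \<Longrightarrow> p k \<noteq> 0"
  using regular a_nz [of 0] by (cases k) (auto simp: p_def z0 peterson_regular_def)

lemma W_low: "k < CARD('n) \<Longrightarrow> W k = 1 / p k"
  by (simp add: W_def p_def mult.commute)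

text \<open>The separation expression is \<open>radg\<close> divided by
  \<open>p (k - 1) * p k * a k\<close>, and at the last index \<open>- radh\<close> divided by
  \<open>p (k - 1) * a k\<close>: up to the factor \<open>cosprod\<close> squared, the reciprocals
  of the joined squares.\<close>

lemma joined_separation:
  assumes u: "u \<in> V" and k: "k \<in> {1..CARD('n)}"
  shows "joined_square X Y (\<iota> k) u * (W k - W (k - 1) * (cos (u $ \<iota> k))\<^sup>2 - (sin (u $ \<iota> k))\<^sup>2 / a k) = (cosprod \<iota> u k)\<^sup>2"
proof -
  define S where "S = (sin (u $ \<iota> k))\<^sup>2"
  have c: "(cos (u $ \<iota> k))\<^sup>2 = 1 - S" by (simp add: S_def cos_squared_eq)
  have ak: "a k \<noteq> 0" using a_nz k by simp
  have k1: "k - 1 < CARD('n)" using k by auto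
  have p1: "p (k - 1) \<noteq> 0" by (rule p_nz [OF k1])
  show ?thesis
  proof (cases "k = CARD('n)")
    case False
    then have k': "k \<in> {1..CARD('n) - 1}" "k < CARD('n)" using k by auto
    have R: "radg a z k (u $ \<iota> k) \<noteq> 0" using regular u k' by (simp add: peterson_regular_def)
    have "p (k - 1) * p k * a k * (1 / p k - 1 / p (k - 1) * (1 - S) - S / a k) = radg a z k (u $ \<iota> k)"
      using p1 p_nz [OF k'(2)] ak unfolding radg_alt S_def [symmetric] by (simp add: field_simps)
    then have "W k - W (k - 1) * (1 - S) - S / a k = radg a z k (u $ \<iota> k) / (p (k - 1) * p k * a k)"
      unfolding W_low [OF k'(2)] W_low [OF k1] using p1 p_nz [OF k'(2)] ak by (simp add: eq_divide_eq mult.commute)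
    then show ?thesis unfolding c S_def [symmetric] joined_square_Y(1) [OF u k'(1) R]
      using R p1 p_nz [OF k'(2)] ak by simp
  next
    case True
    have R: "radh CARD('n) a z (u $ \<iota> CARD('n)) \<noteq> 0" using regular u by (simp add: peterson_regular_def)
    have "p (k - 1) * a k * (0 - 1 / p (k - 1) * (1 - S) - S / a k) = - radh CARD('n) a z (u $ \<iota> CARD('n))"
      using p1 ak unfolding radh_alt unfolding True [symmetric] S_def [symmetric] by (simp add: field_simps)
    moreover have "P * x = y \<Longrightarrow> P \<noteq> 0 \<Longrightarrow> x = y / P" for P x y :: complex by (simp add: eq_divide_eq mult.commute)
    ultimately have "0 - 1 / p (k - 1) * (1 - S) - S / a k = - radh CARD('n) a z (u $ \<iota> CARD('n)) / (p (k - 1) * a k)"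
      using p1 ak by (metis no_zero_divisors)
    then have "W k - W (k - 1) * (1 - S) - S / a k = - radh CARD('n) a z (u $ \<iota> CARD('n)) / (p (k - 1) * a k)"
      unfolding W_low [OF k1] by (simp only: W_def True if_True refl)
    moreover have "joined_square X Y (\<iota> k) u = - p (k - 1) * a k / radh CARD('n) a z (u $ \<iota> CARD('n))"
      using joined_square_Y(2) [OF u R] True by simp
    moreover have "cosprod \<iota> u k = 1" using True cosprod_last by simp
    ultimately show ?thesis unfolding c S_def [symmetric] using R p1 ak by simp
  qed
qed

lemma joined_square_Y_nz: "u \<in> V \<Longrightarrow> joined_square X Y j u \<noteq> 0"
proof -
  assume u: "u \<in> V"
  obtain k where k: "k \<in> {1..CARD('n)}" "j = \<iota> k" by (rule enum_cases)
  have "cosprod \<iota> u k \<noteq> 0" by (rule cosprod_nz [OF u]) (use k in simp)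
  then show ?thesis using joined_separation [OF u k(1)] k(2) by auto
qed

end

lemma deformation_Y: "deformation V X Y"
  by (simp add: deformation_def Y.holo_Y metric_Y)

lemma conjugate_Y: "(\<And>u j. u \<in> V \<Longrightarrow> bil (M u) (vpd j Y u) = 0) \<Longrightarrow> conjugate_system V M Y"
  unfolding conjugate_system_def sff_def by (auto intro!: Y.mixed_tangential)

end

lemma explicit_map_frame:
  fixes Y :: "complex^'n::finite \<Rightarrow> complex^('n + 'a::finite)"
  assumes "explicit_map V \<iota> a N0 e z Y f r g s h"
  shows "\<exists>N. normal_frame V Y N \<and> (\<forall>\<alpha>. conjugate_system V (N \<alpha>) Y)"
    and "peterson_regular a \<iota> V z \<Longrightarrow> Y \<in> conjugate_deformations V (spherical a \<iota>) N0"
proof -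
  interpret explicit_map V \<iota> a N0 e z Y f r g s h by (rule assms)
  obtain N :: "'a \<Rightarrow> complex^'n \<Rightarrow> complex^('n + 'a)" where N: "normal_frame V Y N"
    using normal_frame_exists [of V Y] metric_Y det_spherical by auto
  have c: "conjugate_system V (N \<alpha>) Y" for \<alpha>
    by (rule conjugate_Y) (use N in \<open>simp add: normal_frame_def\<close>)
  show "\<exists>N. normal_frame V Y N \<and> (\<forall>\<alpha>. conjugate_system V (N \<alpha>) Y)"
    by (intro exI [of _ "\<lambda>\<alpha>. N \<alpha>"] conjI allI N c)
  show "Y \<in> conjugate_deformations V X N0" if "peterson_regular a \<iota> V z"
    by (rule conjugate_deformationI [OF quadric_piece_spherical deformation_Y N c joined_square_Y_nz [OF that]])
qed

lemma peterson_map_explicit: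
  assumes "spherical_net V \<iota> a N0" and e: "bij_betw e {0..2 * CARD('n::finite) - 2} UNIV"
    and Y: "peterson_map a \<iota> e V z (Y :: complex^'n \<Rightarrow> complex^'m::finite)"
  shows "\<exists>f r g s h. explicit_map V \<iota> a N0 e z Y f r g s h"
proof -
  interpret spherical_net V \<iota> a N0 by (rule assms(1))
  from Y obtain f r g s h where z0: "z 0 = 1"
    and fr: "\<forall>k\<in>{1..CARD('n)-1}.
           f k holomorphic_on (\<lambda>u. u $ \<iota> k) ` V \<and> r k holomorphic_on (\<lambda>u. u $ \<iota> k) ` V \<and>
           (\<forall>t\<in>(\<lambda>u. u $ \<iota> k) ` V. (f k t)\<^sup>2 = radf a z k t \<and> radf a z k t \<noteq> 0 \<and> (r k t)\<^sup>2 = radg a z k t \<and>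
                    (g k has_field_derivative r k t / radf a z k t) (at t)) \<and>
           (0 \<in> (\<lambda>u. u $ \<iota> k) ` V \<longrightarrow> g k 0 = 0)"
    and s: "s holomorphic_on (\<lambda>u. u $ \<iota> CARD('n)) ` V"
    and sh: "\<forall>t\<in>(\<lambda>u. u $ \<iota> CARD('n)) ` V. (s t)\<^sup>2 = radh CARD('n) a z t \<and> (h has_field_derivative s t) (at t)"
    and Yeq: "\<forall>u\<in>V. Y u =
           (\<Sum>k\<in>{1..CARD('n)-1}. (cosprod \<iota> u k * f k (u $ \<iota> k)) *s
              (cos (g k (u $ \<iota> k)) *s axis (e (2*k-2)) 1 + sin (g k (u $ \<iota> k)) *s axis (e (2*k-1)) 1))
           + h (u $ \<iota> CARD('n)) *s axis (e (2*CARD('n)-2)) 1"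
    unfolding peterson_map_def Let_def by (elim conjE exE) (rule that)
  have "explicit_map V \<iota> a N0 e z Y f r g s h"
  proof unfold_locales
    show "bij_betw e {0..2 * CARD('n) - 2} UNIV" by (rule e)
    show "z 0 = 1" by (rule z0)
    show "s holomorphic_on (\<lambda>u. u $ \<iota> CARD('n)) ` V" by (rule s)
    fix k assume k: "k \<in> {1..CARD('n) - 1}"
    show "f k holomorphic_on (\<lambda>u. u $ \<iota> k) ` V" "r k holomorphic_on (\<lambda>u. u $ \<iota> k) ` V" using fr k by blast+
    fix t assume t: "t \<in> (\<lambda>u. u $ \<iota> k) ` V"
    have "(f k t)\<^sup>2 = radf a z k t \<and> radf a z k t \<noteq> 0 \<and> (r k t)\<^sup>2 = radg a z k t \<and>
       (g k has_field_derivative r k t / radf a z k t) (at t)" using bspec [OF fr k] t by blast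
    then show "(f k t)\<^sup>2 = radf a z k t" "radf a z k t \<noteq> 0" "(r k t)\<^sup>2 = radg a z k t"
       "(g k has_field_derivative r k t / radf a z k t) (at t)" by blast+
  next
    fix t assume t: "t \<in> (\<lambda>u. u $ \<iota> CARD('n)) ` V"
    show "(s t)\<^sup>2 = radh CARD('n) a z t" "(h has_field_derivative s t) (at t)" using bspec [OF sh t] by blast+
  next
    fix u assume "u \<in> V"
    then show "Y u = (\<Sum>k\<in>{1..CARD('n)-1}. (cosprod \<iota> u k * f k (u $ \<iota> k)) *s
              (cos (g k (u $ \<iota> k)) *s axis (e (2*k-2)) 1 + sin (g k (u $ \<iota> k)) *s axis (e (2*k-1)) 1))
           + h (u $ \<iota> CARD('n)) *s axis (e (2*CARD('n)-2)) 1" by (rule bspec [OF Yeq])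
  qed
  then show ?thesis by blast
qed

lemma primitive_vanishing_at_zero:
  fixes \<phi> :: "complex \<Rightarrow> complex"
  assumes S: "convex S" "open S" and \<phi>: "\<phi> holomorphic_on S"
  shows "\<exists>g. (\<forall>t\<in>S. (g has_field_derivative \<phi> t) (at t)) \<and> g 0 = 0"
proof -
  obtain g where g: "\<And>t. t \<in> S \<Longrightarrow> (g has_field_derivative \<phi> t) (at t within S)"
    by (rule holomorphic_convex_primitive' [OF S \<phi>]) (rule that)
  have "((\<lambda>t. g t - g 0) has_field_derivative \<phi> t) (at t)" if "t \<in> S" for t
    using g [OF that] at_within_open [OF that S(2)] by (auto intro!: derivative_eq_intros)
  \<comment> \<open>If \<open>0\<close> lies outside \<open>S\<close>, the number \<open>g 0\<close>
    is arbitrary, but subtracting it still changes \<open>g\<close> only by a constant.\<close>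
  then show ?thesis by (intro exI [of _ "\<lambda>t. g t - g 0"]) simp
qed

text \<open>Projections of a convex domain are convex, so the square roots of the non-vanishing
  radicands have holomorphic branches on them and the integrands have primitives.\<close>

lemma peterson_map_exists:
  assumes net: "spherical_net V \<iota> a N0" and cv: "convex V" and z0: "z 0 = 1"
    and regular: "peterson_regular a \<iota> V z"
    and nz: "\<forall>u\<in>V. \<forall>k\<in>{1..CARD('n::finite)-1}. radf a z k (u $ \<iota> k) \<noteq> 0"
  shows "\<exists>Y :: complex^'n \<Rightarrow> complex^'m::finite. peterson_map a \<iota> e V z Y"
proof -
  interpret spherical_net V \<iota> a N0 by (rule net)
  define P where "P = (\<lambda>k. (\<lambda>u :: complex^'n. u $ \<iota> k) ` V)"
  have oP: "open (P k)" for k unfolding P_def by (rule open_projection)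
  have cP: "convex (P k)" for k
    unfolding P_def by (rule convex_linear_image [OF _ cv]) (rule bounded_linear.linear [OF bounded_linear_vec_nth])
  have sq: "\<exists>f. f holomorphic_on P k \<and> (\<forall>t\<in>P k. (f t)\<^sup>2 = R t)"
    if R: "R holomorphic_on P k" "\<forall>t\<in>P k. R t \<noteq> 0" for R k
  proof -
    obtain f where "f holomorphic_on P k" "\<And>t. t \<in> P k \<Longrightarrow> R t = f t ^ 2"
      by (rule contractible_imp_holomorphic_sqrt [OF R(1) convex_imp_contractible [OF cP]])
        (rule bspec [OF R(2)], assumption, rule that)
    then show ?thesis by (intro exI [of _ f]) simp
  qed
  have hol: "radf a z k holomorphic_on A" "radg a z k holomorphic_on A" "radh m a z holomorphic_on A" for k m A
    unfolding radf_def radg_def radh_def by (auto intro!: holomorphic_intros)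
  have nzf: "\<forall>t\<in>P k. radf a z k t \<noteq> 0" if "k \<in> {1..CARD('n) - 1}" for k using nz that by (auto simp: P_def)
  have nzg: "\<forall>t\<in>P k. radg a z k t \<noteq> 0" if "k \<in> {1..CARD('n) - 1}" for k
    using regular that by (auto simp: P_def peterson_regular_def)
  have nzh: "\<forall>t\<in>P CARD('n). radh CARD('n) a z t \<noteq> 0"
    using regular by (auto simp: P_def peterson_regular_def)
  have "\<forall>k\<in>{1..CARD('n) - 1}. \<exists>f. f holomorphic_on P k \<and> (\<forall>t\<in>P k. (f t)\<^sup>2 = radf a z k t)"
    using sq [OF hol(1) nzf] by blast
  from bchoice [OF this] obtain f where f: "\<forall>k\<in>{1..CARD('n) - 1}. f k holomorphic_on P k \<and> (\<forall>t\<in>P k. (f k t)\<^sup>2 = radf a z k t)" ..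
  have "\<forall>k\<in>{1..CARD('n) - 1}. \<exists>r. r holomorphic_on P k \<and> (\<forall>t\<in>P k. (r t)\<^sup>2 = radg a z k t)"
    using sq [OF hol(2) nzg] by blast
  from bchoice [OF this] obtain r where r: "\<forall>k\<in>{1..CARD('n) - 1}. r k holomorphic_on P k \<and> (\<forall>t\<in>P k. (r k t)\<^sup>2 = radg a z k t)" ..
  have "\<forall>k\<in>{1..CARD('n) - 1}. \<exists>g. (\<forall>t\<in>P k. (g has_field_derivative r k t / radf a z k t) (at t)) \<and> g 0 = 0"
  proof
    fix k assume k: "k \<in> {1..CARD('n) - 1}"
    have "(\<lambda>t. r k t / radf a z k t) holomorphic_on P k"
      by (intro holomorphic_on_divide hol) (use r k nzf [OF k] in auto)
    then show "\<exists>g. (\<forall>t\<in>P k. (g has_field_derivative r k t / radf a z k t) (at t)) \<and> g 0 = 0"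
      by (rule primitive_vanishing_at_zero [OF cP oP])
  qed
  from bchoice [OF this] obtain g where g: "\<forall>k\<in>{1..CARD('n) - 1}.
    (\<forall>t\<in>P k. (g k has_field_derivative r k t / radf a z k t) (at t)) \<and> g k 0 = 0" ..
  obtain s where s: "s holomorphic_on P CARD('n)" "\<forall>t\<in>P CARD('n). (s t)\<^sup>2 = radh CARD('n) a z t"
    using sq [OF hol(3) nzh] by blast
  obtain h where h: "\<forall>t\<in>P CARD('n). (h has_field_derivative s t) (at t)" "h 0 = 0"
    using primitive_vanishing_at_zero [OF cP oP s(1)] by blast
  show ?thesis
    unfolding peterson_map_def Let_def P_def [symmetric]
  proof (intro exI conjI)
    show "\<forall>k\<in>{1..CARD('n)-1}.
           f k holomorphic_on P k \<and> r k holomorphic_on P k \<and>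
           (\<forall>t\<in>P k. (f k t)\<^sup>2 = radf a z k t \<and> radf a z k t \<noteq> 0 \<and> (r k t)\<^sup>2 = radg a z k t \<and>
                    (g k has_field_derivative r k t / radf a z k t) (at t)) \<and>
           (0 \<in> P k \<longrightarrow> g k 0 = 0)"
      using f r g nzf by simp
    show "\<forall>u\<in>V. (\<lambda>u. (\<Sum>k\<in>{1..CARD('n)-1}. (cosprod \<iota> u k * f k (u $ \<iota> k)) *s
              (cos (g k (u $ \<iota> k)) *s axis (e (2*k-2)) 1 + sin (g k (u $ \<iota> k)) *s axis (e (2*k-1)) 1))
           + h (u $ \<iota> CARD('n)) *s axis (e (2*CARD('n)-2)) 1) u =
           (\<Sum>k\<in>{1..CARD('n)-1}. (cosprod \<iota> u k * f k (u $ \<iota> k)) *s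
              (cos (g k (u $ \<iota> k)) *s axis (e (2*k-2)) 1 + sin (g k (u $ \<iota> k)) *s axis (e (2*k-1)) 1))
           + h (u $ \<iota> CARD('n)) *s axis (e (2*CARD('n)-2)) 1" by simp
  qed (use z0 s h in auto)
qed

section \<open>Maximality of the explicit family\<close>

lemma spherical_net_subset:
  assumes "spherical_net U \<iota> a N0" and V: "subdomain V U"
  shows "spherical_net V \<iota> a N0"
proof -
  interpret spherical_net U \<iota> a N0 by (rule assms(1))
  show ?thesis
    by unfold_locales
      (use V enum a_nz det_spherical normal holo_map_subset [of U N0 V] in
        \<open>auto simp: subdomain_def unit_normal_def subset_iff\<close>)
qed

text \<open>At a single point the joined squares determine the constants \<open>W\<close> one after
  the other, because they are nonzero; conversely equal constants give equal joined squares
  everywhere.\<close>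

lemma explicit_maps_congruent_iff:
  fixes Y Y' :: "complex^'n::finite \<Rightarrow> complex^('n + 'a::finite)"
  assumes card: "CARD('a) + 1 = CARD('n)" and cv: "convex V"
    and Y: "explicit_map V \<iota> a N0 e z Y f r g s h" and Y': "explicit_map V \<iota> a N0 e z' Y' f' r' g' s' h'"
    and reg: "peterson_regular a \<iota> V z" "peterson_regular a \<iota> V z'"
  shows "congruent_on V Y Y' \<longleftrightarrow> (\<forall>k\<in>{1..CARD('n)-1}. z k = z' k)"
proof -
  interpret Y: explicit_map V \<iota> a N0 e z Y f r g s h by (rule Y)
  interpret Y': explicit_map V \<iota> a N0 e z' Y' f' r' g' s' h' by (rule Y')
  note js = Y.joined_separation [OF reg(1)] and js' = Y'.joined_separation [OF reg(2)]
  show ?thesis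
  proof
    assume cong: "congruent_on V Y Y'"
    obtain u where u: "u \<in> V" using Y.nonempty by blast
    have eq: "joined_square Y.X Y j u = joined_square Y.X Y' j u" for j
      using congruent_on_second_derivative [OF Y.open_U Y.Y.holo_Y cong u] by (simp add: joined_square_def)
    have W: "Y.W k = Y'.W k" if "k \<le> CARD('n) - 1" for k
      using that
    proof (induction k)
      case 0
      then show ?case by (simp add: Y.W_def Y'.W_def Y.z0 Y'.z0)
    next
      case (Suc k)
      then have k: "Suc k \<in> {1..CARD('n)}" by simp
      have "joined_square Y.X Y (\<iota> (Suc k)) u * (Y.W (Suc k) - Y'.W (Suc k)) = 0"
        using js [OF u k] js' [OF u k] Suc by (simp add: eq algebra_simps)
      then show ?case using Y.joined_square_Y_nz [OF reg(1) u] by simp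
    qed
    show "\<forall>k\<in>{1..CARD('n)-1}. z k = z' k"
    proof
      fix k assume k: "k \<in> {1..CARD('n) - 1}"
      then have "k \<le> CARD('n) - 1" "k \<noteq> CARD('n)" using Y.elev_e(5) by auto
      then have "1 / (a 0 * z k) = 1 / (a 0 * z' k)" using W [of k] by (simp add: Y.W_def Y'.W_def)
      moreover have "a 0 \<noteq> 0" "z k \<noteq> 0" "z' k \<noteq> 0" using reg k Y.a_nz [of 0] by (auto simp: peterson_regular_def)
      ultimately show "z k = z' k" by (simp add: field_simps)
    qed
  next
    assume eq: "\<forall>k\<in>{1..CARD('n)-1}. z k = z' k"
    have W: "Y.W k = Y'.W k" if "k \<le> CARD('n)" for k
    proof (cases "k = 0 \<or> k = CARD('n)")
      case True then show ?thesis by (auto simp: Y.W_def Y'.W_def Y.z0 Y'.z0)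
    next
      case False
      then have "k \<in> {1..CARD('n) - 1}" using that by auto
      then show ?thesis using eq by (simp add: Y.W_def Y'.W_def)
    qed
    show "congruent_on V Y Y'"
    proof (rule conjugate_deformations_congruent [OF card Y.quadric_piece_spherical cv
          explicit_map_frame(2) [OF Y reg(1)] explicit_map_frame(2) [OF Y' reg(2)]])
      fix u j assume u: "u \<in> V"
      obtain k where k: "k \<in> {1..CARD('n)}" "j = \<iota> k" by (rule Y.enum_cases)
      have "Y.W k = Y'.W k" "Y.W (k - 1) = Y'.W (k - 1)" using W [of k] W [of "k - 1"] k(1) by auto
      moreover have "cosprod \<iota> u k \<noteq> 0" by (rule Y.cosprod_nz [OF u]) (use k in simp)
      ultimately show "joined_square Y.X Y j u = joined_square Y.X Y' j u"
        using js [OF u k(1)] js' [OF u k(1)] unfolding k(2)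
        by (metis mult_right_cancel mult_zero_right zero_eq_power2)
    qed
  qed
qed

text \<open>The explicit map with these parameters has the same separation constants, hence the same
  joined squares as \<open>x\<close>, which decide congruence.\<close>

lemma separated_deformation_explicit:
  fixes x :: "complex^'n::finite \<Rightarrow> complex^('n + 'a::finite)"
  assumes card: "CARD('a) + 1 = CARD('n)" and net: "spherical_net V \<iota> a N0" and cv: "convex V"
    and e: "bij_betw e {0..2 * CARD('n) - 2} UNIV"
    and w: "separation_constants V a \<iota> b w" and wnz: "\<forall>k\<in>{1..CARD('n)-1}. w k \<noteq> 0"
    and x: "x \<in> conjugate_deformations V (spherical a \<iota>) N0"
    and b: "\<And>u j. u \<in> V \<Longrightarrow> (b j u)\<^sup>2 = joined_square (spherical a \<iota>) x j u"
    and nz: "\<forall>u\<in>V. \<forall>k\<in>{1..CARD('n)-1}. radf a (\<lambda>i. 1 / (a 0 * w i)) k (u $ \<iota> k) \<noteq> 0"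
  shows "\<exists>Y. peterson_map a \<iota> e V (\<lambda>i. 1 / (a 0 * w i)) Y \<and> congruent_on V x Y"
proof -
  interpret spherical_net V \<iota> a N0 by (rule net)
  define z where "z = (\<lambda>i. 1 / (a 0 * w i))"
  have a0: "a 0 \<noteq> 0" using a_nz by simp
  have w0: "w 0 = 1 / a 0" "w CARD('n) = 0" using w by (simp_all add: separation_constants_def)
  have wn: "w k \<noteq> 0" if "k < CARD('n)" for k
    using that wnz w0 a0 by (cases k) auto
  have z0: "z 0 = 1" using a0 by (simp add: z_def w0)
  have za: "z k * a 0 = 1 / w k" for k using a0 by (simp add: z_def)
  have sep: "(b (\<iota> k) u)\<^sup>2 * (w k - w (k-1) * (cos (u $ \<iota> k))\<^sup>2 - (sin (u $ \<iota> k))\<^sup>2 / a k) = (cosprod \<iota> u k)\<^sup>2"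
    if "u \<in> V" "k \<in> {1..CARD('n)}" for u k using w that unfolding separation_constants_def by blast
  have sepnz: "w k - w (k-1) * (cos (u $ \<iota> k))\<^sup>2 - (sin (u $ \<iota> k))\<^sup>2 / a k \<noteq> 0"
    if "u \<in> V" "k \<in> {1..CARD('n)}" for u k
  proof -
    have "cosprod \<iota> u k \<noteq> 0" by (rule cosprod_nz [OF that(1)]) (use that in simp)
    then show ?thesis using sep [OF that] by auto
  qed
  have reg: "peterson_regular a \<iota> V z"
    unfolding peterson_regular_def
  proof (intro conjI ballI)
    fix k assume k: "k \<in> {1..CARD('n) - 1}"
    then show "z k \<noteq> 0" using a0 wnz by (simp add: z_def)
    fix u assume u: "u \<in> V"
    have k': "k \<in> {1..CARD('n)}" "k < CARD('n)" "k - 1 < CARD('n)" using k by auto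
    have ak: "a k \<noteq> 0" using a_nz k' by simp
    \<comment> \<open>Regularity is automatic: \<open>radg\<close> is a nonzero multiple of the
      separation expression, which cannot vanish because \<open>cosprod\<close> does not.\<close>
    have "radg a z k (u $ \<iota> k) =
        a k * (w k - w (k-1) * (cos (u $ \<iota> k))\<^sup>2 - (sin (u $ \<iota> k))\<^sup>2 / a k) / (w k * w (k - 1))"
    proof -
      have R: "radg a z k t = (z (k - 1) * a 0 - z k * a 0) * a k + (a k - z (k - 1) * a 0) * (z k * a 0) * (sin t)\<^sup>2" for t
        by (simp add: radg_def algebra_simps)
      show ?thesis unfolding R za using wn [OF k'(2)] wn [OF k'(3)] \<open>a k \<noteq> 0\<close>
        by (simp add: cos_squared_eq field_simps)
    qed
    then show "radg a z k (u $ \<iota> k) \<noteq> 0" using sepnz [OF u k'(1)] \<open>a k \<noteq> 0\<close> wn [OF k'(2)] wn [OF k'(3)] by simp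
  next
    fix u assume u: "u \<in> V"
    let ?n = "CARD('n)"
    have "a ?n \<noteq> 0" using a_nz by simp
    have n1: "?n - 1 < ?n" by simp
    have "radh ?n a z (u $ \<iota> ?n) =
        - a ?n * (w ?n - w (?n - 1) * (cos (u $ \<iota> ?n))\<^sup>2 - (sin (u $ \<iota> ?n))\<^sup>2 / a ?n) / w (?n - 1)"
      using wn [OF n1] \<open>a ?n \<noteq> 0\<close> unfolding radh_def za by (simp add: w0 cos_squared_eq field_simps)
    then show "radh ?n a z (u $ \<iota> ?n) \<noteq> 0" using sepnz [OF u card_range] \<open>a ?n \<noteq> 0\<close> wn [OF n1] by simp
  qed
  obtain Y :: "complex^'n \<Rightarrow> complex^('n + 'a)" where Y: "peterson_map a \<iota> e V z Y"
    using peterson_map_exists [OF net cv z0 reg] nz unfolding z_def by blast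
  then obtain f r g s h where E: "explicit_map V \<iota> a N0 e z Y f r g s h"
    using peterson_map_explicit [OF net e] by blast
  interpret Y: explicit_map V \<iota> a N0 e z Y f r g s h by (rule E)
  have W: "Y.W k = w k" for k unfolding Y.W_def using za [of k] w0(2) by (simp add: mult.commute)
  have "congruent_on V x Y"
  proof (rule conjugate_deformations_congruent [OF card quadric_piece_spherical cv x explicit_map_frame(2) [OF E reg]])
    fix u j assume u: "u \<in> V"
    obtain k where k: "k \<in> {1..CARD('n)}" "j = \<iota> k" by (rule enum_cases)
    show "joined_square X x j u = joined_square X Y j u"
      using Y.joined_separation [OF reg u k(1)] sep [OF u k(1)] sepnz [OF u k(1)] unfolding b [OF u] W k(2)
      by (metis mult_right_cancel)
  qed
  then show ?thesis using Y unfolding z_def by blast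
qed

lemma continuous_on_vpd_param:
  fixes y :: "'p::topological_space \<Rightarrow> complex^'n::finite \<Rightarrow> complex^'m"
  assumes U: "open U" and c: "continuous_on (T \<times> U) (\<lambda>(t, u). y t u)" and h: "\<And>t. t \<in> T \<Longrightarrow> holo_map U (y t)"
  shows "continuous_on (T \<times> U) (\<lambda>(t, u). vpd k (y t) u)"
proof -
  have "continuous_on (T \<times> U) (\<lambda>(t, u). pd k (\<lambda>v. y t v $ i) u)" for i
  proof (rule continuous_on_pd_param [OF U])
    have "continuous_on (T \<times> U) (\<lambda>x. (case x of (t, u) \<Rightarrow> y t u) $ i)" by (intro continuous_intros c)
    then show "continuous_on (T \<times> U) (\<lambda>(t, u). y t u $ i)" by (simp add: case_prod_beta)
    show "sepholo U (\<lambda>u. y t u $ i)" if "t \<in> T" for t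
      by (rule holo_fun_sepholo [OF holo_map_nth [OF h [OF that]]])
  qed
  then have "continuous_on (T \<times> U) (\<lambda>x. \<chi> i. pd k (\<lambda>v. y (fst x) v $ i) (snd x))"
    by (intro continuous_on_vec_lambda) (simp add: case_prod_beta)
  then show ?thesis by (simp add: vpd_def case_prod_beta)
qed

lemma separation_function_cong:
  assumes "\<And>j. \<beta> j u = \<beta>' j u"
  shows "separation_function \<iota> a \<beta> k u = separation_function \<iota> a \<beta>' k u"
  by (induction k) (simp_all add: assms)

theorem effective_family_dimension:
  fixes y :: "complex^'d::finite \<Rightarrow> complex^'n::finite \<Rightarrow> complex^('n + 'a::finite)"
  assumes card: "CARD('a) + 1 = CARD('n)" and net: "spherical_net U \<iota> a N0" and cv: "convex U"
    and fam: "effective_family U (spherical a \<iota>) N0 T y"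
  shows "CARD('d) \<le> CARD('n) - 1"
proof -
  interpret spherical_net U \<iota> a N0 by (rule net)
  obtain u0 where u0: "u0 \<in> U" using nonempty by blast
  have T: "open T" "T \<noteq> {}" and cont: "continuous_on (T \<times> U) (\<lambda>(t, u). y t u)"
    and D: "t \<in> T \<Longrightarrow> y t \<in> conjugate_deformations U X N0"
    and inj: "t \<in> T \<Longrightarrow> t' \<in> T \<Longrightarrow> congruent_on U (y t) (y t') \<Longrightarrow> t = t'" for t t'
    using fam unfolding effective_family_def by blast+
  have hy: "holo_map U (y t)" if "t \<in> T" for t
    using D [OF that] unfolding conjugate_deformations_def deformation_def by blast
  \<comment> \<open>The constants are computed from the joined squares, which depend continuously on
    \<open>t\<close>; the solutions \<open>b\<close> below are square roots chosen separately for
    each \<open>t\<close>.\<close>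
  define B where "B = (\<lambda>t j u. joined_square X (y t) j u)"
  define w where "w = (\<lambda>t k. separation_function \<iota> a (B t) k u0)"
  have "\<forall>t\<in>T. \<exists>b. b \<in> solutions U X N0 \<and> (\<forall>u\<in>U. \<forall>j. (b j u)\<^sup>2 = B t j u)"
    using conjugate_deformation_solution [OF card quadric_piece_spherical cv D] unfolding B_def by blast
  from bchoice [OF this] obtain b where b: "\<forall>t\<in>T. b t \<in> solutions U X N0 \<and> (\<forall>u\<in>U. \<forall>j. (b t j u)\<^sup>2 = B t j u)" ..
  have B_nz: "B t j u \<noteq> 0" if "t \<in> T" "u \<in> U" for t j u
    using b that b_nz [of "b t" u j] by (metis zero_eq_power2)
  have sep: "separation_constants U a \<iota> (b t) (w t)" if t: "t \<in> T" for t
  proof -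
    have "w t = (\<lambda>k. separation_function \<iota> a (\<lambda>j u. (b t j u)\<^sup>2) k u0)"
      unfolding w_def fun_eq_iff by (intro allI separation_function_cong) (use b t u0 in simp)
    then show ?thesis using separation_constants_exist [of "b t", OF _ cv u0] b t by simp
  qed
  have cB: "continuous_on T (\<lambda>t. B t j u0)" for j
  proof -
    have "continuous_on (T \<times> U) (\<lambda>(t, u). vpd j (vpd j (y t)) u)"
      by (intro continuous_on_vpd_param open_U cont hy holo_vpd)
    then have "continuous_on T (\<lambda>t. (case (t, u0) of (t, u) \<Rightarrow> vpd j (vpd j (y t)) u))"
      by (rule continuous_on_compose2) (use u0 in \<open>auto intro!: continuous_intros\<close>)
    then show ?thesis unfolding B_def joined_square_def bil_def by (intro continuous_intros) simp_all
  qed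
  have cw: "continuous_on T (\<lambda>t. w t k)" for k
    unfolding w_def
    by (induction k) (auto intro!: continuous_intros cB simp: B_nz u0)
  \<comment> \<open>The constants with index \<open>0\<close> and \<open>CARD('n)\<close> are the
    same for all \<open>t\<close>, so the ones in between are the coordinates of an injective
    continuous map.\<close>
  obtain \<kappa> :: "'a \<Rightarrow> nat" where \<kappa>: "bij_betw \<kappa> UNIV {1..CARD('n) - 1}"
  proof -
    have "CARD('a) = card {1..CARD('n) - 1}" by (simp only: card_atLeastAtMost) (use card in linarith)
    then show thesis using finite_same_card_bij [of "UNIV :: 'a set" "{1..CARD('n) - 1}"] that by auto
  qed
  define F :: "complex^'d \<Rightarrow> complex^'a" where "F = (\<lambda>t. \<chi> \<alpha>. w t (\<kappa> \<alpha>))"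
  have "continuous_on T F" unfolding F_def by (intro continuous_intros cw)
  moreover have "inj_on F T"
  proof (rule inj_onI)
    fix t t' assume t: "t \<in> T" and t': "t' \<in> T" and eq: "F t = F t'"
    have weq: "w t k = w t' k" if "k \<le> CARD('n)" for k
    proof (cases "k = 0 \<or> k = CARD('n)")
      case True
      then show ?thesis using sep [OF t] sep [OF t'] by (auto simp: separation_constants_def)
    next
      case False
      then have "k \<in> \<kappa> ` UNIV" using that \<kappa> by (auto simp: bij_betw_def)
      then obtain \<alpha> where "k = \<kappa> \<alpha>" by blast
      then show ?thesis using eq by (simp add: F_def vec_eq_iff)
    qed
    have "congruent_on U (y t) (y t')"
    proof (rule conjugate_deformations_congruent [OF card quadric_piece_spherical cv D [OF t] D [OF t']])
      fix u j assume u: "u \<in> U"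
      obtain k where k: "k \<in> {1..CARD('n)}" "j = \<iota> k" by (rule enum_cases)
      let ?S = "w t k - w t (k-1) * (cos (u $ \<iota> k))\<^sup>2 - (sin (u $ \<iota> k))\<^sup>2 / a k"
      have "(b t (\<iota> k) u)\<^sup>2 * ?S = (cosprod \<iota> u k)\<^sup>2"
        using sep [OF t] u k(1) unfolding separation_constants_def by blast
      moreover have "(b t' (\<iota> k) u)\<^sup>2 * (w t' k - w t' (k-1) * (cos (u $ \<iota> k))\<^sup>2 - (sin (u $ \<iota> k))\<^sup>2 / a k) = (cosprod \<iota> u k)\<^sup>2"
        using sep [OF t'] u k(1) unfolding separation_constants_def by blast
      moreover have "w t' k = w t k" "w t' (k - 1) = w t (k - 1)" using weq [of k] weq [of "k - 1"] k(1) by auto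
      moreover have "cosprod \<iota> u k \<noteq> 0" by (rule cosprod_nz [OF u]) (use k in simp)
      ultimately have "(b t (\<iota> k) u)\<^sup>2 = (b t' (\<iota> k) u)\<^sup>2"
        by (metis mult_right_cancel mult_zero_right zero_eq_power2)
      then show "joined_square X (y t) j u = joined_square X (y t') j u"
        using b t t' u k(2) by (simp add: B_def)
    qed
    then show "t = t'" by (rule inj [OF t t'])
  qed
  \<comment> \<open>The real dimensions are twice the complex ones, so the comparison passes to the
    numbers of complex parameters.\<close>
  ultimately have "DIM(complex^'d) \<le> DIM(complex^'a)" using invariance_of_dimension [of T F] T by simp
  then show ?thesis using card by simp
qed

theorem theorem2:
  assumes "CARD('n::finite) \<ge> 3" and "CARD('a::finite) = CARD('n) - 1"
  shows
    "(\<forall>U x0 N0. \<forall>x \<in> (conjugate_deformations U x0 N0 :: (complex^'n \<Rightarrow> complex^('n + 'a)) set).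
        quadric_piece U x0 N0 \<longrightarrow>
        (\<forall>u\<in>U. \<forall>j k l. j \<noteq> k \<and> k \<noteq> l \<and> j \<noteq> l \<longrightarrow> christoffel (induced_metric x0) l j k u = 0))
     \<and>
     (\<forall>(U :: (complex^'n) set) x0 N0.
        quadric_piece U x0 N0 \<and> convex U \<and>
        (\<forall>u\<in>U. \<forall>j k l. j \<noteq> k \<and> k \<noteq> l \<and> j \<noteq> l \<longrightarrow> christoffel (induced_metric x0) l j k u = 0) \<longrightarrow>
        bij_betw (correspondence U x0 N0)
          ((conjugate_deformations U x0 N0 :: (complex^'n \<Rightarrow> complex^('n + 'a)) set) //
             congruence_rel U (conjugate_deformations U x0 N0))
          (solutions U x0 N0 // sign_rel U (solutions U x0 N0)))
     \<and>
     (\<forall>(a :: nat \<Rightarrow> complex) (\<iota> :: nat \<Rightarrow> 'n) (e :: nat \<Rightarrow> 'n + 'a) U N0.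
        (\<forall>j\<le>CARD('n). a j \<noteq> 0) \<and> inj_on a {0..CARD('n)} \<and>
        bij_betw \<iota> {1..CARD('n)} UNIV \<and> bij_betw e {0..2 * CARD('n) - 2} UNIV \<and>
        open U \<and> convex U \<and> U \<noteq> {} \<and>
        (\<forall>u\<in>U. det (induced_metric (spherical a \<iota>) u) \<noteq> 0) \<and> unit_normal U (spherical a \<iota>) N0 \<longrightarrow>
          (\<forall>u\<in>U. spherical a \<iota> u \<in> central_quadric a \<iota>) \<and>
          quadric_piece U (spherical a \<iota>) N0 \<and>
          (\<forall>V z Y. subdomain V U \<and> peterson_map a \<iota> e V z Y \<longrightarrow>
             deformation V (spherical a \<iota>) Y \<and>
             (\<exists>N. normal_frame V Y N \<and> (\<forall>\<alpha>. conjugate_system V (N \<alpha>) Y)) \<and>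
             (peterson_regular a \<iota> V z \<longrightarrow> Y \<in> conjugate_deformations V (spherical a \<iota>) N0)) \<and>
          (\<forall>V z. subdomain V U \<and> z 0 = 1 \<and> peterson_regular a \<iota> V z \<and>
             (\<forall>u\<in>V. \<forall>k\<in>{1..CARD('n)-1}. radf a z k (u $ \<iota> k) \<noteq> 0) \<longrightarrow>
             (\<exists>Y. peterson_map a \<iota> e V z Y)) \<and>
          (\<forall>V z z' Y Y'. subdomain V U \<and> peterson_map a \<iota> e V z Y \<and> peterson_map a \<iota> e V z' Y' \<and>
             peterson_regular a \<iota> V z \<and> peterson_regular a \<iota> V z' \<longrightarrow>
             (congruent_on V Y Y' \<longleftrightarrow> (\<forall>k\<in>{1..CARD('n)-1}. z k = z' k))) \<and>
          (\<forall>b \<in> solutions U (spherical a \<iota>) N0. \<exists>w. separation_constants U a \<iota> b w \<and>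
             ((\<forall>k\<in>{1..CARD('n)-1}. w k \<noteq> 0) \<longrightarrow>
              (\<forall>x \<in> conjugate_deformations U (spherical a \<iota>) N0.
                 corresponds U (spherical a \<iota>) N0 x b \<longrightarrow>
                 (\<forall>V. subdomain V U \<and>
                    (\<forall>u\<in>V. \<forall>k\<in>{1..CARD('n)-1}. radf a (\<lambda>i. 1 / (a 0 * w i)) k (u $ \<iota> k) \<noteq> 0) \<longrightarrow>
                    (\<exists>Y. peterson_map a \<iota> e V (\<lambda>i. 1 / (a 0 * w i)) Y \<and> congruent_on V x Y))))) \<and>
          (\<forall>(T :: (complex^'d) set) (y :: complex^'d \<Rightarrow> complex^'n \<Rightarrow> complex^('n + 'a)).
             effective_family U (spherical a \<iota>) N0 T y \<longrightarrow> CARD('d) \<le> CARD('n) - 1))"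
proof (intro conjI, goal_cases)
  case 1
  show ?case
    by (intro allI ballI impI, elim conjE) (rule conjugate_deformations_christoffel_zero)
next
  case 2
  have card: "CARD('a) + 1 = CARD('n)" using assms by linarith
  show ?case
  proof (intro allI impI, elim conjE, goal_cases)
    case (1 U x0 N0)
    show ?case by (rule correspondence_bij [OF card 1(1,2)]) (use 1(3) in simp)
  qed
next
  case 3
  have card: "CARD('a) + 1 = CARD('n)" using assms by linarith
  show ?case
  proof (intro allI impI, elim conjE, goal_cases)
    case (1 a \<iota> e U N0)
    have net: "spherical_net U \<iota> a N0"
      by unfold_locales (use 1 in auto)
    interpret spherical_net U \<iota> a N0 by (rule net)
    have explicit: "\<exists>f r g s h. explicit_map V \<iota> a N0 e z Y f r g s h"
      if "subdomain V U" "peterson_map a \<iota> e V z Y" for V z and Y :: "complex^'n \<Rightarrow> complex^('n + 'a)"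
      by (rule peterson_map_explicit [OF spherical_net_subset [OF net that(1)] 1(4) that(2)])
    show ?case
    proof (intro conjI, goal_cases)
      case 1
      show ?case using in_central_quadric by blast
    next
      case 2
      show ?case by (rule quadric_piece_spherical)
    next
      case 3
      show ?case
      proof (intro allI impI, elim conjE, goal_cases)
        case (1 V z Y)
        obtain f r g s h where E: "explicit_map V \<iota> a N0 e z Y f r g s h" using explicit [OF 1] by blast
        show ?case
          using explicit_map.deformation_Y [OF E] explicit_map_frame [OF E] by blast
      qed
    next
      case 4
      show ?case
      proof (intro allI impI, elim conjE, goal_cases)
        case (1 V z)
        then show ?case by (intro peterson_map_exists [OF spherical_net_subset [OF net]]) (simp_all add: subdomain_def)
      qed
    next
      case 5
      show ?case
      proof (intro allI impI, elim conjE, goal_cases)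
        case (1 V z z' Y Y')
        obtain f r g s h where E: "explicit_map V \<iota> a N0 e z Y f r g s h" using explicit [OF 1(1,2)] by blast
        obtain f' r' g' s' h' where E': "explicit_map V \<iota> a N0 e z' Y' f' r' g' s' h'" using explicit [OF 1(1,3)] by blast
        show ?case
          by (rule explicit_maps_congruent_iff [OF card _ E E' 1(4,5)]) (use 1(1) in \<open>simp add: subdomain_def\<close>)
      qed
    next
      case 6
      obtain u0 where u0: "u0 \<in> U" using nonempty by blast
      show ?case
      proof (rule ballI)
        fix b assume b: "b \<in> solutions U X N0"
        \<comment> \<open>The separation functions are constant on the convex domain, so their
          values at any point \<open>u0\<close> serve as the constants.\<close>
        define w where "w = (\<lambda>k. separation_function \<iota> a (\<lambda>j u. (b j u)\<^sup>2) k u0)"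
        have w: "separation_constants U a \<iota> b w"
          unfolding w_def by (rule separation_constants_exist [OF b 1(6) u0])
        have V: "\<exists>Y. peterson_map a \<iota> e V (\<lambda>i. 1 / (a 0 * w i)) Y \<and> congruent_on V x Y"
          if wnz: "\<forall>k\<in>{1..CARD('n)-1}. w k \<noteq> 0" and x: "x \<in> conjugate_deformations U X N0"
            and c: "corresponds U X N0 x b" and V: "subdomain V U"
            and nz: "\<forall>u\<in>V. \<forall>k\<in>{1..CARD('n)-1}. radf a (\<lambda>i. 1 / (a 0 * w i)) k (u $ \<iota> k) \<noteq> 0"
          for V and x :: "complex^'n \<Rightarrow> complex^('n + 'a)"
        proof (rule separated_deformation_explicit [OF card spherical_net_subset [OF net V] _ 1(4) _ wnz _ _ nz])
          have VU: "V \<subseteq> U" and "convex V" using V by (simp_all add: subdomain_def)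
          show "convex V" by fact
          show "separation_constants V a \<iota> b w" using w VU unfolding separation_constants_def by blast
          show "x \<in> conjugate_deformations V X N0" by (rule conjugate_deformations_subset [OF x VU])
          have "deformation U X x" using x unfolding conjugate_deformations_def by blast
          then show "(b j u)\<^sup>2 = joined_square X x j u" if "u \<in> V" for u j
            using c corresponds_iff [OF N.conjugate_map_axioms] that VU by blast
        qed
        show "\<exists>w. separation_constants U a \<iota> b w \<and>
             ((\<forall>k\<in>{1..CARD('n)-1}. w k \<noteq> 0) \<longrightarrow>
              (\<forall>x \<in> conjugate_deformations U X N0.
                 corresponds U X N0 x b \<longrightarrow>
                 (\<forall>V. subdomain V U \<and>
                    (\<forall>u\<in>V. \<forall>k\<in>{1..CARD('n)-1}. radf a (\<lambda>i. 1 / (a 0 * w i)) k (u $ \<iota> k) \<noteq> 0) \<longrightarrow>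
                    (\<exists>Y :: complex^'n \<Rightarrow> complex^('n + 'a). peterson_map a \<iota> e V (\<lambda>i. 1 / (a 0 * w i)) Y \<and> congruent_on V x Y))))"
        proof (intro exI [of _ w] conjI w impI ballI allI, elim conjE, goal_cases)
          case (1 x V)
          then show ?case by (rule V)
        qed
      qed
    next
      case 7
      show ?case
        by (intro allI impI) (rule effective_family_dimension [OF card net 1(6)])
    qed
  qed
qed

end
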